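(* Let $(A,\bigoplus_n\Omega^n,d,\wedge)$ be a differential graded algebra over a field $\mathbb{K}$ with $\Omega^0=A$, with surjective first order calculus, equipped with a pivotal structure, and such that $\wedge:\Omega^1\otimes_A\Omega^1\to\Omega^2$ is surjective. Then the algebra $\mathcal{D}\mathfrak{X}$ is isomorphic to the quotient of $H\mathfrak{X}^1$ by the relations (repeated indices $i,j,k$ summed) $$\mathrm{ev}^2(\xi\otimes d\omega_i)\bullet x_i-\mathrm{ev}^2(\xi\otimes\omega_j\wedge\omega_k)\bullet x_k\bullet x_j=0,$$ $$\sum_m\mathrm{ev}^2(\xi\otimes\omega_i\wedge\omega_j)\bullet[x_j,\overline{b_m}]\bullet[x_i,\overline{a_m}]\bullet\overline{r_m}=0,$$ $$\sum_m\overline{\underline{\mathrm{ev}}^2(\rho_i\wedge\rho_j\otimes\xi)}\bullet r_m\bullet[\overline{y_i},a_m]\bullet[\overline{y_j},b_m]=0,$$ for all $\xi\in\mathfrak{X}^2$ and all $\sum_m r_m\,da_m\otimes db_m\in\ker(\wedge:\Omega^1\otimes_A\Omega^1\to\Omega^2)$.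
   Context: $A^{\mathrm{op}}$ has elements $\overline a$ with $\overline a\bullet\overline b=\overline{ba}$; $A^e=A\otimes A^{\mathrm{op}}$; $T_{\mathbb{K}}$ is the tensor algebra of a vector space, $\star$ the free product of algebras, $\bullet$ the product in the constructed algebras, $[\cdot,\cdot]$ the commutator for $\bullet$. The calculus is surjective if $\Omega^1$ is spanned by elements $a\,db$. **Pivotal structure.** For $n=1,2$: an $A$-bimodule $\mathfrak{X}^n$ and bimodule maps $\mathrm{coev}^n:A\to\Omega^n\otimes_A\mathfrak{X}^n$, $\mathrm{ev}^n:\mathfrak{X}^n\otimes_A\Omega^n\to A$, $\underline{\mathrm{coev}}^n:A\to\mathfrak{X}^n\otimes_A\Omega^n$, $\underline{\mathrm{ev}}^n:\Omega^n\otimes_A\mathfrak{X}^n\to A$ exhibiting $\mathfrak{X}^n$ as both a left and a right dual of $\Omega^n$ in the monoidal category of $A$-bimodules (triangle identities). For $n=1$ drop the superscript and write $\mathrm{coev}(1)=\sum_i\omega_i\otimes x_i$, $\underline{\mathrm{coev}}(1)=\sum_j y_j\otimes\rho_j$. Moreover $\wedge$ is pivotal: for all $\xi\in\mathfrak{X}^2$, $\mathrm{ev}^2(\xi\otimes\omega_i\wedge\omega_j)x_j\otimes x_i=y_i\otimes y_j\,\underline{\mathrm{ev}}^2(\rho_j\wedge\rho_i\otimes\xi)$. For a surjective calculus choose representatives with $\omega_i=db_i$ and $\rho_j=dc_j$. **Definition of $\mathcal{D}\mathfrak{X}$.** The quotient of the free product of $A^e$, $T_{\mathbb{K}}\mathfrak{X}^1$,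 $T_{\mathbb{K}}(\mathfrak{X}^n\otimes_{\mathbb{K}}\Omega^n)$ and $T_{\mathbb{K}}(\Omega^n\otimes_{\mathbb{K}}\mathfrak{X}^n)$ for $n=1,2$ (generators $a\overline b$, $x$, $(x^n,\omega^n)$, $(\omega^n,x^n)$) by the relations (all $a,b,a',b'\in A$; $x,y\in\mathfrak{X}^1$; $\omega,\rho\in\Omega^1$; $\xi\in\mathfrak{X}^2$; $n=1,2$): $a\bullet x=ax$; $x\bullet a=xa+\mathrm{ev}(x\otimes da)$; $x\bullet\overline a=\overline a\bullet x+(x,da)$; $a\overline{a'}\bullet(x^n,\omega^n)\bullet b\overline{b'}=(ax^nb,b'\omega^na')$; $a\overline{a'}\bullet(\omega^n,x^n)\bullet b\overline{b'}=(a\omega^nb,b'x^na')$; $(\omega_i,y)\bullet(x_i,\omega)=\overline{\underline{\mathrm{ev}}(\omega\otimes y)}$; $(x,\rho_j)\bullet(\omega,y_j)=\mathrm{ev}(x\otimes\omega)$; $(y_j,\omega)\bullet(\rho_j,x)=\overline{\mathrm{ev}(x\otimes\omega)}$; $(\omega,x_i)\bullet(x,\omega_i)=\underline{\mathrm{ev}}(\omega\otimes x)$; $\mathrm{ev}^2(\xi\otimes d\omega_i)\bullet x_i=\mathrm{ev}^2(\xi\otimes\omega_j\wedge\omega_k)\bullet x_k\bullet x_j$; $\mathrm{ev}^2(\xi\otimes\omega_i\wedge\omega_j)\bullet[x_j\bullet(x_i,\omega)+(x_j,\omega)\bullet x_i]=\mathrm{ev}^2(\xi\otimes d\omega_i)\bullet(x_i,\omega)-(\xi,d\omega)$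 (here the square brackets are ordinary parentheses); $\mathrm{ev}^2(\xi\otimes\omega_i\wedge\omega_j)\bullet(x_j,\rho)\bullet(x_i,\omega)=(\xi,\omega\wedge\rho)$; $\overline{\underline{\mathrm{ev}}^2(\rho_i\wedge\rho_j\otimes\xi)}\bullet(\omega,y_i)\bullet(\rho,y_j)=(\omega\wedge\rho,\xi)$. **Presentation of $H\mathfrak{X}^1$ used here.** The quotient of $A^e\star T_{\mathbb{K}}\mathfrak{X}^1\star T_{\mathbb{K}}\mathfrak{X}^1$ (elements of the second copy of $\mathfrak{X}^1$ written $\overline y$) by: $a\bullet x=ax$; $x\bullet a=xa+\mathrm{ev}(x\otimes da)$; $\overline a\bullet\overline y=\overline{ya}$; $\overline y\bullet\overline a=\overline{ay}+\overline{\underline{\mathrm{ev}}(da\otimes y)}$; $\sum_m\overline{s_m}\bullet x\bullet\overline{r_m}=0$ and $\sum_m r_m\bullet\overline y\bullet s_m=0$ for every $\sum_m r_m\otimes s_m\in A\otimes_{\mathbb{K}}A$ with $\sum r_ms_m=0$ and $\sum r_m\,ds_m=0$ in $\Omega^1$; $[\overline y,b_i]\bullet x_i=\overline y$; $[x,\overline{c_j}]\bullet\overline{y_j}=x$; $[y_j,\overline a]\bullet[\overline x,c_j]=\overline{\mathrm{ev}(x\otimes da)}$; $[\overline{x_i},a]\bullet[x,\overline{b_i}]=\underline{\mathrm{ev}}(da\otimes x)$. *)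

theory Defs
  imports "HOL-Algebra.QuotRing" "HOL-Algebra.Module" "HOL-Library.Poly_Mapping" Complex_Main
begin

text \<open>
  The ground field is an arbitrary type of class \<^class>\<open>field\<close>; vector spaces, algebras and
  bimodules over it are records extending \<^type>\<open>module\<close>.  For vector spaces and bimodules the
  fields \<open>mult\<close> and \<open>one\<close> carry no meaning.
\<close>

section \<open>Vector spaces and associative unital algebras\<close>

locale k_vector_space = abelian_group M
  for M :: "('k::field, 'v, 'z) module_scheme" (structure) +
  assumes smult_closed: "v \<in> carrier M \<Longrightarrow> c \<odot> v \<in> carrier M"
    and smult_l_distr: "v \<in> carrier M \<Longrightarrow> (c + e) \<odot> v = c \<odot> v \<oplus> e \<odot> v"
    and smult_r_distr:
      "v \<in> carrier M \<Longrightarrow> w \<in> carrier M \<Longrightarrow> c \<odot> (v \<oplus> w) = c \<odot> v \<oplus> c \<odot> w"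
    and smult_assoc: "v \<in> carrier M \<Longrightarrow> (c * e) \<odot> v = c \<odot> (e \<odot> v)"
    and smult_one: "v \<in> carrier M \<Longrightarrow> 1 \<odot> v = v"

locale k_algebra = ring R + k_vector_space R
  for R :: "('k::field, 'a, 'z) module_scheme" (structure) +
  assumes smult_mult_left:
      "u \<in> carrier R \<Longrightarrow> v \<in> carrier R \<Longrightarrow> (c \<odot> u) \<otimes> v = c \<odot> (u \<otimes> v)"
    and smult_mult_right:
      "u \<in> carrier R \<Longrightarrow> v \<in> carrier R \<Longrightarrow> u \<otimes> (c \<odot> v) = c \<odot> (u \<otimes> v)"

definition k_algebra_iso ::
    "('k, 'a, 'y) module_scheme \<Rightarrow> ('k, 'b, 'z) module_scheme \<Rightarrow> bool"
  where "k_algebra_iso R S \<longleftrightarrow>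
    (\<exists>h \<in> ring_iso R S. \<forall>c. \<forall>u \<in> carrier R. h (c \<odot>\<^bsub>R\<^esub> u) = c \<odot>\<^bsub>S\<^esub> h u)"

text \<open>
  Besides two-sided ideals, \<open>I\<close> may be a linear subspace; then the additive group and the scalar
  action of the quotient are still meaningful.
\<close>
definition k_quotient ::
    "('k, 'a, 'z) module_scheme \<Rightarrow> 'a set \<Rightarrow> ('k, 'a set) module"
  where "k_quotient R I = ring.extend (R Quot I)
    (module.fields (\<lambda>c P. \<Union>p\<in>P. I +>\<^bsub>R\<^esub> (c \<odot>\<^bsub>R\<^esub> p)))"

definition mod_rels ::
    "('k, 'a, 'z) module_scheme \<Rightarrow> 'a set \<Rightarrow> ('k, 'a set) module"
  where "mod_rels R S = k_quotient R (Idl\<^bsub>R\<^esub> S)"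

definition rel_class :: "('k, 'a, 'z) module_scheme \<Rightarrow> 'a set \<Rightarrow> 'a \<Rightarrow> 'a set"
  where "rel_class R S u = (Idl\<^bsub>R\<^esub> S) +>\<^bsub>R\<^esub> u"

definition op_algebra :: "('k, 'a) module \<Rightarrow> ('k, 'a) module"
  where "op_algebra R = R\<lparr>mult := \<lambda>u v. v \<otimes>\<^bsub>R\<^esub> u\<rparr>"

definition commutator :: "('a, 'z) ring_scheme \<Rightarrow> 'a \<Rightarrow> 'a \<Rightarrow> 'a"
  where "commutator R u v = u \<otimes>\<^bsub>R\<^esub> v \<ominus>\<^bsub>R\<^esub> v \<otimes>\<^bsub>R\<^esub> u"


section \<open>Free algebras, tensor algebras and free products\<close>

definition scale :: "'k::field \<Rightarrow> ('g \<Rightarrow>\<^sub>0 'k) \<Rightarrow> ('g \<Rightarrow>\<^sub>0 'k)"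
  where "scale c p = Poly_Mapping.map ((*) c) p"

definition monoid_algebra :: "('g, 'z) monoid_scheme \<Rightarrow> ('k::field, 'g \<Rightarrow>\<^sub>0 'k) module"
  where "monoid_algebra G =
    \<lparr>carrier = {p. Poly_Mapping.keys p \<subseteq> carrier G},
     mult = (\<lambda>p q. \<Sum>u\<in>Poly_Mapping.keys p. \<Sum>v\<in>Poly_Mapping.keys q.
        Poly_Mapping.single (u \<otimes>\<^bsub>G\<^esub> v) (Poly_Mapping.lookup p u * Poly_Mapping.lookup q v)),
     one = Poly_Mapping.single \<one>\<^bsub>G\<^esub> 1,
     zero = 0, add = (+), smult = scale\<rparr>"

definition free_algebra :: "'g set \<Rightarrow> ('k::field, 'g list \<Rightarrow>\<^sub>0 'k) module"
  where "free_algebra S = monoid_algebra \<lparr>carrier = lists S, mult = (@), one = []\<rparr>"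

definition letter :: "'g \<Rightarrow> ('g list \<Rightarrow>\<^sub>0 'k::field)"
  where "letter s = Poly_Mapping.single [s] 1"

definition linear_rels ::
    "('k::field, 'v, 'z) module_scheme \<Rightarrow> ('v \<Rightarrow> 'g) \<Rightarrow> ('g list \<Rightarrow>\<^sub>0 'k) set"
  where "linear_rels V e =
      {letter (e (u \<oplus>\<^bsub>V\<^esub> v)) - (letter (e u) + letter (e v)) | u v.
         u \<in> carrier V \<and> v \<in> carrier V}
    \<union> {letter (e (c \<odot>\<^bsub>V\<^esub> u)) - scale c (letter (e u)) | c u. u \<in> carrier V}"

definition mult_rels ::
    "('k::field, 'a, 'z) module_scheme \<Rightarrow> ('a \<Rightarrow> 'g) \<Rightarrow> ('g list \<Rightarrow>\<^sub>0 'k) set"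
  where "mult_rels R e =
      {letter (e (u \<otimes>\<^bsub>R\<^esub> v)) - Poly_Mapping.single [e u, e v] 1 | u v.
         u \<in> carrier R \<and> v \<in> carrier R}
    \<union> {letter (e \<one>\<^bsub>R\<^esub>) - Poly_Mapping.single [] 1}"

definition tensor_algebra ::
    "('k::field, 'v, 'z) module_scheme \<Rightarrow> ('k, ('v list \<Rightarrow>\<^sub>0 'k) set) module"
  where "tensor_algebra V = mod_rels (free_algebra (carrier V)) (linear_rels V id)"

definition ta_gen ::
    "('k::field, 'v, 'z) module_scheme \<Rightarrow> 'v \<Rightarrow> ('v list \<Rightarrow>\<^sub>0 'k) set"
  where "ta_gen V v = rel_class (free_algebra (carrier V)) (linear_rels V id) (letter v)"

definition free_product_rels ::
    "('k::field, 'a, 'y) module_scheme \<Rightarrow> ('k, 'b, 'z) module_scheme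
      \<Rightarrow> (('a + 'b) list \<Rightarrow>\<^sub>0 'k) set"
  where "free_product_rels P Q =
    linear_rels P Inl \<union> mult_rels P Inl \<union> linear_rels Q Inr \<union> mult_rels Q Inr"

text \<open>The coproduct of unital algebras; in particular the units of the factors are identified.\<close>
definition free_product ::
    "('k::field, 'a, 'y) module_scheme \<Rightarrow> ('k, 'b, 'z) module_scheme
      \<Rightarrow> ('k, (('a + 'b) list \<Rightarrow>\<^sub>0 'k) set) module"  (infixr \<open>\<star>\<close> 65)
  where "P \<star> Q = mod_rels (free_algebra (carrier P <+> carrier Q)) (free_product_rels P Q)"

definition fp_inl ::
    "('k::field, 'a, 'y) module_scheme \<Rightarrow> ('k, 'b, 'z) module_scheme
      \<Rightarrow> 'a \<Rightarrow> (('a + 'b) list \<Rightarrow>\<^sub>0 'k) set"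
  where "fp_inl P Q u =
    rel_class (free_algebra (carrier P <+> carrier Q)) (free_product_rels P Q) (letter (Inl u))"

definition fp_inr ::
    "('k::field, 'a, 'y) module_scheme \<Rightarrow> ('k, 'b, 'z) module_scheme
      \<Rightarrow> 'b \<Rightarrow> (('a + 'b) list \<Rightarrow>\<^sub>0 'k) set"
  where "fp_inr P Q v =
    rel_class (free_algebra (carrier P <+> carrier Q)) (free_product_rels P Q) (letter (Inr v))"


section \<open>Tensor products over the ground field\<close>

definition lin_span :: "('g \<Rightarrow>\<^sub>0 'k::field) set \<Rightarrow> ('g \<Rightarrow>\<^sub>0 'k) set"
  where "lin_span S = Modules.module.span scale S"

definition bilinear_rels ::
    "('k::field, 'm, 'y) module_scheme \<Rightarrow> ('k, 'n, 'z) module_scheme \<Rightarrow> ('m \<times> 'n \<Rightarrow>\<^sub>0 'k) set"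
  where "bilinear_rels M N =
      {Poly_Mapping.single (m \<oplus>\<^bsub>M\<^esub> m', n) 1
         - (Poly_Mapping.single (m, n) 1 + Poly_Mapping.single (m', n) 1) | m m' n.
         m \<in> carrier M \<and> m' \<in> carrier M \<and> n \<in> carrier N}
    \<union> {Poly_Mapping.single (m, n \<oplus>\<^bsub>N\<^esub> n') 1
         - (Poly_Mapping.single (m, n) 1 + Poly_Mapping.single (m, n') 1) | m n n'.
         m \<in> carrier M \<and> n \<in> carrier N \<and> n' \<in> carrier N}
    \<union> {Poly_Mapping.single (c \<odot>\<^bsub>M\<^esub> m, n) 1 - Poly_Mapping.single (m, n) c | c m n.
         m \<in> carrier M \<and> n \<in> carrier N}
    \<union> {Poly_Mapping.single (m, c \<odot>\<^bsub>N\<^esub> n) 1 - Poly_Mapping.single (m, n) c | c m n.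
         m \<in> carrier M \<and> n \<in> carrier N}"

text \<open>
  If \<open>M\<close> and \<open>N\<close> are algebras, the span of the bilinear relations is an ideal of the monoid algebra
  and the quotient carries the usual product \<open>(m \<otimes> n)(m' \<otimes> n') = mm' \<otimes> nn'\<close>.
\<close>
definition k_tensor ::
    "('k::field, 'm, 'y) module_scheme \<Rightarrow> ('k, 'n, 'z) module_scheme
      \<Rightarrow> ('k, ('m \<times> 'n \<Rightarrow>\<^sub>0 'k) set) module"
  where "k_tensor M N = k_quotient (monoid_algebra (M \<times>\<times> N)) (lin_span (bilinear_rels M N))"

definition k_tens ::
    "('k::field, 'm, 'y) module_scheme \<Rightarrow> ('k, 'n, 'z) module_scheme
      \<Rightarrow> 'm \<Rightarrow> 'n \<Rightarrow> ('m \<times> 'n \<Rightarrow>\<^sub>0 'k) set"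
  where "k_tens M N m n =
    lin_span (bilinear_rels M N) +>\<^bsub>monoid_algebra (M \<times>\<times> N)\<^esub> Poly_Mapping.single (m, n) 1"

definition enveloping :: "('k::field, 'a) module \<Rightarrow> ('k, ('a \<times> 'a \<Rightarrow>\<^sub>0 'k) set) module"
  where "enveloping R = k_tensor R (op_algebra R)"


section \<open>Bimodules and tensor products over an algebra\<close>

record ('k, 'a, 'm) bimod = "('k, 'm) module" +
  lact :: "'a \<Rightarrow> 'm \<Rightarrow> 'm"
  ract :: "'m \<Rightarrow> 'a \<Rightarrow> 'm"

locale bimodule = R: k_algebra R + M: k_vector_space M
  for R :: "('k::field, 'a, 'y) module_scheme" and M :: "('k, 'a, 'm, 'z) bimod_scheme" +
  assumes lact_closed: "a \<in> carrier R \<Longrightarrow> m \<in> carrier M \<Longrightarrow> lact M a m \<in> carrier M"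
    and ract_closed: "a \<in> carrier R \<Longrightarrow> m \<in> carrier M \<Longrightarrow> ract M m a \<in> carrier M"
    and lact_add_left: "a \<in> carrier R \<Longrightarrow> a' \<in> carrier R \<Longrightarrow> m \<in> carrier M \<Longrightarrow>
      lact M (a \<oplus>\<^bsub>R\<^esub> a') m = lact M a m \<oplus>\<^bsub>M\<^esub> lact M a' m"
    and lact_add_right: "a \<in> carrier R \<Longrightarrow> m \<in> carrier M \<Longrightarrow> m' \<in> carrier M \<Longrightarrow>
      lact M a (m \<oplus>\<^bsub>M\<^esub> m') = lact M a m \<oplus>\<^bsub>M\<^esub> lact M a m'"
    and ract_add_left: "a \<in> carrier R \<Longrightarrow> m \<in> carrier M \<Longrightarrow> m' \<in> carrier M \<Longrightarrow>
      ract M (m \<oplus>\<^bsub>M\<^esub> m') a = ract M m a \<oplus>\<^bsub>M\<^esub> ract M m' a"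
    and ract_add_right: "a \<in> carrier R \<Longrightarrow> a' \<in> carrier R \<Longrightarrow> m \<in> carrier M \<Longrightarrow>
      ract M m (a \<oplus>\<^bsub>R\<^esub> a') = ract M m a \<oplus>\<^bsub>M\<^esub> ract M m a'"
    and lact_mult: "a \<in> carrier R \<Longrightarrow> a' \<in> carrier R \<Longrightarrow> m \<in> carrier M \<Longrightarrow>
      lact M (a \<otimes>\<^bsub>R\<^esub> a') m = lact M a (lact M a' m)"
    and ract_mult: "a \<in> carrier R \<Longrightarrow> a' \<in> carrier R \<Longrightarrow> m \<in> carrier M \<Longrightarrow>
      ract M m (a \<otimes>\<^bsub>R\<^esub> a') = ract M (ract M m a) a'"
    and lact_one: "m \<in> carrier M \<Longrightarrow> lact M \<one>\<^bsub>R\<^esub> m = m"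
    and ract_one: "m \<in> carrier M \<Longrightarrow> ract M m \<one>\<^bsub>R\<^esub> = m"
    and lact_ract: "a \<in> carrier R \<Longrightarrow> a' \<in> carrier R \<Longrightarrow> m \<in> carrier M \<Longrightarrow>
      ract M (lact M a m) a' = lact M a (ract M m a')"
    and lact_smult: "m \<in> carrier M \<Longrightarrow> lact M (c \<odot>\<^bsub>R\<^esub> \<one>\<^bsub>R\<^esub>) m = c \<odot>\<^bsub>M\<^esub> m"
    and ract_smult: "m \<in> carrier M \<Longrightarrow> ract M m (c \<odot>\<^bsub>R\<^esub> \<one>\<^bsub>R\<^esub>) = c \<odot>\<^bsub>M\<^esub> m"

definition bimod_hom ::
    "('k, 'a, 'x) module_scheme \<Rightarrow> ('k, 'a, 'm, 'y) bimod_scheme \<Rightarrow> ('k, 'a, 'n, 'z) bimod_scheme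
      \<Rightarrow> ('m \<Rightarrow> 'n) set"
  where "bimod_hom R M N = {f \<in> carrier M \<rightarrow> carrier N.
      (\<forall>m \<in> carrier M. \<forall>m' \<in> carrier M. f (m \<oplus>\<^bsub>M\<^esub> m') = f m \<oplus>\<^bsub>N\<^esub> f m')
    \<and> (\<forall>a \<in> carrier R. \<forall>m \<in> carrier M. f (lact M a m) = lact N a (f m))
    \<and> (\<forall>a \<in> carrier R. \<forall>m \<in> carrier M. f (ract M m a) = ract N (f m) a)}"

text \<open>\<open>M \<otimes>\<^sub>R N\<close> for an \<open>R\<close>-bimodule \<open>M\<close> and an \<open>R\<close>-bimodule \<open>N\<close>.\<close>

definition balanced_rels ::
    "('k::field, 'a, 'x) module_scheme \<Rightarrow> ('k, 'a, 'm, 'y) bimod_scheme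
      \<Rightarrow> ('k, 'a, 'n, 'z) bimod_scheme \<Rightarrow> ('m \<times> 'n \<Rightarrow>\<^sub>0 'k) set"
  where "balanced_rels R M N = bilinear_rels M N
    \<union> {Poly_Mapping.single (ract M m a, n) 1 - Poly_Mapping.single (m, lact N a n) 1 | m a n.
         m \<in> carrier M \<and> a \<in> carrier R \<and> n \<in> carrier N}"

definition tensor ::
    "('k::field, 'a, 'x) module_scheme \<Rightarrow> ('k, 'a, 'm, 'y) bimod_scheme
      \<Rightarrow> ('k, 'a, 'n, 'z) bimod_scheme \<Rightarrow> ('k, 'a, ('m \<times> 'n \<Rightarrow>\<^sub>0 'k) set) bimod"
  where "tensor R M N =
    (let F = monoid_algebra (M \<times>\<times> N); B = lin_span (balanced_rels R M N) in
     module.extend (k_quotient F B)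
       (bimod.fields
         (\<lambda>a P. \<Union>p\<in>P. B +>\<^bsub>F\<^esub> (\<Sum>k\<in>Poly_Mapping.keys p.
            Poly_Mapping.single (lact M a (fst k), snd k) (Poly_Mapping.lookup p k)))
         (\<lambda>P a. \<Union>p\<in>P. B +>\<^bsub>F\<^esub> (\<Sum>k\<in>Poly_Mapping.keys p.
            Poly_Mapping.single (fst k, ract N (snd k) a) (Poly_Mapping.lookup p k)))))"

definition tens ::
    "('k::field, 'a, 'x) module_scheme \<Rightarrow> ('k, 'a, 'm, 'y) bimod_scheme
      \<Rightarrow> ('k, 'a, 'n, 'z) bimod_scheme \<Rightarrow> 'm \<Rightarrow> 'n \<Rightarrow> ('m \<times> 'n \<Rightarrow>\<^sub>0 'k) set"
  where "tens R M N m n =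
    lin_span (balanced_rels R M N) +>\<^bsub>monoid_algebra (M \<times>\<times> N)\<^esub> Poly_Mapping.single (m, n) 1"

text \<open>
  The linear map \<open>m \<otimes> n \<mapsto> h m n\<close> from a tensor product to \<open>C\<close> induced by a bilinear and balanced \<open>h\<close>:
  \<open>P\<close> is a set of formal sums of pairs, on all of which the linear extension of \<open>h\<close> agrees.
\<close>
definition tensor_lift ::
    "('k::field, 'c, 'z) module_scheme \<Rightarrow> ('m \<Rightarrow> 'n \<Rightarrow> 'c) \<Rightarrow> ('m \<times> 'n \<Rightarrow>\<^sub>0 'k) set \<Rightarrow> 'c"
  where "tensor_lift C h P = the_elem
    ((\<lambda>p. \<Oplus>\<^bsub>C\<^esub>k\<in>Poly_Mapping.keys p. Poly_Mapping.lookup p k \<odot>\<^bsub>C\<^esub> h (fst k) (snd k)) ` P)"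


section \<open>Differential graded algebras\<close>

record ('k, 'w) dga = "('k, 'w) module" +
  grade :: "nat \<Rightarrow> 'w set"
  diff :: "'w \<Rightarrow> 'w"

locale dg_algebra = k_algebra W
  for W :: "('k::field, 'w) dga" (structure) +
  assumes grade_subset: "grade W n \<subseteq> carrier W"
    and grade_zero: "\<zero> \<in> grade W n"
    and grade_add: "u \<in> grade W n \<Longrightarrow> v \<in> grade W n \<Longrightarrow> u \<oplus> v \<in> grade W n"
    and grade_smult: "u \<in> grade W n \<Longrightarrow> c \<odot> u \<in> grade W n"
    and direct_sum: "u \<in> carrier W \<Longrightarrow>
      \<exists>!f. (\<forall>n. f n \<in> grade W n) \<and> finite {n. f n \<noteq> \<zero>} \<and> u = (\<Oplus>n\<in>{n. f n \<noteq> \<zero>}. f n)"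
    and grade_one: "\<one> \<in> grade W 0"
    and grade_mult: "u \<in> grade W m \<Longrightarrow> v \<in> grade W n \<Longrightarrow> u \<otimes> v \<in> grade W (m + n)"
    and diff_grade: "u \<in> grade W n \<Longrightarrow> diff W u \<in> grade W (Suc n)"
    and diff_add: "u \<in> carrier W \<Longrightarrow> v \<in> carrier W \<Longrightarrow> diff W (u \<oplus> v) = diff W u \<oplus> diff W v"
    and diff_smult: "u \<in> carrier W \<Longrightarrow> diff W (c \<odot> u) = c \<odot> diff W u"
    and diff_diff: "u \<in> carrier W \<Longrightarrow> diff W (diff W u) = \<zero>"
    and leibniz: "u \<in> grade W n \<Longrightarrow> v \<in> carrier W \<Longrightarrow>
      diff W (u \<otimes> v) = diff W u \<otimes> v \<oplus> (- 1) ^ n \<odot> (u \<otimes> diff W v)"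

text \<open>
  \<open>\<Omega>\<^sup>n\<close> as a bimodule over \<open>A = \<Omega>\<^sup>0\<close>, and \<open>A\<close> itself, both as an algebra and as a bimodule.
  The wedge product is the multiplication of \<open>W\<close>.
\<close>

definition forms :: "('k, 'w) dga \<Rightarrow> nat \<Rightarrow> ('k, 'w, 'w) bimod"
  where "forms W n = \<lparr>carrier = grade W n, mult = mult W, one = one W, zero = zero W, add = add W,
    smult = smult W, lact = mult W, ract = mult W\<rparr>"

definition base_algebra :: "('k, 'w) dga \<Rightarrow> ('k, 'w) module"
  where "base_algebra W = \<lparr>carrier = grade W 0, mult = mult W, one = one W, zero = zero W,
    add = add W, smult = smult W\<rparr>"

definition surjective_calculus :: "('k, 'w) dga \<Rightarrow> bool"
  where "surjective_calculus W \<longleftrightarrow>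
    (\<forall>\<omega> \<in> grade W 1. \<exists>(n::nat) a b. a \<in> {..<n} \<rightarrow> grade W 0 \<and> b \<in> {..<n} \<rightarrow> grade W 0
       \<and> \<omega> = (\<Oplus>\<^bsub>W\<^esub>m\<in>{..<n}. a m \<otimes>\<^bsub>W\<^esub> diff W (b m)))"

definition wedge11 :: "('k::field, 'w) dga \<Rightarrow> ('w \<times> 'w \<Rightarrow>\<^sub>0 'k) set \<Rightarrow> 'w"
  where "wedge11 W = tensor_lift (forms W 2) (mult W)"

definition wedge_surjective :: "('k::field, 'w) dga \<Rightarrow> bool"
  where "wedge_surjective W \<longleftrightarrow>
    wedge11 W ` carrier (tensor (base_algebra W) (forms W 1) (forms W 1)) = grade W 2"


section \<open>Pivotal structures\<close>

text \<open>
  The triangle identities for \<open>coev : A \<rightarrow> M \<otimes>\<^sub>A N\<close> and \<open>ev : N \<otimes>\<^sub>A M \<rightarrow> A\<close>, with the unit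
  and associativity isomorphisms of the monoidal category suppressed:
  \<open>(id \<otimes> ev)(coev(1) \<otimes> m) = m\<close> and \<open>(ev \<otimes> id)(n \<otimes> coev(1)) = n\<close>.
\<close>
definition duality ::
    "('k::field, 'w) dga \<Rightarrow> ('k, 'w, 'm) bimod \<Rightarrow> ('k, 'w, 'n) bimod
      \<Rightarrow> ('w \<Rightarrow> ('m \<times> 'n \<Rightarrow>\<^sub>0 'k) set) \<Rightarrow> (('n \<times> 'm \<Rightarrow>\<^sub>0 'k) set \<Rightarrow> 'w) \<Rightarrow> bool"
  where "duality W M N cv e \<longleftrightarrow>
    (let A = base_algebra W in
       cv \<in> bimod_hom A (forms W 0) (tensor A M N)
     \<and> e \<in> bimod_hom A (tensor A N M) (forms W 0)
     \<and> (\<forall>m \<in> carrier M.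
          tensor_lift M (\<lambda>m' n'. ract M m' (e (tens A N M n' m))) (cv \<one>\<^bsub>W\<^esub>) = m)
     \<and> (\<forall>n \<in> carrier N.
          tensor_lift N (\<lambda>m' n'. lact N (e (tens A N M n m')) n') (cv \<one>\<^bsub>W\<^esub>) = n))"

text \<open>\<open>dual\<close> is \<open>\<XX>\<^sup>n\<close>; \<open>ucoev\<close> and \<open>uev\<close> are the underlined coevaluation and evaluation.\<close>
record (overloaded) ('k, 'w, 'x) two_sided_dual =
  dual :: "('k, 'w, 'x) bimod"
  coev :: "'w \<Rightarrow> ('w \<times> 'x \<Rightarrow>\<^sub>0 'k) set"
  ev :: "('x \<times> 'w \<Rightarrow>\<^sub>0 'k) set \<Rightarrow> 'w"
  ucoev :: "'w \<Rightarrow> ('x \<times> 'w \<Rightarrow>\<^sub>0 'k) set"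
  uev :: "('w \<times> 'x \<Rightarrow>\<^sub>0 'k) set \<Rightarrow> 'w"

definition pivotal_dual ::
    "('k::field, 'w) dga \<Rightarrow> nat \<Rightarrow> ('k, 'w, 'x) two_sided_dual \<Rightarrow> bool"
  where "pivotal_dual W n P \<longleftrightarrow> bimodule (base_algebra W) (dual P)
    \<and> duality W (forms W n) (dual P) (coev P) (ev P)
    \<and> duality W (dual P) (forms W n) (ucoev P) (uev P)"

text \<open>
  \<open>P\<close> and \<open>Q\<close> are the duality data in degrees 1 and 2.  The families \<open>b, x\<close> (of length \<open>p\<close>) and
  \<open>y, c\<close> (of length \<open>q\<close>) give the representatives \<open>coev(1) = \<Sum>\<^sub>i db\<^sub>i \<otimes> x\<^sub>i\<close> and
  \<open>ucoev(1) = \<Sum>\<^sub>j y\<^sub>j \<otimes> dc\<^sub>j\<close>.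
\<close>
locale calculus_data =
  fixes W :: "('k::field, 'w) dga"
    and P :: "('k, 'w, 'x) two_sided_dual"
    and Q :: "('k, 'w, 'y) two_sided_dual"
    and p :: nat and b :: "nat \<Rightarrow> 'w" and x :: "nat \<Rightarrow> 'x"
    and q :: nat and y :: "nat \<Rightarrow> 'x" and c :: "nat \<Rightarrow> 'w"
begin

abbreviation d :: "'w \<Rightarrow> 'w" where "d \<equiv> diff W"
abbreviation wedge :: "'w \<Rightarrow> 'w \<Rightarrow> 'w" (infixl \<open>\<and>\<^sub>W\<close> 70) where "u \<and>\<^sub>W v \<equiv> u \<otimes>\<^bsub>W\<^esub> v"
abbreviation \<omega> :: "nat \<Rightarrow> 'w" where "\<omega> i \<equiv> d (b i)"
abbreviation \<rho> :: "nat \<Rightarrow> 'w" where "\<rho> j \<equiv> d (c j)"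
abbreviation A :: "('k, 'w) module" where "A \<equiv> base_algebra W"
abbreviation \<Omega>1 :: "('k, 'w, 'w) bimod" where "\<Omega>1 \<equiv> forms W 1"
abbreviation \<Omega>2 :: "('k, 'w, 'w) bimod" where "\<Omega>2 \<equiv> forms W 2"
abbreviation X1 :: "('k, 'w, 'x) bimod" where "X1 \<equiv> dual P"
abbreviation X2 :: "('k, 'w, 'y) bimod" where "X2 \<equiv> dual Q"
abbreviation ev1 :: "'x \<Rightarrow> 'w \<Rightarrow> 'w" where "ev1 u \<eta> \<equiv> ev P (tens A X1 \<Omega>1 u \<eta>)"
abbreviation uev1 :: "'w \<Rightarrow> 'x \<Rightarrow> 'w" where "uev1 \<eta> u \<equiv> uev P (tens A \<Omega>1 X1 \<eta> u)"
abbreviation ev2 :: "'y \<Rightarrow> 'w \<Rightarrow> 'w" where "ev2 \<xi> \<eta> \<equiv> ev Q (tens A X2 \<Omega>2 \<xi> \<eta>)"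
abbreviation uev2 :: "'w \<Rightarrow> 'y \<Rightarrow> 'w" where "uev2 \<eta> \<xi> \<equiv> uev Q (tens A \<Omega>2 X2 \<eta> \<xi>)"

definition representatives :: bool
  where "representatives \<longleftrightarrow>
      b \<in> {..<p} \<rightarrow> carrier A \<and> x \<in> {..<p} \<rightarrow> carrier X1
    \<and> coev P \<one>\<^bsub>W\<^esub> = (\<Oplus>\<^bsub>tensor A \<Omega>1 X1\<^esub>i\<in>{..<p}. tens A \<Omega>1 X1 (\<omega> i) (x i))
    \<and> y \<in> {..<q} \<rightarrow> carrier X1 \<and> c \<in> {..<q} \<rightarrow> carrier A
    \<and> ucoev P \<one>\<^bsub>W\<^esub> = (\<Oplus>\<^bsub>tensor A X1 \<Omega>1\<^esub>j\<in>{..<q}. tens A X1 \<Omega>1 (y j) (\<rho> j))"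

definition wedge_pivotal :: bool
  where "wedge_pivotal \<longleftrightarrow> (\<forall>\<xi> \<in> carrier X2.
      (\<Oplus>\<^bsub>tensor A X1 X1\<^esub>i\<in>{..<p}. \<Oplus>\<^bsub>tensor A X1 X1\<^esub>j\<in>{..<p}.
         tens A X1 X1 (lact X1 (ev2 \<xi> (\<omega> i \<and>\<^sub>W \<omega> j)) (x j)) (x i))
    = (\<Oplus>\<^bsub>tensor A X1 X1\<^esub>i\<in>{..<q}. \<Oplus>\<^bsub>tensor A X1 X1\<^esub>j\<in>{..<q}.
         tens A X1 X1 (y i) (ract X1 (y j) (uev2 (\<rho> j \<and>\<^sub>W \<rho> i) \<xi>))))"

definition pivotal_structure :: bool
  where "pivotal_structure \<longleftrightarrow>
    pivotal_dual W 1 P \<and> pivotal_dual W 2 Q \<and> representatives \<and> wedge_pivotal"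


subsection \<open>The algebra \<open>D\<close>\<close>

abbreviation "T_X1 \<equiv> tensor_algebra X1"
abbreviation "T_X\<Omega>1 \<equiv> tensor_algebra (k_tensor X1 \<Omega>1)"
abbreviation "T_X\<Omega>2 \<equiv> tensor_algebra (k_tensor X2 \<Omega>2)"
abbreviation "T_\<Omega>X1 \<equiv> tensor_algebra (k_tensor \<Omega>1 X1)"
abbreviation "T_\<Omega>X2 \<equiv> tensor_algebra (k_tensor \<Omega>2 X2)"

abbreviation "D4 \<equiv> T_\<Omega>X1 \<star> T_\<Omega>X2"
abbreviation "D3 \<equiv> T_X\<Omega>2 \<star> D4"
abbreviation "D2 \<equiv> T_X\<Omega>1 \<star> D3"
abbreviation "D1 \<equiv> T_X1 \<star> D2"

definition "D = enveloping A \<star> D1"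

text \<open>
  The generators: \<open>D_A a a'\<close> is \<open>a \<otimes> a'\<close> in \<open>A \<otimes> A\<^sup>o\<^sup>p\<close>, \<open>D_X u\<close> is \<open>u \<in> \<XX>\<^sup>1\<close>, and the remaining
  four are the pairs \<open>(u, \<eta>)\<close>, \<open>(\<xi>, \<eta>)\<close>, \<open>(\<eta>, u)\<close>, \<open>(\<eta>, \<xi>)\<close>.
\<close>
definition "D_A a a' = fp_inl (enveloping A) D1 (k_tens A (op_algebra A) a a')"
definition "D_X u = fp_inr (enveloping A) D1 (fp_inl T_X1 D2 (ta_gen X1 u))"
definition "D_X\<Omega>1 u \<eta> = fp_inr (enveloping A) D1 (fp_inr T_X1 D2
  (fp_inl T_X\<Omega>1 D3 (ta_gen (k_tensor X1 \<Omega>1) (k_tens X1 \<Omega>1 u \<eta>))))"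
definition "D_X\<Omega>2 \<xi> \<eta> = fp_inr (enveloping A) D1 (fp_inr T_X1 D2 (fp_inr T_X\<Omega>1 D3
  (fp_inl T_X\<Omega>2 D4 (ta_gen (k_tensor X2 \<Omega>2) (k_tens X2 \<Omega>2 \<xi> \<eta>)))))"
definition "D_\<Omega>X1 \<eta> u = fp_inr (enveloping A) D1 (fp_inr T_X1 D2 (fp_inr T_X\<Omega>1 D3
  (fp_inr T_X\<Omega>2 D4 (fp_inl T_\<Omega>X1 T_\<Omega>X2 (ta_gen (k_tensor \<Omega>1 X1) (k_tens \<Omega>1 X1 \<eta> u))))))"
definition "D_\<Omega>X2 \<eta> \<xi> = fp_inr (enveloping A) D1 (fp_inr T_X1 D2 (fp_inr T_X\<Omega>1 D3
  (fp_inr T_X\<Omega>2 D4 (fp_inr T_\<Omega>X1 T_\<Omega>X2 (ta_gen (k_tensor \<Omega>2 X2) (k_tens \<Omega>2 X2 \<eta> \<xi>))))))"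

abbreviation "D_a a \<equiv> D_A a \<one>\<^bsub>A\<^esub>"
abbreviation "D_bar a \<equiv> D_A \<one>\<^bsub>A\<^esub> a"

text \<open>An equation \<open>l = r\<close> is encoded as the element \<open>l - r\<close> to be divided out.\<close>

definition "D_rels_bimod =
    {D_A a a' \<otimes>\<^bsub>D\<^esub> D_X\<Omega>1 u \<eta> \<otimes>\<^bsub>D\<^esub> D_A e e'
       \<ominus>\<^bsub>D\<^esub> D_X\<Omega>1 (ract X1 (lact X1 a u) e) (ract \<Omega>1 (lact \<Omega>1 e' \<eta>) a') | a a' e e' u \<eta>.
       {a, a', e, e'} \<subseteq> carrier A \<and> u \<in> carrier X1 \<and> \<eta> \<in> carrier \<Omega>1}
  \<union> {D_A a a' \<otimes>\<^bsub>D\<^esub> D_X\<Omega>2 \<xi> \<eta> \<otimes>\<^bsub>D\<^esub> D_A e e'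
       \<ominus>\<^bsub>D\<^esub> D_X\<Omega>2 (ract X2 (lact X2 a \<xi>) e) (ract \<Omega>2 (lact \<Omega>2 e' \<eta>) a') | a a' e e' \<xi> \<eta>.
       {a, a', e, e'} \<subseteq> carrier A \<and> \<xi> \<in> carrier X2 \<and> \<eta> \<in> carrier \<Omega>2}
  \<union> {D_A a a' \<otimes>\<^bsub>D\<^esub> D_\<Omega>X1 \<eta> u \<otimes>\<^bsub>D\<^esub> D_A e e'
       \<ominus>\<^bsub>D\<^esub> D_\<Omega>X1 (ract \<Omega>1 (lact \<Omega>1 a \<eta>) e) (ract X1 (lact X1 e' u) a') | a a' e e' \<eta> u.
       {a, a', e, e'} \<subseteq> carrier A \<and> \<eta> \<in> carrier \<Omega>1 \<and> u \<in> carrier X1}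
  \<union> {D_A a a' \<otimes>\<^bsub>D\<^esub> D_\<Omega>X2 \<eta> \<xi> \<otimes>\<^bsub>D\<^esub> D_A e e'
       \<ominus>\<^bsub>D\<^esub> D_\<Omega>X2 (ract \<Omega>2 (lact \<Omega>2 a \<eta>) e) (ract X2 (lact X2 e' \<xi>) a') | a a' e e' \<eta> \<xi>.
       {a, a', e, e'} \<subseteq> carrier A \<and> \<eta> \<in> carrier \<Omega>2 \<and> \<xi> \<in> carrier X2}"

definition "D_rels_first_order =
    {D_a a \<otimes>\<^bsub>D\<^esub> D_X u \<ominus>\<^bsub>D\<^esub> D_X (lact X1 a u) | a u. a \<in> carrier A \<and> u \<in> carrier X1}
  \<union> {D_X u \<otimes>\<^bsub>D\<^esub> D_a a \<ominus>\<^bsub>D\<^esub> (D_X (ract X1 u a) \<oplus>\<^bsub>D\<^esub> D_a (ev1 u (d a))) | a u.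
       a \<in> carrier A \<and> u \<in> carrier X1}
  \<union> {D_X u \<otimes>\<^bsub>D\<^esub> D_bar a \<ominus>\<^bsub>D\<^esub> (D_bar a \<otimes>\<^bsub>D\<^esub> D_X u \<oplus>\<^bsub>D\<^esub> D_X\<Omega>1 u (d a)) | a u.
       a \<in> carrier A \<and> u \<in> carrier X1}
  \<union> {(\<Oplus>\<^bsub>D\<^esub>i\<in>{..<p}. D_\<Omega>X1 (\<omega> i) v \<otimes>\<^bsub>D\<^esub> D_X\<Omega>1 (x i) \<eta>) \<ominus>\<^bsub>D\<^esub> D_bar (uev1 \<eta> v) | v \<eta>.
       v \<in> carrier X1 \<and> \<eta> \<in> carrier \<Omega>1}
  \<union> {(\<Oplus>\<^bsub>D\<^esub>j\<in>{..<q}. D_X\<Omega>1 u (\<rho> j) \<otimes>\<^bsub>D\<^esub> D_\<Omega>X1 \<eta> (y j)) \<ominus>\<^bsub>D\<^esub> D_a (ev1 u \<eta>) | u \<eta>.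
       u \<in> carrier X1 \<and> \<eta> \<in> carrier \<Omega>1}
  \<union> {(\<Oplus>\<^bsub>D\<^esub>j\<in>{..<q}. D_X\<Omega>1 (y j) \<eta> \<otimes>\<^bsub>D\<^esub> D_\<Omega>X1 (\<rho> j) u) \<ominus>\<^bsub>D\<^esub> D_bar (ev1 u \<eta>) | u \<eta>.
       u \<in> carrier X1 \<and> \<eta> \<in> carrier \<Omega>1}
  \<union> {(\<Oplus>\<^bsub>D\<^esub>i\<in>{..<p}. D_\<Omega>X1 \<eta> (x i) \<otimes>\<^bsub>D\<^esub> D_X\<Omega>1 u (\<omega> i)) \<ominus>\<^bsub>D\<^esub> D_a (uev1 \<eta> u) | u \<eta>.
       u \<in> carrier X1 \<and> \<eta> \<in> carrier \<Omega>1}"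

definition "D_rels_second_order =
    {(\<Oplus>\<^bsub>D\<^esub>i\<in>{..<p}. D_a (ev2 \<xi> (d (\<omega> i))) \<otimes>\<^bsub>D\<^esub> D_X (x i))
       \<ominus>\<^bsub>D\<^esub> (\<Oplus>\<^bsub>D\<^esub>j\<in>{..<p}. \<Oplus>\<^bsub>D\<^esub>k\<in>{..<p}.
             D_a (ev2 \<xi> (\<omega> j \<and>\<^sub>W \<omega> k)) \<otimes>\<^bsub>D\<^esub> D_X (x k) \<otimes>\<^bsub>D\<^esub> D_X (x j)) | \<xi>.
       \<xi> \<in> carrier X2}
  \<union> {(\<Oplus>\<^bsub>D\<^esub>i\<in>{..<p}. \<Oplus>\<^bsub>D\<^esub>j\<in>{..<p}. D_a (ev2 \<xi> (\<omega> i \<and>\<^sub>W \<omega> j)) \<otimes>\<^bsub>D\<^esub>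
          (D_X (x j) \<otimes>\<^bsub>D\<^esub> D_X\<Omega>1 (x i) \<eta> \<oplus>\<^bsub>D\<^esub> D_X\<Omega>1 (x j) \<eta> \<otimes>\<^bsub>D\<^esub> D_X (x i)))
       \<ominus>\<^bsub>D\<^esub> ((\<Oplus>\<^bsub>D\<^esub>i\<in>{..<p}. D_a (ev2 \<xi> (d (\<omega> i))) \<otimes>\<^bsub>D\<^esub> D_X\<Omega>1 (x i) \<eta>)
             \<ominus>\<^bsub>D\<^esub> D_X\<Omega>2 \<xi> (d \<eta>)) | \<xi> \<eta>.
       \<xi> \<in> carrier X2 \<and> \<eta> \<in> carrier \<Omega>1}
  \<union> {(\<Oplus>\<^bsub>D\<^esub>i\<in>{..<p}. \<Oplus>\<^bsub>D\<^esub>j\<in>{..<p}.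
          D_a (ev2 \<xi> (\<omega> i \<and>\<^sub>W \<omega> j)) \<otimes>\<^bsub>D\<^esub> D_X\<Omega>1 (x j) \<theta> \<otimes>\<^bsub>D\<^esub> D_X\<Omega>1 (x i) \<eta>)
       \<ominus>\<^bsub>D\<^esub> D_X\<Omega>2 \<xi> (\<eta> \<and>\<^sub>W \<theta>) | \<xi> \<eta> \<theta>.
       \<xi> \<in> carrier X2 \<and> \<eta> \<in> carrier \<Omega>1 \<and> \<theta> \<in> carrier \<Omega>1}
  \<union> {(\<Oplus>\<^bsub>D\<^esub>i\<in>{..<q}. \<Oplus>\<^bsub>D\<^esub>j\<in>{..<q}.
          D_bar (uev2 (\<rho> i \<and>\<^sub>W \<rho> j) \<xi>) \<otimes>\<^bsub>D\<^esub> D_\<Omega>X1 \<eta> (y i) \<otimes>\<^bsub>D\<^esub> D_\<Omega>X1 \<theta> (y j))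
       \<ominus>\<^bsub>D\<^esub> D_\<Omega>X2 (\<eta> \<and>\<^sub>W \<theta>) \<xi> | \<xi> \<eta> \<theta>.
       \<xi> \<in> carrier X2 \<and> \<eta> \<in> carrier \<Omega>1 \<and> \<theta> \<in> carrier \<Omega>1}"

definition "DX = mod_rels D (D_rels_bimod \<union> D_rels_first_order \<union> D_rels_second_order)"


subsection \<open>The algebra \<open>HX1\<close> and its quotient\<close>

definition "H = enveloping A \<star> (T_X1 \<star> T_X1)"

text \<open>\<open>H_Y u\<close> is the generator \<open>u\<close> with a bar, from the second copy of \<open>\<XX>\<^sup>1\<close>.\<close>
definition "H_A a a' = fp_inl (enveloping A) (T_X1 \<star> T_X1) (k_tens A (op_algebra A) a a')"
definition "H_X u = fp_inr (enveloping A) (T_X1 \<star> T_X1) (fp_inl T_X1 T_X1 (ta_gen X1 u))"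
definition "H_Y u = fp_inr (enveloping A) (T_X1 \<star> T_X1) (fp_inr T_X1 T_X1 (ta_gen X1 u))"

abbreviation "H_a a \<equiv> H_A a \<one>\<^bsub>A\<^esub>"
abbreviation "H_bar a \<equiv> H_A \<one>\<^bsub>A\<^esub> a"

definition first_order_null :: "nat \<Rightarrow> (nat \<Rightarrow> 'w) \<Rightarrow> (nat \<Rightarrow> 'w) \<Rightarrow> bool"
  where "first_order_null n r s \<longleftrightarrow> r \<in> {..<n} \<rightarrow> carrier A \<and> s \<in> {..<n} \<rightarrow> carrier A
    \<and> (\<Oplus>\<^bsub>A\<^esub>m\<in>{..<n}. r m \<otimes>\<^bsub>A\<^esub> s m) = \<zero>\<^bsub>A\<^esub>
    \<and> (\<Oplus>\<^bsub>\<Omega>1\<^esub>m\<in>{..<n}. lact \<Omega>1 (r m) (d (s m))) = \<zero>\<^bsub>\<Omega>1\<^esub>"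

definition "H_rels =
    {H_a a \<otimes>\<^bsub>H\<^esub> H_X u \<ominus>\<^bsub>H\<^esub> H_X (lact X1 a u) | a u. a \<in> carrier A \<and> u \<in> carrier X1}
  \<union> {H_X u \<otimes>\<^bsub>H\<^esub> H_a a \<ominus>\<^bsub>H\<^esub> (H_X (ract X1 u a) \<oplus>\<^bsub>H\<^esub> H_a (ev1 u (d a))) | a u.
       a \<in> carrier A \<and> u \<in> carrier X1}
  \<union> {H_bar a \<otimes>\<^bsub>H\<^esub> H_Y v \<ominus>\<^bsub>H\<^esub> H_Y (ract X1 v a) | a v. a \<in> carrier A \<and> v \<in> carrier X1}
  \<union> {H_Y v \<otimes>\<^bsub>H\<^esub> H_bar a \<ominus>\<^bsub>H\<^esub> (H_Y (lact X1 a v) \<oplus>\<^bsub>H\<^esub> H_bar (uev1 (d a) v)) | a v.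
       a \<in> carrier A \<and> v \<in> carrier X1}
  \<union> {\<Oplus>\<^bsub>H\<^esub>m\<in>{..<n}. H_bar (s m) \<otimes>\<^bsub>H\<^esub> H_X u \<otimes>\<^bsub>H\<^esub> H_bar (r m) | n r s u.
       first_order_null n r s \<and> u \<in> carrier X1}
  \<union> {\<Oplus>\<^bsub>H\<^esub>m\<in>{..<n}. H_a (r m) \<otimes>\<^bsub>H\<^esub> H_Y v \<otimes>\<^bsub>H\<^esub> H_a (s m) | n r s v.
       first_order_null n r s \<and> v \<in> carrier X1}
  \<union> {(\<Oplus>\<^bsub>H\<^esub>i\<in>{..<p}. commutator H (H_Y v) (H_a (b i)) \<otimes>\<^bsub>H\<^esub> H_X (x i)) \<ominus>\<^bsub>H\<^esub> H_Y v | v.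
       v \<in> carrier X1}
  \<union> {(\<Oplus>\<^bsub>H\<^esub>j\<in>{..<q}. commutator H (H_X u) (H_bar (c j)) \<otimes>\<^bsub>H\<^esub> H_Y (y j)) \<ominus>\<^bsub>H\<^esub> H_X u | u.
       u \<in> carrier X1}
  \<union> {(\<Oplus>\<^bsub>H\<^esub>j\<in>{..<q}. commutator H (H_X (y j)) (H_bar a) \<otimes>\<^bsub>H\<^esub> commutator H (H_Y u) (H_a (c j)))
       \<ominus>\<^bsub>H\<^esub> H_bar (ev1 u (d a)) | a u. a \<in> carrier A \<and> u \<in> carrier X1}
  \<union> {(\<Oplus>\<^bsub>H\<^esub>i\<in>{..<p}. commutator H (H_Y (x i)) (H_a a) \<otimes>\<^bsub>H\<^esub> commutator H (H_X u) (H_bar (b i)))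
       \<ominus>\<^bsub>H\<^esub> H_a (uev1 (d a) u) | a u. a \<in> carrier A \<and> u \<in> carrier X1}"

definition "HX1 = mod_rels H H_rels"

definition "HX_A a a' = rel_class H H_rels (H_A a a')"
definition "HX_X u = rel_class H H_rels (H_X u)"
definition "HX_Y u = rel_class H H_rels (H_Y u)"

abbreviation "HX_a a \<equiv> HX_A a \<one>\<^bsub>A\<^esub>"
abbreviation "HX_bar a \<equiv> HX_A \<one>\<^bsub>A\<^esub> a"

text \<open>\<open>\<Sum>\<^sub>m r\<^sub>m da\<^sub>m \<otimes> de\<^sub>m\<close> lies in the kernel of \<open>\<and> : \<Omega>\<^sup>1 \<otimes>\<^sub>A \<Omega>\<^sup>1 \<rightarrow> \<Omega>\<^sup>2\<close>.\<close>
definition wedge_null :: "nat \<Rightarrow> (nat \<Rightarrow> 'w) \<Rightarrow> (nat \<Rightarrow> 'w) \<Rightarrow> (nat \<Rightarrow> 'w) \<Rightarrow> bool"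
  where "wedge_null n r a e \<longleftrightarrow> r \<in> {..<n} \<rightarrow> carrier A \<and> a \<in> {..<n} \<rightarrow> carrier A
    \<and> e \<in> {..<n} \<rightarrow> carrier A
    \<and> wedge11 W (\<Oplus>\<^bsub>tensor A \<Omega>1 \<Omega>1\<^esub>m\<in>{..<n}.
         tens A \<Omega>1 \<Omega>1 (lact \<Omega>1 (r m) (d (a m))) (d (e m))) = \<zero>\<^bsub>\<Omega>2\<^esub>"

definition "HX_rels =
    {(\<Oplus>\<^bsub>HX1\<^esub>i\<in>{..<p}. HX_a (ev2 \<xi> (d (\<omega> i))) \<otimes>\<^bsub>HX1\<^esub> HX_X (x i))
       \<ominus>\<^bsub>HX1\<^esub> (\<Oplus>\<^bsub>HX1\<^esub>j\<in>{..<p}. \<Oplus>\<^bsub>HX1\<^esub>k\<in>{..<p}.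
             HX_a (ev2 \<xi> (\<omega> j \<and>\<^sub>W \<omega> k)) \<otimes>\<^bsub>HX1\<^esub> HX_X (x k) \<otimes>\<^bsub>HX1\<^esub> HX_X (x j)) | \<xi>.
       \<xi> \<in> carrier X2}
  \<union> {\<Oplus>\<^bsub>HX1\<^esub>m\<in>{..<n}. \<Oplus>\<^bsub>HX1\<^esub>i\<in>{..<p}. \<Oplus>\<^bsub>HX1\<^esub>j\<in>{..<p}.
         HX_a (ev2 \<xi> (\<omega> i \<and>\<^sub>W \<omega> j))
           \<otimes>\<^bsub>HX1\<^esub> commutator HX1 (HX_X (x j)) (HX_bar (e m))
           \<otimes>\<^bsub>HX1\<^esub> commutator HX1 (HX_X (x i)) (HX_bar (a m))
           \<otimes>\<^bsub>HX1\<^esub> HX_bar (r m) | n r a e \<xi>.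
       wedge_null n r a e \<and> \<xi> \<in> carrier X2}
  \<union> {\<Oplus>\<^bsub>HX1\<^esub>m\<in>{..<n}. \<Oplus>\<^bsub>HX1\<^esub>i\<in>{..<q}. \<Oplus>\<^bsub>HX1\<^esub>j\<in>{..<q}.
         HX_bar (uev2 (\<rho> i \<and>\<^sub>W \<rho> j) \<xi>)
           \<otimes>\<^bsub>HX1\<^esub> HX_a (r m)
           \<otimes>\<^bsub>HX1\<^esub> commutator HX1 (HX_Y (y i)) (HX_a (a m))
           \<otimes>\<^bsub>HX1\<^esub> commutator HX1 (HX_Y (y j)) (HX_a (e m)) | n r a e \<xi>.
       wedge_null n r a e \<and> \<xi> \<in> carrier X2}"

definition "HX_quotient = mod_rels HX1 HX_rels"

end

end

theory Submission
  imports Defs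
begin

text \<open>
Both algebras represent the same functor.  A homomorphism from \<open>DX\<close> to an algebra \<open>B\<close> is a choice
  of images of the generators for which the relations hold, a \<open>D_model\<close> in \<open>B\<close>; a homomorphism from
  \<open>HX_quotient\<close> is in the same way an \<open>H_model\<close> in \<open>B\<close>.  Every model of one kind gives one of the other
  kind in the same algebra \<open>B\<close>, with the same images \<open>\<alpha> a\<close>, \<open>\<beta> a\<close>, \<open>X u\<close> of \<open>a\<close>, \<open>a\<close> with a bar and
  \<open>u \<in> \<XX>\<^sup>1\<close>.  The two passages are forced and mutually inverse, so the universal models determine
  each other.

  From \<open>D\<close> to \<open>H\<close>, only the second copy \<open>Y\<close> of \<open>\<XX>\<^sup>1\<close> has to be found.  The relation
  \<open>\<Sum>\<^sub>i [Y v, b\<^sub>i] x\<^sub>i = Y v\<close> leaves one candidate as soon as \<open>[Y v, a]\<close> is to be the pair \<open>(da, v)\<close>: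
  it must be \<open>Y v = \<Sum>\<^sub>i (\<omega>\<^sub>i, v) x\<^sub>i\<close>.  That its commutators with \<open>a\<close> are indeed \<open>(da, v)\<close> is the lemma
  \<open>D_model.Y_alpha\<close>, where the term \<open>ev(x\<^sub>i \<otimes> da)\<close> in the commutation of \<open>x\<^sub>i\<close> with \<open>a\<close> and a triangle
  identity produce \<open>da\<close>.  All other relations of \<open>H\<close> then follow
  from the relations of \<open>D\<close> for the pairs.

  From \<open>H\<close> to \<open>D\<close>, the pairs are forced on exact forms, \<open>(u, da) = [u, \<beta> a]\<close> and \<open>(da, v) = [Y v, \<alpha> a]\<close>,
  hence by the bimodule relations on all forms \<open>r da\<close>, which span because the calculus is surjective.
  They are well defined because the relations indexed by \<open>\<Sum> r\<^sub>m \<otimes> s\<^sub>m\<close> with \<open>\<Sum> r\<^sub>m s\<^sub>m = 0\<close> and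
  \<open>\<Sum> r\<^sub>m ds\<^sub>m = 0\<close> imply that the relations between the forms \<open>r da\<close> are respected
  (\<open>H_model.null_family\<close>).  In the same way the pairs with two-forms are forced on products of
  one-forms, which span because \<open>\<and>\<close> is surjective, and they are well defined by the relations indexed
  by \<open>ker \<and>\<close>.  One relation of \<open>D\<close> is left that is not visible in \<open>H\<close>, the one that mixes \<open>x\<^sub>j\<close> with
  the pairs \<open>(x\<^sub>i, \<eta>)\<close>; it is the commutator of the relation \<open>ev\<^sup>2(\<xi> \<otimes> d\<omega>\<^sub>i) x\<^sub>i = ev\<^sup>2(\<xi> \<otimes> \<omega>\<^sub>j \<and> \<omega>\<^sub>k) x\<^sub>k x\<^sub>j\<close>
  with \<open>\<beta> a\<close> (\<open>H_model.mixed\<close>).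

  The preparations establish that quotients, tensor products, tensor algebras and free products,
  given by formal sums and ideals, have their universal properties.  In each case the point is that
  a map out of a free object kills the imposed relations iff its values on generators are linear,
  bilinear or multiplicative.
\<close>

section \<open>Linear maps, subspaces and quotients\<close>

declare (in k_vector_space) smult_closed [simp]

context k_vector_space
begin

lemma smult_zero_left: "v \<in> carrier M \<Longrightarrow> 0 \<odot> v = \<zero>"
proof -
  assume v: "v \<in> carrier M"
  have "0 \<odot> v \<oplus> 0 \<odot> v = (0 + 0) \<odot> v"
    using v by (simp only: smult_l_distr)
  then show ?thesis
    using add.l_cancel_one[OF smult_closed[OF v] smult_closed[OF v]] by simp
qed

lemma smult_zero_right: "c \<odot> \<zero> = \<zero>"
proof -
  have "c \<odot> \<zero> \<oplus> c \<odot> \<zero> = c \<odot> \<zero>"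
    using smult_r_distr[of \<zero> \<zero> c] by simp
  then show ?thesis
    using add.l_cancel_one[OF smult_closed[OF zero_closed] smult_closed[OF zero_closed]] by simp
qed

lemma smult_minus_one: "v \<in> carrier M \<Longrightarrow> (- 1) \<odot> v = \<ominus> v"
proof -
  assume v: "v \<in> carrier M"
  have "(- 1) \<odot> v \<oplus> v = (- 1 + 1) \<odot> v"
    using v smult_l_distr[of v "- 1" 1] by (simp add: smult_one)
  also have "\<dots> = \<zero>"
    using v by (simp add: smult_zero_left)
  finally show ?thesis
    using v smult_closed by (simp add: minus_equality)
qed

lemma minus_eq_zero_iff:
  "u \<in> carrier M \<Longrightarrow> v \<in> carrier M \<Longrightarrow> u \<ominus> v = \<zero> \<longleftrightarrow> u = v"
  by (metis r_neg add.inv_closed minus_eq minus_equality minus_minus add.inv_inv)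

end

locale k_linear_map = V: k_vector_space V + C: k_vector_space C
  for V :: "('k::field, 'v, 'y) module_scheme" and C :: "('k, 'c, 'z) module_scheme" +
  fixes f :: "'v \<Rightarrow> 'c"
  assumes closed: "u \<in> carrier V \<Longrightarrow> f u \<in> carrier C"
    and add: "u \<in> carrier V \<Longrightarrow> v \<in> carrier V \<Longrightarrow> f (u \<oplus>\<^bsub>V\<^esub> v) = f u \<oplus>\<^bsub>C\<^esub> f v"
    and smult: "u \<in> carrier V \<Longrightarrow> f (k \<odot>\<^bsub>V\<^esub> u) = k \<odot>\<^bsub>C\<^esub> f u"
begin

lemma zero: "f \<zero>\<^bsub>V\<^esub> = \<zero>\<^bsub>C\<^esub>"
  using smult[of "\<zero>\<^bsub>V\<^esub>" 0] closed[of "\<zero>\<^bsub>V\<^esub>"]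
  by (simp add: V.smult_zero_right C.smult_zero_left)

lemma uminus: "u \<in> carrier V \<Longrightarrow> f (\<ominus>\<^bsub>V\<^esub> u) = \<ominus>\<^bsub>C\<^esub> f u"
  using smult[of u "- 1"] closed[of u] by (simp add: V.smult_minus_one C.smult_minus_one)

lemma minus: "u \<in> carrier V \<Longrightarrow> v \<in> carrier V \<Longrightarrow> f (u \<ominus>\<^bsub>V\<^esub> v) = f u \<ominus>\<^bsub>C\<^esub> f v"
  by (simp add: a_minus_def add uminus)

lemma finsum:
  assumes "finite S" and "\<And>s. s \<in> S \<Longrightarrow> g s \<in> carrier V"
  shows "f (finsum V g S) = finsum C (\<lambda>s. f (g s)) S"
  using assms
proof (induction S rule: finite_induct)
  case empty
  show ?case by (simp add: zero)
next
  case (insert s S)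
  then show ?case
    by (simp add: Pi_iff add closed V.finsum_insert C.finsum_insert V.finsum_closed)
qed

end

lemma k_linear_map_comp:
  assumes "k_linear_map U V f" and "k_linear_map V C g"
  shows "k_linear_map U C (\<lambda>u. g (f u))"
proof -
  interpret f: k_linear_map U V f by fact
  interpret g: k_linear_map V C g by fact
  show ?thesis
    by unfold_locales (simp_all add: f.closed g.closed f.add g.add f.smult g.smult)
qed

locale k_algebra_hom = R: k_algebra R + B: k_algebra B + k_linear_map R B f
  for R :: "('k::field, 'v, 'y) module_scheme" and B :: "('k, 'c, 'z) module_scheme" and f +
  assumes mult: "u \<in> carrier R \<Longrightarrow> v \<in> carrier R \<Longrightarrow> f (u \<otimes>\<^bsub>R\<^esub> v) = f u \<otimes>\<^bsub>B\<^esub> f v"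
    and one: "f \<one>\<^bsub>R\<^esub> = \<one>\<^bsub>B\<^esub>"
begin

lemma ring_hom_ring: "ring_hom_ring R B f"
  by unfold_locales (auto simp: ring_hom_def closed add mult one)

lemma commutator:
  "u \<in> carrier R \<Longrightarrow> v \<in> carrier R \<Longrightarrow> f (commutator R u v) = commutator B (f u) (f v)"
  by (simp add: commutator_def minus mult)

end

lemma k_algebra_hom_comp:
  assumes "k_algebra_hom R S f" and "k_algebra_hom S B g"
  shows "k_algebra_hom R B (\<lambda>u. g (f u))"
proof -
  interpret f: k_algebra_hom R S f by fact
  interpret g: k_algebra_hom S B g by fact
  show ?thesis
    by unfold_locales
      (simp_all add: f.closed g.closed f.add g.add f.smult g.smult f.mult g.mult f.one g.one)
qed

lemma k_algebra_hom_id: "k_algebra R \<Longrightarrow> k_algebra_hom R R (\<lambda>u. u)"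
  by (simp add: k_algebra_hom_def k_linear_map_def k_algebra.axioms
      k_linear_map_axioms_def k_algebra_hom_axioms_def)

text \<open>
  The structures below are images of known ones under maps that respect the operations, and the
  axioms, being identities, descend along such a map.
\<close>
lemma k_vector_space_image:
  fixes V :: "('k::field, 'v, 'y) module_scheme" and C :: "('k, 'c, 'z) module_scheme"
  assumes "k_vector_space V" and car: "carrier C = f ` carrier V"
    and zero: "\<zero>\<^bsub>C\<^esub> = f \<zero>\<^bsub>V\<^esub>"
    and add: "\<And>u v. u \<in> carrier V \<Longrightarrow> v \<in> carrier V \<Longrightarrow> f u \<oplus>\<^bsub>C\<^esub> f v = f (u \<oplus>\<^bsub>V\<^esub> v)"
    and smult: "\<And>k u. u \<in> carrier V \<Longrightarrow> k \<odot>\<^bsub>C\<^esub> f u = f (k \<odot>\<^bsub>V\<^esub> u)"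
  shows "k_vector_space C" and "k_linear_map V C f"
proof -
  interpret V: k_vector_space V by fact
  have ag: "abelian_group C"
  proof (rule abelian_groupI)
    fix u v w assume "u \<in> carrier C" "v \<in> carrier C" "w \<in> carrier C"
    then show "u \<oplus>\<^bsub>C\<^esub> v \<oplus>\<^bsub>C\<^esub> w = u \<oplus>\<^bsub>C\<^esub> (v \<oplus>\<^bsub>C\<^esub> w)"
      by (auto simp: car add V.a_assoc)
  next
    fix u assume "u \<in> carrier C"
    then obtain v where v: "v \<in> carrier V" "u = f v" by (auto simp: car)
    then show "\<exists>y\<in>carrier C. y \<oplus>\<^bsub>C\<^esub> u = \<zero>\<^bsub>C\<^esub>"
      by (auto simp: car add zero V.l_neg intro!: bexI[of _ "\<ominus>\<^bsub>V\<^esub> v"])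
  qed (auto simp: car zero add V.a_comm)
  show C: "k_vector_space C"
    using ag
    by (simp add: k_vector_space_def k_vector_space_axioms_def)
      (auto simp: car smult add V.smult_closed V.smult_l_distr V.smult_r_distr
        V.smult_assoc V.smult_one)
  show "k_linear_map V C f"
    using C V.k_vector_space_axioms
    by (simp add: k_linear_map_def k_linear_map_axioms_def car smult add)
qed

lemma k_algebra_image:
  fixes R :: "('k::field, 'v, 'y) module_scheme" and B :: "('k, 'c, 'z) module_scheme"
  assumes "k_algebra R" and car: "carrier B = f ` carrier R"
    and zero: "\<zero>\<^bsub>B\<^esub> = f \<zero>\<^bsub>R\<^esub>"
    and add: "\<And>u v. u \<in> carrier R \<Longrightarrow> v \<in> carrier R \<Longrightarrow> f u \<oplus>\<^bsub>B\<^esub> f v = f (u \<oplus>\<^bsub>R\<^esub> v)"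
    and smult: "\<And>k u. u \<in> carrier R \<Longrightarrow> k \<odot>\<^bsub>B\<^esub> f u = f (k \<odot>\<^bsub>R\<^esub> u)"
    and mult: "\<And>u v. u \<in> carrier R \<Longrightarrow> v \<in> carrier R \<Longrightarrow> f u \<otimes>\<^bsub>B\<^esub> f v = f (u \<otimes>\<^bsub>R\<^esub> v)"
    and one: "\<one>\<^bsub>B\<^esub> = f \<one>\<^bsub>R\<^esub>"
  shows "k_algebra B" and "k_algebra_hom R B f"
proof -
  interpret R: k_algebra R by fact
  have lin: "k_linear_map R B f"
    using k_vector_space_image[OF R.k_vector_space_axioms car zero add smult] by blast
  then interpret f: k_linear_map R B f .
  have "ring B"
  proof (rule ringI)
    show "abelian_group B" by (rule f.C.abelian_group_axioms)
    show "Group.monoid B"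
      by (rule monoidI) (auto simp: car mult one R.m_assoc)
  qed (auto simp: car add mult R.l_distr R.r_distr)
  then show B: "k_algebra B"
    using f.C.k_vector_space_axioms
    by (simp add: k_algebra_def k_algebra_axioms_def)
      (auto simp: car mult smult R.smult_mult_left R.smult_mult_right)
  show "k_algebra_hom R B f"
    using B R.k_algebra_axioms lin
    by (simp add: k_algebra_hom_def k_algebra_hom_axioms_def mult one)
qed

locale k_subspace = k_vector_space V
  for V :: "('k::field, 'v, 'y) module_scheme" (structure) +
  fixes I :: "'v set"
  assumes subset: "I \<subseteq> carrier V"
    and zero_mem: "\<zero> \<in> I"
    and add_mem: "u \<in> I \<Longrightarrow> v \<in> I \<Longrightarrow> u \<oplus> v \<in> I"
    and smult_mem: "u \<in> I \<Longrightarrow> c \<odot> u \<in> I"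
begin

lemma uminus_mem: "u \<in> I \<Longrightarrow> \<ominus> u \<in> I"
  using smult_mem[of u "- 1"] subset by (auto simp: smult_minus_one)

lemma subspace_subgroup: "abelian_subgroup I V"
proof (rule abelian_subgroupI3)
  show "additive_subgroup I V"
    by (rule additive_subgroupI, rule add.subgroupI)
      (use subset zero_mem add_mem uminus_mem in \<open>auto simp flip: a_inv_def\<close>)
qed (rule abelian_group_axioms)

lemma coset_eq_iff:
  assumes "u \<in> carrier V" and "v \<in> carrier V"
  shows "I +> u = I +> v \<longleftrightarrow> u \<ominus> v \<in> I"
proof -
  interpret I: abelian_subgroup I V by (rule subspace_subgroup)
  have "u \<in> I +> v \<longleftrightarrow> u \<ominus> v \<in> I"
    using assms I.a_rcos_module[of v u] by (simp add: a_minus_def)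
  moreover have "u \<in> I +> v \<longleftrightarrow> I +> u = I +> v"
    using assms I.a_rcos_self[of u] I.a_repr_independence'[of u v] by auto
  ultimately show ?thesis by simp
qed

lemma mem_coset: "u \<in> carrier V \<Longrightarrow> w \<in> I +> u \<Longrightarrow> w \<in> carrier V \<and> I +> w = I +> u"
proof -
  interpret I: abelian_subgroup I V by (rule subspace_subgroup)
  assume "u \<in> carrier V" and w: "w \<in> I +> u"
  then show ?thesis
    using I.a_elemrcos_carrier[of u w] I.a_repr_independence'[of w u] by simp
qed

lemma coset_self: "u \<in> carrier V \<Longrightarrow> u \<in> I +> u"
  using abelian_subgroup.a_rcos_self[OF subspace_subgroup] .

lemma coset_Union:
  assumes u: "u \<in> carrier V"
    and T: "\<And>v. v \<in> carrier V \<Longrightarrow> T v \<in> carrier V"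
    and T_minus: "\<And>v w. v \<in> carrier V \<Longrightarrow> w \<in> carrier V \<Longrightarrow> T (v \<ominus> w) = T v \<ominus> T w"
    and T_mem: "\<And>v. v \<in> I \<Longrightarrow> T v \<in> I"
  shows "(\<Union>w\<in>I +> u. I +> T w) = I +> T u"
proof -
  have eq: "I +> T w = I +> T u" if "w \<in> I +> u" for w
  proof -
    have w: "w \<in> carrier V" "I +> w = I +> u" using mem_coset[OF u that] by auto
    have "w \<ominus> u \<in> I" using coset_eq_iff[OF w(1) u] w(2) by simp
    then have "T w \<ominus> T u \<in> I" using T_mem[of "w \<ominus> u"] T_minus[OF w(1) u] by simp
    then show ?thesis using coset_eq_iff[OF T[OF w(1)] T[OF u]] by simp
  qed
  have "(\<Union>w\<in>I +> u. I +> T w) = (\<Union>w\<in>I +> u. I +> T u)"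
    by (rule SUP_cong[OF refl eq])
  then show ?thesis using coset_self[OF u] by (simp only: UN_constant) auto
qed

lemma k_quotient_carrier: "carrier (k_quotient V I) = (\<lambda>u. I +> u) ` carrier V"
  by (auto simp: k_quotient_def ring.extend_def module.fields_def FactRing_def A_RCOSETS_def'
      a_r_coset_def' a_r_coset_def r_coset_def)

lemma k_quotient_zero: "\<zero>\<^bsub>k_quotient V I\<^esub> = I +> \<zero>"
  by (simp add: k_quotient_def ring.extend_def module.fields_def FactRing_def a_coset_add_zero subset)

lemma k_quotient_add:
  "u \<in> carrier V \<Longrightarrow> v \<in> carrier V \<Longrightarrow> (I +> u) \<oplus>\<^bsub>k_quotient V I\<^esub> (I +> v) = I +> (u \<oplus> v)"
  using abelian_subgroup.a_rcos_sum[OF subspace_subgroup]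
  by (simp add: k_quotient_def ring.extend_def module.fields_def FactRing_def)

lemma k_quotient_smult:
  assumes "u \<in> carrier V"
  shows "k \<odot>\<^bsub>k_quotient V I\<^esub> (I +> u) = I +> (k \<odot> u)"
proof -
  have "k \<odot> (v \<ominus> w) = k \<odot> v \<ominus> k \<odot> w" if "v \<in> carrier V" "w \<in> carrier V" for v w
  proof -
    have "k \<odot> (\<ominus> w) = \<ominus> (k \<odot> w)"
      using that smult_closed smult_assoc[of w k "- 1"] smult_assoc[of w "- 1" k]
      by (simp add: smult_minus_one)
    then show ?thesis using that by (simp add: a_minus_def smult_r_distr)
  qed
  then have "(\<Union>w\<in>I +> u. I +> (k \<odot> w)) = I +> (k \<odot> u)"
    using assms by (intro coset_Union) (auto simp: smult_closed smult_mem)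
  then show ?thesis
    by (simp add: k_quotient_def ring.extend_def module.fields_def)
qed

lemma k_quotient_vector_space: "k_vector_space (k_quotient V I)"
  and coset_linear: "k_linear_map V (k_quotient V I) (\<lambda>u. I +> u)"
  using k_vector_space_image[OF k_vector_space_axioms k_quotient_carrier k_quotient_zero
      k_quotient_add k_quotient_smult] by blast+

text \<open>A linear map that kills \<open>I\<close> is constant on each coset, so its value on a coset is read off
  from the image of the coset.\<close>
lemma linear_lift:
  assumes "k_linear_map V C f" and ker: "\<And>u. u \<in> I \<Longrightarrow> f u = \<zero>\<^bsub>C\<^esub>"
  shows "u \<in> carrier V \<Longrightarrow> the_elem (f ` (I +> u)) = f u"
    and "k_linear_map (k_quotient V I) C (\<lambda>S. the_elem (f ` S))"
proof -
  interpret f: k_linear_map V C f by fact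
  have val: "the_elem (f ` (I +> u)) = f u" if u: "u \<in> carrier V" for u
  proof -
    have "f w = f u" if "w \<in> I +> u" for w
    proof -
      have w: "w \<in> carrier V" "I +> w = I +> u" using mem_coset[OF u that] by auto
      have "w \<ominus> u \<in> I" using coset_eq_iff[OF w(1) u] w(2) by simp
      then have "f w \<ominus>\<^bsub>C\<^esub> f u = \<zero>\<^bsub>C\<^esub>" using ker f.minus[OF w(1) u] by simp
      then show ?thesis
        using f.C.minus_eq_zero_iff[OF f.closed[OF w(1)] f.closed[OF u]] by simp
    qed
    then show ?thesis
      using coset_self[OF u] by (intro the_elem_image_unique) blast+
  qed
  then show "u \<in> carrier V \<Longrightarrow> the_elem (f ` (I +> u)) = f u" .
  interpret q: k_vector_space "k_quotient V I" by (rule k_quotient_vector_space)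
  show "k_linear_map (k_quotient V I) C (\<lambda>S. the_elem (f ` S))"
  proof unfold_locales
    fix S assume "S \<in> carrier (k_quotient V I)"
    then obtain u where u: "u \<in> carrier V" "S = I +> u" by (auto simp: k_quotient_carrier)
    then show "the_elem (f ` S) \<in> carrier C" by (simp add: val f.closed)
    show "the_elem (f ` (k \<odot>\<^bsub>k_quotient V I\<^esub> S)) = k \<odot>\<^bsub>C\<^esub> the_elem (f ` S)" for k
      using u by (simp add: k_quotient_smult val f.smult)
    fix S' assume "S' \<in> carrier (k_quotient V I)"
    then obtain u' where u': "u' \<in> carrier V" "S' = I +> u'" by (auto simp: k_quotient_carrier)
    show "the_elem (f ` (S \<oplus>\<^bsub>k_quotient V I\<^esub> S')) = the_elem (f ` S) \<oplus>\<^bsub>C\<^esub> the_elem (f ` S')"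
      using u u' by (simp add: k_quotient_add val f.add)
  qed
qed

end

lemma ideal_k_subspace:
  assumes "k_algebra R" and "ideal I R"
  shows "k_subspace R I"
proof -
  interpret R: k_algebra R by fact
  interpret I: ideal I R by fact
  have "c \<odot>\<^bsub>R\<^esub> u \<in> I" if u: "u \<in> I" for c u
  proof -
    have "(c \<odot>\<^bsub>R\<^esub> \<one>\<^bsub>R\<^esub>) \<otimes>\<^bsub>R\<^esub> u = c \<odot>\<^bsub>R\<^esub> u"
      using u I.Icarr by (simp add: R.smult_mult_left)
    then show ?thesis using u I.I_l_closed R.smult_closed R.one_closed by metis
  qed
  then show ?thesis
    by unfold_locales (use I.a_subset in auto)
qed

lemma k_quotient_ideal:
  assumes "k_algebra R" and "ideal I R"
  shows "k_algebra (k_quotient R I)" and "k_algebra_hom R (k_quotient R I) (\<lambda>u. I +>\<^bsub>R\<^esub> u)"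
proof -
  interpret R: k_algebra R by fact
  interpret I: k_subspace R I by (rule ideal_k_subspace) fact+
  have m: "(I +>\<^bsub>R\<^esub> u) \<otimes>\<^bsub>k_quotient R I\<^esub> (I +>\<^bsub>R\<^esub> v) = I +>\<^bsub>R\<^esub> (u \<otimes>\<^bsub>R\<^esub> v)"
    if "u \<in> carrier R" "v \<in> carrier R" for u v
    using ideal.rcoset_mult_add[OF assms(2) that]
    by (simp add: k_quotient_def ring.extend_def module.fields_def FactRing_def)
  have o: "\<one>\<^bsub>k_quotient R I\<^esub> = I +>\<^bsub>R\<^esub> \<one>\<^bsub>R\<^esub>"
    by (simp add: k_quotient_def ring.extend_def module.fields_def FactRing_def)
  note im = k_algebra_image[OF assms(1) I.k_quotient_carrier I.k_quotient_zero I.k_quotient_add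
      I.k_quotient_smult m o]
  show "k_algebra (k_quotient R I)" "k_algebra_hom R (k_quotient R I) (\<lambda>u. I +>\<^bsub>R\<^esub> u)"
    using im by blast+
qed

text \<open>The analogue of \<open>linear_lift\<close> for algebras: the representatives may be multiplied before \<open>f\<close> is applied.\<close>
lemma ideal_lift:
  assumes "k_algebra_hom R B f" and "ideal I R" and ker: "\<And>u. u \<in> I \<Longrightarrow> f u = \<zero>\<^bsub>B\<^esub>"
  shows "k_algebra_hom (k_quotient R I) B (\<lambda>P. the_elem (f ` P))"
    and "u \<in> carrier R \<Longrightarrow> the_elem (f ` (I +>\<^bsub>R\<^esub> u)) = f u"
proof -
  interpret f: k_algebra_hom R B f by fact
  interpret I: k_subspace R I by (rule ideal_k_subspace[OF f.R.k_algebra_axioms assms(2)])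
  interpret Q: k_algebra "k_quotient R I"
    by (rule k_quotient_ideal(1)[OF f.R.k_algebra_axioms assms(2)])
  interpret c: k_algebra_hom R "k_quotient R I" "\<lambda>u. I +>\<^bsub>R\<^esub> u"
    by (rule k_quotient_ideal(2)[OF f.R.k_algebra_axioms assms(2)])
  note val = I.linear_lift(1)[OF f.k_linear_map_axioms ker]
  show "u \<in> carrier R \<Longrightarrow> the_elem (f ` (I +>\<^bsub>R\<^esub> u)) = f u" by (rule val)
  interpret g: k_linear_map "k_quotient R I" B "\<lambda>P. the_elem (f ` P)"
    by (rule I.linear_lift(2)[OF f.k_linear_map_axioms ker])
  show "k_algebra_hom (k_quotient R I) B (\<lambda>P. the_elem (f ` P))"
  proof unfold_locales
    show "the_elem (f ` \<one>\<^bsub>k_quotient R I\<^esub>) = \<one>\<^bsub>B\<^esub>"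
      by (simp add: val f.one flip: c.one)
    fix S S' assume "S \<in> carrier (k_quotient R I)" "S' \<in> carrier (k_quotient R I)"
    then obtain u u' where u: "u \<in> carrier R" "S = I +>\<^bsub>R\<^esub> u"
      and u': "u' \<in> carrier R" "S' = I +>\<^bsub>R\<^esub> u'"
      by (auto simp: I.k_quotient_carrier)
    show "the_elem (f ` (S \<otimes>\<^bsub>k_quotient R I\<^esub> S')) = the_elem (f ` S) \<otimes>\<^bsub>B\<^esub> the_elem (f ` S')"
      using u u' by (simp add: val f.mult flip: c.mult)
  qed
qed

section \<open>Algebras given by generators and relations\<close>
text \<open>Quotients by the ideal that a set of elements generates.  The set must consist of elements of the
  carrier, since otherwise the generated ideal need not be one.\<close>
locale relations = k_algebra R
  for R :: "('k::field, 'a, 'z) module_scheme" (structure) +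
  fixes S :: "'a set"
  assumes rels_carrier: "S \<subseteq> carrier R"
begin

lemma rels_ideal: "ideal (Idl S) R"
  using genideal_ideal[OF rels_carrier] .

lemma mod_rels_algebra: "k_algebra (mod_rels R S)"
  and rel_class_hom: "k_algebra_hom R (mod_rels R S) (rel_class R S)"
  using k_quotient_ideal[OF k_algebra_axioms rels_ideal]
  by (auto simp: mod_rels_def rel_class_def[abs_def])

lemma mod_rels_carrier: "carrier (mod_rels R S) = rel_class R S ` carrier R"
  using k_subspace.k_quotient_carrier[OF ideal_k_subspace[OF k_algebra_axioms rels_ideal]]
  by (auto simp: mod_rels_def rel_class_def)

lemma rel_class_zero:
  assumes "u \<in> S"
  shows "rel_class R S u = \<zero>\<^bsub>mod_rels R S\<^esub>"
proof -
  interpret I: k_subspace R "Idl S" by (rule ideal_k_subspace[OF k_algebra_axioms rels_ideal])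
  have "u \<in> Idl S" using genideal_self[OF rels_carrier] assms by auto
  then have "Idl S +> u = Idl S +> \<zero>"
    using I.coset_eq_iff[of u \<zero>] I.subset by (auto simp: a_minus_def)
  then show ?thesis by (simp add: rel_class_def mod_rels_def I.k_quotient_zero)
qed

lemma mod_rels_lift:
  assumes "k_algebra_hom R B f" and ker: "\<And>s. s \<in> S \<Longrightarrow> f s = \<zero>\<^bsub>B\<^esub>"
  obtains g where "k_algebra_hom (mod_rels R S) B g"
    and "\<And>u. u \<in> carrier R \<Longrightarrow> g (rel_class R S u) = f u"
proof -
  interpret f: k_algebra_hom R B f by fact
  have "Idl S \<subseteq> a_kernel R B f"
    using genideal_minimal[OF ring_hom_ring.kernel_is_ideal[OF f.ring_hom_ring]] ker rels_carrier
    by (auto simp: a_kernel_def')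
  then have ker': "f u = \<zero>\<^bsub>B\<^esub>" if "u \<in> Idl S" for u
    using that by (auto simp: a_kernel_def')
  show ?thesis
    using that[of "\<lambda>P. the_elem (f ` P)"] ideal_lift[OF assms(1) rels_ideal ker']
    by (simp add: mod_rels_def rel_class_def)
qed

end

section \<open>Formal linear combinations\<close>
definition lin_ext ::
    "('k::field, 'c, 'z) module_scheme \<Rightarrow> ('g \<Rightarrow> 'c) \<Rightarrow> ('g \<Rightarrow>\<^sub>0 'k) \<Rightarrow> 'c"
  where "lin_ext C h p =
    (\<Oplus>\<^bsub>C\<^esub>k\<in>Poly_Mapping.keys p. Poly_Mapping.lookup p k \<odot>\<^bsub>C\<^esub> h k)"

lemma lookup_scale: "Poly_Mapping.lookup (scale c p) k = c * Poly_Mapping.lookup p k"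
  by (simp add: scale_def Poly_Mapping.map.rep_eq when_def)

lemma scale_single: "scale c (Poly_Mapping.single k e) = Poly_Mapping.single k (c * e)"
  by (rule poly_mapping_eqI) (simp add: lookup_scale lookup_single when_def)

lemma keys_scale: "Poly_Mapping.keys (scale c p) \<subseteq> Poly_Mapping.keys p"
  by (auto simp: in_keys_iff lookup_scale)

lemma scale_module: "Modules.module (scale :: 'k::field \<Rightarrow> ('g \<Rightarrow>\<^sub>0 'k) \<Rightarrow> _)"
  by unfold_locales
    (auto intro!: poly_mapping_eqI simp: lookup_scale lookup_add algebra_simps)

lemma sum_singles: "(\<Sum>k\<in>Poly_Mapping.keys p. Poly_Mapping.single k (Poly_Mapping.lookup p k)) = p"
  by (rule poly_mapping_eqI)
    (simp add: lookup_sum lookup_single when_def sum.delta in_keys_iff)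

lemma poly_mapping_additive_induct [consumes 1, case_names zero single add]:
  fixes p :: "'g \<Rightarrow>\<^sub>0 'k::comm_monoid_add"
  assumes "Poly_Mapping.keys p \<subseteq> S"
    and "P 0"
    and single: "\<And>k c. k \<in> S \<Longrightarrow> P (Poly_Mapping.single k c)"
    and add: "\<And>p q. Poly_Mapping.keys p \<subseteq> S \<Longrightarrow> Poly_Mapping.keys q \<subseteq> S \<Longrightarrow> P p \<Longrightarrow> P q \<Longrightarrow> P (p + q)"
  shows "P p"
proof -
  have "P (\<Sum>k\<in>T. Poly_Mapping.single k (Poly_Mapping.lookup p k)) \<and>
      Poly_Mapping.keys (\<Sum>k\<in>T. Poly_Mapping.single k (Poly_Mapping.lookup p k)) \<subseteq> S"
    if "finite T" "T \<subseteq> S" for T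
    using that
  proof (induction T)
    case empty
    show ?case using assms(2) by simp
  next
    case (insert k T)
    let ?s = "Poly_Mapping.single k (Poly_Mapping.lookup p k)"
    let ?r = "\<Sum>k\<in>T. Poly_Mapping.single k (Poly_Mapping.lookup p k)"
    have "Poly_Mapping.keys ?s \<subseteq> S" using insert.prems by auto
    moreover have "P ?r" "Poly_Mapping.keys ?r \<subseteq> S" using insert.IH insert.prems by auto
    ultimately have "P (?s + ?r)" "Poly_Mapping.keys (?s + ?r) \<subseteq> S"
      using add[of ?s ?r] single[of k] insert.prems keys_add[of ?s ?r] by auto
    then show ?case using insert.hyps by simp
  qed
  from this[of "Poly_Mapping.keys p"] show ?thesis
    using assms(1) by (simp add: sum_singles)
qed

lemma monoid_algebra_simps:
  "carrier (monoid_algebra G) = {p. Poly_Mapping.keys p \<subseteq> carrier G}"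
  "\<zero>\<^bsub>monoid_algebra G\<^esub> = 0" "p \<oplus>\<^bsub>monoid_algebra G\<^esub> q = p + q"
  "c \<odot>\<^bsub>monoid_algebra G\<^esub> p = scale c p" "\<one>\<^bsub>monoid_algebra G\<^esub> = Poly_Mapping.single \<one>\<^bsub>G\<^esub> 1"
  by (simp_all add: monoid_algebra_def)

lemma single_mem_monoid_algebra:
  "k \<in> carrier G \<Longrightarrow> Poly_Mapping.single k c \<in> carrier (monoid_algebra G)"
  by (auto simp: monoid_algebra_simps)

lemma monoid_algebra_vector_space: "k_vector_space (monoid_algebra G)"
proof -
  have "abelian_group (monoid_algebra G)"
    using keys_add
    by (intro abelian_groupI)
      (fastforce simp: monoid_algebra_simps add.assoc add.commute intro: bexI[of _ "- _"])+
  then show ?thesis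
    using keys_scale
    by (simp add: k_vector_space_def k_vector_space_axioms_def)
      (fastforce simp: monoid_algebra_simps Modules.module.scale_left_distrib[OF scale_module]
        Modules.module.scale_right_distrib[OF scale_module]
        Modules.module.scale_scale[OF scale_module] Modules.module.scale_one[OF scale_module])
qed

lemma monoid_algebra_minus:
  assumes "p \<in> carrier (monoid_algebra G)" and "q \<in> carrier (monoid_algebra G)"
  shows "p \<ominus>\<^bsub>monoid_algebra G\<^esub> q = p - q"
proof -
  interpret F: k_vector_space "monoid_algebra G" by (rule monoid_algebra_vector_space)
  have "\<ominus>\<^bsub>monoid_algebra G\<^esub> q = - q"
    by (rule F.minus_equality) (use assms in \<open>auto simp: monoid_algebra_simps\<close>)
  then show ?thesis by (simp add: a_minus_def monoid_algebra_simps)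
qed

lemma monoid_algebra_minus_closed:
  "p \<in> carrier (monoid_algebra G) \<Longrightarrow> q \<in> carrier (monoid_algebra G) \<Longrightarrow>
    p - q \<in> carrier (monoid_algebra G)"
  using keys_diff[of p q] by (auto simp: monoid_algebra_simps)

lemma monoid_algebra_add_closed:
  "p \<in> carrier (monoid_algebra G) \<Longrightarrow> q \<in> carrier (monoid_algebra G) \<Longrightarrow>
    p + q \<in> carrier (monoid_algebra G)"
  using keys_add[of p q] by (auto simp: monoid_algebra_simps)

lemma linear_map_monoid_algebra_minus:
  assumes "k_linear_map (monoid_algebra G) C f"
    and "p \<in> carrier (monoid_algebra G)" and "q \<in> carrier (monoid_algebra G)"
  shows "f (p - q) = f p \<ominus>\<^bsub>C\<^esub> f q"
  using k_linear_map.minus[OF assms] assms(2,3) by (simp add: monoid_algebra_minus)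

context k_vector_space
begin

lemma lin_ext_superset:
  assumes "finite S" and "Poly_Mapping.keys p \<subseteq> S" and "\<And>k. k \<in> S \<Longrightarrow> h k \<in> carrier M"
  shows "lin_ext M h p = (\<Oplus>k\<in>S. Poly_Mapping.lookup p k \<odot> h k)"
  unfolding lin_ext_def
  by (rule add.finprod_mono_neutral_cong_left)
    (use assms in \<open>auto simp: in_keys_iff smult_zero_left\<close>)

lemma lin_ext_single:
  "h k \<in> carrier M \<Longrightarrow> lin_ext M h (Poly_Mapping.single k c) = c \<odot> h k"
  using lin_ext_superset[of "{k}" "Poly_Mapping.single k c" h] by (simp add: finsum_insert)

lemma lin_ext_linear:
  fixes G :: "('g, 'm) monoid_scheme"
  assumes h: "\<And>k. k \<in> carrier G \<Longrightarrow> h k \<in> carrier M"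
  shows "k_linear_map (monoid_algebra G) M (lin_ext M h)"
proof -
  interpret F: k_vector_space "monoid_algebra G :: ('k, 'g \<Rightarrow>\<^sub>0 'k) module"
    by (rule monoid_algebra_vector_space)
  have fs: "(\<lambda>k. Poly_Mapping.lookup p k \<odot> h k) \<in> T \<rightarrow> carrier M" if "T \<subseteq> carrier G" for p T
    using h that by auto
  show ?thesis
  proof unfold_locales
    fix u :: "'g \<Rightarrow>\<^sub>0 'k" assume u: "u \<in> carrier (monoid_algebra G)"
    let ?T = "Poly_Mapping.keys u"
    have T: "?T \<subseteq> carrier G" using u by (simp add: monoid_algebra_simps)
    show "lin_ext M h u \<in> carrier M"
      unfolding lin_ext_def by (rule finsum_closed[OF fs[OF T]])
    fix k
    have "lin_ext M h (scale k u) = (\<Oplus>s\<in>?T. Poly_Mapping.lookup (scale k u) s \<odot> h s)"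
      using T h by (intro lin_ext_superset) (auto simp: keys_scale)
    also have "\<dots> = (\<Oplus>s\<in>?T. k \<odot> (Poly_Mapping.lookup u s \<odot> h s))"
      using T h by (intro add.finprod_cong') (auto simp: lookup_scale smult_assoc)
    also have "\<dots> = k \<odot> lin_ext M h u"
    proof -
      interpret s: k_linear_map M M "\<lambda>v. k \<odot> v"
        by unfold_locales (auto simp: smult_r_distr mult.commute simp flip: smult_assoc)
      show ?thesis
        unfolding lin_ext_def using T h by (subst s.finsum) auto
    qed
    finally show "lin_ext M h (k \<odot>\<^bsub>monoid_algebra G\<^esub> u) = k \<odot> lin_ext M h u"
      by (simp add: monoid_algebra_simps)
    fix v :: "'g \<Rightarrow>\<^sub>0 'k" assume v: "v \<in> carrier (monoid_algebra G)"
    let ?S = "Poly_Mapping.keys u \<union> Poly_Mapping.keys v"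
    have S: "?S \<subseteq> carrier G" using u v by (simp add: monoid_algebra_simps)
    have e: "lin_ext M h w = (\<Oplus>s\<in>?S. Poly_Mapping.lookup w s \<odot> h s)"
      if "Poly_Mapping.keys w \<subseteq> ?S" for w
      using S h that by (intro lin_ext_superset) auto
    have "lin_ext M h (u + v) = (\<Oplus>s\<in>?S. Poly_Mapping.lookup u s \<odot> h s \<oplus> Poly_Mapping.lookup v s \<odot> h s)"
      unfolding e[OF keys_add] using S h
      by (intro add.finprod_cong') (auto simp: lookup_add smult_l_distr)
    also have "\<dots> = lin_ext M h u \<oplus> lin_ext M h v"
      using fs[OF S, of u] fs[OF S, of v] by (simp add: e finsum_addf)
    finally show "lin_ext M h (u \<oplus>\<^bsub>monoid_algebra G\<^esub> v) = lin_ext M h u \<oplus> lin_ext M h v"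
      by (simp add: monoid_algebra_simps)
  qed
qed

end

lemma linear_map_monoid_algebra_eq:
  fixes G :: "('g, 'm) monoid_scheme" and C :: "('k::field, 'c, 'z) module_scheme"
  assumes "k_linear_map (monoid_algebra G) C f" and "k_linear_map (monoid_algebra G) C g"
    and eq: "\<And>k. k \<in> carrier G \<Longrightarrow> f (Poly_Mapping.single k 1) = g (Poly_Mapping.single k 1)"
    and p: "p \<in> carrier (monoid_algebra G)"
  shows "f p = g p"
proof -
  interpret f: k_linear_map "monoid_algebra G" C f by fact
  interpret g: k_linear_map "monoid_algebra G" C g by fact
  have "Poly_Mapping.keys p \<subseteq> carrier G" using p by (simp add: monoid_algebra_simps)
  then show ?thesis
  proof (induction rule: poly_mapping_additive_induct)
    show "f 0 = g 0" using f.zero g.zero by (simp add: monoid_algebra_simps)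
  next
    fix k :: 'g and c :: 'k assume k: "k \<in> carrier G"
    have m: "Poly_Mapping.single k 1 \<in> carrier (monoid_algebra G)"
      using k by (rule single_mem_monoid_algebra)
    have "Poly_Mapping.single k c = c \<odot>\<^bsub>monoid_algebra G\<^esub> Poly_Mapping.single k 1"
      by (simp add: monoid_algebra_simps scale_single)
    then show "f (Poly_Mapping.single k c) = g (Poly_Mapping.single k c)"
      using f.smult[OF m] g.smult[OF m] eq[OF k] by simp
  next
    fix p q :: "'g \<Rightarrow>\<^sub>0 'k"
    assume "Poly_Mapping.keys p \<subseteq> carrier G" "Poly_Mapping.keys q \<subseteq> carrier G"
      and "f p = g p" "f q = g q"
    then show "f (p + q) = g (p + q)"
      using f.add[of p q] g.add[of p q] by (simp add: monoid_algebra_simps)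
  qed
qed

lemma lin_span_subspace:
  fixes G :: "('g, 'm) monoid_scheme" and S :: "('g \<Rightarrow>\<^sub>0 'k::field) set"
  assumes "S \<subseteq> carrier (monoid_algebra G)"
  shows "k_subspace (monoid_algebra G) (lin_span S)"
proof -
  interpret F: k_vector_space "monoid_algebra G :: ('k, 'g \<Rightarrow>\<^sub>0 'k) module"
    by (rule monoid_algebra_vector_space)
  interpret s: Modules.module "scale :: 'k \<Rightarrow> ('g \<Rightarrow>\<^sub>0 'k) \<Rightarrow> _" by (rule scale_module)
  have "s.subspace (carrier (monoid_algebra G :: ('k, 'g \<Rightarrow>\<^sub>0 'k) module))"
    using F.zero_closed F.add.m_closed F.smult_closed
    unfolding s.subspace_def by (simp add: monoid_algebra_simps)
  then have "lin_span S \<subseteq> carrier (monoid_algebra G)"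
    using s.span_minimal[OF assms] by (simp add: lin_span_def)
  then show ?thesis
    by unfold_locales
      (auto simp: lin_span_def monoid_algebra_simps s.span_zero s.span_add s.span_scale)
qed

lemma lin_span_mem: "s \<in> S \<Longrightarrow> s \<in> lin_span S"
  using Modules.module.span_base[OF scale_module] by (simp add: lin_span_def)

lemma lin_span_induct [consumes 1, case_names base zero add scale]:
  assumes "p \<in> lin_span S" and "\<And>s. s \<in> S \<Longrightarrow> P s" and "P 0"
    and "\<And>p q. P p \<Longrightarrow> P q \<Longrightarrow> P (p + q)" and "\<And>c p. P p \<Longrightarrow> P (scale c p)"
  shows "P p"
  using Modules.module.span_induct[OF scale_module, of p S P] assms
  by (simp add: lin_span_def Modules.module.subspace_def[OF scale_module])

text \<open>The elements whose image lies in \<open>I\<close> form a subspace, so it is enough to look at the spanning set.\<close>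
lemma linear_map_lin_span:
  assumes "k_linear_map (monoid_algebra G) C f" and "k_subspace C I"
    and S: "S \<subseteq> carrier (monoid_algebra G)"
    and f: "\<And>s. s \<in> S \<Longrightarrow> f s \<in> I" and p: "p \<in> lin_span S"
  shows "f p \<in> I"
proof -
  interpret f: k_linear_map "monoid_algebra G" C f by fact
  interpret I: k_subspace C I by fact
  have "p \<in> carrier (monoid_algebra G) \<and> f p \<in> I"
    using p
  proof (induction rule: lin_span_induct)
    fix p q assume "p \<in> carrier (monoid_algebra G) \<and> f p \<in> I" "q \<in> carrier (monoid_algebra G) \<and> f q \<in> I"
    then show "p + q \<in> carrier (monoid_algebra G) \<and> f (p + q) \<in> I"
      using f.add[of p q] I.add_mem monoid_algebra_add_closed[of p G q] by (simp add: monoid_algebra_simps)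
  next
    fix c p assume "p \<in> carrier (monoid_algebra G) \<and> f p \<in> I"
    then show "scale c p \<in> carrier (monoid_algebra G) \<and> f (scale c p) \<in> I"
      using f.smult[of p c] I.smult_mem f.V.smult_closed[of p c] by (simp add: monoid_algebra_simps)
  qed (use S f f.zero I.zero_mem in \<open>auto simp: monoid_algebra_simps\<close>)
  then show ?thesis by simp
qed

lemma zero_subspace: "k_vector_space C \<Longrightarrow> k_subspace C {\<zero>\<^bsub>C\<^esub>}"
  by (auto simp: k_subspace_def k_subspace_axioms_def k_vector_space.smult_zero_right
      abelian_group.axioms abelian_monoid.zero_closed abelian_monoid.l_zero
      dest: k_vector_space.axioms(1))

text \<open>Quotients of spaces of formal sums by the span of a set of relations; all tensor products
  are of this form.\<close>
locale linear_relations =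
  fixes G :: "('g, 'm) monoid_scheme" and S :: "('g \<Rightarrow>\<^sub>0 'k::field) set"
  assumes lin_rels_carrier: "S \<subseteq> carrier (monoid_algebra G)"
begin

abbreviation "quot \<equiv> k_quotient (monoid_algebra G) (lin_span S)"
abbreviation "gen k \<equiv> lin_span S +>\<^bsub>monoid_algebra G\<^esub> Poly_Mapping.single k 1"
abbreviation "coset p \<equiv> lin_span S +>\<^bsub>monoid_algebra G\<^esub> p"

sublocale k_subspace "monoid_algebra G" "lin_span S"
  by (rule lin_span_subspace[OF lin_rels_carrier])

lemma quot_eq:
  "p \<in> carrier (monoid_algebra G) \<Longrightarrow> q \<in> carrier (monoid_algebra G) \<Longrightarrow> p - q \<in> S \<Longrightarrow>
    coset p = coset q"
  using coset_eq_iff[of p q] lin_span_mem[of "p - q" S] by (simp add: monoid_algebra_minus)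

lemma quot_lift:
  assumes C: "k_vector_space C" and h: "\<And>k. k \<in> carrier G \<Longrightarrow> h k \<in> carrier C"
    and ker: "\<And>s. s \<in> S \<Longrightarrow> lin_ext C h s = \<zero>\<^bsub>C\<^esub>"
  shows "k_linear_map quot C (\<lambda>P. the_elem (lin_ext C h ` P))"
    and "k \<in> carrier G \<Longrightarrow> the_elem (lin_ext C h ` gen k) = h k"
proof -
  interpret C: k_vector_space C by fact
  have lin: "k_linear_map (monoid_algebra G) C (lin_ext C h)"
    by (rule C.lin_ext_linear) (rule h)
  have 0: "lin_ext C h p = \<zero>\<^bsub>C\<^esub>" if "p \<in> lin_span S" for p
    using linear_map_lin_span[OF lin zero_subspace[OF C] lin_rels_carrier _ that] ker by simp
  show "k_linear_map quot C (\<lambda>P. the_elem (lin_ext C h ` P))"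
    by (rule linear_lift(2)[OF lin 0])
  assume k: "k \<in> carrier G"
  then show "the_elem (lin_ext C h ` gen k) = h k"
    using linear_lift(1)[OF lin 0 single_mem_monoid_algebra[OF k]] h[OF k]
    by (simp add: C.lin_ext_single C.smult_one)
qed

lemma linear_maps_eq:
  assumes "k_linear_map quot C f" and "k_linear_map quot C g"
    and eq: "\<And>k. k \<in> carrier G \<Longrightarrow> f (gen k) = g (gen k)" and u: "u \<in> carrier quot"
  shows "f u = g u"
proof -
  obtain p where p: "p \<in> carrier (monoid_algebra G)" "u = coset p"
    using u by (auto simp: k_quotient_carrier)
  show ?thesis
    unfolding p(2)
    by (rule linear_map_monoid_algebra_eq[OF k_linear_map_comp[OF coset_linear assms(1)]
          k_linear_map_comp[OF coset_linear assms(2)] eq p(1)])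
qed

lemma gen_mem: "k \<in> carrier G \<Longrightarrow> gen k \<in> carrier quot"
  by (simp add: k_quotient_carrier single_mem_monoid_algebra)

end

subsection \<open>Bilinear maps and tensor products\<close>
definition k_bilinear ::
    "('k::field, 'm, 'x) module_scheme \<Rightarrow> ('k, 'n, 'y) module_scheme \<Rightarrow> ('k, 'c, 'z) module_scheme
      \<Rightarrow> ('m \<Rightarrow> 'n \<Rightarrow> 'c) \<Rightarrow> bool"
  where "k_bilinear M N C h \<longleftrightarrow>
    (\<forall>m n. m \<in> carrier M \<and> n \<in> carrier N \<longrightarrow> h m n \<in> carrier C) \<and>
    (((\<forall>m m' n. m \<in> carrier M \<and> m' \<in> carrier M \<and> n \<in> carrier N \<longrightarrow>
         h (m \<oplus>\<^bsub>M\<^esub> m') n = h m n \<oplus>\<^bsub>C\<^esub> h m' n) \<and>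
      (\<forall>m n n'. m \<in> carrier M \<and> n \<in> carrier N \<and> n' \<in> carrier N \<longrightarrow>
         h m (n \<oplus>\<^bsub>N\<^esub> n') = h m n \<oplus>\<^bsub>C\<^esub> h m n')) \<and>
      (\<forall>c m n. m \<in> carrier M \<and> n \<in> carrier N \<longrightarrow> h (c \<odot>\<^bsub>M\<^esub> m) n = c \<odot>\<^bsub>C\<^esub> h m n)) \<and>
      (\<forall>c m n. m \<in> carrier M \<and> n \<in> carrier N \<longrightarrow> h m (c \<odot>\<^bsub>N\<^esub> n) = c \<odot>\<^bsub>C\<^esub> h m n)"

lemma k_bilinear_linear_right:
  "k_bilinear M N C h \<Longrightarrow> k_vector_space N \<Longrightarrow> k_vector_space C \<Longrightarrow> m \<in> carrier M \<Longrightarrow>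
    k_linear_map N C (h m)"
  by (simp add: k_bilinear_def k_linear_map_def k_linear_map_axioms_def)

lemma k_bilinear_linear_left:
  "k_bilinear M N C h \<Longrightarrow> k_vector_space M \<Longrightarrow> k_vector_space C \<Longrightarrow> n \<in> carrier N \<Longrightarrow>
    k_linear_map M C (\<lambda>m. h m n)"
  by (simp add: k_bilinear_def k_linear_map_def k_linear_map_axioms_def)

lemma k_bilinear_closed:
  "k_bilinear M N C h \<Longrightarrow> m \<in> carrier M \<Longrightarrow> n \<in> carrier N \<Longrightarrow> h m n \<in> carrier C"
  by (simp add: k_bilinear_def)

lemma k_bilinear_cong:
  assumes "k_vector_space M" and "k_vector_space N"
    and eq: "\<And>m n. m \<in> carrier M \<Longrightarrow> n \<in> carrier N \<Longrightarrow> h m n = h' m n"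
  shows "k_bilinear M N C h \<longleftrightarrow> k_bilinear M N C h'"
proof -
  interpret M: k_vector_space M by fact
  interpret N: k_vector_space N by fact
  show ?thesis unfolding k_bilinear_def by (simp add: eq cong: imp_cong)
qed

lemma k_bilinearI:
  assumes "\<And>m. m \<in> carrier M \<Longrightarrow> k_linear_map N C (h m)"
    and "\<And>n. n \<in> carrier N \<Longrightarrow> k_linear_map M C (\<lambda>m. h m n)"
  shows "k_bilinear M N C h"
  unfolding k_bilinear_def
  using k_linear_map.closed[OF assms(1)] k_linear_map.add[OF assms(1)] k_linear_map.add[OF assms(2)]
    k_linear_map.smult[OF assms(1)] k_linear_map.smult[OF assms(2)] by simp

lemma bilinear_rels_carrier:
  assumes "k_vector_space M" and "k_vector_space N"
  shows "bilinear_rels M N \<subseteq> carrier (monoid_algebra (M \<times>\<times> N))"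
proof -
  interpret M: k_vector_space M by fact
  interpret N: k_vector_space N by fact
  note [intro!] = monoid_algebra_minus_closed monoid_algebra_add_closed single_mem_monoid_algebra
  show ?thesis
    unfolding bilinear_rels_def by (fastforce simp: carrier_DirProd)
qed

lemma balanced_rels_carrier:
  assumes "bimodule R M" and "bimodule R N"
  shows "balanced_rels R M N \<subseteq> carrier (monoid_algebra (M \<times>\<times> N))"
proof -
  interpret M: bimodule R M by fact
  interpret N: bimodule R N by fact
  note [intro!] = monoid_algebra_minus_closed monoid_algebra_add_closed single_mem_monoid_algebra
  show ?thesis
    using bilinear_rels_carrier[OF M.M.k_vector_space_axioms N.M.k_vector_space_axioms]
    unfolding balanced_rels_def by (fastforce simp: carrier_DirProd M.ract_closed N.lact_closed)
qed

text \<open>The relations of \<open>M \<otimes> N\<close> are the axioms of bilinearity for the generators; this gives the universal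
  property in both directions, for the tautological map and for maps to other spaces.\<close>
lemma bilinear_rels_iff:
  assumes M: "k_vector_space M" and N: "k_vector_space N"
    and f: "k_linear_map (monoid_algebra (M \<times>\<times> N)) C f"
  shows "(\<forall>s\<in>bilinear_rels M N. f s = \<zero>\<^bsub>C\<^esub>) \<longleftrightarrow>
    k_bilinear M N C (\<lambda>m n. f (Poly_Mapping.single (m, n) 1))"
proof -
  interpret M: k_vector_space M by fact
  interpret N: k_vector_space N by fact
  interpret f: k_linear_map "monoid_algebra (M \<times>\<times> N)" C f by fact
  have s: "Poly_Mapping.single (m, n) c \<in> carrier (monoid_algebra (M \<times>\<times> N))"
    if "m \<in> carrier M" "n \<in> carrier N" for m n c
    using that by (intro single_mem_monoid_algebra) (simp add: carrier_DirProd)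
  have fs: "f (Poly_Mapping.single (m, n) c) = c \<odot>\<^bsub>C\<^esub> f (Poly_Mapping.single (m, n) 1)"
    if "m \<in> carrier M" "n \<in> carrier N" for m n c
    using f.smult[OF s[OF that, of 1], of c] by (simp add: monoid_algebra_simps scale_single)
  have fa: "f (p - q) = \<zero>\<^bsub>C\<^esub> \<longleftrightarrow> f p = f q"
    if "p \<in> carrier (monoid_algebra (M \<times>\<times> N))" "q \<in> carrier (monoid_algebra (M \<times>\<times> N))" for p q
    using linear_map_monoid_algebra_minus[OF f that] f.closed that by (simp add: f.C.minus_eq_zero_iff)
  have fadd: "f (p + q) = f p \<oplus>\<^bsub>C\<^esub> f q"
    if "p \<in> carrier (monoid_algebra (M \<times>\<times> N))" "q \<in> carrier (monoid_algebra (M \<times>\<times> N))" for p q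
    using f.add[OF that] by (simp add: monoid_algebra_simps)
  let ?h = "\<lambda>m n. f (Poly_Mapping.single (m, n) 1)"
  have "(\<forall>s\<in>bilinear_rels M N. f s = \<zero>\<^bsub>C\<^esub>) \<longleftrightarrow>
      (((\<forall>m m' n. m \<in> carrier M \<and> m' \<in> carrier M \<and> n \<in> carrier N \<longrightarrow> ?h (m \<oplus>\<^bsub>M\<^esub> m') n = ?h m n \<oplus>\<^bsub>C\<^esub> ?h m' n) \<and>
      (\<forall>m n n'. m \<in> carrier M \<and> n \<in> carrier N \<and> n' \<in> carrier N \<longrightarrow> ?h m (n \<oplus>\<^bsub>N\<^esub> n') = ?h m n \<oplus>\<^bsub>C\<^esub> ?h m n')) \<and>
      (\<forall>c m n. m \<in> carrier M \<and> n \<in> carrier N \<longrightarrow> ?h (c \<odot>\<^bsub>M\<^esub> m) n = c \<odot>\<^bsub>C\<^esub> ?h m n)) \<and>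
      (\<forall>c m n. m \<in> carrier M \<and> n \<in> carrier N \<longrightarrow> ?h m (c \<odot>\<^bsub>N\<^esub> n) = c \<odot>\<^bsub>C\<^esub> ?h m n)"
  proof -
    have 1: "f (Poly_Mapping.single (m \<oplus>\<^bsub>M\<^esub> m', n) 1
         - (Poly_Mapping.single (m, n) 1 + Poly_Mapping.single (m', n) 1)) = \<zero>\<^bsub>C\<^esub> \<longleftrightarrow>
       ?h (m \<oplus>\<^bsub>M\<^esub> m') n = ?h m n \<oplus>\<^bsub>C\<^esub> ?h m' n"
      if "m \<in> carrier M" "m' \<in> carrier M" "n \<in> carrier N" for m m' n
      using that by (simp add: s fa fadd monoid_algebra_add_closed)
    have 2: "f (Poly_Mapping.single (m, n \<oplus>\<^bsub>N\<^esub> n') 1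
         - (Poly_Mapping.single (m, n) 1 + Poly_Mapping.single (m, n') 1)) = \<zero>\<^bsub>C\<^esub> \<longleftrightarrow>
       ?h m (n \<oplus>\<^bsub>N\<^esub> n') = ?h m n \<oplus>\<^bsub>C\<^esub> ?h m n'"
      if "m \<in> carrier M" "n \<in> carrier N" "n' \<in> carrier N" for m n n'
      using that by (simp add: s fa fadd monoid_algebra_add_closed)
    have 3: "f (Poly_Mapping.single (c \<odot>\<^bsub>M\<^esub> m, n) 1 - Poly_Mapping.single (m, n) c) = \<zero>\<^bsub>C\<^esub> \<longleftrightarrow>
       ?h (c \<odot>\<^bsub>M\<^esub> m) n = c \<odot>\<^bsub>C\<^esub> ?h m n"
      if "m \<in> carrier M" "n \<in> carrier N" for c m n
      using that fs[of m n c] by (simp add: s fa)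
    have 4: "f (Poly_Mapping.single (m, c \<odot>\<^bsub>N\<^esub> n) 1 - Poly_Mapping.single (m, n) c) = \<zero>\<^bsub>C\<^esub> \<longleftrightarrow>
       ?h m (c \<odot>\<^bsub>N\<^esub> n) = c \<odot>\<^bsub>C\<^esub> ?h m n"
      if "m \<in> carrier M" "n \<in> carrier N" for c m n
      using that fs[of m n c] by (simp add: s fa)
    have all: "(\<forall>s\<in>{F u v w | u v w. P u v w}. Z s) \<longleftrightarrow> (\<forall>u v w. P u v w \<longrightarrow> Z (F u v w))"
      for F and P :: "'u \<Rightarrow> 'v \<Rightarrow> 'w \<Rightarrow> bool" and Z :: "'t \<Rightarrow> bool"
      by blast
    show ?thesis
      unfolding bilinear_rels_def ball_Un all
      by (intro arg_cong2[where f = "(\<and>)"] all_cong1 imp_cong refl; elim conjE)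
        ((rule 1; assumption) | (rule 2; assumption) | (rule 3; assumption) | (rule 4; assumption))+
  qed
  also have "\<dots> \<longleftrightarrow> k_bilinear M N C ?h"
    unfolding k_bilinear_def using f.closed[OF s] by simp
  finally show ?thesis .
qed

locale k_tensor_product = M: k_vector_space M + N: k_vector_space N
  for M :: "('k::field, 'm, 'y) module_scheme" and N :: "('k, 'n, 'z) module_scheme"
begin

sublocale T: linear_relations "M \<times>\<times> N" "bilinear_rels M N"
  by (rule linear_relations.intro[OF bilinear_rels_carrier])
    (rule M.k_vector_space_axioms N.k_vector_space_axioms)+

lemma k_tensor_vector_space: "k_vector_space (k_tensor M N)"
  unfolding k_tensor_def by (rule T.k_quotient_vector_space)

lemma k_tens_bilinear: "k_bilinear M N (k_tensor M N) (k_tens M N)"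
proof -
  have "\<forall>s\<in>bilinear_rels M N. T.coset s = \<zero>\<^bsub>T.quot\<^esub>"
    using T.quot_eq[of _ 0] T.lin_rels_carrier T.k_quotient_zero
    by (auto simp: monoid_algebra_simps)
  then show ?thesis
    using bilinear_rels_iff[OF M.k_vector_space_axioms N.k_vector_space_axioms T.coset_linear]
    by (simp add: k_tens_def[abs_def] k_tensor_def)
qed

lemma k_tensor_lift:
  assumes h: "k_bilinear M N C h" and C: "k_vector_space C"
  obtains f where "k_linear_map (k_tensor M N) C f"
    and "\<And>m n. m \<in> carrier M \<Longrightarrow> n \<in> carrier N \<Longrightarrow> f (k_tens M N m n) = h m n"
proof -
  interpret C: k_vector_space C by fact
  have cl: "h m n \<in> carrier C" if "m \<in> carrier M" "n \<in> carrier N" for m n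
    using k_bilinear_closed[OF h that] .
  let ?l = "lin_ext C (\<lambda>k. h (fst k) (snd k))"
  have lin: "k_linear_map (monoid_algebra (M \<times>\<times> N)) C ?l"
    by (rule C.lin_ext_linear) (auto simp: carrier_DirProd cl)
  have "k_bilinear M N C (\<lambda>m n. ?l (Poly_Mapping.single (m, n) 1)) \<longleftrightarrow> k_bilinear M N C h"
    using M.k_vector_space_axioms N.k_vector_space_axioms
    by (rule k_bilinear_cong) (simp add: C.lin_ext_single cl C.smult_one)
  then have "\<forall>s\<in>bilinear_rels M N. ?l s = \<zero>\<^bsub>C\<^esub>"
    using bilinear_rels_iff[OF M.k_vector_space_axioms N.k_vector_space_axioms lin] h by simp
  then show ?thesis
    using that[of "\<lambda>P. the_elem (?l ` P)"] T.quot_lift[OF C, of "\<lambda>k. h (fst k) (snd k)"] cl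
    by (auto simp: k_tensor_def k_tens_def carrier_DirProd)
qed

lemma k_tensor_maps_eq:
  assumes "k_linear_map (k_tensor M N) C f" and "k_linear_map (k_tensor M N) C g"
    and "\<And>m n. m \<in> carrier M \<Longrightarrow> n \<in> carrier N \<Longrightarrow> f (k_tens M N m n) = g (k_tens M N m n)"
    and "u \<in> carrier (k_tensor M N)"
  shows "f u = g u"
  using assms T.linear_maps_eq[of C f g u] by (auto simp: k_tensor_def k_tens_def carrier_DirProd)

end

subsection \<open>Balanced tensor products\<close>

context bimodule
begin

lemma lact_smult_right: "a \<in> carrier R \<Longrightarrow> m \<in> carrier M \<Longrightarrow> lact M a (k \<odot>\<^bsub>M\<^esub> m) = k \<odot>\<^bsub>M\<^esub> lact M a m"
proof -
  assume a: "a \<in> carrier R" "m \<in> carrier M"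
  have "lact M a (k \<odot>\<^bsub>M\<^esub> m) = lact M (a \<otimes>\<^bsub>R\<^esub> (k \<odot>\<^bsub>R\<^esub> \<one>\<^bsub>R\<^esub>)) m"
    using a lact_smult[of m k] lact_mult[of a "k \<odot>\<^bsub>R\<^esub> \<one>\<^bsub>R\<^esub>" m] by simp
  also have "a \<otimes>\<^bsub>R\<^esub> (k \<odot>\<^bsub>R\<^esub> \<one>\<^bsub>R\<^esub>) = (k \<odot>\<^bsub>R\<^esub> \<one>\<^bsub>R\<^esub>) \<otimes>\<^bsub>R\<^esub> a"
    using a by (simp add: R.smult_mult_left R.smult_mult_right)
  finally show ?thesis using a lact_smult lact_mult lact_closed by simp
qed

lemma ract_smult_left: "a \<in> carrier R \<Longrightarrow> m \<in> carrier M \<Longrightarrow> ract M (k \<odot>\<^bsub>M\<^esub> m) a = k \<odot>\<^bsub>M\<^esub> ract M m a"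
proof -
  assume a: "a \<in> carrier R" "m \<in> carrier M"
  have "ract M (k \<odot>\<^bsub>M\<^esub> m) a = ract M m ((k \<odot>\<^bsub>R\<^esub> \<one>\<^bsub>R\<^esub>) \<otimes>\<^bsub>R\<^esub> a)"
    using a ract_smult[of m k] ract_mult[of "k \<odot>\<^bsub>R\<^esub> \<one>\<^bsub>R\<^esub>" a m] by simp
  also have "(k \<odot>\<^bsub>R\<^esub> \<one>\<^bsub>R\<^esub>) \<otimes>\<^bsub>R\<^esub> a = a \<otimes>\<^bsub>R\<^esub> (k \<odot>\<^bsub>R\<^esub> \<one>\<^bsub>R\<^esub>)"
    using a by (simp add: R.smult_mult_left R.smult_mult_right)
  finally show ?thesis using a ract_smult ract_mult ract_closed by simp
qed

lemma lact_linear: "a \<in> carrier R \<Longrightarrow> k_linear_map M M (lact M a)"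
  by unfold_locales (simp_all add: lact_closed lact_add_right lact_smult_right)

lemma ract_linear: "a \<in> carrier R \<Longrightarrow> k_linear_map M M (\<lambda>m. ract M m a)"
  by unfold_locales (simp_all add: ract_closed ract_add_left ract_smult_left)

lemma lact_linear_left: "m \<in> carrier M \<Longrightarrow> k_linear_map R M (\<lambda>a. lact M a m)"
proof unfold_locales
  fix k u assume u: "u \<in> carrier R" and m: "m \<in> carrier M"
  have "lact M ((k \<odot>\<^bsub>R\<^esub> \<one>\<^bsub>R\<^esub>) \<otimes>\<^bsub>R\<^esub> u) m = k \<odot>\<^bsub>M\<^esub> lact M u m"
    using u m lact_smult lact_mult lact_closed by simp
  then show "lact M (k \<odot>\<^bsub>R\<^esub> u) m = k \<odot>\<^bsub>M\<^esub> lact M u m"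
    using u by (simp add: R.smult_mult_left)
qed (simp_all add: lact_closed lact_add_left)

lemma ract_linear_right: "m \<in> carrier M \<Longrightarrow> k_linear_map R M (ract M m)"
proof unfold_locales
  fix k u assume u: "u \<in> carrier R" and m: "m \<in> carrier M"
  have "ract M m (u \<otimes>\<^bsub>R\<^esub> (k \<odot>\<^bsub>R\<^esub> \<one>\<^bsub>R\<^esub>)) = k \<odot>\<^bsub>M\<^esub> ract M m u"
    using u m ract_smult ract_mult ract_closed by simp
  then show "ract M m (k \<odot>\<^bsub>R\<^esub> u) = k \<odot>\<^bsub>M\<^esub> ract M m u"
    using u by (simp add: R.smult_mult_right)
qed (simp_all add: ract_closed ract_add_right)

end

locale bimodule_tensor = M: bimodule R M + N: bimodule R N
  for R :: "('k::field, 'a, 'x) module_scheme" and M :: "('k, 'a, 'm, 'y) bimod_scheme"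
    and N :: "('k, 'a, 'n, 'z) bimod_scheme"
begin

sublocale T: linear_relations "M \<times>\<times> N" "balanced_rels R M N"
  by (rule linear_relations.intro[OF balanced_rels_carrier])
    (rule M.bimodule_axioms N.bimodule_axioms)+

lemma tensor_fields:
  "carrier (tensor R M N) = carrier T.quot" "\<zero>\<^bsub>tensor R M N\<^esub> = \<zero>\<^bsub>T.quot\<^esub>"
  "add (tensor R M N) = add T.quot" "smult (tensor R M N) = smult T.quot"
  by (simp_all add: tensor_def Let_def module.extend_def bimod.fields_def)

lemma tensor_quot: "k_linear_map T.quot (tensor R M N) (\<lambda>u. u)"
  and tensor_vector_space: "k_vector_space (tensor R M N)"
  using k_vector_space_image[OF T.k_quotient_vector_space, of "tensor R M N" "\<lambda>u. u"]
  by (simp_all add: tensor_fields)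

lemma quot_tensor: "k_linear_map (tensor R M N) T.quot (\<lambda>u. u)"
  using tensor_vector_space T.k_quotient_vector_space
  by (simp add: k_linear_map_def k_linear_map_axioms_def tensor_fields)

lemma tens_mem: "m \<in> carrier M \<Longrightarrow> n \<in> carrier N \<Longrightarrow> tens R M N m n \<in> carrier (tensor R M N)"
  by (simp add: tensor_fields tens_def T.gen_mem carrier_DirProd)

lemma coset_tensor_linear: "k_linear_map (monoid_algebra (M \<times>\<times> N)) (tensor R M N) T.coset"
  by (rule k_linear_map_comp[OF T.coset_linear tensor_quot])

lemma tens_bilinear: "k_bilinear M N (tensor R M N) (tens R M N)"
proof -
  have "\<forall>s\<in>bilinear_rels M N. T.coset s = \<zero>\<^bsub>tensor R M N\<^esub>"
    using T.quot_eq[of _ 0] T.lin_rels_carrier T.k_quotient_zero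
    by (auto simp: monoid_algebra_simps balanced_rels_def tensor_fields)
  then show ?thesis
    using bilinear_rels_iff[OF M.M.k_vector_space_axioms N.M.k_vector_space_axioms coset_tensor_linear]
    by (simp add: tens_def[abs_def])
qed

lemma tens_balanced:
  assumes "m \<in> carrier M" and "a \<in> carrier R" and "n \<in> carrier N"
  shows "tens R M N (ract M m a) n = tens R M N m (lact N a n)"
  unfolding tens_def
  by (rule T.quot_eq)
    (use assms in \<open>auto simp: carrier_DirProd M.ract_closed N.lact_closed balanced_rels_def
        intro!: single_mem_monoid_algebra\<close>)

text \<open>The sum over any representative is the value of one linear map out of the tensor product, which
  balancedness of \<open>h\<close> makes well defined.\<close>
lemma tensor_lift_tens:
  assumes h: "k_bilinear M N C h" and C: "k_vector_space C"
    and bal: "\<And>m a n. m \<in> carrier M \<Longrightarrow> a \<in> carrier R \<Longrightarrow> n \<in> carrier N \<Longrightarrow>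
      h (ract M m a) n = h m (lact N a n)"
  shows "k_linear_map (tensor R M N) C (tensor_lift C h)"
    and "m \<in> carrier M \<Longrightarrow> n \<in> carrier N \<Longrightarrow> tensor_lift C h (tens R M N m n) = h m n"
proof -
  interpret C: k_vector_space C by fact
  have cl: "h m n \<in> carrier C" if "m \<in> carrier M" "n \<in> carrier N" for m n
    using k_bilinear_closed[OF h that] .
  let ?l = "lin_ext C (\<lambda>k. h (fst k) (snd k))"
  have lin: "k_linear_map (monoid_algebra (M \<times>\<times> N)) C ?l"
    by (rule C.lin_ext_linear) (auto simp: carrier_DirProd cl)
  have "k_bilinear M N C (\<lambda>m n. ?l (Poly_Mapping.single (m, n) 1)) \<longleftrightarrow> k_bilinear M N C h"
    using M.M.k_vector_space_axioms N.M.k_vector_space_axioms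
    by (rule k_bilinear_cong) (simp add: C.lin_ext_single cl C.smult_one)
  then have 1: "\<forall>s\<in>bilinear_rels M N. ?l s = \<zero>\<^bsub>C\<^esub>"
    using bilinear_rels_iff[OF M.M.k_vector_space_axioms N.M.k_vector_space_axioms lin] h by simp
  have "?l (Poly_Mapping.single (ract M m a, n) 1 - Poly_Mapping.single (m, lact N a n) 1) = \<zero>\<^bsub>C\<^esub>"
    if "m \<in> carrier M" "a \<in> carrier R" "n \<in> carrier N" for m a n
    using that
    by (subst linear_map_monoid_algebra_minus[OF lin])
      (auto simp: carrier_DirProd M.ract_closed N.lact_closed C.lin_ext_single cl C.smult_one bal
        C.minus_eq_zero_iff intro!: single_mem_monoid_algebra)
  with 1 have 2: "?l s = \<zero>\<^bsub>C\<^esub>" if "s \<in> balanced_rels R M N" for s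
    using that by (auto simp: balanced_rels_def)
  have e: "tensor_lift C h = (\<lambda>P. the_elem (?l ` P))"
    by (auto simp: tensor_lift_def lin_ext_def[abs_def])
  have cl': "h (fst k) (snd k) \<in> carrier C" if "k \<in> carrier (M \<times>\<times> N)" for k
    using that by (auto simp: cl)
  show "k_linear_map (tensor R M N) C (tensor_lift C h)"
    using k_linear_map_comp[OF quot_tensor T.quot_lift(1)[OF C cl' 2]] by (simp add: e)
  show "m \<in> carrier M \<Longrightarrow> n \<in> carrier N \<Longrightarrow> tensor_lift C h (tens R M N m n) = h m n"
    using T.quot_lift(2)[OF C cl' 2, of "(m, n)"] by (simp add: e tens_def)
qed

lemma tensor_rep:
  assumes "u \<in> carrier (tensor R M N)"
  obtains p where "Poly_Mapping.keys p \<subseteq> carrier M \<times> carrier N" and "u = T.coset p"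
  using assms that by (auto simp: tensor_fields T.k_quotient_carrier monoid_algebra_simps carrier_DirProd)

text \<open>The left and the right action on \<open>M \<otimes>\<^sub>R N\<close> are the cases where one of \<open>f\<close> and \<open>g\<close> is an action and the
  other one the identity.  The union over representatives is a single coset because \<open>f\<close> and \<open>g\<close> respect
  the balancing relations.\<close>
lemma tensor_action:
  assumes f: "k_linear_map M M f" and g: "k_linear_map N N g"
    and bal: "\<And>m a n. m \<in> carrier M \<Longrightarrow> a \<in> carrier R \<Longrightarrow> n \<in> carrier N \<Longrightarrow>
      f (ract M m a) = ract M (f m) a \<and> g (lact N a n) = lact N a (g n)"
  defines "act \<equiv> \<lambda>P. \<Union>p\<in>P. T.coset (\<Sum>k\<in>Poly_Mapping.keys p.
    Poly_Mapping.single (f (fst k), g (snd k)) (Poly_Mapping.lookup p k))"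
  shows "k_linear_map (tensor R M N) (tensor R M N) act"
    and "m \<in> carrier M \<Longrightarrow> n \<in> carrier N \<Longrightarrow> act (tens R M N m n) = tens R M N (f m) (g n)"
proof -
  interpret f: k_linear_map M M f by fact
  interpret g: k_linear_map N N g by fact
  let ?F = "monoid_algebra (M \<times>\<times> N) :: ('k, 'm \<times> 'n \<Rightarrow>\<^sub>0 'k) module"
  define t where "t = lin_ext ?F (\<lambda>k. Poly_Mapping.single (f (fst k), g (snd k)) 1)"
  have mem: "Poly_Mapping.single (m, n) c \<in> carrier ?F" if "m \<in> carrier M" "n \<in> carrier N" for m n c
    using that by (intro single_mem_monoid_algebra) (simp add: carrier_DirProd)
  have fs: "finsum ?F e S = sum e S" if "finite S" "\<And>s. s \<in> S \<Longrightarrow> e s \<in> carrier ?F" for e and S :: "('m \<times> 'n) set"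
    using that
  proof (induction S)
    case empty
    show ?case by (simp add: monoid_algebra_simps)
  next
    case (insert s S)
    then have "finsum ?F e (insert s S) = e s \<oplus>\<^bsub>?F\<^esub> finsum ?F e S"
      by (intro T.finsum_insert) auto
    then show ?case using insert by (simp add: monoid_algebra_simps(3))
  qed
  have t: "(\<Sum>k\<in>Poly_Mapping.keys p. Poly_Mapping.single (f (fst k), g (snd k)) (Poly_Mapping.lookup p k)) = t p"
    if "p \<in> carrier ?F" for p
  proof -
    have "Poly_Mapping.keys p \<subseteq> carrier M \<times> carrier N" using that by (simp add: monoid_algebra_simps carrier_DirProd)
    then have "t p = (\<Sum>k\<in>Poly_Mapping.keys p.
        Poly_Mapping.lookup p k \<odot>\<^bsub>?F\<^esub> Poly_Mapping.single (f (fst k), g (snd k)) 1)"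
      unfolding t_def lin_ext_def by (intro fs T.smult_closed mem) (auto simp: f.closed g.closed)
    then show ?thesis by (simp add: monoid_algebra_simps scale_single)
  qed
  have tlin: "k_linear_map ?F ?F t"
    unfolding t_def by (rule T.lin_ext_linear) (auto simp: carrier_DirProd f.closed g.closed intro!: mem)
  interpret t: k_linear_map ?F ?F t by (rule tlin)
  have t1: "t (Poly_Mapping.single (m, n) c) = Poly_Mapping.single (f m, g n) c"
    if "m \<in> carrier M" "n \<in> carrier N" for m n c
    using that unfolding t_def
    by (subst T.lin_ext_single) (auto simp: f.closed g.closed mem monoid_algebra_simps scale_single)
  define ct where "ct = (\<lambda>p. T.coset (t p))"
  have ct: "k_linear_map ?F (tensor R M N) ct"
    unfolding ct_def by (rule k_linear_map_comp[OF tlin coset_tensor_linear])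
  interpret ct: k_linear_map ?F "tensor R M N" ct by (rule ct)
  have ct1: "ct (Poly_Mapping.single (m, n) 1) = tens R M N (f m) (g n)"
    if "m \<in> carrier M" "n \<in> carrier N" for m n
    using that by (simp add: ct_def t1 tens_def)
  have "k_bilinear M N (tensor R M N) (\<lambda>m n. ct (Poly_Mapping.single (m, n) 1)) \<longleftrightarrow>
      k_bilinear M N (tensor R M N) (\<lambda>m n. tens R M N (f m) (g n))"
    using M.M.k_vector_space_axioms N.M.k_vector_space_axioms
    by (rule k_bilinear_cong) (simp add: ct1)
  also have "\<dots>"
    using tens_bilinear f.closed g.closed
    by (simp add: k_bilinear_def f.add f.smult g.add g.smult)
  finally have 1: "\<forall>s\<in>bilinear_rels M N. ct s = \<zero>\<^bsub>tensor R M N\<^esub>"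
    using bilinear_rels_iff[OF M.M.k_vector_space_axioms N.M.k_vector_space_axioms ct] by simp
  have "ct (Poly_Mapping.single (ract M m a, n) 1 - Poly_Mapping.single (m, lact N a n) 1) = \<zero>\<^bsub>tensor R M N\<^esub>"
    if "m \<in> carrier M" "a \<in> carrier R" "n \<in> carrier N" for m a n
    using that bal[OF that] f.closed[of m] g.closed[of n]
    by (subst linear_map_monoid_algebra_minus[OF ct])
      (simp_all add: M.ract_closed N.lact_closed ct1 mem tens_balanced ct.C.minus_eq_zero_iff tens_mem)
  with 1 have "ct s = \<zero>\<^bsub>tensor R M N\<^esub>" if "s \<in> balanced_rels R M N" for s
    using that by (auto simp: balanced_rels_def)
  then have ct0: "ct p = \<zero>\<^bsub>tensor R M N\<^esub>" if "p \<in> lin_span (balanced_rels R M N)" for p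
    using linear_map_lin_span[OF ct zero_subspace[OF tensor_vector_space] T.lin_rels_carrier _ that] by simp
  have tI: "t p \<in> lin_span (balanced_rels R M N)" if "p \<in> lin_span (balanced_rels R M N)" for p
  proof -
    have p: "p \<in> carrier ?F" using T.subset that by blast
    have "T.coset (t p) = T.coset 0"
      using ct0[OF that] T.k_quotient_zero by (simp add: ct_def tensor_fields monoid_algebra_simps)
    then show ?thesis
      using T.coset_eq_iff[OF t.closed[OF p] T.zero_closed] monoid_algebra_minus[OF t.closed[OF p] T.zero_closed]
      by (simp add: monoid_algebra_simps)
  qed
  have act: "act (T.coset p) = T.coset (t p)" if p: "p \<in> carrier ?F" for p
  proof -
    have "act (T.coset p) = (\<Union>w\<in>T.coset p. T.coset (t w))"
      unfolding act_def using T.mem_coset[OF p] t by (intro SUP_cong) auto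
    also have "\<dots> = T.coset (t p)"
      by (rule T.coset_Union[OF p t.closed t.minus tI])
    finally show ?thesis .
  qed
  show "m \<in> carrier M \<Longrightarrow> n \<in> carrier N \<Longrightarrow> act (tens R M N m n) = tens R M N (f m) (g n)"
    using act[OF mem] t1 by (simp add: tens_def)
  interpret c: k_linear_map ?F "tensor R M N" T.coset by (rule coset_tensor_linear)
  show "k_linear_map (tensor R M N) (tensor R M N) act"
  proof unfold_locales
    fix S assume "S \<in> carrier (tensor R M N)"
    then obtain u where u: "u \<in> carrier ?F" "S = T.coset u" by (auto simp: tensor_fields T.k_quotient_carrier)
    then show "act S \<in> carrier (tensor R M N)" using ct.closed by (simp add: act ct_def)
    show "act (k \<odot>\<^bsub>tensor R M N\<^esub> S) = k \<odot>\<^bsub>tensor R M N\<^esub> act S" for k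
      using u t.closed[of u] by (simp add: act t.smult flip: c.smult)
    fix S' assume "S' \<in> carrier (tensor R M N)"
    then obtain u' where u': "u' \<in> carrier ?F" "S' = T.coset u'" by (auto simp: tensor_fields T.k_quotient_carrier)
    show "act (S \<oplus>\<^bsub>tensor R M N\<^esub> S') = act S \<oplus>\<^bsub>tensor R M N\<^esub> act S'"
      using u u' t.closed by (simp add: act t.add flip: c.add)
  qed
qed

lemma tensor_lact:
  assumes "a \<in> carrier R"
  shows "k_linear_map (tensor R M N) (tensor R M N) (lact (tensor R M N) a)"
    and "m \<in> carrier M \<Longrightarrow> n \<in> carrier N \<Longrightarrow> lact (tensor R M N) a (tens R M N m n) = tens R M N (lact M a m) n"
proof -
  have id: "k_linear_map N N (\<lambda>n. n)" by unfold_locales auto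
  have e: "lact (tensor R M N) a = (\<lambda>P. \<Union>p\<in>P. T.coset (\<Sum>k\<in>Poly_Mapping.keys p.
      Poly_Mapping.single (lact M a (fst k), snd k) (Poly_Mapping.lookup p k)))"
    by (simp add: tensor_def Let_def module.extend_def bimod.fields_def)
  note act = tensor_action[OF M.lact_linear[OF assms] id]
  show "k_linear_map (tensor R M N) (tensor R M N) (lact (tensor R M N) a)"
    unfolding e by (rule act(1)) (use assms in \<open>auto simp: M.lact_ract\<close>)
  show "m \<in> carrier M \<Longrightarrow> n \<in> carrier N \<Longrightarrow> lact (tensor R M N) a (tens R M N m n) = tens R M N (lact M a m) n"
    unfolding e by (rule act(2)) (use assms in \<open>auto simp: M.lact_ract\<close>)
qed

lemma tensor_ract:
  assumes "a \<in> carrier R"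
  shows "k_linear_map (tensor R M N) (tensor R M N) (\<lambda>u. ract (tensor R M N) u a)"
    and "m \<in> carrier M \<Longrightarrow> n \<in> carrier N \<Longrightarrow> ract (tensor R M N) (tens R M N m n) a = tens R M N m (ract N n a)"
proof -
  have id: "k_linear_map M M (\<lambda>n. n)" by unfold_locales auto
  have e: "(\<lambda>u. ract (tensor R M N) u a) = (\<lambda>P. \<Union>p\<in>P. T.coset (\<Sum>k\<in>Poly_Mapping.keys p.
      Poly_Mapping.single (fst k, ract N (snd k) a) (Poly_Mapping.lookup p k)))"
    by (simp add: tensor_def Let_def module.extend_def bimod.fields_def)
  note act = tensor_action[OF id N.ract_linear[OF assms]]
  show "k_linear_map (tensor R M N) (tensor R M N) (\<lambda>u. ract (tensor R M N) u a)"
    unfolding e by (rule act(1)) (use assms in \<open>auto simp: N.lact_ract\<close>)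
  show "m \<in> carrier M \<Longrightarrow> n \<in> carrier N \<Longrightarrow> ract (tensor R M N) (tens R M N m n) a = tens R M N m (ract N n a)"
    unfolding fun_cong[OF e] by (rule act(2)) (use assms in \<open>auto simp: N.lact_ract\<close>)
qed

end

section \<open>Monoid algebras\<close>
lemma monoid_algebra_mult_superset:
  assumes "finite S" "Poly_Mapping.keys p \<subseteq> S" "finite T" "Poly_Mapping.keys q \<subseteq> T"
  shows "p \<otimes>\<^bsub>monoid_algebra G\<^esub> q = (\<Sum>u\<in>S. \<Sum>v\<in>T.
    Poly_Mapping.single (u \<otimes>\<^bsub>G\<^esub> v) (Poly_Mapping.lookup p u * Poly_Mapping.lookup q v))"
proof -
  have "(\<Sum>v\<in>Poly_Mapping.keys q. Poly_Mapping.single (u \<otimes>\<^bsub>G\<^esub> v) (Poly_Mapping.lookup p u * Poly_Mapping.lookup q v))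
      = (\<Sum>v\<in>T. Poly_Mapping.single (u \<otimes>\<^bsub>G\<^esub> v) (Poly_Mapping.lookup p u * Poly_Mapping.lookup q v))" for u
    using assms by (intro sum.mono_neutral_left) (auto simp: in_keys_iff)
  then have "p \<otimes>\<^bsub>monoid_algebra G\<^esub> q = (\<Sum>u\<in>Poly_Mapping.keys p. \<Sum>v\<in>T.
      Poly_Mapping.single (u \<otimes>\<^bsub>G\<^esub> v) (Poly_Mapping.lookup p u * Poly_Mapping.lookup q v))"
    by (simp add: monoid_algebra_def)
  also have "\<dots> = (\<Sum>u\<in>S. \<Sum>v\<in>T.
      Poly_Mapping.single (u \<otimes>\<^bsub>G\<^esub> v) (Poly_Mapping.lookup p u * Poly_Mapping.lookup q v))"
    using assms by (intro sum.mono_neutral_left) (auto simp: in_keys_iff)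
  finally show ?thesis .
qed

lemma monoid_algebra_mult_single:
  "Poly_Mapping.single u c \<otimes>\<^bsub>monoid_algebra G\<^esub> Poly_Mapping.single v e
    = Poly_Mapping.single (u \<otimes>\<^bsub>G\<^esub> v) (c * e)"
  using monoid_algebra_mult_superset[of "{u}" "Poly_Mapping.single u c" "{v}" "Poly_Mapping.single v e" G]
  by simp

lemma monoid_algebra_distrib_left:
  "(p + p') \<otimes>\<^bsub>monoid_algebra G\<^esub> q = p \<otimes>\<^bsub>monoid_algebra G\<^esub> q + p' \<otimes>\<^bsub>monoid_algebra G\<^esub> q"
proof -
  let ?S = "Poly_Mapping.keys p \<union> Poly_Mapping.keys p'"
  have e: "r \<otimes>\<^bsub>monoid_algebra G\<^esub> q = (\<Sum>u\<in>?S. \<Sum>v\<in>Poly_Mapping.keys q.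
      Poly_Mapping.single (u \<otimes>\<^bsub>G\<^esub> v) (Poly_Mapping.lookup r u * Poly_Mapping.lookup q v))"
    if "Poly_Mapping.keys r \<subseteq> ?S" for r
    using that by (intro monoid_algebra_mult_superset) auto
  show ?thesis
    unfolding e[OF keys_add] e[OF Un_upper1] e[OF Un_upper2]
    by (simp add: lookup_add distrib_right single_add sum.distrib)
qed

lemma monoid_algebra_distrib_right:
  "q \<otimes>\<^bsub>monoid_algebra G\<^esub> (p + p') = q \<otimes>\<^bsub>monoid_algebra G\<^esub> p + q \<otimes>\<^bsub>monoid_algebra G\<^esub> p'"
proof -
  let ?S = "Poly_Mapping.keys p \<union> Poly_Mapping.keys p'"
  have e: "q \<otimes>\<^bsub>monoid_algebra G\<^esub> r = (\<Sum>u\<in>Poly_Mapping.keys q. \<Sum>v\<in>?S.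
      Poly_Mapping.single (u \<otimes>\<^bsub>G\<^esub> v) (Poly_Mapping.lookup q u * Poly_Mapping.lookup r v))"
    if "Poly_Mapping.keys r \<subseteq> ?S" for r
    using that by (intro monoid_algebra_mult_superset) auto
  show ?thesis
    unfolding e[OF keys_add] e[OF Un_upper1] e[OF Un_upper2]
    by (simp add: lookup_add distrib_left single_add sum.distrib)
qed

lemma monoid_algebra_mult_zero:
  "0 \<otimes>\<^bsub>monoid_algebra G\<^esub> q = 0" "q \<otimes>\<^bsub>monoid_algebra G\<^esub> 0 = 0"
  by (simp_all add: monoid_algebra_def)

lemma scale_sum: "scale c (sum f S) = (\<Sum>s\<in>S. scale c (f s))"
  using Modules.module.scale_sum_right[OF scale_module] .

lemma monoid_algebra_scale_mult:
  "scale c p \<otimes>\<^bsub>monoid_algebra G\<^esub> q = scale c (p \<otimes>\<^bsub>monoid_algebra G\<^esub> q)"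
  "p \<otimes>\<^bsub>monoid_algebra G\<^esub> scale c q = scale c (p \<otimes>\<^bsub>monoid_algebra G\<^esub> q)"
proof -
  have e: "r \<otimes>\<^bsub>monoid_algebra G\<^esub> s = (\<Sum>u\<in>Poly_Mapping.keys p. \<Sum>v\<in>Poly_Mapping.keys q.
      Poly_Mapping.single (u \<otimes>\<^bsub>G\<^esub> v) (Poly_Mapping.lookup r u * Poly_Mapping.lookup s v))"
    if "Poly_Mapping.keys r \<subseteq> Poly_Mapping.keys p" "Poly_Mapping.keys s \<subseteq> Poly_Mapping.keys q" for r s
    using that by (intro monoid_algebra_mult_superset) auto
  show "scale c p \<otimes>\<^bsub>monoid_algebra G\<^esub> q = scale c (p \<otimes>\<^bsub>monoid_algebra G\<^esub> q)"
    "p \<otimes>\<^bsub>monoid_algebra G\<^esub> scale c q = scale c (p \<otimes>\<^bsub>monoid_algebra G\<^esub> q)"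
    by (simp_all add: e keys_scale scale_sum scale_single lookup_scale ac_simps)
qed

lemma monoid_algebra_algebra:
  fixes G :: "('g, 'm) monoid_scheme"
  assumes "Group.monoid G"
  shows "k_algebra (monoid_algebra G :: ('k::field, 'g \<Rightarrow>\<^sub>0 'k) module)"
proof -
  interpret G: Group.monoid G by fact
  let ?F = "monoid_algebra G :: ('k, 'g \<Rightarrow>\<^sub>0 'k) module"
  interpret F: k_vector_space ?F by (rule monoid_algebra_vector_space)
  note distrib = monoid_algebra_distrib_left monoid_algebra_distrib_right
  have closed: "p \<otimes>\<^bsub>?F\<^esub> q \<in> carrier ?F" if p: "p \<in> carrier ?F" and q: "q \<in> carrier ?F" for p q
  proof -
    have "Poly_Mapping.keys p \<subseteq> carrier G" using p by (simp add: monoid_algebra_simps)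
    then show ?thesis
    proof (induction rule: poly_mapping_additive_induct)
      case (single k c)
      have "Poly_Mapping.keys q \<subseteq> carrier G" using q by (simp add: monoid_algebra_simps)
      then show ?case
        by (induction rule: poly_mapping_additive_induct)
          (use F.zero_closed in \<open>simp_all add: monoid_algebra_mult_zero monoid_algebra_mult_single distrib
            single single_mem_monoid_algebra monoid_algebra_add_closed monoid_algebra_simps(2)\<close>)
    qed (use F.zero_closed in \<open>simp_all add: monoid_algebra_mult_zero distrib monoid_algebra_add_closed
        monoid_algebra_simps(2)\<close>)
  qed
  have assoc: "p \<otimes>\<^bsub>?F\<^esub> q \<otimes>\<^bsub>?F\<^esub> r = p \<otimes>\<^bsub>?F\<^esub> (q \<otimes>\<^bsub>?F\<^esub> r)"
    if p: "p \<in> carrier ?F" and q: "q \<in> carrier ?F" and r: "r \<in> carrier ?F" for p q r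
  proof -
    have kp: "Poly_Mapping.keys p \<subseteq> carrier G" "Poly_Mapping.keys q \<subseteq> carrier G" "Poly_Mapping.keys r \<subseteq> carrier G"
      using p q r by (simp_all add: monoid_algebra_simps)
    show ?thesis
      using kp(1)
    proof (induction rule: poly_mapping_additive_induct)
      case (single k c)
      show ?case
        using kp(2)
      proof (induction rule: poly_mapping_additive_induct)
        case (single l e)
        show ?case
          using kp(3)
          by (induction rule: poly_mapping_additive_induct)
            (use \<open>k \<in> carrier G\<close> single in \<open>simp_all add: monoid_algebra_mult_zero monoid_algebra_mult_single
              distrib G.m_assoc mult.assoc\<close>)
      qed (simp_all add: monoid_algebra_mult_zero distrib)
    qed (simp_all add: monoid_algebra_mult_zero distrib)
  qed
  have one: "\<one>\<^bsub>?F\<^esub> \<otimes>\<^bsub>?F\<^esub> p = p" "p \<otimes>\<^bsub>?F\<^esub> \<one>\<^bsub>?F\<^esub> = p" if "p \<in> carrier ?F" for p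
  proof -
    have "Poly_Mapping.keys p \<subseteq> carrier G" using that by (simp add: monoid_algebra_simps)
    then have "\<one>\<^bsub>?F\<^esub> \<otimes>\<^bsub>?F\<^esub> p = p \<and> p \<otimes>\<^bsub>?F\<^esub> \<one>\<^bsub>?F\<^esub> = p"
      by (induction rule: poly_mapping_additive_induct)
        (simp_all add: monoid_algebra_simps(5) monoid_algebra_mult_zero monoid_algebra_mult_single distrib)
    then show "\<one>\<^bsub>?F\<^esub> \<otimes>\<^bsub>?F\<^esub> p = p" "p \<otimes>\<^bsub>?F\<^esub> \<one>\<^bsub>?F\<^esub> = p" by auto
  qed
  have one_mem: "\<one>\<^bsub>?F\<^esub> \<in> carrier ?F"
    by (subst monoid_algebra_simps(5)) (simp add: single_mem_monoid_algebra)
  have "ring ?F"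
  proof (rule ringI)
    show "abelian_group ?F" by (rule F.abelian_group_axioms)
    show "Group.monoid ?F"
      by (rule monoidI)
        (simp_all add: closed assoc one one_mem)
  qed (simp_all add: distrib monoid_algebra_simps(3))
  then show ?thesis
    using F.k_vector_space_axioms
    by (simp add: k_algebra_def k_algebra_axioms_def monoid_algebra_simps(4) monoid_algebra_scale_mult)
qed

text \<open>Products of basis elements are basis elements, so multiplicativity on the monoid extends by linearity.\<close>
lemma lin_ext_algebra_hom:
  fixes G :: "('g, 'm) monoid_scheme" and B :: "('k::field, 'c, 'z) module_scheme"
  assumes "Group.monoid G" and "k_algebra B"
    and h: "\<And>u. u \<in> carrier G \<Longrightarrow> h u \<in> carrier B"
    and h_mult: "\<And>u v. u \<in> carrier G \<Longrightarrow> v \<in> carrier G \<Longrightarrow> h (u \<otimes>\<^bsub>G\<^esub> v) = h u \<otimes>\<^bsub>B\<^esub> h v"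
    and h_one: "h \<one>\<^bsub>G\<^esub> = \<one>\<^bsub>B\<^esub>"
  shows "k_algebra_hom (monoid_algebra G) B (lin_ext B h)"
proof -
  interpret G: Group.monoid G by fact
  interpret B: k_algebra B by fact
  let ?F = "monoid_algebra G :: ('k, 'g \<Rightarrow>\<^sub>0 'k) module"
  interpret F: k_algebra ?F by (rule monoid_algebra_algebra) fact
  interpret l: k_linear_map ?F B "lin_ext B h" by (rule B.lin_ext_linear) (rule h)
  have ladd: "lin_ext B h (p + q) = lin_ext B h p \<oplus>\<^bsub>B\<^esub> lin_ext B h q"
    if "p \<in> carrier ?F" "q \<in> carrier ?F" for p q
    using l.add[OF that] by (simp add: monoid_algebra_simps(3))
  have lzero: "lin_ext B h 0 = \<zero>\<^bsub>B\<^esub>" using l.zero by (simp add: monoid_algebra_simps(2))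
  have mult: "lin_ext B h (p \<otimes>\<^bsub>?F\<^esub> q) = lin_ext B h p \<otimes>\<^bsub>B\<^esub> lin_ext B h q"
    if p: "p \<in> carrier ?F" and q: "q \<in> carrier ?F" for p q
  proof -
    have m: "r \<in> carrier ?F" if "Poly_Mapping.keys r \<subseteq> carrier G" for r
      using that by (simp add: monoid_algebra_simps)
    have "Poly_Mapping.keys p \<subseteq> carrier G" using p by (simp add: monoid_algebra_simps)
    then show ?thesis
    proof (induction rule: poly_mapping_additive_induct)
      case zero
      show ?case using q l.closed by (simp add: monoid_algebra_mult_zero lzero)
    next
      case (single k c)
      have "Poly_Mapping.keys q \<subseteq> carrier G" using q by (simp add: monoid_algebra_simps)
      then show ?case
      proof (induction rule: poly_mapping_additive_induct)
        case zero
        show ?case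
          using single l.closed[OF single_mem_monoid_algebra] by (simp add: monoid_algebra_mult_zero lzero)
      next
        case (single l e)
        then show ?case
          using \<open>k \<in> carrier G\<close>
          by (simp add: monoid_algebra_mult_single B.lin_ext_single h h_mult B.smult_mult_left
              B.smult_mult_right mult.commute flip: B.smult_assoc)
      next
        case (add q r)
        then show ?case
          using \<open>k \<in> carrier G\<close> l.closed[OF m] l.closed[OF single_mem_monoid_algebra]
          by (simp add: monoid_algebra_distrib_right ladd
              m single_mem_monoid_algebra B.r_distr)
      qed
    next
      case (add p r)
      then show ?case
        using q l.closed[OF m] l.closed[OF q]
        by (simp add: monoid_algebra_distrib_left ladd
            m B.l_distr)
    qed
  qed
  show ?thesis
    by unfold_locales
      (simp_all add: mult monoid_algebra_simps(5) B.lin_ext_single h h_one B.smult_one)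
qed

section \<open>The enveloping algebra\<close>
lemma op_algebra_algebra:
  assumes "k_algebra R"
  shows "k_algebra (op_algebra R)"
proof -
  interpret R: k_algebra R by fact
  have vs: "k_vector_space (op_algebra R)"
    by (rule k_vector_space_image(1)[OF R.k_vector_space_axioms, of _ "\<lambda>u. u"])
      (auto simp: op_algebra_def)
  have "Group.monoid (op_algebra R)"
    by (rule monoidI) (auto simp: op_algebra_def R.m_assoc)
  then have "ring (op_algebra R)"
    using k_vector_space.axioms(1)[OF vs]
    by (intro ringI) (auto simp: op_algebra_def R.l_distr R.r_distr)
  with vs show ?thesis
    by (simp add: k_algebra_def k_algebra_axioms_def)
      (auto simp: op_algebra_def R.smult_mult_left R.smult_mult_right)
qed

text \<open>A subspace is an ideal once it absorbs the basis elements, since these span the algebra.\<close>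
lemma lin_span_ideal:
  fixes G :: "('g, 'm) monoid_scheme" and S :: "('g \<Rightarrow>\<^sub>0 'k::field) set"
  assumes "Group.monoid G" and S: "S \<subseteq> carrier (monoid_algebra G)"
    and left: "\<And>u s. u \<in> carrier G \<Longrightarrow> s \<in> S \<Longrightarrow>
      Poly_Mapping.single u 1 \<otimes>\<^bsub>monoid_algebra G\<^esub> s \<in> lin_span S"
    and right: "\<And>u s. u \<in> carrier G \<Longrightarrow> s \<in> S \<Longrightarrow>
      s \<otimes>\<^bsub>monoid_algebra G\<^esub> Poly_Mapping.single u 1 \<in> lin_span S"
  shows "ideal (lin_span S) (monoid_algebra G)"
proof -
  let ?F = "monoid_algebra G :: ('k, 'g \<Rightarrow>\<^sub>0 'k) module"
  interpret F: k_algebra ?F by (rule monoid_algebra_algebra) fact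
  have sub: "k_subspace ?F (lin_span S)" by (rule lin_span_subspace[OF S])
  interpret I: k_subspace ?F "lin_span S" by (rule sub)
  have L: "k_linear_map ?F ?F (\<lambda>q. p \<otimes>\<^bsub>?F\<^esub> q)" and R: "k_linear_map ?F ?F (\<lambda>q. q \<otimes>\<^bsub>?F\<^esub> p)"
    if "p \<in> carrier ?F" for p
    using that by (unfold_locales; simp add: F.r_distr F.l_distr F.smult_mult_left F.smult_mult_right)+
  have sc: "Poly_Mapping.single u c = scale c (Poly_Mapping.single u 1)" for u and c :: 'k
    by (simp add: scale_single)
  have add: "p + q \<in> lin_span S" if "p \<in> lin_span S" "q \<in> lin_span S" for p q
    using I.add_mem[OF that] by (simp add: monoid_algebra_simps)
  have smul: "scale c p \<in> lin_span S" if "p \<in> lin_span S" for c p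
    using I.smult_mem[OF that] by (simp add: monoid_algebra_simps)
  have zero: "0 \<in> lin_span S" using I.zero_mem by (simp add: monoid_algebra_simps)
  have "p \<otimes>\<^bsub>?F\<^esub> s \<in> lin_span S \<and> s \<otimes>\<^bsub>?F\<^esub> p \<in> lin_span S"
    if p: "p \<in> carrier ?F" and s: "s \<in> S" for p s
  proof -
    have "Poly_Mapping.keys p \<subseteq> carrier G" using p by (simp add: monoid_algebra_simps)
    then show ?thesis
    proof (induction rule: poly_mapping_additive_induct)
      case (single u c)
      show ?case
        using smul[OF left[OF single s]] smul[OF right[OF single s]]
        unfolding sc[of u c] by (simp add: monoid_algebra_scale_mult)
    qed (simp_all add: monoid_algebra_mult_zero zero monoid_algebra_distrib_left
        monoid_algebra_distrib_right add)
  qed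
  then have "p \<otimes>\<^bsub>?F\<^esub> u \<in> lin_span S" "u \<otimes>\<^bsub>?F\<^esub> p \<in> lin_span S"
    if "p \<in> carrier ?F" "u \<in> lin_span S" for p u
    using linear_map_lin_span[OF L[OF that(1)] sub S _ that(2)]
      linear_map_lin_span[OF R[OF that(1)] sub S _ that(2)] that(1) by auto
  then show ?thesis
    using abelian_subgroup.axioms(1)[OF I.subspace_subgroup] F.ring_axioms
    by (intro idealI) (auto simp: additive_subgroup_def)
qed

locale enveloping_algebra = R: k_algebra R for R :: "('k::field, 'a) module"
begin

sublocale op: k_algebra "op_algebra R" by (rule op_algebra_algebra[OF R.k_algebra_axioms])

sublocale k_tensor_product R "op_algebra R" ..

lemma op_carrier: "carrier (op_algebra R) = carrier R"
  by (simp add: op_algebra_def)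

lemma product_monoid: "Group.monoid (R \<times>\<times> op_algebra R)"
  by (rule DirProd_monoid) (rule R.is_monoid op.is_monoid)+

text \<open>Multiplying a bilinear relation by \<open>(m, n)\<close> gives a bilinear relation again, as the products of \<open>R\<close> and of
  its opposite are bilinear.\<close>
lemma enveloping_ideal:
  "ideal (lin_span (bilinear_rels R (op_algebra R))) (monoid_algebra (R \<times>\<times> op_algebra R))"
proof -
  let ?G = "R \<times>\<times> op_algebra R"
  let ?F = "monoid_algebra ?G :: ('k, 'a \<times> 'a \<Rightarrow>\<^sub>0 'k) module"
  interpret F: k_algebra ?F by (rule monoid_algebra_algebra[OF product_monoid])
  interpret c: k_linear_map ?F T.quot T.coset by (rule T.coset_linear)
  let ?t = "\<lambda>m n. T.coset (Poly_Mapping.single (m, n) 1)"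
  have bil: "k_bilinear R (op_algebra R) T.quot ?t"
    using k_tens_bilinear by (simp add: k_tens_def[abs_def] k_tensor_def)
  have mem: "k \<in> carrier ?G \<Longrightarrow> Poly_Mapping.single k 1 \<in> carrier ?F" for k
    by (rule single_mem_monoid_algebra)
  have in_span: "p \<in> lin_span (bilinear_rels R (op_algebra R))"
    if "p \<in> carrier ?F" "T.coset p = \<zero>\<^bsub>T.quot\<^esub>" for p
    using that T.coset_eq_iff[of p 0] T.k_quotient_zero T.zero_closed monoid_algebra_minus[of p ?G 0]
    by (simp add: monoid_algebra_simps(2))
  have mono: "\<And>u k. u \<in> carrier ?G \<Longrightarrow> k \<in> carrier ?G \<Longrightarrow>
      Poly_Mapping.single u 1 \<otimes>\<^bsub>?F\<^esub> Poly_Mapping.single k 1 = Poly_Mapping.single (u \<otimes>\<^bsub>?G\<^esub> k) 1"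
    by (simp add: monoid_algebra_mult_single)
  show ?thesis
  proof (rule lin_span_ideal[OF product_monoid T.lin_rels_carrier])
    fix u s assume u: "u \<in> carrier ?G" and s: "s \<in> bilinear_rels R (op_algebra R)"
    then have u': "fst u \<in> carrier R" "snd u \<in> carrier R" by (auto simp: op_carrier)
    have sF: "s \<in> carrier ?F" using s T.lin_rels_carrier by auto
    have L: "k_linear_map ?F ?F (\<lambda>q. Poly_Mapping.single u 1 \<otimes>\<^bsub>?F\<^esub> q)"
      and R: "k_linear_map ?F ?F (\<lambda>q. q \<otimes>\<^bsub>?F\<^esub> Poly_Mapping.single u 1)"
      using mem[OF u]
      by (unfold_locales; simp add: F.r_distr F.l_distr F.smult_mult_left F.smult_mult_right)+
    have "k_bilinear R (op_algebra R) T.quot (\<lambda>m n. ?t (fst u \<otimes>\<^bsub>R\<^esub> m) (n \<otimes>\<^bsub>R\<^esub> snd u))"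
      using bil u' unfolding k_bilinear_def
      by (simp add: op_algebra_def R.r_distr R.l_distr R.smult_mult_left R.smult_mult_right)
    then have "\<forall>s\<in>bilinear_rels R (op_algebra R). T.coset (Poly_Mapping.single u 1 \<otimes>\<^bsub>?F\<^esub> s) = \<zero>\<^bsub>T.quot\<^esub>"
      using bilinear_rels_iff[OF R.k_vector_space_axioms op.k_vector_space_axioms
          k_linear_map_comp[OF L T.coset_linear]]
      by (simp add: monoid_algebra_mult_single mult_DirProd' op_algebra_def)
    then show "Poly_Mapping.single u 1 \<otimes>\<^bsub>?F\<^esub> s \<in> lin_span (bilinear_rels R (op_algebra R))"
      using in_span s mem[OF u] sF by simp
    have "k_bilinear R (op_algebra R) T.quot (\<lambda>m n. ?t (m \<otimes>\<^bsub>R\<^esub> fst u) (snd u \<otimes>\<^bsub>R\<^esub> n))"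
      using bil u' unfolding k_bilinear_def
      by (simp add: op_algebra_def R.r_distr R.l_distr R.smult_mult_left R.smult_mult_right)
    then have "\<forall>s\<in>bilinear_rels R (op_algebra R). T.coset (s \<otimes>\<^bsub>?F\<^esub> Poly_Mapping.single u 1) = \<zero>\<^bsub>T.quot\<^esub>"
      using bilinear_rels_iff[OF R.k_vector_space_axioms op.k_vector_space_axioms
          k_linear_map_comp[OF R T.coset_linear]]
      by (simp add: monoid_algebra_mult_single mult_DirProd' op_algebra_def)
    then show "s \<otimes>\<^bsub>?F\<^esub> Poly_Mapping.single u 1 \<in> lin_span (bilinear_rels R (op_algebra R))"
      using in_span s mem[OF u] sF by simp
  qed
qed

abbreviation "tn \<equiv> k_tens R (op_algebra R)"

lemma enveloping_algebra: "k_algebra (enveloping R)"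
  and enveloping_coset: "k_algebra_hom (monoid_algebra (R \<times>\<times> op_algebra R)) (enveloping R) T.coset"
  using k_quotient_ideal[OF monoid_algebra_algebra[OF product_monoid] enveloping_ideal]
  by (simp_all add: enveloping_def k_tensor_def)

lemma tn_bilinear: "k_bilinear R (op_algebra R) (enveloping R) tn"
  using k_tens_bilinear by (simp add: enveloping_def)

lemma tn_mult:
  assumes "{a, a', e, e'} \<subseteq> carrier R"
  shows "tn a a' \<otimes>\<^bsub>enveloping R\<^esub> tn e e' = tn (a \<otimes>\<^bsub>R\<^esub> e) (e' \<otimes>\<^bsub>R\<^esub> a')"
proof -
  interpret c: k_algebra_hom "monoid_algebra (R \<times>\<times> op_algebra R)" "enveloping R" T.coset
    by (rule enveloping_coset)
  show ?thesis
    using assms c.mult[of "Poly_Mapping.single (a, a') 1" "Poly_Mapping.single (e, e') 1"]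
    by (simp add: k_tens_def single_mem_monoid_algebra op_carrier monoid_algebra_mult_single)
      (simp add: op_algebra_def)
qed

lemma tn_one: "tn \<one>\<^bsub>R\<^esub> \<one>\<^bsub>R\<^esub> = \<one>\<^bsub>enveloping R\<^esub>"
proof -
  interpret c: k_algebra_hom "monoid_algebra (R \<times>\<times> op_algebra R)" "enveloping R" T.coset
    by (rule enveloping_coset)
  show ?thesis
    using c.one by (simp add: k_tens_def monoid_algebra_simps(5)) (simp add: op_algebra_def)
qed

text \<open>The commuting images of \<open>R\<close> and of its opposite multiply to \<open>u \<otimes> v \<mapsto> \<alpha> u \<beta> v\<close>, and commutativity is what
  makes this map multiplicative.\<close>
lemma enveloping_lift:
  assumes f: "k_algebra_hom R B f" and g: "k_algebra_hom (op_algebra R) B g"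
    and comm: "\<And>u v. u \<in> carrier R \<Longrightarrow> v \<in> carrier R \<Longrightarrow> f u \<otimes>\<^bsub>B\<^esub> g v = g v \<otimes>\<^bsub>B\<^esub> f u"
  obtains h where "k_algebra_hom (enveloping R) B h"
    and "\<And>u v. u \<in> carrier R \<Longrightarrow> v \<in> carrier R \<Longrightarrow> h (tn u v) = f u \<otimes>\<^bsub>B\<^esub> g v"
proof -
  interpret f: k_algebra_hom R B f by fact
  interpret g: k_algebra_hom "op_algebra R" B g by fact
  note g' = g.closed[unfolded op_carrier] g.add[unfolded op_carrier] g.smult[unfolded op_carrier]
  have gm: "g (v \<otimes>\<^bsub>R\<^esub> u) = g u \<otimes>\<^bsub>B\<^esub> g v" if "u \<in> carrier R" "v \<in> carrier R" for u v
    using g.mult[of u v] that by (simp add: op_algebra_def)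
  have go: "g \<one>\<^bsub>R\<^esub> = \<one>\<^bsub>B\<^esub>" using g.one by (simp add: op_algebra_def)
  let ?h = "\<lambda>k. f (fst k) \<otimes>\<^bsub>B\<^esub> g (snd k)"
  let ?F = "monoid_algebra (R \<times>\<times> op_algebra R) :: ('k, 'a \<times> 'a \<Rightarrow>\<^sub>0 'k) module"
  have cl: "?h k \<in> carrier B" if "k \<in> carrier (R \<times>\<times> op_algebra R)" for k
    using that by (auto simp: op_carrier f.closed g')
  have hom: "k_algebra_hom ?F B (lin_ext B ?h)"
  proof (rule lin_ext_algebra_hom[OF product_monoid f.B.k_algebra_axioms cl])
    fix u v assume "u \<in> carrier (R \<times>\<times> op_algebra R)" "v \<in> carrier (R \<times>\<times> op_algebra R)"
    then obtain a a' e e' where uv: "u = (a, a')" "v = (e, e')"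
      "a \<in> carrier R" "a' \<in> carrier R" "e \<in> carrier R" "e' \<in> carrier R"
      by (auto simp: op_carrier)
    have "f a \<otimes>\<^bsub>B\<^esub> f e \<otimes>\<^bsub>B\<^esub> (g a' \<otimes>\<^bsub>B\<^esub> g e') = f a \<otimes>\<^bsub>B\<^esub> (f e \<otimes>\<^bsub>B\<^esub> g a') \<otimes>\<^bsub>B\<^esub> g e'"
      using uv by (simp add: f.closed g' f.B.m_assoc)
    also have "\<dots> = f a \<otimes>\<^bsub>B\<^esub> g a' \<otimes>\<^bsub>B\<^esub> (f e \<otimes>\<^bsub>B\<^esub> g e')"
      unfolding comm[OF uv(5) uv(4)] using uv by (simp add: f.closed g' f.B.m_assoc)
    finally show "?h (u \<otimes>\<^bsub>R \<times>\<times> op_algebra R\<^esub> v) = ?h u \<otimes>\<^bsub>B\<^esub> ?h v"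
      using uv gm by (simp add: mult_DirProd' f.mult) (simp add: op_algebra_def gm)
  next
    show "?h \<one>\<^bsub>R \<times>\<times> op_algebra R\<^esub> = \<one>\<^bsub>B\<^esub>"
      by (simp add: f.one) (simp add: op_algebra_def go)
  qed auto
  interpret l: k_algebra_hom ?F B "lin_ext B ?h" by (rule hom)
  have l1: "lin_ext B ?h (Poly_Mapping.single (m, n) 1) = f m \<otimes>\<^bsub>B\<^esub> g n"
    if "m \<in> carrier R" "n \<in> carrier R" for m n
    using that by (simp add: f.B.lin_ext_single f.closed g' f.B.smult_one)
  have "k_bilinear R (op_algebra R) B (\<lambda>m n. lin_ext B ?h (Poly_Mapping.single (m, n) 1)) \<longleftrightarrow>
      k_bilinear R (op_algebra R) B (\<lambda>m n. f m \<otimes>\<^bsub>B\<^esub> g n)"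
    by (rule k_bilinear_cong[OF R.k_vector_space_axioms op.k_vector_space_axioms])
      (simp add: l1 op_carrier)
  also have "\<dots>"
    unfolding k_bilinear_def
    by (simp add: op_carrier f.closed g' f.add f.smult f.B.l_distr f.B.r_distr f.B.smult_mult_left f.B.smult_mult_right)
  finally have "\<forall>s\<in>bilinear_rels R (op_algebra R). lin_ext B ?h s = \<zero>\<^bsub>B\<^esub>"
    using bilinear_rels_iff[OF R.k_vector_space_axioms op.k_vector_space_axioms l.k_linear_map_axioms]
    by simp
  then have ker: "lin_ext B ?h p = \<zero>\<^bsub>B\<^esub>" if "p \<in> lin_span (bilinear_rels R (op_algebra R))" for p
    using linear_map_lin_span[OF l.k_linear_map_axioms zero_subspace[OF f.B.k_vector_space_axioms]
        T.lin_rels_carrier _ that] by simp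
  show ?thesis
  proof
    show "k_algebra_hom (enveloping R) B (\<lambda>P. the_elem (lin_ext B ?h ` P))"
      using ideal_lift(1)[OF hom enveloping_ideal ker] by (simp add: enveloping_def k_tensor_def)
    show "the_elem (lin_ext B ?h ` tn u v) = f u \<otimes>\<^bsub>B\<^esub> g v" if "u \<in> carrier R" "v \<in> carrier R" for u v
      using ideal_lift(2)[OF hom enveloping_ideal ker single_mem_monoid_algebra, of "(u, v)" 1] that
      by (simp add: k_tens_def op_carrier l1)
  qed
qed

lemma enveloping_maps_eq:
  assumes "k_algebra_hom (enveloping R) B f" and "k_algebra_hom (enveloping R) B g"
    and "\<And>m n. m \<in> carrier R \<Longrightarrow> n \<in> carrier R \<Longrightarrow> f (tn m n) = g (tn m n)"
    and "u \<in> carrier (enveloping R)"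
  shows "f u = g u"
  using k_tensor_maps_eq[of B f g u] assms
  by (simp add: k_algebra_hom_def enveloping_def op_carrier)

end

section \<open>Free algebras, tensor algebras and free products\<close>
lemma lists_monoid: "Group.monoid \<lparr>carrier = lists S, mult = (@), one = []\<rparr>"
  by (rule monoidI) auto

lemma free_algebra_algebra: "k_algebra (free_algebra S)"
  unfolding free_algebra_def by (rule monoid_algebra_algebra[OF lists_monoid])

lemma single_mem_free_algebra: "set w \<subseteq> S \<Longrightarrow> Poly_Mapping.single w c \<in> carrier (free_algebra S)"
  unfolding free_algebra_def by (rule single_mem_monoid_algebra) auto

lemma letter_mem: "s \<in> S \<Longrightarrow> letter s \<in> carrier (free_algebra S)"
  unfolding letter_def by (rule single_mem_free_algebra) simp

lemma free_algebra_minus: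
  "p \<in> carrier (free_algebra S) \<Longrightarrow> q \<in> carrier (free_algebra S) \<Longrightarrow>
    p \<ominus>\<^bsub>free_algebra S\<^esub> q = p - q"
  unfolding free_algebra_def by (rule monoid_algebra_minus)

lemma free_algebra_simps:
  "p \<oplus>\<^bsub>free_algebra S\<^esub> q = p + q" "k \<odot>\<^bsub>free_algebra S\<^esub> p = scale k p"
  "\<one>\<^bsub>free_algebra S\<^esub> = Poly_Mapping.single [] 1"
  "Poly_Mapping.single u c \<otimes>\<^bsub>free_algebra S\<^esub> Poly_Mapping.single v e = Poly_Mapping.single (u @ v) (c * e)"
  by (simp_all add: free_algebra_def monoid_algebra_simps monoid_algebra_mult_single)

lemma free_algebra_lift:
  assumes B: "k_algebra B" and h: "\<And>s. s \<in> S \<Longrightarrow> h s \<in> carrier B"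
  obtains f where "k_algebra_hom (free_algebra S) B f"
    and "\<And>s. s \<in> S \<Longrightarrow> f (letter s) = h s"
proof -
  interpret B: k_algebra B by fact
  define w where "w = (\<lambda>u. foldr (\<lambda>s v. h s \<otimes>\<^bsub>B\<^esub> v) u \<one>\<^bsub>B\<^esub>)"
  have wc: "w u \<in> carrier B" if "set u \<subseteq> S" for u
    using that by (induction u) (auto simp: w_def h)
  have wm: "w (u @ v) = w u \<otimes>\<^bsub>B\<^esub> w v" if "set u \<subseteq> S" "set v \<subseteq> S" for u v
    using that(1)
  proof (induction u)
    case Nil
    show ?case using wc[OF that(2)] by (simp add: w_def)
  next
    case (Cons s u)
    then show ?case using wc[of u] wc[OF that(2)] h by (simp add: w_def B.m_assoc)
  qed
  have "k_algebra_hom (free_algebra S) B (lin_ext B w)"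
    unfolding free_algebra_def
    by (rule lin_ext_algebra_hom[OF lists_monoid B])
      (simp_all add: wc wm in_lists_conv_set subset_eq, simp add: w_def)
  moreover have "lin_ext B w (letter s) = h s" if "s \<in> S" for s
    using that wc[of "[s]"] h[OF that]
    by (simp add: letter_def B.lin_ext_single B.smult_one) (simp add: w_def)
  ultimately show ?thesis using that by blast
qed

lemma free_algebra_maps_eq:
  fixes S :: "'g set" and B :: "('k::field, 'c, 'z) module_scheme"
  assumes "k_algebra_hom (free_algebra S) B f" and "k_algebra_hom (free_algebra S) B g"
    and eq: "\<And>s. s \<in> S \<Longrightarrow> f (letter s) = g (letter s)" and p: "p \<in> carrier (free_algebra S)"
  shows "f p = g p"
proof -
  interpret f: k_algebra_hom "free_algebra S" B f by fact
  interpret g: k_algebra_hom "free_algebra S" B g by fact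
  have "f (Poly_Mapping.single w 1) = g (Poly_Mapping.single w 1)" if "set w \<subseteq> S" for w
    using that
  proof (induction w)
    case Nil
    show ?case using f.one g.one by (simp add: free_algebra_simps)
  next
    case (Cons s w)
    then have "letter s \<in> carrier (free_algebra S)" "Poly_Mapping.single w 1 \<in> carrier (free_algebra S)"
      by (auto intro: letter_mem single_mem_free_algebra)
    note m = f.mult[OF this] g.mult[OF this]
    have "(letter s :: 'g list \<Rightarrow>\<^sub>0 'k) \<otimes>\<^bsub>free_algebra S\<^esub> Poly_Mapping.single w 1 = Poly_Mapping.single (s # w) 1"
      by (simp add: letter_def free_algebra_simps)
    then show ?case using m Cons eq by simp
  qed
  then show ?thesis
    using linear_map_monoid_algebra_eq[OF f.k_linear_map_axioms[unfolded free_algebra_def]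
        g.k_linear_map_axioms[unfolded free_algebra_def]] p
    by (simp add: free_algebra_def in_lists_conv_set subset_eq)
qed

lemma linear_rels_iff:
  fixes S :: "'g set" and B :: "('k::field, 'c, 'y) module_scheme" and V :: "('k, 'v, 'z) module_scheme"
  assumes f: "k_algebra_hom (free_algebra S) B f" and V: "k_vector_space V"
    and e: "\<And>v. v \<in> carrier V \<Longrightarrow> e v \<in> S"
  shows "(\<forall>r\<in>linear_rels V e. f r = \<zero>\<^bsub>B\<^esub>) \<longleftrightarrow> k_linear_map V B (\<lambda>v. f (letter (e v)))"
    and "linear_rels V e \<subseteq> carrier (free_algebra S)"
proof -
  interpret f: k_algebra_hom "free_algebra S" B f by fact
  interpret V: k_vector_space V by fact
  let ?F = "free_algebra S :: ('k, 'g list \<Rightarrow>\<^sub>0 'k) module"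
  have l: "letter (e v) \<in> carrier ?F" if "v \<in> carrier V" for v
    using that by (intro letter_mem e)
  have add_mem: "letter (e u) + letter (e v) \<in> carrier ?F" if "u \<in> carrier V" "v \<in> carrier V" for u v
    using f.R.add.m_closed[OF l[OF that(1)] l[OF that(2)]] by (simp add: free_algebra_simps)
  have scale_mem: "scale k (letter (e u)) \<in> carrier ?F" if "u \<in> carrier V" for k u
    using f.R.smult_closed[OF l[OF that]] by (simp add: free_algebra_simps)
  have minus: "f (r - s) = \<zero>\<^bsub>B\<^esub> \<longleftrightarrow> f r = f s" "r - s \<in> carrier ?F" if "r \<in> carrier ?F" "s \<in> carrier ?F" for r s
    using f.minus[OF that] f.closed that free_algebra_minus[OF that]
      f.R.minus_closed[OF that] by (simp_all add: f.B.minus_eq_zero_iff)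
  have 1: "f (letter (e (u \<oplus>\<^bsub>V\<^esub> v)) - (letter (e u) + letter (e v))) = \<zero>\<^bsub>B\<^esub> \<longleftrightarrow>
      f (letter (e (u \<oplus>\<^bsub>V\<^esub> v))) = f (letter (e u)) \<oplus>\<^bsub>B\<^esub> f (letter (e v))"
    if "u \<in> carrier V" "v \<in> carrier V" for u v
    using that f.add[OF l[OF that(1)] l[OF that(2)]]
    by (simp add: minus l add_mem free_algebra_simps(1))
  have 2: "f (letter (e (k \<odot>\<^bsub>V\<^esub> u)) - scale k (letter (e u))) = \<zero>\<^bsub>B\<^esub> \<longleftrightarrow>
      f (letter (e (k \<odot>\<^bsub>V\<^esub> u))) = k \<odot>\<^bsub>B\<^esub> f (letter (e u))"
    if "u \<in> carrier V" for k u
    using that f.smult[OF l[OF that]]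
    by (simp add: minus l scale_mem free_algebra_simps(2))
  show "linear_rels V e \<subseteq> carrier ?F"
    unfolding linear_rels_def by (auto intro!: minus(2) l add_mem scale_mem)
  have "(\<forall>r\<in>linear_rels V e. f r = \<zero>\<^bsub>B\<^esub>) \<longleftrightarrow>
      (\<forall>u v. u \<in> carrier V \<and> v \<in> carrier V \<longrightarrow> f (letter (e (u \<oplus>\<^bsub>V\<^esub> v))) = f (letter (e u)) \<oplus>\<^bsub>B\<^esub> f (letter (e v))) \<and>
      (\<forall>k u. u \<in> carrier V \<longrightarrow> f (letter (e (k \<odot>\<^bsub>V\<^esub> u))) = k \<odot>\<^bsub>B\<^esub> f (letter (e u)))"
    (is "_ \<longleftrightarrow> ?R")
  proof
    assume a: "\<forall>r\<in>linear_rels V e. f r = \<zero>\<^bsub>B\<^esub>"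
    have "f (letter (e (u \<oplus>\<^bsub>V\<^esub> v))) = f (letter (e u)) \<oplus>\<^bsub>B\<^esub> f (letter (e v))"
      if "u \<in> carrier V" "v \<in> carrier V" for u v
      using that by (intro iffD1[OF 1] bspec[OF a]) (auto simp: linear_rels_def)
    moreover have "f (letter (e (k \<odot>\<^bsub>V\<^esub> u))) = k \<odot>\<^bsub>B\<^esub> f (letter (e u))"
      if "u \<in> carrier V" for u k
      using that by (intro iffD1[OF 2] bspec[OF a]) (auto simp: linear_rels_def)
    ultimately show ?R by simp
  next
    assume R: ?R
    show "\<forall>r\<in>linear_rels V e. f r = \<zero>\<^bsub>B\<^esub>"
      unfolding linear_rels_def
    proof (intro ballI, elim UnE CollectE exE conjE)
      fix r :: "'g list \<Rightarrow>\<^sub>0 'k" and u v assume "r = letter (e (u \<oplus>\<^bsub>V\<^esub> v)) - (letter (e u) + letter (e v))"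
        "u \<in> carrier V" "v \<in> carrier V"
      then show "f r = \<zero>\<^bsub>B\<^esub>" using 1 R by simp
    next
      fix r :: "'g list \<Rightarrow>\<^sub>0 'k" and k u assume "r = letter (e (k \<odot>\<^bsub>V\<^esub> u)) - scale k (letter (e u))" "u \<in> carrier V"
      then show "f r = \<zero>\<^bsub>B\<^esub>" using 2 R by simp
    qed
  qed
  also have "\<dots> \<longleftrightarrow> k_linear_map V B (\<lambda>v. f (letter (e v)))"
    using V f.B.k_vector_space_axioms f.closed[OF l]
    by (simp add: k_linear_map_def k_linear_map_axioms_def) (rule iffI; simp)
  finally show "(\<forall>r\<in>linear_rels V e. f r = \<zero>\<^bsub>B\<^esub>) \<longleftrightarrow> k_linear_map V B (\<lambda>v. f (letter (e v)))" .
qed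

lemma mult_rels_iff:
  fixes S :: "'g set" and B :: "('k::field, 'c, 'y) module_scheme" and R :: "('k, 'v, 'z) module_scheme"
  assumes f: "k_algebra_hom (free_algebra S) B f" and R: "k_algebra R"
    and e: "\<And>v. v \<in> carrier R \<Longrightarrow> e v \<in> S"
  shows "(\<forall>r\<in>linear_rels R e \<union> mult_rels R e. f r = \<zero>\<^bsub>B\<^esub>) \<longleftrightarrow>
      k_algebra_hom R B (\<lambda>v. f (letter (e v)))"
    and "mult_rels R e \<subseteq> carrier (free_algebra S)"
proof -
  interpret f: k_algebra_hom "free_algebra S" B f by fact
  interpret R: k_algebra R by fact
  let ?F = "free_algebra S :: ('k, 'g list \<Rightarrow>\<^sub>0 'k) module"
  have l: "letter (e v) \<in> carrier ?F" if "v \<in> carrier R" for v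
    using that by (intro letter_mem e)
  have two: "Poly_Mapping.single [e u, e v] 1 = letter (e u) \<otimes>\<^bsub>?F\<^esub> letter (e v)" for u v
    by (simp add: letter_def free_algebra_simps)
  have minus: "f (r - s) = \<zero>\<^bsub>B\<^esub> \<longleftrightarrow> f r = f s" "r - s \<in> carrier ?F" if "r \<in> carrier ?F" "s \<in> carrier ?F" for r s
    using f.minus[OF that] f.closed that free_algebra_minus[OF that]
      f.R.minus_closed[OF that] by (simp_all add: f.B.minus_eq_zero_iff)
  have 1: "f (letter (e (u \<otimes>\<^bsub>R\<^esub> v)) - Poly_Mapping.single [e u, e v] 1) = \<zero>\<^bsub>B\<^esub> \<longleftrightarrow>
      f (letter (e (u \<otimes>\<^bsub>R\<^esub> v))) = f (letter (e u)) \<otimes>\<^bsub>B\<^esub> f (letter (e v))"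
    if "u \<in> carrier R" "v \<in> carrier R" for u v
    using that by (simp add: minus l two f.mult)
  have 2: "f (letter (e \<one>\<^bsub>R\<^esub>) - Poly_Mapping.single [] 1) = \<zero>\<^bsub>B\<^esub> \<longleftrightarrow> f (letter (e \<one>\<^bsub>R\<^esub>)) = \<one>\<^bsub>B\<^esub>"
    using minus(1)[OF l[OF R.one_closed] f.R.one_closed] f.one by (simp add: free_algebra_simps)
  have 3: "letter (e \<one>\<^bsub>R\<^esub>) - Poly_Mapping.single [] 1 \<in> carrier ?F"
    by (rule minus(2)[OF l[OF R.one_closed] single_mem_free_algebra]) simp
  show "mult_rels R e \<subseteq> carrier ?F"
    unfolding mult_rels_def using 3 by (auto intro!: minus(2) l simp: two)
  have "(\<forall>r\<in>mult_rels R e. f r = \<zero>\<^bsub>B\<^esub>) \<longleftrightarrow>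
      (\<forall>u v. u \<in> carrier R \<and> v \<in> carrier R \<longrightarrow> f (letter (e (u \<otimes>\<^bsub>R\<^esub> v))) = f (letter (e u)) \<otimes>\<^bsub>B\<^esub> f (letter (e v))) \<and>
      f (letter (e \<one>\<^bsub>R\<^esub>)) = \<one>\<^bsub>B\<^esub>"
    (is "_ \<longleftrightarrow> ?R")
  proof
    assume a: "\<forall>r\<in>mult_rels R e. f r = \<zero>\<^bsub>B\<^esub>"
    have "f (letter (e (u \<otimes>\<^bsub>R\<^esub> v))) = f (letter (e u)) \<otimes>\<^bsub>B\<^esub> f (letter (e v))"
      if "u \<in> carrier R" "v \<in> carrier R" for u v
      using that by (intro iffD1[OF 1] bspec[OF a]) (auto simp: mult_rels_def)
    moreover have "f (letter (e \<one>\<^bsub>R\<^esub>)) = \<one>\<^bsub>B\<^esub>"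
      by (intro iffD1[OF 2] bspec[OF a]) (simp add: mult_rels_def)
    ultimately show ?R by simp
  next
    assume R: ?R
    show "\<forall>r\<in>mult_rels R e. f r = \<zero>\<^bsub>B\<^esub>"
      unfolding mult_rels_def
    proof (intro ballI, elim UnE CollectE exE conjE singletonE)
      fix r :: "'g list \<Rightarrow>\<^sub>0 'k" and u v assume "r = letter (e (u \<otimes>\<^bsub>R\<^esub> v)) - Poly_Mapping.single [e u, e v] 1"
        "u \<in> carrier R" "v \<in> carrier R"
      then show "f r = \<zero>\<^bsub>B\<^esub>" using 1 R by simp
    next
      fix r :: "'g list \<Rightarrow>\<^sub>0 'k" assume "r = letter (e \<one>\<^bsub>R\<^esub>) - Poly_Mapping.single [] 1"
      then show "f r = \<zero>\<^bsub>B\<^esub>" using 2 R by simp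
    qed
  qed
  then show "(\<forall>r\<in>linear_rels R e \<union> mult_rels R e. f r = \<zero>\<^bsub>B\<^esub>) \<longleftrightarrow>
      k_algebra_hom R B (\<lambda>v. f (letter (e v)))"
    using R f.B.k_algebra_axioms linear_rels_iff(1)[OF f R.k_vector_space_axioms e]
    by (simp add: ball_Un k_algebra_hom_def k_algebra_hom_axioms_def) (rule iffI; simp)
qed

lemma free_algebra_id: "k_algebra_hom (free_algebra S) (free_algebra S) (\<lambda>u. u)"
  by (rule k_algebra_hom_id[OF free_algebra_algebra])

text \<open>Letters generate a free algebra, hence every quotient of it.\<close>
lemma rel_class_letter_maps_eq:
  assumes "relations (free_algebra S) Rel"
    and f: "k_algebra_hom (mod_rels (free_algebra S) Rel) B f"
    and g: "k_algebra_hom (mod_rels (free_algebra S) Rel) B g"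
    and eq: "\<And>s. s \<in> S \<Longrightarrow> f (rel_class (free_algebra S) Rel (letter s)) = g (rel_class (free_algebra S) Rel (letter s))"
    and u: "u \<in> carrier (mod_rels (free_algebra S) Rel)"
  shows "f u = g u"
proof -
  interpret relations "free_algebra S" Rel by fact
  obtain v where v: "v \<in> carrier (free_algebra S)" "u = rel_class (free_algebra S) Rel v"
    using u mod_rels_carrier by auto
  show ?thesis
    unfolding v(2)
    by (rule free_algebra_maps_eq[OF k_algebra_hom_comp[OF rel_class_hom f]
          k_algebra_hom_comp[OF rel_class_hom g] eq v(1)])
qed

context k_vector_space
begin

lemma tensor_algebra_relations: "relations (free_algebra (carrier M)) (linear_rels M id)"
  using linear_rels_iff(2)[OF free_algebra_id k_vector_space_axioms, of id "carrier M"]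
  by (simp add: relations_def relations_axioms_def free_algebra_algebra)

lemma tensor_algebra_algebra: "k_algebra (tensor_algebra M)"
  unfolding tensor_algebra_def by (rule relations.mod_rels_algebra[OF tensor_algebra_relations])

lemma ta_gen_linear: "k_linear_map M (tensor_algebra M) (ta_gen M)"
  using linear_rels_iff(1)[OF relations.rel_class_hom[OF tensor_algebra_relations] k_vector_space_axioms, of id]
    relations.rel_class_zero[OF tensor_algebra_relations]
  by (simp add: tensor_algebra_def ta_gen_def[abs_def])

lemma tensor_algebra_lift:
  assumes B: "k_algebra B" and h: "k_linear_map M B h"
  obtains f where "k_algebra_hom (tensor_algebra M) B f"
    and "\<And>v. v \<in> carrier M \<Longrightarrow> f (ta_gen M v) = h v"
proof -
  obtain f where f: "k_algebra_hom (free_algebra (carrier M)) B f"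
    and f1: "\<And>v. v \<in> carrier M \<Longrightarrow> f (letter v) = h v"
    using free_algebra_lift[OF B, of "carrier M" h] k_linear_map.closed[OF h] by blast
  interpret f: k_algebra_hom "free_algebra (carrier M)" B f by (rule f)
  have "k_linear_map M B (\<lambda>v. f (letter (id v)))"
    using h by (simp add: k_linear_map_def k_linear_map_axioms_def f1)
  then have "\<forall>r\<in>linear_rels M id. f r = \<zero>\<^bsub>B\<^esub>"
    using linear_rels_iff(1)[OF f k_vector_space_axioms, of id] by simp
  then obtain g where g: "k_algebra_hom (tensor_algebra M) B g"
    and g1: "\<And>u. u \<in> carrier (free_algebra (carrier M)) \<Longrightarrow>
      g (rel_class (free_algebra (carrier M)) (linear_rels M id) u) = f u"
    using relations.mod_rels_lift[OF tensor_algebra_relations f] unfolding tensor_algebra_def by blast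
  show ?thesis
    by (rule that[OF g]) (simp add: ta_gen_def g1 letter_mem f1)
qed

lemma tensor_algebra_maps_eq:
  assumes "k_algebra_hom (tensor_algebra M) B f" and "k_algebra_hom (tensor_algebra M) B g"
    and "\<And>v. v \<in> carrier M \<Longrightarrow> f (ta_gen M v) = g (ta_gen M v)"
    and "u \<in> carrier (tensor_algebra M)"
  shows "f u = g u"
  using rel_class_letter_maps_eq[OF tensor_algebra_relations, of B f g u] assms
  by (simp add: tensor_algebra_def ta_gen_def)

end

locale free_product_algebra = P: k_algebra P + Q: k_algebra Q
  for P :: "('k::field, 'a, 'y) module_scheme" and Q :: "('k, 'b, 'z) module_scheme"
begin

abbreviation "letters \<equiv> carrier P <+> carrier Q"

lemma free_product_rels_iff:
  assumes f: "k_algebra_hom (free_algebra letters) B f"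
  shows "(\<forall>r\<in>free_product_rels P Q. f r = \<zero>\<^bsub>B\<^esub>) \<longleftrightarrow>
    k_algebra_hom P B (\<lambda>u. f (letter (Inl u))) \<and> k_algebra_hom Q B (\<lambda>u. f (letter (Inr u)))"
  using mult_rels_iff(1)[OF f P.k_algebra_axioms, of Inl] mult_rels_iff(1)[OF f Q.k_algebra_axioms, of Inr]
  by (auto simp: free_product_rels_def ball_Un)

lemma free_product_relations: "relations (free_algebra letters) (free_product_rels P Q)"
  using mult_rels_iff(2)[OF free_algebra_id P.k_algebra_axioms, of Inl letters]
    mult_rels_iff(2)[OF free_algebra_id Q.k_algebra_axioms, of Inr letters]
    linear_rels_iff(2)[OF free_algebra_id P.k_vector_space_axioms, of Inl letters]
    linear_rels_iff(2)[OF free_algebra_id Q.k_vector_space_axioms, of Inr letters]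
  by (simp add: relations_def relations_axioms_def free_algebra_algebra free_product_rels_def InlI InrI)

lemma free_product_is_algebra: "k_algebra (P \<star> Q)"
  unfolding free_product_def by (rule relations.mod_rels_algebra[OF free_product_relations])

lemma fp_inl_hom: "k_algebra_hom P (P \<star> Q) (fp_inl P Q)"
  and fp_inr_hom: "k_algebra_hom Q (P \<star> Q) (fp_inr P Q)"
  using free_product_rels_iff[OF relations.rel_class_hom[OF free_product_relations]]
    relations.rel_class_zero[OF free_product_relations]
  by (simp_all add: free_product_def fp_inl_def[abs_def] fp_inr_def[abs_def])

lemma free_product_lift:
  assumes f: "k_algebra_hom P B f" and g: "k_algebra_hom Q B g"
  obtains h where "k_algebra_hom (P \<star> Q) B h"
    and "\<And>u. u \<in> carrier P \<Longrightarrow> h (fp_inl P Q u) = f u"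
    and "\<And>u. u \<in> carrier Q \<Longrightarrow> h (fp_inr P Q u) = g u"
proof -
  interpret f: k_algebra_hom P B f by (rule f)
  interpret g: k_algebra_hom Q B g by (rule g)
  have cl: "case_sum f g s \<in> carrier B" if "s \<in> letters" for s
    using that by (auto simp: f.closed g.closed)
  obtain k where k: "k_algebra_hom (free_algebra letters) B k"
    and "\<And>s. s \<in> letters \<Longrightarrow> k (letter s) = case_sum f g s"
    using free_algebra_lift[OF f.B.k_algebra_axioms, of letters "case_sum f g", OF cl] by blast
  then have k1: "\<And>u. u \<in> carrier P \<Longrightarrow> k (letter (Inl u)) = f u"
    "\<And>u. u \<in> carrier Q \<Longrightarrow> k (letter (Inr u)) = g u"
    by (auto simp: InlI InrI)
  have "k_algebra_hom P B (\<lambda>u. k (letter (Inl u)))" "k_algebra_hom Q B (\<lambda>u. k (letter (Inr u)))"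
    using f g by (simp_all add: k_algebra_hom_def k_algebra_hom_axioms_def k_linear_map_def
        k_linear_map_axioms_def k1)
  then have "\<forall>r\<in>free_product_rels P Q. k r = \<zero>\<^bsub>B\<^esub>" using free_product_rels_iff[OF k] by simp
  then obtain h where h: "k_algebra_hom (P \<star> Q) B h"
    and h1: "\<And>u. u \<in> carrier (free_algebra letters) \<Longrightarrow>
      h (rel_class (free_algebra letters) (free_product_rels P Q) u) = k u"
    using relations.mod_rels_lift[OF free_product_relations k] unfolding free_product_def by blast
  show ?thesis
    by (rule that[OF h]) (simp_all add: fp_inl_def fp_inr_def h1 letter_mem InlI InrI k1)
qed

lemma free_product_maps_eq:
  assumes "k_algebra_hom (P \<star> Q) B f" and "k_algebra_hom (P \<star> Q) B g"
    and "\<And>u. u \<in> carrier P \<Longrightarrow> f (fp_inl P Q u) = g (fp_inl P Q u)"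
    and "\<And>u. u \<in> carrier Q \<Longrightarrow> f (fp_inr P Q u) = g (fp_inr P Q u)"
    and "u \<in> carrier (P \<star> Q)"
  shows "f u = g u"
  using rel_class_letter_maps_eq[OF free_product_relations, of B f g u] assms
  by (auto simp: free_product_def fp_inl_def fp_inr_def)

end

section \<open>Differential calculi\<close>

text \<open>The degree of \<open>\<Omega>\<^sup>1\<close> should not be rewritten to \<open>Suc 0\<close>.\<close>
declare One_nat_def [simp del]

lemma k_subspace_vector_space:
  fixes C :: "('k::field, 'v, 'z) module_scheme"
  assumes "k_subspace V I" and car: "carrier C = I"
    and ops: "\<zero>\<^bsub>C\<^esub> = \<zero>\<^bsub>V\<^esub>" "add C = add V" "smult C = smult V"
  shows "k_vector_space C"
proof -
  interpret k_subspace V I by fact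
  have mem: "u \<in> I \<Longrightarrow> u \<in> carrier V" for u using subset by auto
  have "abelian_group C"
  proof (rule abelian_groupI)
    fix u assume "u \<in> carrier C"
    then show "\<exists>v\<in>carrier C. v \<oplus>\<^bsub>C\<^esub> u = \<zero>\<^bsub>C\<^esub>"
      using uminus_mem[of u] mem[of u]
      by (intro bexI[of _ "\<ominus>\<^bsub>V\<^esub> u"]) (auto simp: car ops l_neg)
  qed (auto simp: car ops zero_mem add_mem mem a_ac)
  then show ?thesis
    by (simp add: k_vector_space_def k_vector_space_axioms_def)
      (auto simp: car ops smult_mem mem smult_l_distr smult_r_distr smult_assoc smult_one)
qed

lemma forms_simps [simp]:
  "carrier (forms W n) = grade W n" "mult (forms W n) = mult W" "one (forms W n) = one W"
  "zero (forms W n) = zero W" "add (forms W n) = add W" "smult (forms W n) = smult W"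
  "lact (forms W n) = mult W" "ract (forms W n) = mult W"
  by (simp_all add: forms_def)

lemma base_algebra_simps [simp]:
  "carrier (base_algebra W) = grade W 0" "mult (base_algebra W) = mult W"
  "one (base_algebra W) = one W" "zero (base_algebra W) = zero W"
  "add (base_algebra W) = add W" "smult (base_algebra W) = smult W"
  by (simp_all add: base_algebra_def)

lemma op_algebra_simps [simp]:
  "carrier (op_algebra R) = carrier R" "u \<otimes>\<^bsub>op_algebra R\<^esub> v = v \<otimes>\<^bsub>R\<^esub> u"
  "one (op_algebra R) = one R" "zero (op_algebra R) = zero R" "add (op_algebra R) = add R"
  "smult (op_algebra R) = smult R"
  by (simp_all add: op_algebra_def)

context dg_algebra
begin

lemma grade_mem: "u \<in> grade W n \<Longrightarrow> u \<in> carrier W"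
  using grade_subset by auto

lemma grade_subspace: "k_subspace W (grade W n)"
  by unfold_locales (use grade_subset grade_zero grade_add grade_smult in auto)

lemma grade_mult_zero:
  "u \<in> grade W 0 \<Longrightarrow> v \<in> grade W n \<Longrightarrow> u \<otimes> v \<in> grade W n"
  "u \<in> grade W n \<Longrightarrow> v \<in> grade W 0 \<Longrightarrow> u \<otimes> v \<in> grade W n"
  using grade_mult[of u 0 v n] grade_mult[of u n v 0] by auto

lemma forms_vector_space: "k_vector_space (forms W n)"
  by (rule k_subspace_vector_space[OF grade_subspace]) auto

lemma base_algebra_algebra: "k_algebra (base_algebra W)"
proof -
  have vs: "k_vector_space (base_algebra W)"
    by (rule k_subspace_vector_space[OF grade_subspace]) auto
  have "Group.monoid (base_algebra W)"
    by (rule monoidI) (auto simp: grade_mult_zero grade_one m_assoc grade_mem)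
  then have "ring (base_algebra W)"
    using k_vector_space.axioms(1)[OF vs]
    by (intro ringI) (auto simp: l_distr r_distr grade_mem)
  with vs show ?thesis
    by (simp add: k_algebra_def k_algebra_axioms_def)
      (auto simp: smult_mult_left smult_mult_right grade_mem)
qed

lemma forms_bimodule: "bimodule (base_algebra W) (forms W n)"
  using base_algebra_algebra forms_vector_space[of n]
  by (simp add: bimodule_def bimodule_axioms_def)
    (simp add: grade_mult_zero grade_mem l_distr r_distr m_assoc smult_mult_left smult_mult_right)

lemma diff_closed: "a \<in> grade W 0 \<Longrightarrow> diff W a \<in> grade W 1"
  using diff_grade[of a 0] by (simp add: One_nat_def)

lemma diff_closed_1: "\<eta> \<in> grade W 1 \<Longrightarrow> diff W \<eta> \<in> grade W 2"
  using diff_grade[of \<eta> 1] by (simp add: One_nat_def numeral_2_eq_2)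

lemma wedge_closed: "\<eta> \<in> grade W 1 \<Longrightarrow> \<theta> \<in> grade W 1 \<Longrightarrow> \<eta> \<otimes> \<theta> \<in> grade W 2"
  using grade_mult[of \<eta> 1 \<theta> 1] by (simp add: One_nat_def numeral_2_eq_2)

lemma leibniz_zero:
  "a \<in> grade W 0 \<Longrightarrow> u \<in> grade W n \<Longrightarrow> diff W (a \<otimes> u) = diff W a \<otimes> u \<oplus> a \<otimes> diff W u"
  using leibniz[of a 0 u] grade_mem[of a 0] grade_mem[of u n] grade_mem[OF diff_grade[of u n]]
  by (simp add: smult_one)

end

section \<open>Pivotal calculi\<close>
locale pivotal_calculus = calculus_data W P Q p b x q y c
  for W :: "('k::field, 'w) dga" and P :: "('k, 'w, 'x) two_sided_dual"
    and Q :: "('k, 'w, 'y) two_sided_dual" and p :: nat and b :: "nat \<Rightarrow> 'w" and x :: "nat \<Rightarrow> 'x"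
    and q :: nat and y :: "nat \<Rightarrow> 'x" and c :: "nat \<Rightarrow> 'w" +
  assumes dga: "dg_algebra W" and surjective: "surjective_calculus W"
    and pivotal: pivotal_structure and wedge_surj: "wedge_surjective W"
begin

sublocale W: dg_algebra W by (rule dga)
sublocale A: k_algebra A by (rule W.base_algebra_algebra)
sublocale O1: bimodule A \<Omega>1 by (rule W.forms_bimodule)
sublocale O2: bimodule A \<Omega>2 by (rule W.forms_bimodule)

lemma X1_bimodule: "bimodule A X1" and X2_bimodule: "bimodule A X2"
  using pivotal by (simp_all add: pivotal_structure_def pivotal_dual_def)

sublocale X1: bimodule A X1 by (rule X1_bimodule)
sublocale X2: bimodule A X2 by (rule X2_bimodule)

lemma generators_mem:
  "i < p \<Longrightarrow> b i \<in> grade W 0" "i < p \<Longrightarrow> x i \<in> carrier X1"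
  "j < q \<Longrightarrow> y j \<in> carrier X1" "j < q \<Longrightarrow> c j \<in> grade W 0"
  using pivotal by (auto simp: pivotal_structure_def representatives_def Pi_iff)

lemma omega_rho_mem: "i < p \<Longrightarrow> \<omega> i \<in> grade W 1" "j < q \<Longrightarrow> \<rho> j \<in> grade W 1"
  using generators_mem W.diff_closed by auto

subsection \<open>Evaluation maps\<close>
text \<open>A bimodule map out of a tensor product, read as a pairing of elements: it is bilinear, balanced and
  compatible with the outer actions.\<close>
lemma pairing:
  fixes M :: "('k, 'w, 'm, 'r) bimod_scheme" and N :: "('k, 'w, 'n, 's) bimod_scheme"
  assumes "bimodule A M" and "bimodule A N" and e: "e \<in> bimod_hom A (tensor A M N) (forms W 0)"
  defines "h \<equiv> \<lambda>m n. e (tens A M N m n)"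
  shows "k_bilinear M N A h"
    and "m \<in> carrier M \<Longrightarrow> n \<in> carrier N \<Longrightarrow> h m n \<in> grade W 0"
    and "m \<in> carrier M \<Longrightarrow> n \<in> carrier N \<Longrightarrow> a \<in> grade W 0 \<Longrightarrow> h (lact M a m) n = a \<otimes>\<^bsub>W\<^esub> h m n"
    and "m \<in> carrier M \<Longrightarrow> n \<in> carrier N \<Longrightarrow> a \<in> grade W 0 \<Longrightarrow> h m (ract N n a) = h m n \<otimes>\<^bsub>W\<^esub> a"
    and "m \<in> carrier M \<Longrightarrow> n \<in> carrier N \<Longrightarrow> a \<in> grade W 0 \<Longrightarrow> h (ract M m a) n = h m (lact N a n)"
proof -
  interpret M: bimodule A M by fact
  interpret N: bimodule A N by fact
  interpret MN: bimodule_tensor A M N ..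
  have cl: "h m n \<in> grade W 0" if "m \<in> carrier M" "n \<in> carrier N" for m n
    using e MN.tens_mem[OF that] by (auto simp: h_def bimod_hom_def)
  then show "m \<in> carrier M \<Longrightarrow> n \<in> carrier N \<Longrightarrow> h m n \<in> grade W 0" .
  have eadd: "e (u \<oplus>\<^bsub>tensor A M N\<^esub> v) = e u \<oplus>\<^bsub>W\<^esub> e v"
    if "u \<in> carrier (tensor A M N)" "v \<in> carrier (tensor A M N)" for u v
    using e that by (auto simp: bimod_hom_def)
  have l: "h (lact M a m) n = a \<otimes>\<^bsub>W\<^esub> h m n"
    if "m \<in> carrier M" "n \<in> carrier N" "a \<in> grade W 0" for m n a
    using e that MN.tens_mem[OF that(1,2)] MN.tensor_lact(2)[of a m n, symmetric]
    by (auto simp: h_def bimod_hom_def)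
  then show "m \<in> carrier M \<Longrightarrow> n \<in> carrier N \<Longrightarrow> a \<in> grade W 0 \<Longrightarrow> h (lact M a m) n = a \<otimes>\<^bsub>W\<^esub> h m n" .
  have r: "h m (ract N n a) = h m n \<otimes>\<^bsub>W\<^esub> a"
    if "m \<in> carrier M" "n \<in> carrier N" "a \<in> grade W 0" for m n a
    using e that MN.tens_mem[OF that(1,2)] MN.tensor_ract(2)[of a m n, symmetric]
    by (auto simp: h_def bimod_hom_def)
  then show "m \<in> carrier M \<Longrightarrow> n \<in> carrier N \<Longrightarrow> a \<in> grade W 0 \<Longrightarrow> h m (ract N n a) = h m n \<otimes>\<^bsub>W\<^esub> a" .
  show "m \<in> carrier M \<Longrightarrow> n \<in> carrier N \<Longrightarrow> a \<in> grade W 0 \<Longrightarrow> h (ract M m a) n = h m (lact N a n)"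
    using MN.tens_balanced[of m a n] by (simp add: h_def)
  have "h (k \<odot>\<^bsub>M\<^esub> m) n = k \<odot>\<^bsub>W\<^esub> h m n" if "m \<in> carrier M" "n \<in> carrier N" for k m n
    using l[OF that, of "k \<odot>\<^bsub>W\<^esub> \<one>\<^bsub>W\<^esub>"] M.lact_smult[OF that(1), of k] W.grade_one cl[OF that]
    by (simp add: W.grade_smult W.smult_mult_left W.grade_mem)
  moreover have "h m (k \<odot>\<^bsub>N\<^esub> n) = k \<odot>\<^bsub>W\<^esub> h m n" if "m \<in> carrier M" "n \<in> carrier N" for k m n
    using r[OF that, of "k \<odot>\<^bsub>W\<^esub> \<one>\<^bsub>W\<^esub>"] N.ract_smult[OF that(2), of k] W.grade_one cl[OF that]
    by (simp add: W.grade_smult W.smult_mult_right W.grade_mem)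
  moreover have "h (m \<oplus>\<^bsub>M\<^esub> m') n = h m n \<oplus>\<^bsub>W\<^esub> h m' n"
    if "m \<in> carrier M" "m' \<in> carrier M" "n \<in> carrier N" for m m' n
    using k_linear_map.add[OF k_bilinear_linear_left[OF MN.tens_bilinear M.M.k_vector_space_axioms
          MN.tensor_vector_space that(3)] that(1,2)] eadd MN.tens_mem that
    by (simp add: h_def)
  moreover have "h m (n \<oplus>\<^bsub>N\<^esub> n') = h m n \<oplus>\<^bsub>W\<^esub> h m n'"
    if "m \<in> carrier M" "n \<in> carrier N" "n' \<in> carrier N" for m n n'
    using k_linear_map.add[OF k_bilinear_linear_right[OF MN.tens_bilinear N.M.k_vector_space_axioms
          MN.tensor_vector_space that(1)] that(2,3)] eadd MN.tens_mem that
    by (simp add: h_def)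
  ultimately show "k_bilinear M N A h"
    unfolding k_bilinear_def using cl by simp
qed

lemma pivotal_homs:
  "ev P \<in> bimod_hom A (tensor A X1 \<Omega>1) (forms W 0)" "uev P \<in> bimod_hom A (tensor A \<Omega>1 X1) (forms W 0)"
  "ev Q \<in> bimod_hom A (tensor A X2 \<Omega>2) (forms W 0)" "uev Q \<in> bimod_hom A (tensor A \<Omega>2 X2) (forms W 0)"
  "coev P \<in> bimod_hom A (forms W 0) (tensor A \<Omega>1 X1)" "ucoev P \<in> bimod_hom A (forms W 0) (tensor A X1 \<Omega>1)"
  using pivotal by (simp_all add: pivotal_structure_def pivotal_dual_def duality_def Let_def)

lemmas ev1 = pairing[OF X1_bimodule W.forms_bimodule pivotal_homs(1), simplified]
lemmas uev1 = pairing[OF W.forms_bimodule X1_bimodule pivotal_homs(2), simplified]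
lemmas ev2 = pairing[OF X2_bimodule W.forms_bimodule pivotal_homs(3), simplified]
lemmas uev2 = pairing[OF W.forms_bimodule X2_bimodule pivotal_homs(4), simplified]

subsection \<open>Coevaluations\<close>
text \<open>Since \<open>e\<close> is a bimodule map, \<open>a e(1) = e(a) = e(1) a\<close>; a balanced bilinear map \<open>h\<close> turns this into an equation
  of sums, in which \<open>a\<close> moves from the left of \<open>m\<^sub>i\<close> to the right of \<open>n\<^sub>i\<close>.\<close>
lemma coevaluation_central:
  fixes M :: "('k, 'w, 'm, 'r) bimod_scheme" and N :: "('k, 'w, 'n, 's) bimod_scheme"
    and C :: "('k, 'c, 't) module_scheme" and l :: nat
  assumes "bimodule A M" and "bimodule A N" and e: "e \<in> bimod_hom A (forms W 0) (tensor A M N)"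
    and rep: "e \<one>\<^bsub>W\<^esub> = (\<Oplus>\<^bsub>tensor A M N\<^esub>i\<in>{..<l}. tens A M N (m i) (n i))"
    and m: "\<And>i. i < l \<Longrightarrow> m i \<in> carrier M" and n: "\<And>i. i < l \<Longrightarrow> n i \<in> carrier N"
    and h: "k_bilinear M N C h" and C: "k_vector_space C"
    and bal: "\<And>m a n. m \<in> carrier M \<Longrightarrow> a \<in> grade W 0 \<Longrightarrow> n \<in> carrier N \<Longrightarrow>
      h (ract M m a) n = h m (lact N a n)"
  shows "tensor_lift C h (e \<one>\<^bsub>W\<^esub>) = (\<Oplus>\<^bsub>C\<^esub>i\<in>{..<l}. h (m i) (n i))"
    and "a \<in> grade W 0 \<Longrightarrow>
      (\<Oplus>\<^bsub>C\<^esub>i\<in>{..<l}. h (lact M a (m i)) (n i)) = (\<Oplus>\<^bsub>C\<^esub>i\<in>{..<l}. h (m i) (ract N (n i) a))"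
proof -
  interpret M: bimodule A M by fact
  interpret N: bimodule A N by fact
  interpret MN: bimodule_tensor A M N ..
  interpret C: k_vector_space C by fact
  have bal': "h (ract M m a) n = h m (lact N a n)"
    if "m \<in> carrier M" "a \<in> carrier A" "n \<in> carrier N" for m a n
    using bal that by simp
  interpret L: k_linear_map "tensor A M N" C "tensor_lift C h"
    by (rule MN.tensor_lift_tens(1)[OF h C bal'])
  have lift: "tensor_lift C h (tens A M N m n) = h m n" if "m \<in> carrier M" "n \<in> carrier N" for m n
    by (rule MN.tensor_lift_tens(2)[OF h C bal' that])
  note hc = k_bilinear_closed[OF h]
  have sum: "tensor_lift C h (\<Oplus>\<^bsub>tensor A M N\<^esub>i\<in>{..<l}. tens A M N (m' i) (n' i)) = (\<Oplus>\<^bsub>C\<^esub>i\<in>{..<l}. h (m' i) (n' i))"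
    if "\<And>i. i < l \<Longrightarrow> m' i \<in> carrier M" "\<And>i. i < l \<Longrightarrow> n' i \<in> carrier N" for m' n'
  proof -
    have "tensor_lift C h (\<Oplus>\<^bsub>tensor A M N\<^esub>i\<in>{..<l}. tens A M N (m' i) (n' i))
        = (\<Oplus>\<^bsub>C\<^esub>i\<in>{..<l}. tensor_lift C h (tens A M N (m' i) (n' i)))"
      using that by (intro L.finsum) (auto intro: MN.tens_mem)
    also have "\<dots> = (\<Oplus>\<^bsub>C\<^esub>i\<in>{..<l}. h (m' i) (n' i))"
      using that hc by (intro C.add.finprod_cong') (auto simp: lift)
    finally show ?thesis .
  qed
  show "tensor_lift C h (e \<one>\<^bsub>W\<^esub>) = (\<Oplus>\<^bsub>C\<^esub>i\<in>{..<l}. h (m i) (n i))"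
    unfolding rep by (rule sum[OF m n])
  assume a: "a \<in> grade W 0"
  then have aA: "a \<in> carrier A" by simp
  have ea: "lact (tensor A M N) a (e \<one>\<^bsub>W\<^esub>) = e (a \<otimes>\<^bsub>W\<^esub> \<one>\<^bsub>W\<^esub>)"
    "ract (tensor A M N) (e \<one>\<^bsub>W\<^esub>) a = e (\<one>\<^bsub>W\<^esub> \<otimes>\<^bsub>W\<^esub> a)"
    using e a W.grade_one by (auto simp: bimod_hom_def)
  have "lact (tensor A M N) a (e \<one>\<^bsub>W\<^esub>) = ract (tensor A M N) (e \<one>\<^bsub>W\<^esub>) a"
    using ea a by (simp add: W.grade_mem)
  moreover have "lact (tensor A M N) a (e \<one>\<^bsub>W\<^esub>) = (\<Oplus>\<^bsub>tensor A M N\<^esub>i\<in>{..<l}. tens A M N (lact M a (m i)) (n i))"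
    unfolding rep using m n
    by (subst k_linear_map.finsum[OF MN.tensor_lact(1)[OF aA]], simp_all add: MN.tens_mem)
      (rule L.V.add.finprod_cong', auto simp: MN.tens_mem MN.tensor_lact(2)[OF aA] M.lact_closed[OF aA])
  moreover have "ract (tensor A M N) (e \<one>\<^bsub>W\<^esub>) a = (\<Oplus>\<^bsub>tensor A M N\<^esub>i\<in>{..<l}. tens A M N (m i) (ract N (n i) a))"
    unfolding rep using m n
    by (subst k_linear_map.finsum[OF MN.tensor_ract(1)[OF aA]], simp_all add: MN.tens_mem)
      (rule L.V.add.finprod_cong', auto simp: MN.tens_mem MN.tensor_ract(2)[OF aA] N.ract_closed[OF aA])
  ultimately have "(\<Oplus>\<^bsub>tensor A M N\<^esub>i\<in>{..<l}. tens A M N (lact M a (m i)) (n i))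
      = (\<Oplus>\<^bsub>tensor A M N\<^esub>i\<in>{..<l}. tens A M N (m i) (ract N (n i) a))" by simp
  then show "(\<Oplus>\<^bsub>C\<^esub>i\<in>{..<l}. h (lact M a (m i)) (n i)) = (\<Oplus>\<^bsub>C\<^esub>i\<in>{..<l}. h (m i) (ract N (n i) a))"
    using sum[of "\<lambda>i. lact M a (m i)" n] sum[of m "\<lambda>i. ract N (n i) a"] m n
      M.lact_closed[OF aA] N.ract_closed[OF aA] by simp
qed

lemma coev_rep:
  "coev P \<one>\<^bsub>W\<^esub> = (\<Oplus>\<^bsub>tensor A \<Omega>1 X1\<^esub>i\<in>{..<p}. tens A \<Omega>1 X1 (\<omega> i) (x i))"
  "ucoev P \<one>\<^bsub>W\<^esub> = (\<Oplus>\<^bsub>tensor A X1 \<Omega>1\<^esub>j\<in>{..<q}. tens A X1 \<Omega>1 (y j) (\<rho> j))"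
  using pivotal by (simp_all add: pivotal_structure_def representatives_def)

lemma coev_triangle:
  assumes "\<eta> \<in> grade W 1"
  shows "(\<Oplus>\<^bsub>\<Omega>1\<^esub>i\<in>{..<p}. \<omega> i \<otimes>\<^bsub>W\<^esub> ev1 (x i) \<eta>) = \<eta>"
proof -
  let ?h = "\<lambda>m u. m \<otimes>\<^bsub>W\<^esub> ev1 u \<eta>"
  have e: "k_linear_map X1 A (\<lambda>u. ev1 u \<eta>)"
    using k_bilinear_linear_left[OF ev1(1) X1.M.k_vector_space_axioms A.k_vector_space_axioms] assms by simp
  have h: "k_bilinear \<Omega>1 X1 \<Omega>1 ?h"
  proof (rule k_bilinearI)
    show "k_linear_map X1 \<Omega>1 (\<lambda>u. m \<otimes>\<^bsub>W\<^esub> ev1 u \<eta>)" if "m \<in> carrier \<Omega>1" for m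
      using k_linear_map_comp[OF e O1.ract_linear_right[OF that]] by simp
    show "k_linear_map \<Omega>1 \<Omega>1 (\<lambda>m. m \<otimes>\<^bsub>W\<^esub> ev1 u \<eta>)" if "u \<in> carrier X1" for u
      using O1.ract_linear[of "ev1 u \<eta>"] ev1(2)[OF that assms] by simp
  qed
  have "tensor_lift \<Omega>1 ?h (coev P \<one>\<^bsub>W\<^esub>) = \<eta>"
    using pivotal assms by (simp add: pivotal_structure_def pivotal_dual_def duality_def Let_def)
  moreover have "?h (ract \<Omega>1 m a) v = ?h m (lact X1 a v)"
    if "m \<in> carrier \<Omega>1" "a \<in> grade W 0" "v \<in> carrier X1" for m a v
    using that assms W.grade_mem[OF ev1(2)[OF that(3) assms]]
    by (simp add: ev1 W.m_assoc W.grade_mem)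
  ultimately show ?thesis
    using coevaluation_central(1)[OF W.forms_bimodule X1_bimodule pivotal_homs(5) coev_rep(1) _ _ h
        O1.M.k_vector_space_axioms] omega_rho_mem(1) generators_mem(2) by simp
qed

lemma ev_triangle:
  assumes "u \<in> carrier X1"
  shows "(\<Oplus>\<^bsub>X1\<^esub>i\<in>{..<p}. lact X1 (ev1 u (\<omega> i)) (x i)) = u"
proof -
  let ?h = "\<lambda>m v. lact X1 (ev1 u m) v"
  have e: "k_linear_map \<Omega>1 A (ev1 u)"
    using k_bilinear_linear_right[OF ev1(1) O1.M.k_vector_space_axioms A.k_vector_space_axioms] assms by simp
  have h: "k_bilinear \<Omega>1 X1 X1 ?h"
  proof (rule k_bilinearI)
    show "k_linear_map X1 X1 (\<lambda>v. lact X1 (ev1 u m) v)" if "m \<in> carrier \<Omega>1" for m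
      using X1.lact_linear[of "ev1 u m"] ev1(2)[OF assms] that by simp
    show "k_linear_map \<Omega>1 X1 (\<lambda>m. lact X1 (ev1 u m) v)" if "v \<in> carrier X1" for v
      using k_linear_map_comp[OF e X1.lact_linear_left[OF that]] by simp
  qed
  have "tensor_lift X1 ?h (coev P \<one>\<^bsub>W\<^esub>) = u"
    using pivotal assms by (simp add: pivotal_structure_def pivotal_dual_def duality_def Let_def)
  moreover have "?h (ract \<Omega>1 m a) v = ?h m (lact X1 a v)"
    if "m \<in> carrier \<Omega>1" "a \<in> grade W 0" "v \<in> carrier X1" for m a v
    using that assms ev1(4)[of u m a] ev1(2)[of u m] X1.lact_mult[of "ev1 u m" a v] by simp
  ultimately show ?thesis
    using coevaluation_central(1)[OF W.forms_bimodule X1_bimodule pivotal_homs(5) coev_rep(1) _ _ h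
        X1.M.k_vector_space_axioms] omega_rho_mem(1) generators_mem(2) by simp
qed

subsection \<open>Spanning families\<close>
lemma one_form_induct [consumes 1, case_names base zero add]:
  assumes "\<eta> \<in> grade W 1"
    and base: "\<And>r a. r \<in> grade W 0 \<Longrightarrow> a \<in> grade W 0 \<Longrightarrow> R (r \<otimes>\<^bsub>W\<^esub> d a)"
    and "R \<zero>\<^bsub>W\<^esub>"
    and add: "\<And>\<eta> \<theta>. \<eta> \<in> grade W 1 \<Longrightarrow> \<theta> \<in> grade W 1 \<Longrightarrow> R \<eta> \<Longrightarrow> R \<theta> \<Longrightarrow> R (\<eta> \<oplus>\<^bsub>W\<^esub> \<theta>)"
  shows "R \<eta>"
proof -
  obtain n :: nat and r a where ra: "r \<in> {..<n} \<rightarrow> grade W 0" "a \<in> {..<n} \<rightarrow> grade W 0"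
    and \<eta>: "\<eta> = (\<Oplus>\<^bsub>W\<^esub>m\<in>{..<n}. r m \<otimes>\<^bsub>W\<^esub> d (a m))"
    using surjective assms(1) unfolding surjective_calculus_def by blast
  have g: "r m \<otimes>\<^bsub>W\<^esub> d (a m) \<in> grade W 1" if "m < n" for m
    using ra that by (intro W.grade_mult_zero(1) W.diff_closed) auto
  have "R (\<Oplus>\<^bsub>W\<^esub>m\<in>S. r m \<otimes>\<^bsub>W\<^esub> d (a m)) \<and> (\<Oplus>\<^bsub>W\<^esub>m\<in>S. r m \<otimes>\<^bsub>W\<^esub> d (a m)) \<in> grade W 1"
    if "finite S" "S \<subseteq> {..<n}" for S
    using that
  proof (induction S)
    case empty
    show ?case using assms(3) W.grade_zero by simp
  next
    case (insert s S)
    then have "(\<Oplus>\<^bsub>W\<^esub>m\<in>insert s S. r m \<otimes>\<^bsub>W\<^esub> d (a m))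
        = r s \<otimes>\<^bsub>W\<^esub> d (a s) \<oplus>\<^bsub>W\<^esub> (\<Oplus>\<^bsub>W\<^esub>m\<in>S. r m \<otimes>\<^bsub>W\<^esub> d (a m))"
      by (intro W.finsum_insert) (auto intro!: W.grade_mem[OF g])
    moreover have "R (r s \<otimes>\<^bsub>W\<^esub> d (a s))" using insert.prems ra by (intro base) auto
    ultimately show ?case using insert add g W.grade_add by auto
  qed
  then show ?thesis unfolding \<eta> by blast
qed

lemma forms_inclusion: "k_linear_map (forms W n) W (\<lambda>u. u)"
proof -
  interpret F: k_vector_space "forms W n" by (rule W.forms_vector_space)
  show ?thesis by unfold_locales (auto intro: W.grade_mem)
qed

lemma forms_finsum:
  assumes "finite S" and "\<And>s. s \<in> S \<Longrightarrow> f s \<in> grade W n"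
  shows "finsum (forms W n) f S = finsum W f S"
  using k_linear_map.finsum[OF forms_inclusion[of n] assms(1), of f] assms(2) by simp

sublocale O11: bimodule_tensor A \<Omega>1 \<Omega>1 ..

lemma wedge_bilinear: "k_bilinear \<Omega>1 \<Omega>1 \<Omega>2 (mult W)"
  unfolding k_bilinear_def
  by (auto simp: W.wedge_closed W.grade_mem W.l_distr W.r_distr W.smult_mult_left W.smult_mult_right)

lemma wedge11_linear: "k_linear_map (tensor A \<Omega>1 \<Omega>1) \<Omega>2 (wedge11 W)"
  and wedge11_tens: "\<eta> \<in> grade W 1 \<Longrightarrow> \<theta> \<in> grade W 1 \<Longrightarrow> wedge11 W (tens A \<Omega>1 \<Omega>1 \<eta> \<theta>) = \<eta> \<otimes>\<^bsub>W\<^esub> \<theta>"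
  using O11.tensor_lift_tens[OF wedge_bilinear O2.M.k_vector_space_axioms]
  by (auto simp: wedge11_def W.m_assoc W.grade_mem)

lemma two_form_induct [consumes 1, case_names base zero add]:
  assumes "\<eta> \<in> grade W 2"
    and base: "\<And>\<theta> \<theta>'. \<theta> \<in> grade W 1 \<Longrightarrow> \<theta>' \<in> grade W 1 \<Longrightarrow> R (\<theta> \<otimes>\<^bsub>W\<^esub> \<theta>')"
    and "R \<zero>\<^bsub>W\<^esub>"
    and add: "\<And>\<eta> \<theta>. \<eta> \<in> grade W 2 \<Longrightarrow> \<theta> \<in> grade W 2 \<Longrightarrow> R \<eta> \<Longrightarrow> R \<theta> \<Longrightarrow> R (\<eta> \<oplus>\<^bsub>W\<^esub> \<theta>)"
  shows "R \<eta>"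
proof -
  obtain u where u: "u \<in> carrier (tensor A \<Omega>1 \<Omega>1)" "\<eta> = wedge11 W u"
    using wedge_surj assms(1) unfolding wedge_surjective_def by blast
  obtain s where s: "Poly_Mapping.keys s \<subseteq> grade W 1 \<times> grade W 1" "u = O11.T.coset s"
    using O11.tensor_rep[OF u(1)] by auto
  define L where "L = (\<lambda>s. wedge11 W (O11.T.coset s))"
  interpret L: k_linear_map "monoid_algebra (\<Omega>1 \<times>\<times> \<Omega>1)" \<Omega>2 L
    unfolding L_def by (rule k_linear_map_comp[OF O11.coset_tensor_linear wedge11_linear])
  have "R (L s)"
    using s(1)
  proof (induction rule: poly_mapping_additive_induct)
    case zero
    show ?case using L.zero assms(3) by (simp add: monoid_algebra_simps)
  next
    case (single k r)
    then obtain \<theta> \<theta>' where k: "k = (\<theta>, \<theta>')" "\<theta> \<in> grade W 1" "\<theta>' \<in> grade W 1" by auto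
    have "L (Poly_Mapping.single k r) = r \<odot>\<^bsub>W\<^esub> L (Poly_Mapping.single k 1)"
      using L.smult[of "Poly_Mapping.single k 1" r] k by (simp add: monoid_algebra_simps scale_single)
    also have "L (Poly_Mapping.single k 1) = \<theta> \<otimes>\<^bsub>W\<^esub> \<theta>'"
      using wedge11_tens[OF k(2,3)] by (simp add: k L_def tens_def)
    also have "r \<odot>\<^bsub>W\<^esub> (\<theta> \<otimes>\<^bsub>W\<^esub> \<theta>') = (r \<odot>\<^bsub>W\<^esub> \<theta>) \<otimes>\<^bsub>W\<^esub> \<theta>'"
      using k by (simp add: W.smult_mult_left W.grade_mem)
    finally show ?case using base k W.grade_smult by simp
  next
    case (add s t)
    have m: "s \<in> carrier (monoid_algebra (\<Omega>1 \<times>\<times> \<Omega>1))" "t \<in> carrier (monoid_algebra (\<Omega>1 \<times>\<times> \<Omega>1))"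
      using add by (simp_all add: monoid_algebra_simps)
    show ?case
      using L.add[OF m] assms(4)[of "L s" "L t"] L.closed[OF m(1)] L.closed[OF m(2)] add
      by (simp add: monoid_algebra_simps)
  qed
  then show ?thesis by (simp add: u s L_def)
qed

text \<open>The map induced by the product on \<open>\<Omega>\<^sup>1 \<otimes>\<^sub>A \<Omega>\<^sup>1\<close> is linear, so its value is an ordinary sum of products in \<open>W\<close>.\<close>
lemma wedge_null_iff:
  "wedge_null n r a e \<longleftrightarrow> r \<in> {..<n} \<rightarrow> grade W 0 \<and> a \<in> {..<n} \<rightarrow> grade W 0 \<and> e \<in> {..<n} \<rightarrow> grade W 0
    \<and> (\<Oplus>\<^bsub>W\<^esub>m\<in>{..<n}. r m \<otimes>\<^bsub>W\<^esub> d (a m) \<otimes>\<^bsub>W\<^esub> d (e m)) = \<zero>\<^bsub>W\<^esub>"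
proof -
  have "wedge11 W (\<Oplus>\<^bsub>tensor A \<Omega>1 \<Omega>1\<^esub>m\<in>{..<n}. tens A \<Omega>1 \<Omega>1 (r m \<otimes>\<^bsub>W\<^esub> d (a m)) (d (e m)))
      = (\<Oplus>\<^bsub>W\<^esub>m\<in>{..<n}. r m \<otimes>\<^bsub>W\<^esub> d (a m) \<otimes>\<^bsub>W\<^esub> d (e m))"
    if m: "r \<in> {..<n} \<rightarrow> grade W 0" "a \<in> {..<n} \<rightarrow> grade W 0" "e \<in> {..<n} \<rightarrow> grade W 0"
  proof -
    interpret L: k_linear_map "tensor A \<Omega>1 \<Omega>1" \<Omega>2 "wedge11 W" by (rule wedge11_linear)
    have g: "r m \<otimes>\<^bsub>W\<^esub> d (a m) \<in> grade W 1" "d (e m) \<in> grade W 1" if "m < n" for m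
      using m that by (auto intro!: W.grade_mult_zero(1) W.diff_closed)
    have "wedge11 W (\<Oplus>\<^bsub>tensor A \<Omega>1 \<Omega>1\<^esub>m\<in>{..<n}. tens A \<Omega>1 \<Omega>1 (r m \<otimes>\<^bsub>W\<^esub> d (a m)) (d (e m)))
        = (\<Oplus>\<^bsub>\<Omega>2\<^esub>m\<in>{..<n}. wedge11 W (tens A \<Omega>1 \<Omega>1 (r m \<otimes>\<^bsub>W\<^esub> d (a m)) (d (e m))))"
      using g by (intro L.finsum) (auto intro: O11.tens_mem)
    also have "\<dots> = (\<Oplus>\<^bsub>\<Omega>2\<^esub>m\<in>{..<n}. r m \<otimes>\<^bsub>W\<^esub> d (a m) \<otimes>\<^bsub>W\<^esub> d (e m))"
      using g by (intro O2.M.add.finprod_cong') (auto simp: wedge11_tens W.wedge_closed)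
    also have "\<dots> = (\<Oplus>\<^bsub>W\<^esub>m\<in>{..<n}. r m \<otimes>\<^bsub>W\<^esub> d (a m) \<otimes>\<^bsub>W\<^esub> d (e m))"
      using g by (intro forms_finsum) (auto simp: W.wedge_closed)
    finally show ?thesis .
  qed
  then show ?thesis unfolding wedge_null_def by auto
qed

end

section \<open>The generators of the two algebras\<close>

text \<open>Finite sums only depend on the values of the summands, also outside of the carrier.\<close>
lemma finsum_cong_simple:
  assumes "\<And>i. i \<in> S \<Longrightarrow> f i = g i"
  shows "finsum G f S = finsum G g S"
proof -
  have *: "(S, z) \<in> foldSetD D ((\<otimes>\<^bsub>add_monoid G\<^esub>) \<circ> g) e"
    if "(S, z) \<in> foldSetD D ((\<otimes>\<^bsub>add_monoid G\<^esub>) \<circ> f) e" "\<And>i. i \<in> S \<Longrightarrow> f i = g i" for S z D e f g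
    using that
  proof (induction rule: foldSetD.induct)
    case (insertI i S z)
    then have eq: "((\<otimes>\<^bsub>add_monoid G\<^esub>) \<circ> f) i z = ((\<otimes>\<^bsub>add_monoid G\<^esub>) \<circ> g) i z"
      by simp
    show ?case
      unfolding eq
      by (rule foldSetD.intros(2)) (use insertI.hyps insertI.IH insertI.prems eq in simp_all)
  qed (auto intro: foldSetD.intros)
  have "(S, z) \<in> foldSetD D ((\<otimes>\<^bsub>add_monoid G\<^esub>) \<circ> f) e \<longleftrightarrow>
      (S, z) \<in> foldSetD D ((\<otimes>\<^bsub>add_monoid G\<^esub>) \<circ> g) e" for z D e
    using *[of S z D f e g] *[of S z D g e f] assms by auto
  then show ?thesis
    by (simp add: finsum_def finprod_def foldD_def)
qed

text \<open>As a congruence rule this lets the simplifier assume \<open>i \<in> S\<close> in a summand without a proof that the summands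
  lie in the carrier.\<close>
lemma finsum_cong_simp [cong]:
  "S = T \<Longrightarrow> (\<And>i. i \<in> T =simp=> f i = g i) \<Longrightarrow> finsum G f S = finsum G g T"
  unfolding simp_implies_def using finsum_cong_simple[of T f g G] by simp

lemma k_bilinear_comp:
  assumes "k_bilinear M N C h" and "k_linear_map C B f"
  shows "k_bilinear M N B (\<lambda>m n. f (h m n))"
proof -
  interpret f: k_linear_map C B f by fact
  show ?thesis
    using assms(1) unfolding k_bilinear_def by (simp add: f.closed f.add f.smult)
qed

context enveloping_algebra
begin

lemma tn_left_hom: "k_algebra_hom R (enveloping R) (\<lambda>a. tn a \<one>\<^bsub>R\<^esub>)"
proof -
  interpret E: k_algebra "enveloping R" by (rule enveloping_algebra)
  show ?thesis
    using k_bilinear_linear_left[OF tn_bilinear R.k_vector_space_axioms E.k_vector_space_axioms, of "\<one>\<^bsub>R\<^esub>"]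
    by (simp add: k_algebra_hom_def k_algebra_hom_axioms_def R.k_algebra_axioms E.k_algebra_axioms
        tn_mult tn_one op_carrier)
qed

lemma tn_right_hom: "k_algebra_hom (op_algebra R) (enveloping R) (tn \<one>\<^bsub>R\<^esub>)"
proof -
  interpret E: k_algebra "enveloping R" by (rule enveloping_algebra)
  show ?thesis
    using k_bilinear_linear_right[OF tn_bilinear op.k_vector_space_axioms E.k_vector_space_axioms, of "\<one>\<^bsub>R\<^esub>"]
    by (simp add: k_algebra_hom_def k_algebra_hom_axioms_def op.k_algebra_axioms E.k_algebra_axioms
        tn_mult tn_one)
qed

lemma tn_factors:
  assumes "a \<in> carrier R" and "a' \<in> carrier R"
  shows "tn a \<one>\<^bsub>R\<^esub> \<otimes>\<^bsub>enveloping R\<^esub> tn \<one>\<^bsub>R\<^esub> a' = tn a a'"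
    and "tn \<one>\<^bsub>R\<^esub> a' \<otimes>\<^bsub>enveloping R\<^esub> tn a \<one>\<^bsub>R\<^esub> = tn a a'"
  using assms by (simp_all add: tn_mult)

end

context pivotal_calculus
begin

lemma A_enveloping: "enveloping_algebra A" ..

lemma E_algebra: "k_algebra (enveloping A)"
  by (rule enveloping_algebra.enveloping_algebra[OF A_enveloping])

lemma k_tensors: "k_tensor_product X1 \<Omega>1" "k_tensor_product X2 \<Omega>2"
  "k_tensor_product \<Omega>1 X1" "k_tensor_product \<Omega>2 X2" ..

lemmas k_tensor_spaces = k_tensors[THEN k_tensor_product.k_tensor_vector_space]

lemma T_algebras: "k_algebra T_X1" "k_algebra T_X\<Omega>1" "k_algebra T_X\<Omega>2" "k_algebra T_\<Omega>X1" "k_algebra T_\<Omega>X2"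
  using X1.M.tensor_algebra_algebra k_tensor_spaces[THEN k_vector_space.tensor_algebra_algebra] by auto

lemma D4_free: "free_product_algebra T_\<Omega>X1 T_\<Omega>X2"
  by (rule free_product_algebra.intro) (rule T_algebras)+

lemma D3_free: "free_product_algebra T_X\<Omega>2 D4"
  by (rule free_product_algebra.intro[OF T_algebras(3) free_product_algebra.free_product_is_algebra[OF D4_free]])

lemma D2_free: "free_product_algebra T_X\<Omega>1 D3"
  by (rule free_product_algebra.intro[OF T_algebras(2) free_product_algebra.free_product_is_algebra[OF D3_free]])

lemma D1_free: "free_product_algebra T_X1 D2"
  by (rule free_product_algebra.intro[OF T_algebras(1) free_product_algebra.free_product_is_algebra[OF D2_free]])

lemma D_free: "free_product_algebra (enveloping A) D1"
  by (rule free_product_algebra.intro[OF E_algebra free_product_algebra.free_product_is_algebra[OF D1_free]])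

lemma D_algebra: "k_algebra D"
  unfolding D_def by (rule free_product_algebra.free_product_is_algebra[OF D_free])

lemmas D_inl = free_product_algebra.fp_inl_hom[OF D_free, folded D_def]
lemmas D_inr = free_product_algebra.fp_inr_hom[OF D_free, folded D_def]
lemmas D1_inr = k_algebra_hom_comp[OF free_product_algebra.fp_inr_hom[OF D1_free] D_inr]
lemmas D2_inr = k_algebra_hom_comp[OF free_product_algebra.fp_inr_hom[OF D2_free] D1_inr]
lemmas D3_inr = k_algebra_hom_comp[OF free_product_algebra.fp_inr_hom[OF D3_free] D2_inr]

lemma D_a_hom: "k_algebra_hom A D D_a"
  unfolding D_A_def[abs_def]
  using k_algebra_hom_comp[OF enveloping_algebra.tn_left_hom[OF A_enveloping] D_inl] by simp

lemma D_bar_hom: "k_algebra_hom (op_algebra A) D D_bar"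
  unfolding D_A_def[abs_def]
  using k_algebra_hom_comp[OF enveloping_algebra.tn_right_hom[OF A_enveloping] D_inl] by simp

lemma D_A_factors:
  assumes "a \<in> grade W 0" and "a' \<in> grade W 0"
  shows "D_a a \<otimes>\<^bsub>D\<^esub> D_bar a' = D_A a a'" and "D_bar a' \<otimes>\<^bsub>D\<^esub> D_a a = D_A a a'"
proof -
  interpret i: k_algebra_hom "enveloping A" D "fp_inl (enveloping A) D1" by (rule D_inl)
  note l = k_algebra_hom.axioms(3)[OF enveloping_algebra.tn_left_hom[OF A_enveloping], THEN k_linear_map.closed]
  note r = k_algebra_hom.axioms(3)[OF enveloping_algebra.tn_right_hom[OF A_enveloping], THEN k_linear_map.closed]
  show "D_a a \<otimes>\<^bsub>D\<^esub> D_bar a' = D_A a a'" "D_bar a' \<otimes>\<^bsub>D\<^esub> D_a a = D_A a a'"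
    using assms l[of a] r[of a'] enveloping_algebra.tn_factors[OF A_enveloping, of a a']
    unfolding D_A_def by (simp_all flip: i.mult)
qed

lemma D_X_linear: "k_linear_map X1 D D_X"
  unfolding D_X_def[abs_def]
  by (rule k_linear_map_comp[OF X1.M.ta_gen_linear k_algebra_hom.axioms(3)
        [OF k_algebra_hom_comp[OF free_product_algebra.fp_inl_hom[OF D1_free] D_inr]]])

lemma tensor_gen_bilinear:
  assumes "k_tensor_product M N" and "k_algebra_hom (tensor_algebra (k_tensor M N)) B f"
  shows "k_bilinear M N B (\<lambda>m n. f (ta_gen (k_tensor M N) (k_tens M N m n)))"
  by (rule k_bilinear_comp[OF k_tensor_product.k_tens_bilinear[OF assms(1)]
        k_linear_map_comp[OF k_vector_space.ta_gen_linear[OF k_tensor_product.k_tensor_vector_space[OF assms(1)]]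
          k_algebra_hom.axioms(3)[OF assms(2)]]])

lemma D_bilinear: "k_bilinear X1 \<Omega>1 D D_X\<Omega>1" "k_bilinear X2 \<Omega>2 D D_X\<Omega>2"
  "k_bilinear \<Omega>1 X1 D D_\<Omega>X1" "k_bilinear \<Omega>2 X2 D D_\<Omega>X2"
  unfolding D_X\<Omega>1_def[abs_def] D_X\<Omega>2_def[abs_def] D_\<Omega>X1_def[abs_def] D_\<Omega>X2_def[abs_def]
  by (rule tensor_gen_bilinear[OF k_tensors(1) k_algebra_hom_comp[OF free_product_algebra.fp_inl_hom[OF D2_free] D1_inr]]
      tensor_gen_bilinear[OF k_tensors(2) k_algebra_hom_comp[OF free_product_algebra.fp_inl_hom[OF D3_free] D2_inr]]
      tensor_gen_bilinear[OF k_tensors(3) k_algebra_hom_comp[OF free_product_algebra.fp_inl_hom[OF D4_free] D3_inr]]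
      tensor_gen_bilinear[OF k_tensors(4) k_algebra_hom_comp[OF free_product_algebra.fp_inr_hom[OF D4_free] D3_inr]])+

text \<open>Two universal properties in a row: a bilinear map is a linear map on the tensor product, and that is a
  homomorphism on its tensor algebra.\<close>
lemma tensor_algebra_bilinear_lift:
  assumes "k_tensor_product M N" and "k_algebra B" and h: "k_bilinear M N B h"
  obtains f where "k_algebra_hom (tensor_algebra (k_tensor M N)) B f"
    and "\<And>m n. m \<in> carrier M \<Longrightarrow> n \<in> carrier N \<Longrightarrow> f (ta_gen (k_tensor M N) (k_tens M N m n)) = h m n"
proof -
  interpret k_tensor_product M N by fact
  interpret B: k_algebra B by fact
  obtain g where g: "k_linear_map (k_tensor M N) B g"
    and g1: "\<And>m n. m \<in> carrier M \<Longrightarrow> n \<in> carrier N \<Longrightarrow> g (k_tens M N m n) = h m n"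
    using k_tensor_lift[OF h B.k_vector_space_axioms] by blast
  obtain f where f: "k_algebra_hom (tensor_algebra (k_tensor M N)) B f"
    and f1: "\<And>v. v \<in> carrier (k_tensor M N) \<Longrightarrow> f (ta_gen (k_tensor M N) v) = g v"
    using k_vector_space.tensor_algebra_lift[OF k_tensor_vector_space assms(2) g] by blast
  show ?thesis
    by (rule that[OF f]) (simp add: f1 g1 k_bilinear_closed[OF k_tens_bilinear])
qed

lemma tensor_algebra_bilinear_maps_eq:
  assumes "k_tensor_product M N"
    and f: "k_algebra_hom (tensor_algebra (k_tensor M N)) B f"
    and g: "k_algebra_hom (tensor_algebra (k_tensor M N)) B g"
    and eq: "\<And>m n. m \<in> carrier M \<Longrightarrow> n \<in> carrier N \<Longrightarrow>
      f (ta_gen (k_tensor M N) (k_tens M N m n)) = g (ta_gen (k_tensor M N) (k_tens M N m n))"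
    and u: "u \<in> carrier (tensor_algebra (k_tensor M N))"
  shows "f u = g u"
proof -
  interpret k_tensor_product M N by fact
  note t = k_vector_space.ta_gen_linear[OF k_tensor_vector_space]
  show ?thesis
    by (rule k_vector_space.tensor_algebra_maps_eq[OF k_tensor_vector_space f g _ u])
      (rule k_tensor_maps_eq[OF k_linear_map_comp[OF t k_algebra_hom.axioms(3)[OF f]]
          k_linear_map_comp[OF t k_algebra_hom.axioms(3)[OF g]] eq])
qed

text \<open>A homomorphism out of the free product is a free choice of images of the generators.\<close>
lemma D_lift:
  assumes B: "k_algebra B"
    and \<alpha>: "k_algebra_hom A B \<alpha>" and \<beta>: "k_algebra_hom (op_algebra A) B \<beta>"
    and comm: "\<And>a a'. a \<in> grade W 0 \<Longrightarrow> a' \<in> grade W 0 \<Longrightarrow> \<alpha> a \<otimes>\<^bsub>B\<^esub> \<beta> a' = \<beta> a' \<otimes>\<^bsub>B\<^esub> \<alpha> a"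
    and X: "k_linear_map X1 B X"
    and XO1: "k_bilinear X1 \<Omega>1 B XO1" and XO2: "k_bilinear X2 \<Omega>2 B XO2"
    and OX1: "k_bilinear \<Omega>1 X1 B OX1" and OX2: "k_bilinear \<Omega>2 X2 B OX2"
  obtains \<phi> where "k_algebra_hom D B \<phi>"
    and "\<And>a a'. a \<in> grade W 0 \<Longrightarrow> a' \<in> grade W 0 \<Longrightarrow> \<phi> (D_A a a') = \<alpha> a \<otimes>\<^bsub>B\<^esub> \<beta> a'"
    and "\<And>u. u \<in> carrier X1 \<Longrightarrow> \<phi> (D_X u) = X u"
    and "\<And>u \<eta>. u \<in> carrier X1 \<Longrightarrow> \<eta> \<in> grade W 1 \<Longrightarrow> \<phi> (D_X\<Omega>1 u \<eta>) = XO1 u \<eta>"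
    and "\<And>u \<eta>. u \<in> carrier X2 \<Longrightarrow> \<eta> \<in> grade W 2 \<Longrightarrow> \<phi> (D_X\<Omega>2 u \<eta>) = XO2 u \<eta>"
    and "\<And>u \<eta>. u \<in> carrier X1 \<Longrightarrow> \<eta> \<in> grade W 1 \<Longrightarrow> \<phi> (D_\<Omega>X1 \<eta> u) = OX1 \<eta> u"
    and "\<And>u \<eta>. u \<in> carrier X2 \<Longrightarrow> \<eta> \<in> grade W 2 \<Longrightarrow> \<phi> (D_\<Omega>X2 \<eta> u) = OX2 \<eta> u"
proof -
  have comm': "\<And>a a'. a \<in> carrier A \<Longrightarrow> a' \<in> carrier A \<Longrightarrow> \<alpha> a \<otimes>\<^bsub>B\<^esub> \<beta> a' = \<beta> a' \<otimes>\<^bsub>B\<^esub> \<alpha> a"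
    using comm by simp
  obtain fE where fE: "k_algebra_hom (enveloping A) B fE"
    and fE1: "\<And>u v. u \<in> carrier A \<Longrightarrow> v \<in> carrier A \<Longrightarrow> fE (k_tens A (op_algebra A) u v) = \<alpha> u \<otimes>\<^bsub>B\<^esub> \<beta> v"
    using enveloping_algebra.enveloping_lift[OF A_enveloping \<alpha> \<beta> comm'] by blast
  obtain fX where fX: "k_algebra_hom T_X1 B fX" and fX1: "\<And>v. v \<in> carrier X1 \<Longrightarrow> fX (ta_gen X1 v) = X v"
    using X1.M.tensor_algebra_lift[OF B X] by blast
  obtain f1 where f1: "k_algebra_hom T_X\<Omega>1 B f1"
    and f11: "\<And>m n. m \<in> carrier X1 \<Longrightarrow> n \<in> carrier \<Omega>1 \<Longrightarrow> f1 (ta_gen (k_tensor X1 \<Omega>1) (k_tens X1 \<Omega>1 m n)) = XO1 m n"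
    using tensor_algebra_bilinear_lift[OF k_tensors(1) B XO1] by blast
  obtain f2 where f2: "k_algebra_hom T_X\<Omega>2 B f2"
    and f21: "\<And>m n. m \<in> carrier X2 \<Longrightarrow> n \<in> carrier \<Omega>2 \<Longrightarrow> f2 (ta_gen (k_tensor X2 \<Omega>2) (k_tens X2 \<Omega>2 m n)) = XO2 m n"
    using tensor_algebra_bilinear_lift[OF k_tensors(2) B XO2] by blast
  obtain f3 where f3: "k_algebra_hom T_\<Omega>X1 B f3"
    and f31: "\<And>m n. m \<in> carrier \<Omega>1 \<Longrightarrow> n \<in> carrier X1 \<Longrightarrow> f3 (ta_gen (k_tensor \<Omega>1 X1) (k_tens \<Omega>1 X1 m n)) = OX1 m n"
    using tensor_algebra_bilinear_lift[OF k_tensors(3) B OX1] by blast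
  obtain f4 where f4: "k_algebra_hom T_\<Omega>X2 B f4"
    and f41: "\<And>m n. m \<in> carrier \<Omega>2 \<Longrightarrow> n \<in> carrier X2 \<Longrightarrow> f4 (ta_gen (k_tensor \<Omega>2 X2) (k_tens \<Omega>2 X2 m n)) = OX2 m n"
    using tensor_algebra_bilinear_lift[OF k_tensors(4) B OX2] by blast
  obtain g4 where g4: "k_algebra_hom D4 B g4"
    and g4l: "\<And>u. u \<in> carrier T_\<Omega>X1 \<Longrightarrow> g4 (fp_inl T_\<Omega>X1 T_\<Omega>X2 u) = f3 u"
    and g4r: "\<And>u. u \<in> carrier T_\<Omega>X2 \<Longrightarrow> g4 (fp_inr T_\<Omega>X1 T_\<Omega>X2 u) = f4 u"
    using free_product_algebra.free_product_lift[OF D4_free f3 f4] by blast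
  obtain g3 where g3: "k_algebra_hom D3 B g3"
    and g3l: "\<And>u. u \<in> carrier T_X\<Omega>2 \<Longrightarrow> g3 (fp_inl T_X\<Omega>2 D4 u) = f2 u"
    and g3r: "\<And>u. u \<in> carrier D4 \<Longrightarrow> g3 (fp_inr T_X\<Omega>2 D4 u) = g4 u"
    using free_product_algebra.free_product_lift[OF D3_free f2 g4] by blast
  obtain g2 where g2: "k_algebra_hom D2 B g2"
    and g2l: "\<And>u. u \<in> carrier T_X\<Omega>1 \<Longrightarrow> g2 (fp_inl T_X\<Omega>1 D3 u) = f1 u"
    and g2r: "\<And>u. u \<in> carrier D3 \<Longrightarrow> g2 (fp_inr T_X\<Omega>1 D3 u) = g3 u"
    using free_product_algebra.free_product_lift[OF D2_free f1 g3] by blast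
  obtain g1 where g1: "k_algebra_hom D1 B g1"
    and g1l: "\<And>u. u \<in> carrier T_X1 \<Longrightarrow> g1 (fp_inl T_X1 D2 u) = fX u"
    and g1r: "\<And>u. u \<in> carrier D2 \<Longrightarrow> g1 (fp_inr T_X1 D2 u) = g2 u"
    using free_product_algebra.free_product_lift[OF D1_free fX g2] by blast
  obtain \<phi> where \<phi>: "k_algebra_hom D B \<phi>"
    and \<phi>l: "\<And>u. u \<in> carrier (enveloping A) \<Longrightarrow> \<phi> (fp_inl (enveloping A) D1 u) = fE u"
    and \<phi>r: "\<And>u. u \<in> carrier D1 \<Longrightarrow> \<phi> (fp_inr (enveloping A) D1 u) = g1 u"
    using free_product_algebra.free_product_lift[OF D_free fE g1, folded D_def] by blast
  note cl = k_linear_map.closed[OF k_algebra_hom.axioms(3)]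
  note cls = free_product_algebra.fp_inl_hom[OF D4_free, THEN cl] free_product_algebra.fp_inr_hom[OF D4_free, THEN cl]
    free_product_algebra.fp_inl_hom[OF D3_free, THEN cl] free_product_algebra.fp_inr_hom[OF D3_free, THEN cl]
    free_product_algebra.fp_inl_hom[OF D2_free, THEN cl] free_product_algebra.fp_inr_hom[OF D2_free, THEN cl]
    free_product_algebra.fp_inl_hom[OF D1_free, THEN cl] free_product_algebra.fp_inr_hom[OF D1_free, THEN cl]
    k_bilinear_closed[OF tensor_gen_bilinear[OF k_tensors(1) k_algebra_hom_id[OF T_algebras(2)]]]
    k_bilinear_closed[OF tensor_gen_bilinear[OF k_tensors(2) k_algebra_hom_id[OF T_algebras(3)]]]
    k_bilinear_closed[OF tensor_gen_bilinear[OF k_tensors(3) k_algebra_hom_id[OF T_algebras(4)]]]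
    k_bilinear_closed[OF tensor_gen_bilinear[OF k_tensors(4) k_algebra_hom_id[OF T_algebras(5)]]]
    k_linear_map.closed[OF X1.M.ta_gen_linear]
    k_bilinear_closed[OF enveloping_algebra.tn_bilinear[OF A_enveloping]]
  show ?thesis
    by (rule that[OF \<phi>])
      (simp_all add: D_A_def D_X_def D_X\<Omega>1_def D_X\<Omega>2_def D_\<Omega>X1_def D_\<Omega>X2_def cls \<phi>l \<phi>r g1l g1r g2l g2r
        g3l g3r g4l g4r fE1 fX1 f11 f21 f31 f41)
qed

lemma D_maps_eq:
  assumes f: "k_algebra_hom D B f" and g: "k_algebra_hom D B g"
    and eq: "\<And>a a'. a \<in> grade W 0 \<Longrightarrow> a' \<in> grade W 0 \<Longrightarrow> f (D_A a a') = g (D_A a a')"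
      "\<And>u. u \<in> carrier X1 \<Longrightarrow> f (D_X u) = g (D_X u)"
      "\<And>u \<eta>. u \<in> carrier X1 \<Longrightarrow> \<eta> \<in> grade W 1 \<Longrightarrow> f (D_X\<Omega>1 u \<eta>) = g (D_X\<Omega>1 u \<eta>)"
      "\<And>u \<eta>. u \<in> carrier X2 \<Longrightarrow> \<eta> \<in> grade W 2 \<Longrightarrow> f (D_X\<Omega>2 u \<eta>) = g (D_X\<Omega>2 u \<eta>)"
      "\<And>u \<eta>. u \<in> carrier X1 \<Longrightarrow> \<eta> \<in> grade W 1 \<Longrightarrow> f (D_\<Omega>X1 \<eta> u) = g (D_\<Omega>X1 \<eta> u)"
      "\<And>u \<eta>. u \<in> carrier X2 \<Longrightarrow> \<eta> \<in> grade W 2 \<Longrightarrow> f (D_\<Omega>X2 \<eta> u) = g (D_\<Omega>X2 \<eta> u)"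
    and u: "u \<in> carrier D"
  shows "f u = g u"
proof -
  note comp = k_algebra_hom_comp
  note inl = free_product_algebra.fp_inl_hom and inr = free_product_algebra.fp_inr_hom
  note meq = free_product_algebra.free_product_maps_eq
  have "f (fp_inr (enveloping A) D1 (fp_inr T_X1 D2 (fp_inr T_X\<Omega>1 D3 (fp_inr T_X\<Omega>2 D4 v))))
      = g (fp_inr (enveloping A) D1 (fp_inr T_X1 D2 (fp_inr T_X\<Omega>1 D3 (fp_inr T_X\<Omega>2 D4 v))))"
    if "v \<in> carrier D4" for v
    by (rule meq[OF D4_free comp[OF D3_inr f] comp[OF D3_inr g] _ _ that];
        rule tensor_algebra_bilinear_maps_eq[OF k_tensors(3) comp[OF comp[OF inl[OF D4_free] D3_inr] f] comp[OF comp[OF inl[OF D4_free] D3_inr] g]]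
          tensor_algebra_bilinear_maps_eq[OF k_tensors(4) comp[OF comp[OF inr[OF D4_free] D3_inr] f] comp[OF comp[OF inr[OF D4_free] D3_inr] g]])
      (use eq in \<open>simp_all add: D_\<Omega>X1_def D_\<Omega>X2_def\<close>)
  then have "f (fp_inr (enveloping A) D1 (fp_inr T_X1 D2 (fp_inr T_X\<Omega>1 D3 v)))
      = g (fp_inr (enveloping A) D1 (fp_inr T_X1 D2 (fp_inr T_X\<Omega>1 D3 v)))"
    if "v \<in> carrier D3" for v
    using tensor_algebra_bilinear_maps_eq[OF k_tensors(2) comp[OF comp[OF inl[OF D3_free] D2_inr] f] comp[OF comp[OF inl[OF D3_free] D2_inr] g]]
      eq by (intro meq[OF D3_free comp[OF D2_inr f] comp[OF D2_inr g] _ _ that]) (simp_all add: D_X\<Omega>2_def)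
  then have "f (fp_inr (enveloping A) D1 (fp_inr T_X1 D2 v)) = g (fp_inr (enveloping A) D1 (fp_inr T_X1 D2 v))"
    if "v \<in> carrier D2" for v
    using tensor_algebra_bilinear_maps_eq[OF k_tensors(1) comp[OF comp[OF inl[OF D2_free] D1_inr] f] comp[OF comp[OF inl[OF D2_free] D1_inr] g]]
      eq by (intro meq[OF D2_free comp[OF D1_inr f] comp[OF D1_inr g] _ _ that]) (simp_all add: D_X\<Omega>1_def)
  then have "f (fp_inr (enveloping A) D1 v) = g (fp_inr (enveloping A) D1 v)"
    if "v \<in> carrier D1" for v
    using X1.M.tensor_algebra_maps_eq[OF comp[OF comp[OF inl[OF D1_free] D_inr] f] comp[OF comp[OF inl[OF D1_free] D_inr] g]]
      eq by (intro meq[OF D1_free comp[OF D_inr f] comp[OF D_inr g] _ _ that]) (simp_all add: D_X_def)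
  then show ?thesis
    using enveloping_algebra.enveloping_maps_eq[OF A_enveloping comp[OF D_inl f] comp[OF D_inl g]]
      eq by (intro meq[OF D_free f[unfolded D_def] g[unfolded D_def] _ _ u[unfolded D_def]]) (simp_all add: D_A_def)
qed

subsection \<open>The free generators of \<open>H\<close>\<close>
lemma H1_free: "free_product_algebra T_X1 T_X1"
  by (rule free_product_algebra.intro[OF T_algebras(1) T_algebras(1)])

lemma H_free: "free_product_algebra (enveloping A) (T_X1 \<star> T_X1)"
  by (rule free_product_algebra.intro[OF E_algebra free_product_algebra.free_product_is_algebra[OF H1_free]])

lemma H_algebra: "k_algebra H"
  unfolding H_def by (rule free_product_algebra.free_product_is_algebra[OF H_free])

lemmas H_inl = free_product_algebra.fp_inl_hom[OF H_free, folded H_def]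
lemmas H_inr = free_product_algebra.fp_inr_hom[OF H_free, folded H_def]

lemma H_a_hom: "k_algebra_hom A H H_a"
  unfolding H_A_def[abs_def]
  using k_algebra_hom_comp[OF enveloping_algebra.tn_left_hom[OF A_enveloping] H_inl] by simp

lemma H_bar_hom: "k_algebra_hom (op_algebra A) H H_bar"
  unfolding H_A_def[abs_def]
  using k_algebra_hom_comp[OF enveloping_algebra.tn_right_hom[OF A_enveloping] H_inl] by simp

lemma H_A_factors:
  assumes "a \<in> grade W 0" and "a' \<in> grade W 0"
  shows "H_a a \<otimes>\<^bsub>H\<^esub> H_bar a' = H_A a a'" and "H_bar a' \<otimes>\<^bsub>H\<^esub> H_a a = H_A a a'"
proof -
  interpret i: k_algebra_hom "enveloping A" H "fp_inl (enveloping A) (T_X1 \<star> T_X1)" by (rule H_inl)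
  note l = k_algebra_hom.axioms(3)[OF enveloping_algebra.tn_left_hom[OF A_enveloping], THEN k_linear_map.closed]
  note r = k_algebra_hom.axioms(3)[OF enveloping_algebra.tn_right_hom[OF A_enveloping], THEN k_linear_map.closed]
  show "H_a a \<otimes>\<^bsub>H\<^esub> H_bar a' = H_A a a'" "H_bar a' \<otimes>\<^bsub>H\<^esub> H_a a = H_A a a'"
    using assms l[of a] r[of a'] enveloping_algebra.tn_factors[OF A_enveloping, of a a']
    unfolding H_A_def by (simp_all flip: i.mult)
qed

lemma H_X_linear: "k_linear_map X1 H H_X" and H_Y_linear: "k_linear_map X1 H H_Y"
  unfolding H_X_def[abs_def] H_Y_def[abs_def]
  by (rule k_linear_map_comp[OF X1.M.ta_gen_linear k_algebra_hom.axioms(3)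
        [OF k_algebra_hom_comp[OF free_product_algebra.fp_inl_hom[OF H1_free] H_inr]]]
      k_linear_map_comp[OF X1.M.ta_gen_linear k_algebra_hom.axioms(3)
        [OF k_algebra_hom_comp[OF free_product_algebra.fp_inr_hom[OF H1_free] H_inr]]])+

lemma H_lift:
  assumes B: "k_algebra B"
    and \<alpha>: "k_algebra_hom A B \<alpha>" and \<beta>: "k_algebra_hom (op_algebra A) B \<beta>"
    and comm: "\<And>a a'. a \<in> grade W 0 \<Longrightarrow> a' \<in> grade W 0 \<Longrightarrow> \<alpha> a \<otimes>\<^bsub>B\<^esub> \<beta> a' = \<beta> a' \<otimes>\<^bsub>B\<^esub> \<alpha> a"
    and X: "k_linear_map X1 B X" and Y: "k_linear_map X1 B Y"
  obtains \<phi> where "k_algebra_hom H B \<phi>"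
    and "\<And>a a'. a \<in> grade W 0 \<Longrightarrow> a' \<in> grade W 0 \<Longrightarrow> \<phi> (H_A a a') = \<alpha> a \<otimes>\<^bsub>B\<^esub> \<beta> a'"
    and "\<And>u. u \<in> carrier X1 \<Longrightarrow> \<phi> (H_X u) = X u"
    and "\<And>u. u \<in> carrier X1 \<Longrightarrow> \<phi> (H_Y u) = Y u"
proof -
  have comm': "\<And>a a'. a \<in> carrier A \<Longrightarrow> a' \<in> carrier A \<Longrightarrow> \<alpha> a \<otimes>\<^bsub>B\<^esub> \<beta> a' = \<beta> a' \<otimes>\<^bsub>B\<^esub> \<alpha> a"
    using comm by simp
  obtain fE where fE: "k_algebra_hom (enveloping A) B fE"
    and fE1: "\<And>u v. u \<in> carrier A \<Longrightarrow> v \<in> carrier A \<Longrightarrow> fE (k_tens A (op_algebra A) u v) = \<alpha> u \<otimes>\<^bsub>B\<^esub> \<beta> v"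
    using enveloping_algebra.enveloping_lift[OF A_enveloping \<alpha> \<beta> comm'] by blast
  obtain fX where fX: "k_algebra_hom T_X1 B fX" and fX1: "\<And>v. v \<in> carrier X1 \<Longrightarrow> fX (ta_gen X1 v) = X v"
    using X1.M.tensor_algebra_lift[OF B X] by blast
  obtain fY where fY: "k_algebra_hom T_X1 B fY" and fY1: "\<And>v. v \<in> carrier X1 \<Longrightarrow> fY (ta_gen X1 v) = Y v"
    using X1.M.tensor_algebra_lift[OF B Y] by blast
  obtain g1 where g1: "k_algebra_hom (T_X1 \<star> T_X1) B g1"
    and g1l: "\<And>u. u \<in> carrier T_X1 \<Longrightarrow> g1 (fp_inl T_X1 T_X1 u) = fX u"
    and g1r: "\<And>u. u \<in> carrier T_X1 \<Longrightarrow> g1 (fp_inr T_X1 T_X1 u) = fY u"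
    using free_product_algebra.free_product_lift[OF H1_free fX fY] by blast
  obtain \<phi> where \<phi>: "k_algebra_hom H B \<phi>"
    and \<phi>l: "\<And>u. u \<in> carrier (enveloping A) \<Longrightarrow> \<phi> (fp_inl (enveloping A) (T_X1 \<star> T_X1) u) = fE u"
    and \<phi>r: "\<And>u. u \<in> carrier (T_X1 \<star> T_X1) \<Longrightarrow> \<phi> (fp_inr (enveloping A) (T_X1 \<star> T_X1) u) = g1 u"
    using free_product_algebra.free_product_lift[OF H_free fE g1, folded H_def] by blast
  note cl = k_linear_map.closed[OF k_algebra_hom.axioms(3)]
  note cls = free_product_algebra.fp_inl_hom[OF H1_free, THEN cl] free_product_algebra.fp_inr_hom[OF H1_free, THEN cl]
    k_linear_map.closed[OF X1.M.ta_gen_linear]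
    k_bilinear_closed[OF enveloping_algebra.tn_bilinear[OF A_enveloping]]
  show ?thesis
    by (rule that[OF \<phi>]) (simp_all add: H_A_def H_X_def H_Y_def cls \<phi>l \<phi>r g1l g1r fE1 fX1 fY1)
qed

lemma H_maps_eq:
  assumes f: "k_algebra_hom H B f" and g: "k_algebra_hom H B g"
    and eq: "\<And>a a'. a \<in> grade W 0 \<Longrightarrow> a' \<in> grade W 0 \<Longrightarrow> f (H_A a a') = g (H_A a a')"
      "\<And>u. u \<in> carrier X1 \<Longrightarrow> f (H_X u) = g (H_X u)"
      "\<And>u. u \<in> carrier X1 \<Longrightarrow> f (H_Y u) = g (H_Y u)"
    and u: "u \<in> carrier H"
  shows "f u = g u"
proof -
  note comp = k_algebra_hom_comp
  note inl = free_product_algebra.fp_inl_hom and inr = free_product_algebra.fp_inr_hom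
  note meq = free_product_algebra.free_product_maps_eq
  have "f (fp_inr (enveloping A) (T_X1 \<star> T_X1) v) = g (fp_inr (enveloping A) (T_X1 \<star> T_X1) v)"
    if "v \<in> carrier (T_X1 \<star> T_X1)" for v
    using X1.M.tensor_algebra_maps_eq[OF comp[OF comp[OF inl[OF H1_free] H_inr] f] comp[OF comp[OF inl[OF H1_free] H_inr] g]]
      X1.M.tensor_algebra_maps_eq[OF comp[OF comp[OF inr[OF H1_free] H_inr] f] comp[OF comp[OF inr[OF H1_free] H_inr] g]]
      eq by (intro meq[OF H1_free comp[OF H_inr f] comp[OF H_inr g] _ _ that]) (simp_all add: H_X_def H_Y_def)
  then show ?thesis
    using enveloping_algebra.enveloping_maps_eq[OF A_enveloping comp[OF H_inl f] comp[OF H_inl g]]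
      eq by (intro meq[OF H_free f[unfolded H_def] g[unfolded H_def] _ _ u[unfolded H_def]]) (simp_all add: H_A_def)
qed

end

section \<open>Sums and linear maps in an algebra\<close>

context k_vector_space
begin

lemma finsum_mem: "(\<And>s. s \<in> S \<Longrightarrow> f s \<in> carrier M) \<Longrightarrow> finsum M f S \<in> carrier M"
  by (rule finsum_closed) auto

lemma finsum_plus:
  "(\<And>s. s \<in> S \<Longrightarrow> f s \<in> carrier M) \<Longrightarrow> (\<And>s. s \<in> S \<Longrightarrow> g s \<in> carrier M) \<Longrightarrow>
    (\<Oplus>s\<in>S. f s \<oplus> g s) = finsum M f S \<oplus> finsum M g S"
  by (rule finsum_addf) auto

lemma finsum_minus:
  assumes "finite S" and f: "\<And>s. s \<in> S \<Longrightarrow> f s \<in> carrier M" and g: "\<And>s. s \<in> S \<Longrightarrow> g s \<in> carrier M"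
  shows "(\<Oplus>s\<in>S. f s \<ominus> g s) = finsum M f S \<ominus> finsum M g S"
proof -
  interpret m: k_linear_map M M "\<lambda>v. \<ominus> v"
  proof unfold_locales
    show "\<ominus> (k \<odot> u) = k \<odot> (\<ominus> u)" if "u \<in> carrier M" for k u
      using that smult_assoc[of u "- 1" k] smult_assoc[of u k "- 1"] by (simp add: smult_minus_one)
  qed (simp_all add: minus_add)
  have "(\<Oplus>s\<in>S. f s \<ominus> g s) = finsum M f S \<oplus> (\<Oplus>s\<in>S. \<ominus> g s)"
    unfolding a_minus_def using f g by (intro finsum_plus) auto
  also have "(\<Oplus>s\<in>S. \<ominus> g s) = \<ominus> finsum M g S"
    using m.finsum[OF assms(1), of g] g by simp
  finally show ?thesis by (simp add: a_minus_def)
qed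

lemma finsum_exchange:
  assumes "finite S" and "finite T" and f: "\<And>s t. s \<in> S \<Longrightarrow> t \<in> T \<Longrightarrow> f s t \<in> carrier M"
  shows "(\<Oplus>s\<in>S. \<Oplus>t\<in>T. f s t) = (\<Oplus>t\<in>T. \<Oplus>s\<in>S. f s t)"
  using assms(1) f
proof (induction S)
  case empty
  show ?case by (simp add: finsum_zero)
next
  case (insert s S)
  have "(\<Oplus>u\<in>insert s S. \<Oplus>t\<in>T. f u t) = (\<Oplus>t\<in>T. f s t) \<oplus> (\<Oplus>t\<in>T. \<Oplus>s\<in>S. f s t)"
    using insert by (simp add: finsum_insert finsum_mem Pi_iff)
  also have "\<dots> = (\<Oplus>t\<in>T. f s t \<oplus> (\<Oplus>s\<in>S. f s t))"
    using insert.prems by (intro finsum_plus[symmetric] finsum_mem) auto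
  also have "\<dots> = (\<Oplus>t\<in>T. \<Oplus>u\<in>insert s S. f u t)"
    using insert by (intro finsum_cong_simple) (simp add: finsum_insert Pi_iff)
  finally show ?case .
qed

end

context k_algebra
begin

lemma mult_left_linear: "u \<in> carrier R \<Longrightarrow> k_linear_map R R (\<lambda>v. u \<otimes> v)"
  by unfold_locales (simp_all add: r_distr smult_mult_right)

lemma mult_right_linear: "u \<in> carrier R \<Longrightarrow> k_linear_map R R (\<lambda>v. v \<otimes> u)"
  by unfold_locales (simp_all add: l_distr smult_mult_left)

lemma mult_finsum:
  "finite S \<Longrightarrow> (\<And>s. s \<in> S \<Longrightarrow> f s \<in> carrier R) \<Longrightarrow> u \<in> carrier R \<Longrightarrow>
    u \<otimes> finsum R f S = (\<Oplus>s\<in>S. u \<otimes> f s)"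
  using k_linear_map.finsum[OF mult_left_linear, of u S f] by simp

lemma finsum_mult:
  "finite S \<Longrightarrow> (\<And>s. s \<in> S \<Longrightarrow> f s \<in> carrier R) \<Longrightarrow> u \<in> carrier R \<Longrightarrow>
    finsum R f S \<otimes> u = (\<Oplus>s\<in>S. f s \<otimes> u)"
  using k_linear_map.finsum[OF mult_right_linear, of u S f] by simp

lemma minus_distrib:
  assumes "u \<in> carrier R" "v \<in> carrier R" "w \<in> carrier R"
  shows "(u \<ominus> v) \<otimes> w = u \<otimes> w \<ominus> v \<otimes> w" and "w \<otimes> (u \<ominus> v) = w \<otimes> u \<ominus> w \<otimes> v"
  using assms by (simp_all add: a_minus_def l_distr r_distr l_minus r_minus)

lemma commutator_mem: "u \<in> carrier R \<Longrightarrow> v \<in> carrier R \<Longrightarrow> commutator R u v \<in> carrier R"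
  by (simp add: commutator_def)

lemma commutator_eq_iff:
  assumes "u \<in> carrier R" "v \<in> carrier R" "w \<in> carrier R"
  shows "commutator R u v = w \<longleftrightarrow> u \<otimes> v = v \<otimes> u \<oplus> w"
proof -
  have "u \<otimes> v = v \<otimes> u \<oplus> (u \<otimes> v \<ominus> v \<otimes> u)" "v \<otimes> u \<oplus> w \<ominus> v \<otimes> u = w"
    using assms by algebra+
  then show ?thesis unfolding commutator_def by metis
qed

lemma commutator_linear: "v \<in> carrier R \<Longrightarrow> k_linear_map R R (\<lambda>u. commutator R u v)"
proof unfold_locales
  fix u u' k assume m: "v \<in> carrier R" "u \<in> carrier R"
  then show "commutator R u v \<in> carrier R" by (rule commutator_mem[rotated])
  have "k \<odot> (u \<otimes> v) \<oplus> (- 1) \<odot> (k \<odot> (v \<otimes> u)) = k \<odot> (u \<otimes> v \<oplus> (- 1) \<odot> (v \<otimes> u))"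
    using m by (simp add: smult_r_distr flip: smult_assoc)
  then show "commutator R (k \<odot> u) v = k \<odot> commutator R u v"
    using m by (simp add: commutator_def a_minus_def smult_minus_one smult_mult_left smult_mult_right)
  assume "u' \<in> carrier R"
  with m show "commutator R (u \<oplus> u') v = commutator R u v \<oplus> commutator R u' v"
    unfolding commutator_def by algebra
qed

lemma k_bilinear_mult:
  assumes "k_linear_map M R f" and "k_linear_map N R g"
  shows "k_bilinear M N R (\<lambda>m n. f m \<otimes> g n)"
proof -
  interpret f: k_linear_map M R f by fact
  interpret g: k_linear_map N R g by fact
  show ?thesis
    unfolding k_bilinear_def
    by (simp add: f.closed g.closed f.add g.add f.smult g.smult l_distr r_distr smult_mult_left smult_mult_right)
qed

end

lemma k_linear_map_cong:
  assumes "k_linear_map V C f" and "\<And>v. v \<in> carrier V \<Longrightarrow> f v = g v"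
  shows "k_linear_map V C g"
proof -
  interpret f: k_linear_map V C f by fact
  show ?thesis
    by unfold_locales (simp_all add: f.closed f.add f.smult flip: assms(2))
qed

lemma k_linear_map_add:
  assumes "k_linear_map V C f" and "k_linear_map V C g"
  shows "k_linear_map V C (\<lambda>v. f v \<oplus>\<^bsub>C\<^esub> g v)"
proof -
  interpret f: k_linear_map V C f by fact
  interpret g: k_linear_map V C g by fact
  show ?thesis
    by unfold_locales (simp_all add: f.closed g.closed f.add g.add f.smult g.smult f.C.smult_r_distr f.C.a_ac)
qed

lemma k_linear_map_zero:
  assumes "k_vector_space V" and "k_vector_space C"
  shows "k_linear_map V C (\<lambda>v. \<zero>\<^bsub>C\<^esub>)"
proof -
  interpret V: k_vector_space V by fact
  interpret C: k_vector_space C by fact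
  show ?thesis by unfold_locales (simp_all add: C.smult_zero_right)
qed

lemma k_linear_map_finsum:
  assumes "k_vector_space V" and "k_vector_space C" and "finite S"
    and "\<And>s. s \<in> S \<Longrightarrow> k_linear_map V C (f s)"
  shows "k_linear_map V C (\<lambda>v. \<Oplus>\<^bsub>C\<^esub>s\<in>S. f s v)"
  using assms(3,4)
proof (induction S)
  case empty
  interpret C: k_vector_space C by fact
  show ?case using k_linear_map_zero[OF assms(1,2)] by simp
next
  case (insert s S)
  interpret C: k_vector_space C by fact
  have "k_linear_map V C (\<lambda>v. f s v \<oplus>\<^bsub>C\<^esub> (\<Oplus>\<^bsub>C\<^esub>s\<in>S. f s v))"
    by (rule k_linear_map_add) (use insert in auto)
  then show ?case
    by (rule k_linear_map_cong)
      (use insert.hyps k_linear_map.closed[OF insert.prems] in \<open>simp add: C.finsum_insert Pi_iff\<close>)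
qed

text \<open>A linear map out of \<open>V\<close> may be prescribed on a spanning family, provided that the prescribed
  values satisfy every additive relation of the family.\<close>
lemma linear_extension:
  fixes V :: "('k::field, 'v, 'y) module_scheme" and C :: "('k, 'c, 'z) module_scheme"
  assumes V: "k_vector_space V" and C: "k_vector_space C"
    and g: "\<And>t. t \<in> T \<Longrightarrow> g t \<in> carrier V" and f: "\<And>t. t \<in> T \<Longrightarrow> f t \<in> carrier C"
    and span: "\<And>R v. v \<in> carrier V \<Longrightarrow> (\<And>t. t \<in> T \<Longrightarrow> R (g t)) \<Longrightarrow> R \<zero>\<^bsub>V\<^esub> \<Longrightarrow>
      (\<And>u v. u \<in> carrier V \<Longrightarrow> v \<in> carrier V \<Longrightarrow> R u \<Longrightarrow> R v \<Longrightarrow> R (u \<oplus>\<^bsub>V\<^esub> v)) \<Longrightarrow> R v"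
    and null: "\<And>(n::nat) t. t \<in> {..<n} \<rightarrow> T \<Longrightarrow> (\<Oplus>\<^bsub>V\<^esub>m\<in>{..<n}. g (t m)) = \<zero>\<^bsub>V\<^esub> \<Longrightarrow>
      (\<Oplus>\<^bsub>C\<^esub>m\<in>{..<n}. f (t m)) = \<zero>\<^bsub>C\<^esub>"
    and scal: "\<And>k t. t \<in> T \<Longrightarrow> \<exists>t'\<in>T. g t' = k \<odot>\<^bsub>V\<^esub> g t \<and> f t' = k \<odot>\<^bsub>C\<^esub> f t"
  shows "\<exists>F. k_linear_map V C F \<and> (\<forall>t\<in>T. F (g t) = f t)"
proof -
  interpret V: k_vector_space V by fact
  interpret C: k_vector_space C by fact
  let ?G = "\<lparr>carrier = T, mult = undefined, one = undefined\<rparr>"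
  let ?M = "monoid_algebra ?G :: ('k, _ \<Rightarrow>\<^sub>0 'k) module"
  interpret g: k_linear_map ?M V "lin_ext V g" by (rule V.lin_ext_linear) (simp add: g)
  interpret f: k_linear_map ?M C "lin_ext C f" by (rule C.lin_ext_linear) (simp add: f)
  have mem: "Poly_Mapping.single t k \<in> carrier ?M" if "t \<in> T" for t k
    using that by (intro single_mem_monoid_algebra) simp
  have surj: "\<exists>s\<in>carrier ?M. lin_ext V g s = v" if v: "v \<in> carrier V" for v
    using v
  proof (rule span)
    fix t assume t: "t \<in> T"
    show "\<exists>s\<in>carrier ?M. lin_ext V g s = g t"
      using mem[OF t, of 1] g[OF t] by (intro bexI) (simp_all add: V.lin_ext_single V.smult_one)
  next
    show "\<exists>s\<in>carrier ?M. lin_ext V g s = \<zero>\<^bsub>V\<^esub>" using g.zero g.V.zero_closed by blast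
  next
    fix u v assume "\<exists>s\<in>carrier ?M. lin_ext V g s = u" "\<exists>s\<in>carrier ?M. lin_ext V g s = v"
    then show "\<exists>s\<in>carrier ?M. lin_ext V g s = u \<oplus>\<^bsub>V\<^esub> v" using g.add g.V.a_closed by metis
  qed
  have ker: "lin_ext C f s = \<zero>\<^bsub>C\<^esub>" if s: "s \<in> carrier ?M" and 0: "lin_ext V g s = \<zero>\<^bsub>V\<^esub>" for s
  proof -
    let ?K = "Poly_Mapping.keys s"
    have K: "?K \<subseteq> T" using s by (simp add: monoid_algebra_simps)
    obtain e where e: "bij_betw e {..<card ?K} ?K"
      using ex_bij_betw_nat_finite[of ?K] by (auto simp: atLeast0LessThan)
    have eT: "e m \<in> T" if "m < card ?K" for m using e that K by (auto simp: bij_betw_def)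
    have "\<exists>t. \<forall>m<card ?K. t m \<in> T \<and> g (t m) = Poly_Mapping.lookup s (e m) \<odot>\<^bsub>V\<^esub> g (e m) \<and>
        f (t m) = Poly_Mapping.lookup s (e m) \<odot>\<^bsub>C\<^esub> f (e m)"
      using scal[OF eT] by (intro choice) blast
    then obtain t where t: "\<And>m. m < card ?K \<Longrightarrow> t m \<in> T"
      and gt: "\<And>m. m < card ?K \<Longrightarrow> g (t m) = Poly_Mapping.lookup s (e m) \<odot>\<^bsub>V\<^esub> g (e m)"
      and ft: "\<And>m. m < card ?K \<Longrightarrow> f (t m) = Poly_Mapping.lookup s (e m) \<odot>\<^bsub>C\<^esub> f (e m)" by blast
    have inj: "inj_on e {..<card ?K}" and im: "e ` {..<card ?K} = ?K" using e by (auto simp: bij_betw_def)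
    have "lin_ext V g s = (\<Oplus>\<^bsub>V\<^esub>m\<in>{..<card ?K}. Poly_Mapping.lookup s (e m) \<odot>\<^bsub>V\<^esub> g (e m))"
      using V.finsum_reindex[of "\<lambda>t. Poly_Mapping.lookup s t \<odot>\<^bsub>V\<^esub> g t" e "{..<card ?K}"] inj K
      by (auto simp: lin_ext_def im g Pi_iff subset_iff)
    then have gs: "(\<Oplus>\<^bsub>V\<^esub>m\<in>{..<card ?K}. g (t m)) = \<zero>\<^bsub>V\<^esub>" using gt 0 by simp
    have "lin_ext C f s = (\<Oplus>\<^bsub>C\<^esub>m\<in>{..<card ?K}. Poly_Mapping.lookup s (e m) \<odot>\<^bsub>C\<^esub> f (e m))"
      using C.finsum_reindex[of "\<lambda>t. Poly_Mapping.lookup s t \<odot>\<^bsub>C\<^esub> f t" e "{..<card ?K}"] inj K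
      by (auto simp: lin_ext_def im f Pi_iff subset_iff)
    also have "\<dots> = (\<Oplus>\<^bsub>C\<^esub>m\<in>{..<card ?K}. f (t m))" using ft by simp
    also have "\<dots> = \<zero>\<^bsub>C\<^esub>" using null[of t, OF _ gs] t by simp
    finally show ?thesis .
  qed
  have eq: "lin_ext C f s = lin_ext C f s'"
    if "s \<in> carrier ?M" "s' \<in> carrier ?M" "lin_ext V g s = lin_ext V g s'" for s s'
    using ker[of "s \<ominus>\<^bsub>?M\<^esub> s'"] that g.closed f.closed g.V.minus_closed[OF that(1,2)]
    by (simp add: g.minus f.minus V.minus_eq_zero_iff C.minus_eq_zero_iff)
  define F where "F = (\<lambda>v. lin_ext C f (SOME s. s \<in> carrier ?M \<and> lin_ext V g s = v))"
  have F: "F (lin_ext V g s) = lin_ext C f s" if "s \<in> carrier ?M" for s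
    unfolding F_def using someI[of "\<lambda>s'. s' \<in> carrier ?M \<and> lin_ext V g s' = lin_ext V g s" s] that
    by (intro eq) auto
  have "k_linear_map V C F"
  proof unfold_locales
    fix u assume "u \<in> carrier V"
    then obtain s where s: "s \<in> carrier ?M" "u = lin_ext V g s" using surj by blast
    then show "F u \<in> carrier C" by (simp add: F f.closed)
    show "F (k \<odot>\<^bsub>V\<^esub> u) = k \<odot>\<^bsub>C\<^esub> F u" for k
      using F[of "k \<odot>\<^bsub>?M\<^esub> s"] s by (simp add: F g.smult f.smult)
    fix v assume "v \<in> carrier V"
    then obtain s' where s': "s' \<in> carrier ?M" "v = lin_ext V g s'" using surj by blast
    show "F (u \<oplus>\<^bsub>V\<^esub> v) = F u \<oplus>\<^bsub>C\<^esub> F v"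
      using F[of "s \<oplus>\<^bsub>?M\<^esub> s'"] s s' by (simp add: F g.add f.add)
  qed
  moreover have "F (g t) = f t" if "t \<in> T" for t
    using F[OF mem[OF that, of 1]] that by (simp add: V.lin_ext_single C.lin_ext_single g f V.smult_one C.smult_one)
  ultimately show ?thesis by blast
qed

section \<open>Representations of the generators\<close>
text \<open>The images in \<open>B\<close> of the generators that \<open>D\<close> and \<open>H\<close> have in common.  A homomorphism on \<open>A \<otimes> A\<^sup>o\<^sup>p\<close> is a
  homomorphism \<open>\<alpha>\<close> and an antihomomorphism \<open>\<beta>\<close> with commuting images.\<close>
locale base_generators = pivotal_calculus W P Q p b x q y c + B: k_algebra B
  for W :: "('k::field, 'w) dga" and P :: "('k, 'w, 'x) two_sided_dual"
    and Q :: "('k, 'w, 'y) two_sided_dual" and p :: nat and b :: "nat \<Rightarrow> 'w" and x :: "nat \<Rightarrow> 'x"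
    and q :: nat and y :: "nat \<Rightarrow> 'x" and c :: "nat \<Rightarrow> 'w"
    and B :: "('k, 'e, 'z) module_scheme" (structure) +
  fixes \<alpha> \<beta> :: "'w \<Rightarrow> 'e" and X :: "'x \<Rightarrow> 'e"
  assumes \<alpha>_hom: "k_algebra_hom A B \<alpha>" and \<beta>_hom: "k_algebra_hom (op_algebra A) B \<beta>"
    and comm: "a \<in> grade W 0 \<Longrightarrow> a' \<in> grade W 0 \<Longrightarrow> \<alpha> a \<otimes> \<beta> a' = \<beta> a' \<otimes> \<alpha> a"
    and X_linear: "k_linear_map X1 B X"
begin

lemmas \<alpha> = k_linear_map.closed[OF k_algebra_hom.axioms(3)[OF \<alpha>_hom], simplified]
  k_linear_map.add[OF k_algebra_hom.axioms(3)[OF \<alpha>_hom], simplified]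
  k_linear_map.smult[OF k_algebra_hom.axioms(3)[OF \<alpha>_hom], simplified]
  k_algebra_hom.mult[OF \<alpha>_hom, simplified] k_algebra_hom.one[OF \<alpha>_hom, simplified]
  k_linear_map.zero[OF k_algebra_hom.axioms(3)[OF \<alpha>_hom], simplified]

lemmas \<beta> = k_linear_map.closed[OF k_algebra_hom.axioms(3)[OF \<beta>_hom], simplified]
  k_linear_map.add[OF k_algebra_hom.axioms(3)[OF \<beta>_hom], simplified]
  k_linear_map.smult[OF k_algebra_hom.axioms(3)[OF \<beta>_hom], simplified]
  k_algebra_hom.mult[OF \<beta>_hom, simplified] k_algebra_hom.one[OF \<beta>_hom, simplified]
  k_linear_map.zero[OF k_algebra_hom.axioms(3)[OF \<beta>_hom], simplified]

lemmas X_mem = k_linear_map.closed[OF X_linear]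

text \<open>\<open>(m, n) \<mapsto> F m n\<close> intertwines the four actions of \<open>A\<close> on \<open>M \<otimes> N\<close> with multiplication by
  \<open>a\<close> and \<open>a\<close> with a bar from the left and from the right.\<close>
definition acts :: "('k, 'w, 'm, 'r) bimod_scheme \<Rightarrow> ('k, 'w, 'n, 's) bimod_scheme \<Rightarrow> ('m \<Rightarrow> 'n \<Rightarrow> 'e) \<Rightarrow> bool"
  where "acts M N F \<longleftrightarrow> (\<forall>a\<in>grade W 0. \<forall>m\<in>carrier M. \<forall>n\<in>carrier N.
    \<alpha> a \<otimes> F m n = F (lact M a m) n \<and> F m n \<otimes> \<alpha> a = F (ract M m a) n \<and>
    \<beta> a \<otimes> F m n = F m (ract N n a) \<and> F m n \<otimes> \<beta> a = F m (lact N a n))"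

lemma actsD:
  assumes "acts M N F" and "a \<in> grade W 0" and "m \<in> carrier M" and "n \<in> carrier N"
  shows "\<alpha> a \<otimes> F m n = F (lact M a m) n" and "F m n \<otimes> \<alpha> a = F (ract M m a) n"
    and "\<beta> a \<otimes> F m n = F m (ract N n a)" and "F m n \<otimes> \<beta> a = F m (lact N a n)"
  using assms unfolding acts_def by blast+

end

text \<open>The relations that the two algebras have in common.\<close>
locale base_model = base_generators W P Q p b x q y c B \<alpha> \<beta> X
  for W :: "('k::field, 'w) dga" and P :: "('k, 'w, 'x) two_sided_dual"
    and Q :: "('k, 'w, 'y) two_sided_dual" and p :: nat and b :: "nat \<Rightarrow> 'w" and x :: "nat \<Rightarrow> 'x"
    and q :: nat and y :: "nat \<Rightarrow> 'x" and c :: "nat \<Rightarrow> 'w"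
    and B :: "('k, 'e, 'z) module_scheme" (structure) and \<alpha> \<beta> :: "'w \<Rightarrow> 'e" and X :: "'x \<Rightarrow> 'e" +
  assumes X_left: "a \<in> grade W 0 \<Longrightarrow> u \<in> carrier X1 \<Longrightarrow> \<alpha> a \<otimes> X u = X (lact X1 a u)"
    and X_right: "a \<in> grade W 0 \<Longrightarrow> u \<in> carrier X1 \<Longrightarrow>
      X u \<otimes> \<alpha> a = X (ract X1 u a) \<oplus> \<alpha> (ev1 u (d a))"
    and flat: "\<xi> \<in> carrier X2 \<Longrightarrow> (\<Oplus>i\<in>{..<p}. \<alpha> (ev2 \<xi> (d (\<omega> i))) \<otimes> X (x i))
      = (\<Oplus>j\<in>{..<p}. \<Oplus>k\<in>{..<p}. \<alpha> (ev2 \<xi> (\<omega> j \<and>\<^sub>W \<omega> k)) \<otimes> X (x k) \<otimes> X (x j))"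

lemma (in k_linear_map) finsum2:
  fixes n n' :: nat
  assumes "\<And>i j. i < n \<Longrightarrow> j < n' \<Longrightarrow> g i j \<in> carrier V"
  shows "f (\<Oplus>\<^bsub>V\<^esub>i\<in>{..<n}. \<Oplus>\<^bsub>V\<^esub>j\<in>{..<n'}. g i j) = (\<Oplus>\<^bsub>C\<^esub>i\<in>{..<n}. \<Oplus>\<^bsub>C\<^esub>j\<in>{..<n'}. f (g i j))"
proof -
  have "f (\<Oplus>\<^bsub>V\<^esub>i\<in>{..<n}. \<Oplus>\<^bsub>V\<^esub>j\<in>{..<n'}. g i j) = (\<Oplus>\<^bsub>C\<^esub>i\<in>{..<n}. f (\<Oplus>\<^bsub>V\<^esub>j\<in>{..<n'}. g i j))"
    using assms by (intro finsum) (auto intro: V.finsum_mem)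
  also have "\<dots> = (\<Oplus>\<^bsub>C\<^esub>i\<in>{..<n}. \<Oplus>\<^bsub>C\<^esub>j\<in>{..<n'}. f (g i j))"
    using assms by (intro finsum_cong_simple finsum) auto
  finally show ?thesis .
qed

context base_generators
begin

lemma \<alpha>_linear: "k_linear_map A B \<alpha>"
  by (rule k_algebra_hom.axioms(3)[OF \<alpha>_hom])

lemma \<beta>_linear: "k_linear_map A B \<beta>"
  using k_algebra_hom.axioms(3)[OF \<beta>_hom] A.k_vector_space_axioms
  by (simp add: k_linear_map_def k_linear_map_axioms_def)

text \<open>Centrality of the coevaluation in the form used below: for a balanced expression in \<open>\<omega>\<^sub>i\<close> and \<open>x\<^sub>i\<close>, an
  element \<open>a\<close> on the left of \<open>\<omega>\<^sub>i\<close> may be moved to the right of \<open>x\<^sub>i\<close>.\<close>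
lemma coev_sum:
  assumes "k_bilinear \<Omega>1 X1 B h" and "a \<in> grade W 0"
    and "\<And>m a u. m \<in> grade W 1 \<Longrightarrow> a \<in> grade W 0 \<Longrightarrow> u \<in> carrier X1 \<Longrightarrow>
      h (m \<otimes>\<^bsub>W\<^esub> a) u = h m (lact X1 a u)"
  shows "(\<Oplus>i\<in>{..<p}. h (a \<otimes>\<^bsub>W\<^esub> \<omega> i) (x i)) = (\<Oplus>i\<in>{..<p}. h (\<omega> i) (ract X1 (x i) a))"
  using coevaluation_central(2)[OF W.forms_bimodule X1_bimodule pivotal_homs(5) coev_rep(1) _ _
      assms(1) B.k_vector_space_axioms _ assms(2)] assms(3) omega_rho_mem(1) generators_mem(2)
  by simp

lemma ucoev_sum:
  assumes "k_bilinear X1 \<Omega>1 B h" and "a \<in> grade W 0"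
    and "\<And>u a m. u \<in> carrier X1 \<Longrightarrow> a \<in> grade W 0 \<Longrightarrow> m \<in> grade W 1 \<Longrightarrow>
      h (ract X1 u a) m = h u (a \<otimes>\<^bsub>W\<^esub> m)"
  shows "(\<Oplus>j\<in>{..<q}. h (lact X1 a (y j)) (\<rho> j)) = (\<Oplus>j\<in>{..<q}. h (y j) (\<rho> j \<otimes>\<^bsub>W\<^esub> a))"
  using coevaluation_central(2)[OF X1_bimodule W.forms_bimodule pivotal_homs(6) coev_rep(2) _ _
      assms(1) B.k_vector_space_axioms _ assms(2)] assms(3) omega_rho_mem(2) generators_mem(3)
  by simp

lemma ev_mem: "u \<in> carrier X1 \<Longrightarrow> \<eta> \<in> grade W 1 \<Longrightarrow> ev1 u \<eta> \<in> grade W 0"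
  "u \<in> carrier X1 \<Longrightarrow> \<eta> \<in> grade W 1 \<Longrightarrow> uev1 \<eta> u \<in> grade W 0"
  "\<xi> \<in> carrier X2 \<Longrightarrow> \<zeta> \<in> grade W 2 \<Longrightarrow> ev2 \<xi> \<zeta> \<in> grade W 0"
  "\<xi> \<in> carrier X2 \<Longrightarrow> \<zeta> \<in> grade W 2 \<Longrightarrow> uev2 \<zeta> \<xi> \<in> grade W 0"
  by (simp_all add: ev1(2) uev1(2) ev2(2) uev2(2))

lemmas closed = ev_mem \<alpha>(1) \<beta>(1) X_mem generators_mem omega_rho_mem W.diff_closed W.diff_closed_1
  W.wedge_closed W.grade_mult_zero X1.lact_closed X1.ract_closed X2.lact_closed X2.ract_closed
  W.grade_add W.grade_one B.commutator_mem

lemma null_sums: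
  assumes "first_order_null n r s"
  shows "m < n \<Longrightarrow> r m \<in> grade W 0" and "m < n \<Longrightarrow> s m \<in> grade W 0"
    and "(\<Oplus>\<^bsub>A\<^esub>m\<in>{..<n}. r m \<otimes>\<^bsub>W\<^esub> s m) = \<zero>\<^bsub>W\<^esub>"
    and "(\<Oplus>\<^bsub>\<Omega>1\<^esub>m\<in>{..<n}. r m \<otimes>\<^bsub>W\<^esub> d (s m)) = \<zero>\<^bsub>W\<^esub>"
  using assms unfolding first_order_null_def by auto

end

section \<open>From representations of \<open>D\<close> to representations of \<open>H\<close>\<close>
text \<open>Images in \<open>B\<close> of all generators of \<open>DX\<close> that satisfy its relations.  The letters in the names \<open>XO1\<close>, \<open>XO2\<close>,
  \<open>OX1\<close>, \<open>OX2\<close> give the order in the pairs \<open>(u, \<eta>)\<close>, \<open>(\<xi>, \<zeta>)\<close>, \<open>(\<eta>, u)\<close>, \<open>(\<zeta>, \<xi>)\<close>, and the digit the degree.\<close>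
locale D_model = base_model W P Q p b x q y c B \<alpha> \<beta> X
  for W :: "('k::field, 'w) dga" and P :: "('k, 'w, 'x) two_sided_dual"
    and Q :: "('k, 'w, 'y) two_sided_dual" and p :: nat and b :: "nat \<Rightarrow> 'w" and x :: "nat \<Rightarrow> 'x"
    and q :: nat and y :: "nat \<Rightarrow> 'x" and c :: "nat \<Rightarrow> 'w"
    and B :: "('k, 'e, 'z) module_scheme" (structure) and \<alpha> \<beta> :: "'w \<Rightarrow> 'e" and X :: "'x \<Rightarrow> 'e" +
  fixes XO1 :: "'x \<Rightarrow> 'w \<Rightarrow> 'e" and XO2 :: "'y \<Rightarrow> 'w \<Rightarrow> 'e"
    and OX1 :: "'w \<Rightarrow> 'x \<Rightarrow> 'e" and OX2 :: "'w \<Rightarrow> 'y \<Rightarrow> 'e"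
  assumes bilinear: "k_bilinear X1 \<Omega>1 B XO1" "k_bilinear X2 \<Omega>2 B XO2"
      "k_bilinear \<Omega>1 X1 B OX1" "k_bilinear \<Omega>2 X2 B OX2"
    and actions: "acts X1 \<Omega>1 XO1" "acts X2 \<Omega>2 XO2" "acts \<Omega>1 X1 OX1" "acts \<Omega>2 X2 OX2"
    and X_bar: "a \<in> grade W 0 \<Longrightarrow> u \<in> carrier X1 \<Longrightarrow> X u \<otimes> \<beta> a = \<beta> a \<otimes> X u \<oplus> XO1 u (d a)"
    and OX_XO_coev: "v \<in> carrier X1 \<Longrightarrow> \<eta> \<in> grade W 1 \<Longrightarrow>
      (\<Oplus>i\<in>{..<p}. OX1 (\<omega> i) v \<otimes> XO1 (x i) \<eta>) = \<beta> (uev1 \<eta> v)"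
    and XO_OX_ucoev: "v \<in> carrier X1 \<Longrightarrow> \<eta> \<in> grade W 1 \<Longrightarrow>
      (\<Oplus>j\<in>{..<q}. XO1 v (\<rho> j) \<otimes> OX1 \<eta> (y j)) = \<alpha> (ev1 v \<eta>)"
    and XO_OX_bar: "v \<in> carrier X1 \<Longrightarrow> \<eta> \<in> grade W 1 \<Longrightarrow>
      (\<Oplus>j\<in>{..<q}. XO1 (y j) \<eta> \<otimes> OX1 (\<rho> j) v) = \<beta> (ev1 v \<eta>)"
    and OX_XO: "v \<in> carrier X1 \<Longrightarrow> \<eta> \<in> grade W 1 \<Longrightarrow>
      (\<Oplus>i\<in>{..<p}. OX1 \<eta> (x i) \<otimes> XO1 v (\<omega> i)) = \<alpha> (uev1 \<eta> v)"
    and mixed: "\<xi> \<in> carrier X2 \<Longrightarrow> \<eta> \<in> grade W 1 \<Longrightarrow>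
      (\<Oplus>i\<in>{..<p}. \<Oplus>j\<in>{..<p}. \<alpha> (ev2 \<xi> (\<omega> i \<and>\<^sub>W \<omega> j)) \<otimes>
          (X (x j) \<otimes> XO1 (x i) \<eta> \<oplus> XO1 (x j) \<eta> \<otimes> X (x i)))
      = (\<Oplus>i\<in>{..<p}. \<alpha> (ev2 \<xi> (d (\<omega> i))) \<otimes> XO1 (x i) \<eta>) \<ominus> XO2 \<xi> (d \<eta>)"
    and XO2_wedge: "\<xi> \<in> carrier X2 \<Longrightarrow> \<eta> \<in> grade W 1 \<Longrightarrow> \<theta> \<in> grade W 1 \<Longrightarrow>
      (\<Oplus>i\<in>{..<p}. \<Oplus>j\<in>{..<p}. \<alpha> (ev2 \<xi> (\<omega> i \<and>\<^sub>W \<omega> j)) \<otimes> XO1 (x j) \<theta> \<otimes> XO1 (x i) \<eta>)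
      = XO2 \<xi> (\<eta> \<and>\<^sub>W \<theta>)"
    and OX2_wedge: "\<xi> \<in> carrier X2 \<Longrightarrow> \<eta> \<in> grade W 1 \<Longrightarrow> \<theta> \<in> grade W 1 \<Longrightarrow>
      (\<Oplus>i\<in>{..<q}. \<Oplus>j\<in>{..<q}. \<beta> (uev2 (\<rho> i \<and>\<^sub>W \<rho> j) \<xi>) \<otimes> OX1 \<eta> (y i) \<otimes> OX1 \<theta> (y j))
      = OX2 (\<eta> \<and>\<^sub>W \<theta>) \<xi>"

text \<open>Images in \<open>B\<close> of all generators of \<open>HX_quotient\<close> that satisfy its relations; \<open>Y v\<close> is the image of \<open>v\<close> with a bar.\<close>
locale H_model = base_model W P Q p b x q y c B \<alpha> \<beta> X
  for W :: "('k::field, 'w) dga" and P :: "('k, 'w, 'x) two_sided_dual"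
    and Q :: "('k, 'w, 'y) two_sided_dual" and p :: nat and b :: "nat \<Rightarrow> 'w" and x :: "nat \<Rightarrow> 'x"
    and q :: nat and y :: "nat \<Rightarrow> 'x" and c :: "nat \<Rightarrow> 'w"
    and B :: "('k, 'e, 'z) module_scheme" (structure) and \<alpha> \<beta> :: "'w \<Rightarrow> 'e" and X :: "'x \<Rightarrow> 'e" +
  fixes Y :: "'x \<Rightarrow> 'e"
  assumes Y_linear: "k_linear_map X1 B Y"
    and Y_left: "a \<in> grade W 0 \<Longrightarrow> v \<in> carrier X1 \<Longrightarrow> \<beta> a \<otimes> Y v = Y (ract X1 v a)"
    and Y_right: "a \<in> grade W 0 \<Longrightarrow> v \<in> carrier X1 \<Longrightarrow>
      Y v \<otimes> \<beta> a = Y (lact X1 a v) \<oplus> \<beta> (uev1 (d a) v)"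
    and X_null: "first_order_null n r s \<Longrightarrow> u \<in> carrier X1 \<Longrightarrow>
      (\<Oplus>m\<in>{..<n}. \<beta> (s m) \<otimes> X u \<otimes> \<beta> (r m)) = \<zero>"
    and Y_null: "first_order_null n r s \<Longrightarrow> v \<in> carrier X1 \<Longrightarrow>
      (\<Oplus>m\<in>{..<n}. \<alpha> (r m) \<otimes> Y v \<otimes> \<alpha> (s m)) = \<zero>"
    and Y_coev: "v \<in> carrier X1 \<Longrightarrow> (\<Oplus>i\<in>{..<p}. commutator B (Y v) (\<alpha> (b i)) \<otimes> X (x i)) = Y v"
    and X_ucoev: "u \<in> carrier X1 \<Longrightarrow> (\<Oplus>j\<in>{..<q}. commutator B (X u) (\<beta> (c j)) \<otimes> Y (y j)) = X u"
    and XY: "a \<in> grade W 0 \<Longrightarrow> u \<in> carrier X1 \<Longrightarrow>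
      (\<Oplus>j\<in>{..<q}. commutator B (X (y j)) (\<beta> a) \<otimes> commutator B (Y u) (\<alpha> (c j))) = \<beta> (ev1 u (d a))"
    and YX: "a \<in> grade W 0 \<Longrightarrow> u \<in> carrier X1 \<Longrightarrow>
      (\<Oplus>i\<in>{..<p}. commutator B (Y (x i)) (\<alpha> a) \<otimes> commutator B (X u) (\<beta> (b i))) = \<alpha> (uev1 (d a) u)"
    and X_wedge_null: "wedge_null n r s t \<Longrightarrow> \<xi> \<in> carrier X2 \<Longrightarrow>
      (\<Oplus>m\<in>{..<n}. \<Oplus>i\<in>{..<p}. \<Oplus>j\<in>{..<p}. \<alpha> (ev2 \<xi> (\<omega> i \<and>\<^sub>W \<omega> j)) \<otimes> commutator B (X (x j)) (\<beta> (t m))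
        \<otimes> commutator B (X (x i)) (\<beta> (s m)) \<otimes> \<beta> (r m)) = \<zero>"
    and Y_wedge_null: "wedge_null n r s t \<Longrightarrow> \<xi> \<in> carrier X2 \<Longrightarrow>
      (\<Oplus>m\<in>{..<n}. \<Oplus>i\<in>{..<q}. \<Oplus>j\<in>{..<q}. \<beta> (uev2 (\<rho> i \<and>\<^sub>W \<rho> j) \<xi>) \<otimes> \<alpha> (r m)
        \<otimes> commutator B (Y (y i)) (\<alpha> (s m)) \<otimes> commutator B (Y (y j)) (\<alpha> (t m))) = \<zero>"

context D_model
begin

definition Y :: "'x \<Rightarrow> 'e"
  where "Y v = (\<Oplus>i\<in>{..<p}. OX1 (\<omega> i) v \<otimes> X (x i))"

lemmas mem = closed bilinear[THEN k_bilinear_closed, simplified]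

lemmas XO1_linear = k_bilinear_linear_right[OF bilinear(1) O1.M.k_vector_space_axioms B.k_vector_space_axioms]
lemmas XO2_linear = k_bilinear_linear_right[OF bilinear(2) O2.M.k_vector_space_axioms B.k_vector_space_axioms]
lemmas OX1_linear = k_bilinear_linear_left[OF bilinear(3) O1.M.k_vector_space_axioms B.k_vector_space_axioms]
lemmas OX2_linear = k_bilinear_linear_left[OF bilinear(4) O2.M.k_vector_space_axioms B.k_vector_space_axioms]

lemma Y_linear: "k_linear_map X1 B Y"
  unfolding Y_def[abs_def]
proof (rule k_linear_map_finsum[OF X1.M.k_vector_space_axioms B.k_vector_space_axioms])
  show "k_linear_map X1 B (\<lambda>v. OX1 (\<omega> i) v \<otimes> X (x i))" if "i \<in> {..<p}" for i
    using that mem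
    by (intro k_linear_map_comp[OF k_bilinear_linear_right[OF bilinear(3) X1.M.k_vector_space_axioms
            B.k_vector_space_axioms] B.mult_right_linear]) auto
qed simp

lemmas Y_mem = k_linear_map.closed[OF Y_linear]

lemma OX_X_bilinear: "v \<in> carrier X1 \<Longrightarrow> k_bilinear \<Omega>1 X1 B (\<lambda>m u. OX1 m v \<otimes> X u)"
  by (rule B.k_bilinear_mult[OF OX1_linear X_linear]) simp

lemma OX_X_coev:
  assumes "v \<in> carrier X1" and "a \<in> grade W 0"
  shows "(\<Oplus>i\<in>{..<p}. OX1 (a \<otimes>\<^bsub>W\<^esub> \<omega> i) v \<otimes> X (x i)) = (\<Oplus>i\<in>{..<p}. OX1 (\<omega> i) v \<otimes> X (ract X1 (x i) a))"
proof (rule coev_sum[OF OX_X_bilinear[OF assms(1)] assms(2)])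
  fix m a u assume "m \<in> grade W 1" "a \<in> grade W 0" "u \<in> carrier X1"
  then show "OX1 (m \<otimes>\<^bsub>W\<^esub> a) v \<otimes> X u = OX1 m v \<otimes> X (lact X1 a u)"
    using actsD(2)[OF actions(3), of a m v] X_left[of a u, symmetric] assms
    by (simp add: mem flip: B.m_assoc)
qed

text \<open>This is what forces the definition of \<open>Y\<close>: its commutators with \<open>\<alpha>\<close> are the values of
  \<open>OX1\<close>.\<close>
lemma Y_alpha:
  assumes v: "v \<in> carrier X1" and a: "a \<in> grade W 0"
  shows "Y v \<otimes> \<alpha> a = \<alpha> a \<otimes> Y v \<oplus> OX1 (d a) v"
proof -
  have summand: "OX1 (\<omega> i) v \<otimes> X (x i) \<otimes> \<alpha> a =
      OX1 (\<omega> i) v \<otimes> X (ract X1 (x i) a) \<oplus> OX1 (\<omega> i \<otimes>\<^bsub>W\<^esub> ev1 (x i) (d a)) v" if "i < p" for i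
    using that v a actsD(2)[OF actions(3), of "ev1 (x i) (d a)" "\<omega> i" v]
    by (simp add: B.m_assoc mem X_right B.r_distr)
  have "Y v \<otimes> \<alpha> a = (\<Oplus>i\<in>{..<p}. OX1 (\<omega> i) v \<otimes> X (x i) \<otimes> \<alpha> a)"
    unfolding Y_def using v a by (intro B.finsum_mult) (auto simp: mem)
  also have "\<dots> = (\<Oplus>i\<in>{..<p}. OX1 (\<omega> i) v \<otimes> X (ract X1 (x i) a)) \<oplus>
      (\<Oplus>i\<in>{..<p}. OX1 (\<omega> i \<otimes>\<^bsub>W\<^esub> ev1 (x i) (d a)) v)"
    using v a by (simp add: summand) (rule B.finsum_plus, auto simp: mem)
  also have "(\<Oplus>i\<in>{..<p}. OX1 (\<omega> i) v \<otimes> X (ract X1 (x i) a)) = (\<Oplus>i\<in>{..<p}. \<alpha> a \<otimes> (OX1 (\<omega> i) v \<otimes> X (x i)))"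
    using v a actsD(1)[OF actions(3), of a _ v] unfolding OX_X_coev[OF v a, symmetric]
    by (intro finsum_cong_simple) (simp add: mem flip: B.m_assoc)
  also have "\<dots> = \<alpha> a \<otimes> Y v"
    unfolding Y_def using v a by (intro B.mult_finsum[symmetric]) (auto simp: mem)
  also have "(\<Oplus>i\<in>{..<p}. OX1 (\<omega> i \<otimes>\<^bsub>W\<^esub> ev1 (x i) (d a)) v) = OX1 (d a) v"
    using k_linear_map.finsum[OF OX1_linear[OF v], of "{..<p}" "\<lambda>i. \<omega> i \<otimes>\<^bsub>W\<^esub> ev1 (x i) (d a)"]
      coev_triangle[OF W.diff_closed[OF a]] a by (simp add: mem)
  finally show ?thesis .
qed

lemma commutators:
  assumes "v \<in> carrier X1" and "a \<in> grade W 0"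
  shows "commutator B (Y v) (\<alpha> a) = OX1 (d a) v" and "commutator B (X v) (\<beta> a) = XO1 v (d a)"
  using assms Y_alpha[OF assms] X_bar[OF assms(2,1)]
  by (subst B.commutator_eq_iff; simp add: mem Y_mem)+

lemma Y_beta_left:
  assumes v: "v \<in> carrier X1" and a: "a \<in> grade W 0"
  shows "\<beta> a \<otimes> Y v = Y (ract X1 v a)"
proof -
  have "\<beta> a \<otimes> Y v = (\<Oplus>i\<in>{..<p}. \<beta> a \<otimes> (OX1 (\<omega> i) v \<otimes> X (x i)))"
    unfolding Y_def using v a by (intro B.mult_finsum) (auto simp: mem)
  also have "\<dots> = Y (ract X1 v a)"
    unfolding Y_def using v a actsD(3)[OF actions(3), of a _ v]
    by (intro finsum_cong_simple) (simp add: mem flip: B.m_assoc)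
  finally show ?thesis .
qed

text \<open>Moving \<open>\<beta> a\<close> to the left past \<open>X (x i)\<close> leaves \<open>(x\<^sub>i, da)\<close>, and the sum of \<open>(\<omega>\<^sub>i, v) (x\<^sub>i, da)\<close> is known.\<close>
lemma Y_beta_right:
  assumes v: "v \<in> carrier X1" and a: "a \<in> grade W 0"
  shows "Y v \<otimes> \<beta> a = Y (lact X1 a v) \<oplus> \<beta> (uev1 (d a) v)"
proof -
  have summand: "OX1 (\<omega> i) v \<otimes> X (x i) \<otimes> \<beta> a =
      OX1 (\<omega> i) (lact X1 a v) \<otimes> X (x i) \<oplus> OX1 (\<omega> i) v \<otimes> XO1 (x i) (d a)" if "i < p" for i
    using that v a by (simp add: B.m_assoc mem X_bar B.r_distr)
      (simp add: mem actsD(4)[OF actions(3)] flip: B.m_assoc)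
  have "Y v \<otimes> \<beta> a = (\<Oplus>i\<in>{..<p}. OX1 (\<omega> i) v \<otimes> X (x i) \<otimes> \<beta> a)"
    unfolding Y_def using v a by (intro B.finsum_mult) (auto simp: mem)
  also have "\<dots> = Y (lact X1 a v) \<oplus> (\<Oplus>i\<in>{..<p}. OX1 (\<omega> i) v \<otimes> XO1 (x i) (d a))"
    unfolding Y_def using v a by (simp add: summand) (rule B.finsum_plus, auto simp: mem)
  also have "(\<Oplus>i\<in>{..<p}. OX1 (\<omega> i) v \<otimes> XO1 (x i) (d a)) = \<beta> (uev1 (d a) v)"
    by (rule OX_XO_coev[OF v W.diff_closed[OF a]])
  finally show ?thesis .
qed

text \<open>As \<open>\<beta> s X u = X u \<beta> s - (u, ds)\<close>, the sum equals \<open>X u \<beta> (\<Sum> r\<^sub>m s\<^sub>m) - (u, \<Sum> r\<^sub>m ds\<^sub>m)\<close>, and both arguments vanish.\<close>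
lemma X_first_order_null:
  assumes null: "first_order_null n r s" and u: "u \<in> carrier X1"
  shows "(\<Oplus>m\<in>{..<n}. \<beta> (s m) \<otimes> X u \<otimes> \<beta> (r m)) = \<zero>"
proof -
  note rs = null_sums(1,2)[OF null]
  have summand: "\<beta> (s m) \<otimes> X u \<otimes> \<beta> (r m) = X u \<otimes> \<beta> (r m \<otimes>\<^bsub>W\<^esub> s m) \<ominus> XO1 u (r m \<otimes>\<^bsub>W\<^esub> d (s m))" if "m < n" for m
  proof -
    have "X u \<otimes> \<beta> (r m \<otimes>\<^bsub>W\<^esub> s m) = (\<beta> (s m) \<otimes> X u \<oplus> XO1 u (d (s m))) \<otimes> \<beta> (r m)"
      using rs[OF that] u by (simp add: \<beta> mem flip: X_bar B.m_assoc)
    also have "\<dots> = \<beta> (s m) \<otimes> X u \<otimes> \<beta> (r m) \<oplus> XO1 u (r m \<otimes>\<^bsub>W\<^esub> d (s m))"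
      using rs[OF that] u actsD(4)[OF actions(1), of "r m" u "d (s m)"] by (simp add: mem B.l_distr)
    moreover have "v \<oplus> w \<ominus> w = v" if "v \<in> carrier B" "w \<in> carrier B" for v w
      using that by algebra
    ultimately show ?thesis using rs[OF that] u by (simp add: mem)
  qed
  have "(\<Oplus>m\<in>{..<n}. \<beta> (s m) \<otimes> X u \<otimes> \<beta> (r m)) =
      (\<Oplus>m\<in>{..<n}. X u \<otimes> \<beta> (r m \<otimes>\<^bsub>W\<^esub> s m)) \<ominus> (\<Oplus>m\<in>{..<n}. XO1 u (r m \<otimes>\<^bsub>W\<^esub> d (s m)))"
    using rs u by (simp add: summand) (rule B.finsum_minus, auto simp: mem)
  also have "(\<Oplus>m\<in>{..<n}. X u \<otimes> \<beta> (r m \<otimes>\<^bsub>W\<^esub> s m)) = \<zero>"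
    using k_linear_map.finsum[OF k_linear_map_comp[OF \<beta>_linear B.mult_left_linear[OF X_mem[OF u]]],
        of "{..<n}" "\<lambda>m. r m \<otimes>\<^bsub>W\<^esub> s m"] rs null_sums(3)[OF null] u
    by (simp add: mem \<beta>)
  also have "(\<Oplus>m\<in>{..<n}. XO1 u (r m \<otimes>\<^bsub>W\<^esub> d (s m))) = \<zero>"
    using k_linear_map.finsum[OF XO1_linear[OF u], of "{..<n}" "\<lambda>m. r m \<otimes>\<^bsub>W\<^esub> d (s m)"]
      rs null_sums(4)[OF null] u k_linear_map.zero[OF XO1_linear[OF u]]
    by (simp add: mem)
  finally show ?thesis by (simp add: B.minus_eq)
qed

lemma Y_first_order_null:
  assumes null: "first_order_null n r s" and v: "v \<in> carrier X1"
  shows "(\<Oplus>m\<in>{..<n}. \<alpha> (r m) \<otimes> Y v \<otimes> \<alpha> (s m)) = \<zero>"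
proof -
  note rs = null_sums(1,2)[OF null]
  have summand: "\<alpha> (r m) \<otimes> Y v \<otimes> \<alpha> (s m) = \<alpha> (r m \<otimes>\<^bsub>W\<^esub> s m) \<otimes> Y v \<oplus> OX1 (r m \<otimes>\<^bsub>W\<^esub> d (s m)) v" if "m < n" for m
    using rs[OF that] v actsD(1)[OF actions(3), of "r m" "d (s m)" v]
    by (simp add: B.m_assoc Y_mem Y_alpha mem B.r_distr \<alpha>)
  have "(\<Oplus>m\<in>{..<n}. \<alpha> (r m) \<otimes> Y v \<otimes> \<alpha> (s m)) =
      (\<Oplus>m\<in>{..<n}. \<alpha> (r m \<otimes>\<^bsub>W\<^esub> s m) \<otimes> Y v) \<oplus> (\<Oplus>m\<in>{..<n}. OX1 (r m \<otimes>\<^bsub>W\<^esub> d (s m)) v)"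
    using rs v by (simp add: summand) (rule B.finsum_plus, auto simp: mem Y_mem)
  also have "(\<Oplus>m\<in>{..<n}. \<alpha> (r m \<otimes>\<^bsub>W\<^esub> s m) \<otimes> Y v) = \<zero>"
    using k_linear_map.finsum[OF k_linear_map_comp[OF \<alpha>_linear B.mult_right_linear[OF Y_mem[OF v]]],
        of "{..<n}" "\<lambda>m. r m \<otimes>\<^bsub>W\<^esub> s m"] rs null_sums(3)[OF null] v
    by (simp add: mem \<alpha> Y_mem)
  also have "(\<Oplus>m\<in>{..<n}. OX1 (r m \<otimes>\<^bsub>W\<^esub> d (s m)) v) = \<zero>"
    using k_linear_map.finsum[OF OX1_linear[OF v], of "{..<n}" "\<lambda>m. r m \<otimes>\<^bsub>W\<^esub> d (s m)"]
      rs null_sums(4)[OF null] v k_linear_map.zero[OF OX1_linear[OF v]]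
    by (simp add: mem)
  finally show ?thesis by simp
qed

text \<open>Inserting the definition of \<open>Y\<close>, the pairs \<open>(u, \<rho>\<^sub>j)\<close> and \<open>(\<omega>\<^sub>i, y\<^sub>j)\<close> multiply to \<open>ev(u \<otimes> \<omega>\<^sub>i)\<close>, and
  \<open>\<Sum>\<^sub>i ev(u \<otimes> \<omega>\<^sub>i) x\<^sub>i = u\<close> by a triangle identity.\<close>
lemma X_from_Y:
  assumes u: "u \<in> carrier X1"
  shows "(\<Oplus>j\<in>{..<q}. XO1 u (\<rho> j) \<otimes> Y (y j)) = X u"
proof -
  have "(\<Oplus>j\<in>{..<q}. XO1 u (\<rho> j) \<otimes> Y (y j)) =
      (\<Oplus>j\<in>{..<q}. \<Oplus>i\<in>{..<p}. XO1 u (\<rho> j) \<otimes> (OX1 (\<omega> i) (y j) \<otimes> X (x i)))"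
    unfolding Y_def using u by (intro finsum_cong_simple B.mult_finsum) (auto simp: mem)
  also have "\<dots> = (\<Oplus>i\<in>{..<p}. \<Oplus>j\<in>{..<q}. XO1 u (\<rho> j) \<otimes> OX1 (\<omega> i) (y j) \<otimes> X (x i))"
    using u by (subst B.finsum_exchange) (auto simp: mem B.m_assoc)
  also have "\<dots> = (\<Oplus>i\<in>{..<p}. (\<Oplus>j\<in>{..<q}. XO1 u (\<rho> j) \<otimes> OX1 (\<omega> i) (y j)) \<otimes> X (x i))"
    using u by (intro finsum_cong_simple B.finsum_mult[symmetric]) (auto simp: mem)
  also have "\<dots> = (\<Oplus>i\<in>{..<p}. X (lact X1 (ev1 u (\<omega> i)) (x i)))"
    using u by (intro finsum_cong_simple) (simp add: XO_OX_ucoev X_left mem)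
  also have "\<dots> = X u"
    using k_linear_map.finsum[OF X_linear, of "{..<p}" "\<lambda>i. lact X1 (ev1 u (\<omega> i)) (x i)"]
      ev_triangle[OF u] u by (simp add: mem)
  finally show ?thesis .
qed

lemma two_form_mem: "wedge_null n r a e \<Longrightarrow> m < n \<Longrightarrow> r m \<in> grade W 0 \<and> a m \<in> grade W 0 \<and> e m \<in> grade W 0"
  by (auto simp: wedge_null_iff)

lemma wedge_null_sum:
  assumes "wedge_null n r a e" and "k_linear_map \<Omega>2 B f"
  shows "(\<Oplus>m\<in>{..<n}. f (r m \<otimes>\<^bsub>W\<^esub> d (a m) \<otimes>\<^bsub>W\<^esub> d (e m))) = \<zero>"
proof -
  have "(\<Oplus>\<^bsub>\<Omega>2\<^esub>m\<in>{..<n}. r m \<otimes>\<^bsub>W\<^esub> d (a m) \<otimes>\<^bsub>W\<^esub> d (e m)) = \<zero>\<^bsub>W\<^esub>"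
    using assms(1) two_form_mem[OF assms(1)] by (subst forms_finsum) (auto simp: wedge_null_iff mem)
  then show ?thesis
    using k_linear_map.finsum[OF assms(2), of "{..<n}" "\<lambda>m. r m \<otimes>\<^bsub>W\<^esub> d (a m) \<otimes>\<^bsub>W\<^esub> d (e m)"]
      k_linear_map.zero[OF assms(2)] two_form_mem[OF assms(1)] by (simp add: mem)
qed

text \<open>Each summand is the value of the linear map \<open>(\<xi>, _)\<close> at \<open>r\<^sub>m da\<^sub>m \<and> de\<^sub>m\<close>, so the sum is its value at zero.\<close>
lemma X_second_order_null:
  assumes null: "wedge_null n r a e" and \<xi>: "\<xi> \<in> carrier X2"
  shows "(\<Oplus>m\<in>{..<n}. \<Oplus>i\<in>{..<p}. \<Oplus>j\<in>{..<p}. \<alpha> (ev2 \<xi> (\<omega> i \<and>\<^sub>W \<omega> j)) \<otimes> XO1 (x j) (d (e m))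
        \<otimes> XO1 (x i) (d (a m)) \<otimes> \<beta> (r m)) = \<zero>"
proof -
  have "(\<Oplus>i\<in>{..<p}. \<Oplus>j\<in>{..<p}. \<alpha> (ev2 \<xi> (\<omega> i \<and>\<^sub>W \<omega> j)) \<otimes> XO1 (x j) (d (e m))
        \<otimes> XO1 (x i) (d (a m)) \<otimes> \<beta> (r m)) = XO2 \<xi> (r m \<otimes>\<^bsub>W\<^esub> d (a m) \<otimes>\<^bsub>W\<^esub> d (e m))" if "m < n" for m
    using two_form_mem[OF null that] \<xi>
    by (subst XO2_wedge[symmetric]) (auto simp: mem B.m_assoc actsD(4)[OF actions(1)] intro!: finsum_cong_simple)
  then show ?thesis using wedge_null_sum[OF null XO2_linear[OF \<xi>]] by simp
qed

lemma Y_second_order_null: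
  assumes null: "wedge_null n r a e" and \<xi>: "\<xi> \<in> carrier X2"
  shows "(\<Oplus>m\<in>{..<n}. \<Oplus>i\<in>{..<q}. \<Oplus>j\<in>{..<q}. \<beta> (uev2 (\<rho> i \<and>\<^sub>W \<rho> j) \<xi>) \<otimes> \<alpha> (r m)
        \<otimes> OX1 (d (a m)) (y i) \<otimes> OX1 (d (e m)) (y j)) = \<zero>"
proof -
  have "(\<Oplus>i\<in>{..<q}. \<Oplus>j\<in>{..<q}. \<beta> (uev2 (\<rho> i \<and>\<^sub>W \<rho> j) \<xi>) \<otimes> \<alpha> (r m)
        \<otimes> OX1 (d (a m)) (y i) \<otimes> OX1 (d (e m)) (y j)) = OX2 (r m \<otimes>\<^bsub>W\<^esub> d (a m) \<otimes>\<^bsub>W\<^esub> d (e m)) \<xi>" if "m < n" for m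
    using two_form_mem[OF null that] \<xi> actsD(1)[OF actions(3), of "r m" "d (a m)", symmetric]
    by (subst OX2_wedge[symmetric]) (auto simp: mem B.m_assoc intro!: finsum_cong_simple)
  then show ?thesis using wedge_null_sum[OF null OX2_linear[OF \<xi>]] by simp
qed

theorem H_model: "H_model W P Q p b x q y c B \<alpha> \<beta> X Y"
proof (rule H_model.intro[OF base_model_axioms H_model_axioms.intro], goal_cases)
  case 1 show ?case by (rule Y_linear)
next
  case (2 a v) then show ?case by (simp add: Y_beta_left)
next
  case (3 a v) then show ?case by (simp add: Y_beta_right)
next
  case (4 n r s u) then show ?case by (rule X_first_order_null)
next
  case (5 n r s u) then show ?case by (rule Y_first_order_null)
next
  case (6 v)
  then have "(\<Oplus>i\<in>{..<p}. commutator B (Y v) (\<alpha> (b i)) \<otimes> X (x i)) = Y v"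
    unfolding Y_def[of v] by (intro finsum_cong_simple) (simp add: commutators mem flip: Y_def)
  then show ?case .
next
  case (7 u) then show ?case using X_from_Y[of u] by (simp add: commutators mem)
next
  case (8 a u) then show ?case using XO_OX_bar[of u "d a"] by (simp add: commutators mem)
next
  case (9 a u) then show ?case using OX_XO[of u "d a"] by (simp add: commutators mem)
next
  case (10 n r a e \<xi>)
  then show ?case
    using X_second_order_null[OF 10] two_form_mem[OF 10(1)] by (simp add: commutators mem)
next
  case (11 n r a e \<xi>)
  then show ?case
    using Y_second_order_null[OF 11] two_form_mem[OF 11(1)] by (simp add: commutators mem)
qed

text \<open>All pairs are sums of products of \<open>\<alpha> a\<close>, \<open>\<beta> a\<close> and commutators of \<open>X u\<close> and \<open>Y v\<close> with them.\<close>
lemma homs_agree: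
  assumes f: "k_algebra_hom B C f" and g: "k_algebra_hom B C g"
    and \<alpha>_eq: "\<And>a. a \<in> grade W 0 \<Longrightarrow> f (\<alpha> a) = g (\<alpha> a)" and \<beta>_eq: "\<And>a. a \<in> grade W 0 \<Longrightarrow> f (\<beta> a) = g (\<beta> a)"
    and X_eq: "\<And>u. u \<in> carrier X1 \<Longrightarrow> f (X u) = g (X u)" and Y_eq: "\<And>u. u \<in> carrier X1 \<Longrightarrow> f (Y u) = g (Y u)"
  shows "u \<in> carrier X1 \<Longrightarrow> \<eta> \<in> grade W 1 \<Longrightarrow> f (XO1 u \<eta>) = g (XO1 u \<eta>)"
    and "u \<in> carrier X1 \<Longrightarrow> \<eta> \<in> grade W 1 \<Longrightarrow> f (OX1 \<eta> u) = g (OX1 \<eta> u)"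
    and "\<xi> \<in> carrier X2 \<Longrightarrow> \<zeta> \<in> grade W 2 \<Longrightarrow> f (XO2 \<xi> \<zeta>) = g (XO2 \<xi> \<zeta>)"
    and "\<xi> \<in> carrier X2 \<Longrightarrow> \<zeta> \<in> grade W 2 \<Longrightarrow> f (OX2 \<zeta> \<xi>) = g (OX2 \<zeta> \<xi>)"
proof -
  interpret f: k_algebra_hom B C f by fact
  interpret g: k_algebra_hom B C g by fact
  have XO1: "f (XO1 u \<eta>) = g (XO1 u \<eta>)" if u: "u \<in> carrier X1" and "\<eta> \<in> grade W 1" for u \<eta>
    using that(2)
  proof (induction rule: one_form_induct)
    case (base r a)
    then have "XO1 u (r \<otimes>\<^bsub>W\<^esub> d a) = commutator B (X u) (\<beta> a) \<otimes> \<beta> r"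
      using actsD(4)[OF actions(1), of r u "d a"] u by (simp add: commutators mem)
    then show ?case
      using base u by (simp add: f.mult g.mult f.commutator g.commutator mem \<beta>_eq X_eq)
  next
    case zero
    show ?case using k_linear_map.zero[OF XO1_linear[OF u]] by (simp add: f.zero g.zero)
  next
    case (add \<eta> \<theta>)
    then show ?case
      using k_linear_map.add[OF XO1_linear[OF u], of \<eta> \<theta>] u by (simp add: f.add g.add mem)
  qed
  have OX1: "f (OX1 \<eta> u) = g (OX1 \<eta> u)" if u: "u \<in> carrier X1" and "\<eta> \<in> grade W 1" for u \<eta>
    using that(2)
  proof (induction rule: one_form_induct)
    case (base r a)
    then have "OX1 (r \<otimes>\<^bsub>W\<^esub> d a) u = \<alpha> r \<otimes> commutator B (Y u) (\<alpha> a)"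
      using actsD(1)[OF actions(3), of r "d a" u] u by (simp add: commutators mem)
    then show ?case
      using base u by (simp add: f.mult g.mult f.commutator g.commutator mem \<alpha>_eq Y_eq Y_mem)
  next
    case zero
    show ?case using k_linear_map.zero[OF OX1_linear[OF u]] by (simp add: f.zero g.zero)
  next
    case (add \<eta> \<theta>)
    then show ?case
      using k_linear_map.add[OF OX1_linear[OF u], of \<eta> \<theta>] u by (simp add: f.add g.add mem)
  qed
  show "u \<in> carrier X1 \<Longrightarrow> \<eta> \<in> grade W 1 \<Longrightarrow> f (XO1 u \<eta>) = g (XO1 u \<eta>)" by (rule XO1)
  show "u \<in> carrier X1 \<Longrightarrow> \<eta> \<in> grade W 1 \<Longrightarrow> f (OX1 \<eta> u) = g (OX1 \<eta> u)" by (rule OX1)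
  show "f (XO2 \<xi> \<zeta>) = g (XO2 \<xi> \<zeta>)" if \<xi>: "\<xi> \<in> carrier X2" and "\<zeta> \<in> grade W 2"
    using that(2)
  proof (induction rule: two_form_induct)
    case (base \<theta> \<theta>')
    then show ?case
      unfolding XO2_wedge[OF \<xi> base, symmetric] using \<xi>
      by (subst f.finsum2, simp add: mem, subst g.finsum2)
        (simp_all add: f.mult g.mult mem \<alpha>_eq XO1)
  next
    case zero
    show ?case using k_linear_map.zero[OF XO2_linear[OF \<xi>]] by (simp add: f.zero g.zero)
  next
    case (add \<eta> \<theta>)
    then show ?case
      using k_linear_map.add[OF XO2_linear[OF \<xi>], of \<eta> \<theta>] \<xi> by (simp add: f.add g.add mem)
  qed
  show "f (OX2 \<zeta> \<xi>) = g (OX2 \<zeta> \<xi>)" if \<xi>: "\<xi> \<in> carrier X2" and "\<zeta> \<in> grade W 2"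
    using that(2)
  proof (induction rule: two_form_induct)
    case (base \<theta> \<theta>')
    then show ?case
      unfolding OX2_wedge[OF \<xi> base, symmetric] using \<xi>
      by (subst f.finsum2, simp add: mem, subst g.finsum2)
        (simp_all add: f.mult g.mult mem \<beta>_eq OX1)
  next
    case zero
    show ?case using k_linear_map.zero[OF OX2_linear[OF \<xi>]] by (simp add: f.zero g.zero)
  next
    case (add \<eta> \<theta>)
    then show ?case
      using k_linear_map.add[OF OX2_linear[OF \<xi>], of \<eta> \<theta>] \<xi> by (simp add: f.add g.add mem)
  qed
qed

end

section \<open>From representations of \<open>H\<close> to representations of \<open>D\<close>\<close>
lemma (in k_vector_space) eq_of_minus_plus_zero:
  assumes "\<zero> = \<ominus> v \<oplus> w" and "v \<in> carrier M" and "w \<in> carrier M"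
  shows "w = v"
  using r_neg2[of v w, folded assms(1)] assms(2,3) by simp

context H_model
begin

abbreviation dX :: "'x \<Rightarrow> 'w \<Rightarrow> 'e" where "dX u a \<equiv> commutator B (X u) (\<beta> a)"
abbreviation dY :: "'x \<Rightarrow> 'w \<Rightarrow> 'e" where "dY v a \<equiv> commutator B (Y v) (\<alpha> a)"

lemmas Y_mem = k_linear_map.closed[OF Y_linear]
lemmas mem' = closed Y_mem

lemma X_beta: "u \<in> carrier X1 \<Longrightarrow> a \<in> grade W 0 \<Longrightarrow> X u \<otimes> \<beta> a = \<beta> a \<otimes> X u \<oplus> dX u a"
  using B.commutator_eq_iff[of "X u" "\<beta> a" "dX u a"] by (simp add: mem')

lemma Y_alpha: "u \<in> carrier X1 \<Longrightarrow> a \<in> grade W 0 \<Longrightarrow> Y u \<otimes> \<alpha> a = \<alpha> a \<otimes> Y u \<oplus> dY u a"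
  using B.commutator_eq_iff[of "Y u" "\<alpha> a" "dY u a"] by (simp add: mem')

subsection \<open>The commutators as derivations\<close>
text \<open>These are the bimodule relations for the pairs \<open>(u, ds)\<close>.  The last one is the Leibniz rule: \<open>ds a\<close> is not exact,
  but equal to \<open>d(sa) - s da\<close>.\<close>
lemma dX_actions:
  assumes u: "u \<in> carrier X1" and a: "a \<in> grade W 0" and s: "s \<in> grade W 0"
  shows "\<alpha> a \<otimes> dX u s = dX (lact X1 a u) s"
    and "dX u s \<otimes> \<alpha> a = dX (ract X1 u a) s"
    and "\<beta> a \<otimes> dX u s = dX u (s \<otimes>\<^bsub>W\<^esub> a) \<ominus> dX u a \<otimes> \<beta> s"
proof -
  note m = mem' u a s
  have "\<alpha> a \<otimes> (X u \<otimes> \<beta> s \<ominus> \<beta> s \<otimes> X u) = \<alpha> a \<otimes> X u \<otimes> \<beta> s \<ominus> \<alpha> a \<otimes> \<beta> s \<otimes> X u"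
    using m by (simp add: B.minus_distrib B.m_assoc)
  also have "\<dots> = X (lact X1 a u) \<otimes> \<beta> s \<ominus> \<beta> s \<otimes> X (lact X1 a u)"
    using m by (simp add: comm B.m_assoc flip: X_left)
  finally show "\<alpha> a \<otimes> dX u s = dX (lact X1 a u) s" by (simp add: commutator_def)
  have "(X u \<otimes> \<beta> s \<ominus> \<beta> s \<otimes> X u) \<otimes> \<alpha> a = X u \<otimes> (\<beta> s \<otimes> \<alpha> a) \<ominus> \<beta> s \<otimes> (X u \<otimes> \<alpha> a)"
    using m by (simp add: B.minus_distrib B.m_assoc)
  also have "\<dots> = (X u \<otimes> \<alpha> a) \<otimes> \<beta> s \<ominus> \<beta> s \<otimes> (X u \<otimes> \<alpha> a)"
    using m by (simp add: B.m_assoc flip: comm)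
  also have "\<dots> = (X (ract X1 u a) \<otimes> \<beta> s \<oplus> \<beta> s \<otimes> \<alpha> (ev1 u (d a))) \<ominus>
      (\<beta> s \<otimes> X (ract X1 u a) \<oplus> \<beta> s \<otimes> \<alpha> (ev1 u (d a)))"
    using m by (simp add: X_right B.l_distr B.r_distr comm)
  also have "\<dots> = X (ract X1 u a) \<otimes> \<beta> s \<ominus> \<beta> s \<otimes> X (ract X1 u a)"
  proof -
    have "(v \<oplus> w) \<ominus> (v' \<oplus> w) = v \<ominus> v'" if "v \<in> carrier B" "v' \<in> carrier B" "w \<in> carrier B" for v v' w
      using that by algebra
    then show ?thesis using m by simp
  qed
  finally show "dX u s \<otimes> \<alpha> a = dX (ract X1 u a) s" by (simp add: commutator_def)
  have "\<beta> (s \<otimes>\<^bsub>W\<^esub> a) = \<beta> a \<otimes> \<beta> s" using m by (simp add: \<beta>)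
  moreover have "w \<otimes> (v \<otimes> t \<ominus> t \<otimes> v) = v \<otimes> (w \<otimes> t) \<ominus> w \<otimes> t \<otimes> v \<ominus> (v \<otimes> w \<ominus> w \<otimes> v) \<otimes> t"
    if "v \<in> carrier B" "w \<in> carrier B" "t \<in> carrier B" for v w t using that by algebra
  ultimately show "\<beta> a \<otimes> dX u s = dX u (s \<otimes>\<^bsub>W\<^esub> a) \<ominus> dX u a \<otimes> \<beta> s"
    using m by (simp add: commutator_def)
qed

lemma dY_actions:
  assumes v: "v \<in> carrier X1" and a: "a \<in> grade W 0" and s: "s \<in> grade W 0"
  shows "\<beta> a \<otimes> dY v s = dY (ract X1 v a) s"
    and "dY v s \<otimes> \<beta> a = dY (lact X1 a v) s"
    and "dY v s \<otimes> \<alpha> a = dY v (s \<otimes>\<^bsub>W\<^esub> a) \<ominus> \<alpha> s \<otimes> dY v a"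
proof -
  note m = mem' v a s
  have "\<beta> a \<otimes> (Y v \<otimes> \<alpha> s \<ominus> \<alpha> s \<otimes> Y v) = \<beta> a \<otimes> Y v \<otimes> \<alpha> s \<ominus> \<beta> a \<otimes> \<alpha> s \<otimes> Y v"
    using m by (simp add: B.minus_distrib B.m_assoc)
  also have "\<dots> = Y (ract X1 v a) \<otimes> \<alpha> s \<ominus> \<alpha> s \<otimes> Y (ract X1 v a)"
    using m by (simp add: B.m_assoc flip: Y_left comm)
  finally show "\<beta> a \<otimes> dY v s = dY (ract X1 v a) s" by (simp add: commutator_def)
  have "(Y v \<otimes> \<alpha> s \<ominus> \<alpha> s \<otimes> Y v) \<otimes> \<beta> a = Y v \<otimes> (\<alpha> s \<otimes> \<beta> a) \<ominus> \<alpha> s \<otimes> (Y v \<otimes> \<beta> a)"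
    using m by (simp add: B.minus_distrib B.m_assoc)
  also have "\<dots> = (Y v \<otimes> \<beta> a) \<otimes> \<alpha> s \<ominus> \<alpha> s \<otimes> (Y v \<otimes> \<beta> a)"
    using m by (simp add: B.m_assoc comm)
  also have "\<dots> = (Y (lact X1 a v) \<otimes> \<alpha> s \<oplus> \<alpha> s \<otimes> \<beta> (uev1 (d a) v)) \<ominus>
      (\<alpha> s \<otimes> Y (lact X1 a v) \<oplus> \<alpha> s \<otimes> \<beta> (uev1 (d a) v))"
    using m by (simp add: Y_right B.l_distr B.r_distr comm)
  also have "\<dots> = Y (lact X1 a v) \<otimes> \<alpha> s \<ominus> \<alpha> s \<otimes> Y (lact X1 a v)"
  proof -
    have "(v \<oplus> w) \<ominus> (v' \<oplus> w) = v \<ominus> v'" if "v \<in> carrier B" "v' \<in> carrier B" "w \<in> carrier B" for v v' w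
      using that by algebra
    then show ?thesis using m by simp
  qed
  finally show "dY v s \<otimes> \<beta> a = dY (lact X1 a v) s" by (simp add: commutator_def)
  have "\<alpha> (s \<otimes>\<^bsub>W\<^esub> a) = \<alpha> s \<otimes> \<alpha> a" using m by (simp add: \<alpha>)
  moreover have "(w \<otimes> t \<ominus> t \<otimes> w) \<otimes> r = w \<otimes> (t \<otimes> r) \<ominus> t \<otimes> r \<otimes> w \<ominus> t \<otimes> (w \<otimes> r \<ominus> r \<otimes> w)"
    if "w \<in> carrier B" "t \<in> carrier B" "r \<in> carrier B" for w t r using that by algebra
  ultimately show "dY v s \<otimes> \<alpha> a = dY v (s \<otimes>\<^bsub>W\<^esub> a) \<ominus> \<alpha> s \<otimes> dY v a"
    using m by (simp add: commutator_def)
qed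

subsection \<open>Extension to one-forms\<close>
lemma diff_one: "d \<one>\<^bsub>W\<^esub> = \<zero>\<^bsub>W\<^esub>"
proof -
  have "d \<one>\<^bsub>W\<^esub> = d \<one>\<^bsub>W\<^esub> \<oplus>\<^bsub>W\<^esub> d \<one>\<^bsub>W\<^esub>"
    using W.leibniz_zero[OF W.grade_one W.grade_one] W.grade_mem[OF W.diff_closed[OF W.grade_one]]
    by simp
  then show ?thesis
    using W.add.l_cancel_one'[of "d \<one>\<^bsub>W\<^esub>" "d \<one>\<^bsub>W\<^esub>"] W.grade_mem[OF W.diff_closed[OF W.grade_one]] by simp
qed

text \<open>A relation \<open>\<Sum> r\<^sub>m da\<^sub>m = 0\<close> becomes a first order null family once the term
  \<open>- \<Sum> r\<^sub>m a\<^sub>m \<otimes> 1\<close> is added, which is invisible to \<open>d\<close>.\<close>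
lemma null_family:
  assumes r: "\<And>m. m < n \<Longrightarrow> r m \<in> grade W 0" and s: "\<And>m. m < n \<Longrightarrow> s m \<in> grade W 0"
    and null: "(\<Oplus>\<^bsub>\<Omega>1\<^esub>m\<in>{..<n}. r m \<otimes>\<^bsub>W\<^esub> d (s m)) = \<zero>\<^bsub>W\<^esub>"
  defines "t \<equiv> \<Oplus>\<^bsub>A\<^esub>m\<in>{..<n}. r m \<otimes>\<^bsub>W\<^esub> s m"
  shows "first_order_null (Suc n) (r(n := \<ominus>\<^bsub>A\<^esub> t)) (s(n := \<one>\<^bsub>W\<^esub>))"
proof -
  have t: "t \<in> grade W 0"
    using A.finsum_mem[of "{..<n}" "\<lambda>m. r m \<otimes>\<^bsub>W\<^esub> s m"] r s by (simp add: t_def closed)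
  then have nt: "\<ominus>\<^bsub>A\<^esub> t \<in> grade W 0" using A.a_inv_closed[of t] by simp
  have fA: "(\<Oplus>\<^bsub>A\<^esub>m\<in>insert n {..<n}. g m) = g n \<oplus>\<^bsub>W\<^esub> (\<Oplus>\<^bsub>A\<^esub>m\<in>{..<n}. g m)"
    if "\<And>m. m \<le> n \<Longrightarrow> g m \<in> grade W 0" for g
    using that by (subst A.finsum_insert) (auto simp: Pi_iff)
  have fO: "(\<Oplus>\<^bsub>\<Omega>1\<^esub>m\<in>insert n {..<n}. g m) = g n \<oplus>\<^bsub>W\<^esub> (\<Oplus>\<^bsub>\<Omega>1\<^esub>m\<in>{..<n}. g m)"
    if "\<And>m. m \<le> n \<Longrightarrow> g m \<in> grade W 1" for g
    using that by (subst O1.M.finsum_insert) (auto simp: Pi_iff)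
  have "(\<Oplus>\<^bsub>A\<^esub>m\<in>{..<Suc n}. (r(n := \<ominus>\<^bsub>A\<^esub> t)) m \<otimes>\<^bsub>W\<^esub> (s(n := \<one>\<^bsub>W\<^esub>)) m) = \<ominus>\<^bsub>A\<^esub> t \<oplus>\<^bsub>W\<^esub> t"
    unfolding lessThan_Suc using r s nt t
    by (subst fA) (auto simp: closed t_def W.grade_mem[of _ 0])
  also have "\<dots> = \<zero>\<^bsub>W\<^esub>" using A.l_neg[of t] t by simp
  finally have 1: "(\<Oplus>\<^bsub>A\<^esub>m\<in>{..<Suc n}. (r(n := \<ominus>\<^bsub>A\<^esub> t)) m \<otimes>\<^bsub>W\<^esub> (s(n := \<one>\<^bsub>W\<^esub>)) m) = \<zero>\<^bsub>W\<^esub>" .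
  have "(\<Oplus>\<^bsub>\<Omega>1\<^esub>m\<in>{..<Suc n}. (r(n := \<ominus>\<^bsub>A\<^esub> t)) m \<otimes>\<^bsub>W\<^esub> d ((s(n := \<one>\<^bsub>W\<^esub>)) m)) = \<zero>\<^bsub>W\<^esub>"
    unfolding lessThan_Suc using r s nt null W.grade_zero[of 1]
    by (subst fO) (auto simp: closed diff_one W.grade_mem[of _ 0])
  with 1 r s nt show ?thesis
    unfolding first_order_null_def by (auto simp: less_Suc_eq closed)
qed

text \<open>Surjectivity of the calculus makes the forms \<open>r da\<close> a spanning family, so a map may be prescribed on them
  once it respects every relation \<open>\<Sum> r\<^sub>m da\<^sub>m = 0\<close>.\<close>
lemma one_form_extension:
  fixes f :: "'w \<times> 'w \<Rightarrow> 'e"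
  assumes f: "\<And>r a. r \<in> grade W 0 \<Longrightarrow> a \<in> grade W 0 \<Longrightarrow> f (r, a) \<in> carrier B"
    and scal: "\<And>k r a. r \<in> grade W 0 \<Longrightarrow> a \<in> grade W 0 \<Longrightarrow> f (k \<odot>\<^bsub>W\<^esub> r, a) = k \<odot> f (r, a)"
    and null: "\<And>(n::nat) r a. (\<And>m. m < n \<Longrightarrow> r m \<in> grade W 0) \<Longrightarrow> (\<And>m. m < n \<Longrightarrow> a m \<in> grade W 0) \<Longrightarrow>
      (\<Oplus>\<^bsub>\<Omega>1\<^esub>m\<in>{..<n}. r m \<otimes>\<^bsub>W\<^esub> d (a m)) = \<zero>\<^bsub>W\<^esub> \<Longrightarrow> (\<Oplus>m\<in>{..<n}. f (r m, a m)) = \<zero>"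
  shows "\<exists>F. k_linear_map \<Omega>1 B F \<and> (\<forall>r\<in>grade W 0. \<forall>a\<in>grade W 0. F (r \<otimes>\<^bsub>W\<^esub> d a) = f (r, a))"
proof -
  have "\<exists>F. k_linear_map \<Omega>1 B F \<and> (\<forall>t\<in>grade W 0 \<times> grade W 0. F (fst t \<otimes>\<^bsub>W\<^esub> d (snd t)) = f t)"
  proof (rule linear_extension[OF O1.M.k_vector_space_axioms B.k_vector_space_axioms])
    fix R v assume "v \<in> carrier \<Omega>1"
      and R: "\<And>t. t \<in> grade W 0 \<times> grade W 0 \<Longrightarrow> R (fst t \<otimes>\<^bsub>W\<^esub> d (snd t))" "R \<zero>\<^bsub>\<Omega>1\<^esub>"
      and add: "\<And>u v. u \<in> carrier \<Omega>1 \<Longrightarrow> v \<in> carrier \<Omega>1 \<Longrightarrow> R u \<Longrightarrow> R v \<Longrightarrow> R (u \<oplus>\<^bsub>\<Omega>1\<^esub> v)"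
    then have "v \<in> grade W 1" by simp
    then show "R v"
      by (induction rule: one_form_induct) (use R(1)[of "(_, _)"] R(2) add in simp_all)
  next
    fix n :: nat and t
    assume "t \<in> {..<n} \<rightarrow> grade W 0 \<times> grade W 0"
      and 0: "(\<Oplus>\<^bsub>\<Omega>1\<^esub>m\<in>{..<n}. fst (t m) \<otimes>\<^bsub>W\<^esub> d (snd (t m))) = \<zero>\<^bsub>\<Omega>1\<^esub>"
    then have t: "fst (t m) \<in> grade W 0" "snd (t m) \<in> grade W 0" if "m < n" for m using that by (auto simp: Pi_iff mem_Times_iff)
    show "(\<Oplus>m\<in>{..<n}. f (t m)) = \<zero>"
      using null[of n "\<lambda>m. fst (t m)" "\<lambda>m. snd (t m)", OF t] 0 by simp
  next
    fix k t assume "t \<in> grade W 0 \<times> grade W 0"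
    then show "\<exists>t'\<in>grade W 0 \<times> grade W 0. fst t' \<otimes>\<^bsub>W\<^esub> d (snd t') = k \<odot>\<^bsub>\<Omega>1\<^esub> (fst t \<otimes>\<^bsub>W\<^esub> d (snd t)) \<and>
        f t' = k \<odot> f t"
      by (intro bexI[of _ "(k \<odot>\<^bsub>W\<^esub> fst t, snd t)"])
        (auto simp: W.grade_smult scal W.smult_mult_left W.grade_mem[of _ 0] W.grade_mem[OF W.diff_closed])
  qed (auto simp: closed f)
  then show ?thesis by fastforce
qed

text \<open>For \<open>\<Sum> r\<^sub>m da\<^sub>m = 0\<close> the sum of \<open>[X u, \<beta> a\<^sub>m] \<beta> r\<^sub>m\<close> is \<open>X u \<beta> t\<close>, with \<open>t = \<Sum> r\<^sub>m a\<^sub>m\<close>, minus the sum of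
  \<open>\<beta> a\<^sub>m X u \<beta> r\<^sub>m\<close>; this difference is minus the relation of \<open>H\<close> for the family completed by \<open>- t \<otimes> 1\<close>.\<close>
lemma XO1_exists:
  assumes u: "u \<in> carrier X1"
  shows "\<exists>F. k_linear_map \<Omega>1 B F \<and> (\<forall>r\<in>grade W 0. \<forall>a\<in>grade W 0. F (r \<otimes>\<^bsub>W\<^esub> d a) = dX u a \<otimes> \<beta> r)"
proof -
  have "\<exists>F. k_linear_map \<Omega>1 B F \<and> (\<forall>r\<in>grade W 0. \<forall>a\<in>grade W 0. F (r \<otimes>\<^bsub>W\<^esub> d a) =
      (\<lambda>(r, a). dX u a \<otimes> \<beta> r) (r, a))"
  proof (rule one_form_extension)
    fix n :: nat and r a :: "nat \<Rightarrow> 'w"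
    assume r: "\<And>m. m < n \<Longrightarrow> r m \<in> grade W 0" and a: "\<And>m. m < n \<Longrightarrow> a m \<in> grade W 0"
      and null: "(\<Oplus>\<^bsub>\<Omega>1\<^esub>m\<in>{..<n}. r m \<otimes>\<^bsub>W\<^esub> d (a m)) = \<zero>\<^bsub>W\<^esub>"
    let ?t = "\<Oplus>\<^bsub>A\<^esub>m\<in>{..<n}. r m \<otimes>\<^bsub>W\<^esub> a m"
    have t: "?t \<in> grade W 0"
      using A.finsum_mem[of "{..<n}" "\<lambda>m. r m \<otimes>\<^bsub>W\<^esub> a m"] r a by (simp add: closed)
    have nt: "\<ominus>\<^bsub>A\<^esub> ?t \<in> grade W 0" using A.a_inv_closed[of ?t] t by simp
    let ?S = "\<Oplus>m\<in>{..<n}. \<beta> (a m) \<otimes> X u \<otimes> \<beta> (r m)"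
    have S: "?S \<in> carrier B" using r a u by (intro B.finsum_mem) (auto simp: mem')
    have "\<zero> = (\<Oplus>m\<in>{..<Suc n}. \<beta> ((a(n := \<one>\<^bsub>W\<^esub>)) m) \<otimes> X u \<otimes> \<beta> ((r(n := \<ominus>\<^bsub>A\<^esub> ?t)) m))"
      by (rule X_null[OF null_family[OF r a null] u, symmetric])
    also have "\<dots> = X u \<otimes> \<beta> (\<ominus>\<^bsub>A\<^esub> ?t) \<oplus> ?S"
      unfolding lessThan_Suc using r a u nt
      by (subst B.finsum_insert) (auto simp: mem' Pi_iff \<beta>(5))
    also have "X u \<otimes> \<beta> (\<ominus>\<^bsub>A\<^esub> ?t) = \<ominus> (X u \<otimes> \<beta> ?t)"
      using k_linear_map.uminus[OF \<beta>_linear, of ?t] t u by (simp add: mem' B.r_minus)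
    finally have zero_eq: "\<zero> = \<ominus> (X u \<otimes> \<beta> ?t) \<oplus> ?S" .
    have "?S = X u \<otimes> \<beta> ?t"
      by (rule B.eq_of_minus_plus_zero[OF zero_eq]) (use S t u in \<open>simp_all add: mem'\<close>)
    also have "\<beta> ?t = (\<Oplus>m\<in>{..<n}. \<beta> (a m) \<otimes> \<beta> (r m))"
      using k_linear_map.finsum[OF \<beta>_linear, of "{..<n}" "\<lambda>m. r m \<otimes>\<^bsub>W\<^esub> a m"] r a by (simp add: closed \<beta>)
    also have "X u \<otimes> \<dots> = (\<Oplus>m\<in>{..<n}. X u \<otimes> \<beta> (a m) \<otimes> \<beta> (r m))"
      using r a u by (subst B.mult_finsum) (auto simp: mem' B.m_assoc)
    finally have eq: "?S = (\<Oplus>m\<in>{..<n}. X u \<otimes> \<beta> (a m) \<otimes> \<beta> (r m))" .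
    have "(\<Oplus>m\<in>{..<n}. dX u (a m) \<otimes> \<beta> (r m)) = (\<Oplus>m\<in>{..<n}. X u \<otimes> \<beta> (a m) \<otimes> \<beta> (r m) \<ominus> \<beta> (a m) \<otimes> X u \<otimes> \<beta> (r m))"
      using r a u by (intro finsum_cong_simple) (simp add: commutator_def B.minus_distrib mem')
    also have "\<dots> = \<zero>"
      using r a u by (subst B.finsum_minus) (auto simp: mem' B.minus_eq_zero_iff[OF S S] simp flip: eq)
    finally show "(\<Oplus>m\<in>{..<n}. (\<lambda>(r, a). dX u a \<otimes> \<beta> r) (r m, a m)) = \<zero>" by simp
  qed (use u in \<open>simp_all add: mem' \<beta> B.smult_mult_right\<close>)
  then show ?thesis by simp
qed

lemma OX1_exists:
  assumes u: "u \<in> carrier X1"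
  shows "\<exists>F. k_linear_map \<Omega>1 B F \<and> (\<forall>r\<in>grade W 0. \<forall>a\<in>grade W 0. F (r \<otimes>\<^bsub>W\<^esub> d a) = \<alpha> r \<otimes> dY u a)"
proof -
  have "\<exists>F. k_linear_map \<Omega>1 B F \<and> (\<forall>r\<in>grade W 0. \<forall>a\<in>grade W 0. F (r \<otimes>\<^bsub>W\<^esub> d a) =
      (\<lambda>(r, a). \<alpha> r \<otimes> dY u a) (r, a))"
  proof (rule one_form_extension)
    fix n :: nat and r a :: "nat \<Rightarrow> 'w"
    assume r: "\<And>m. m < n \<Longrightarrow> r m \<in> grade W 0" and a: "\<And>m. m < n \<Longrightarrow> a m \<in> grade W 0"
      and null: "(\<Oplus>\<^bsub>\<Omega>1\<^esub>m\<in>{..<n}. r m \<otimes>\<^bsub>W\<^esub> d (a m)) = \<zero>\<^bsub>W\<^esub>"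
    let ?t = "\<Oplus>\<^bsub>A\<^esub>m\<in>{..<n}. r m \<otimes>\<^bsub>W\<^esub> a m"
    have t: "?t \<in> grade W 0"
      using A.finsum_mem[of "{..<n}" "\<lambda>m. r m \<otimes>\<^bsub>W\<^esub> a m"] r a by (simp add: closed)
    have nt: "\<ominus>\<^bsub>A\<^esub> ?t \<in> grade W 0" using A.a_inv_closed[of ?t] t by simp
    let ?S = "\<Oplus>m\<in>{..<n}. \<alpha> (r m) \<otimes> Y u \<otimes> \<alpha> (a m)"
    have S: "?S \<in> carrier B" using r a u by (intro B.finsum_mem) (auto simp: mem')
    have "\<zero> = (\<Oplus>m\<in>{..<Suc n}. \<alpha> ((r(n := \<ominus>\<^bsub>A\<^esub> ?t)) m) \<otimes> Y u \<otimes> \<alpha> ((a(n := \<one>\<^bsub>W\<^esub>)) m))"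
      by (rule Y_null[OF null_family[OF r a null] u, symmetric])
    also have "\<dots> = \<alpha> (\<ominus>\<^bsub>A\<^esub> ?t) \<otimes> Y u \<oplus> ?S"
      unfolding lessThan_Suc using r a u nt
      by (subst B.finsum_insert) (auto simp: mem' Pi_iff \<alpha>(5))
    also have "\<alpha> (\<ominus>\<^bsub>A\<^esub> ?t) \<otimes> Y u = \<ominus> (\<alpha> ?t \<otimes> Y u)"
      using k_linear_map.uminus[OF \<alpha>_linear, of ?t] t u by (simp add: mem' B.l_minus)
    finally have zero_eq: "\<zero> = \<ominus> (\<alpha> ?t \<otimes> Y u) \<oplus> ?S" .
    have "?S = \<alpha> ?t \<otimes> Y u"
      by (rule B.eq_of_minus_plus_zero[OF zero_eq]) (use S t u in \<open>simp_all add: mem'\<close>)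
    also have "\<alpha> ?t = (\<Oplus>m\<in>{..<n}. \<alpha> (r m) \<otimes> \<alpha> (a m))"
      using k_linear_map.finsum[OF \<alpha>_linear, of "{..<n}" "\<lambda>m. r m \<otimes>\<^bsub>W\<^esub> a m"] r a by (simp add: closed \<alpha>)
    also have "\<dots> \<otimes> Y u = (\<Oplus>m\<in>{..<n}. \<alpha> (r m) \<otimes> (\<alpha> (a m) \<otimes> Y u))"
      using r a u by (subst B.finsum_mult) (auto simp: mem' B.m_assoc)
    finally have eq: "?S = (\<Oplus>m\<in>{..<n}. \<alpha> (r m) \<otimes> (\<alpha> (a m) \<otimes> Y u))" .
    have "(\<Oplus>m\<in>{..<n}. \<alpha> (r m) \<otimes> dY u (a m)) = (\<Oplus>m\<in>{..<n}. \<alpha> (r m) \<otimes> Y u \<otimes> \<alpha> (a m) \<ominus> \<alpha> (r m) \<otimes> (\<alpha> (a m) \<otimes> Y u))"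
      using r a u by (intro finsum_cong_simple) (simp add: commutator_def B.minus_distrib mem' B.m_assoc)
    also have "\<dots> = \<zero>"
      using r a u by (subst B.finsum_minus) (auto simp: mem' B.minus_eq_zero_iff[OF S S] simp flip: eq)
    finally show "(\<Oplus>m\<in>{..<n}. (\<lambda>(r, a). \<alpha> r \<otimes> dY u a) (r m, a m)) = \<zero>" by simp
  qed (use u in \<open>simp_all add: mem' \<alpha> B.smult_mult_left\<close>)
  then show ?thesis by simp
qed

text \<open>The choice is immaterial, as a linear map on one-forms is determined by its values at \<open>r da\<close>; the same holds
  for \<open>OX1\<close>.\<close>
definition XO1 :: "'x \<Rightarrow> 'w \<Rightarrow> 'e" where
  "XO1 u = (SOME F. k_linear_map \<Omega>1 B F \<and>
    (\<forall>r\<in>grade W 0. \<forall>a\<in>grade W 0. F (r \<otimes>\<^bsub>W\<^esub> d a) = dX u a \<otimes> \<beta> r))"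

definition OX1 :: "'w \<Rightarrow> 'x \<Rightarrow> 'e" where
  "OX1 \<eta> u = (SOME F. k_linear_map \<Omega>1 B F \<and>
    (\<forall>r\<in>grade W 0. \<forall>a\<in>grade W 0. F (r \<otimes>\<^bsub>W\<^esub> d a) = \<alpha> r \<otimes> dY u a)) \<eta>"

lemma XO1_linear: "u \<in> carrier X1 \<Longrightarrow> k_linear_map \<Omega>1 B (XO1 u)"
  and XO1_base: "u \<in> carrier X1 \<Longrightarrow> r \<in> grade W 0 \<Longrightarrow> a \<in> grade W 0 \<Longrightarrow> XO1 u (r \<otimes>\<^bsub>W\<^esub> d a) = dX u a \<otimes> \<beta> r"
  using someI_ex[OF XO1_exists] unfolding XO1_def by blast+

lemma OX1_linear: "u \<in> carrier X1 \<Longrightarrow> k_linear_map \<Omega>1 B (\<lambda>\<eta>. OX1 \<eta> u)"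
  and OX1_base: "u \<in> carrier X1 \<Longrightarrow> r \<in> grade W 0 \<Longrightarrow> a \<in> grade W 0 \<Longrightarrow> OX1 (r \<otimes>\<^bsub>W\<^esub> d a) u = \<alpha> r \<otimes> dY u a"
  using someI_ex[OF OX1_exists] unfolding OX1_def by blast+

lemma XO1_d: "u \<in> carrier X1 \<Longrightarrow> a \<in> grade W 0 \<Longrightarrow> XO1 u (d a) = dX u a"
  using XO1_base[of u "\<one>\<^bsub>W\<^esub>" a] W.grade_mem[OF W.diff_closed[of a]] by (simp add: mem' \<beta>)

lemma OX1_d: "u \<in> carrier X1 \<Longrightarrow> a \<in> grade W 0 \<Longrightarrow> OX1 (d a) u = dY u a"
  using OX1_base[of u "\<one>\<^bsub>W\<^esub>" a] W.grade_mem[OF W.diff_closed[of a]] by (simp add: mem' \<alpha>)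

lemmas XO1_mem = k_linear_map.closed[OF XO1_linear, simplified]
lemmas OX1_mem = k_linear_map.closed[OF OX1_linear, simplified]
lemmas XO1_add = k_linear_map.add[OF XO1_linear, simplified]
lemmas OX1_add = k_linear_map.add[OF OX1_linear, simplified]
lemmas XO1_zero = k_linear_map.zero[OF XO1_linear, simplified]
lemmas OX1_zero = k_linear_map.zero[OF OX1_linear, simplified]
lemmas mem = mem' XO1_mem OX1_mem

lemma XO1_bilinear: "k_bilinear X1 \<Omega>1 B XO1"
proof (rule k_bilinearI)
  show "k_linear_map \<Omega>1 B (XO1 u)" if "u \<in> carrier X1" for u using that by (rule XO1_linear)
  fix \<eta> assume "\<eta> \<in> carrier \<Omega>1"
  then have "\<eta> \<in> grade W 1" by simp
  then show "k_linear_map X1 B (\<lambda>u. XO1 u \<eta>)"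
  proof (induction rule: one_form_induct)
    case (base r a)
    have "k_linear_map X1 B (\<lambda>u. dX u a \<otimes> \<beta> r)"
      using base by (intro k_linear_map_comp[OF k_linear_map_comp[OF X_linear B.commutator_linear] B.mult_right_linear]) (simp_all add: mem)
    then show ?case by (rule k_linear_map_cong) (simp add: XO1_base base)
  next
    case zero
    show ?case
      using k_linear_map_zero[OF X1.M.k_vector_space_axioms B.k_vector_space_axioms]
      by (rule k_linear_map_cong) (simp add: XO1_zero)
  next
    case (add \<eta> \<theta>)
    show ?case
      using k_linear_map_add[OF add(3,4)] by (rule k_linear_map_cong) (simp add: XO1_add add)
  qed
qed

lemma OX1_bilinear: "k_bilinear \<Omega>1 X1 B OX1"
proof (rule k_bilinearI)
  show "k_linear_map \<Omega>1 B (\<lambda>\<eta>. OX1 \<eta> u)" if "u \<in> carrier X1" for u using that by (rule OX1_linear)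
  fix \<eta> assume "\<eta> \<in> carrier \<Omega>1"
  then have "\<eta> \<in> grade W 1" by simp
  then show "k_linear_map X1 B (OX1 \<eta>)"
  proof (induction rule: one_form_induct)
    case (base r a)
    have "k_linear_map X1 B (\<lambda>u. \<alpha> r \<otimes> dY u a)"
      using base by (intro k_linear_map_comp[OF k_linear_map_comp[OF Y_linear B.commutator_linear] B.mult_left_linear]) (simp_all add: mem)
    then show ?case by (rule k_linear_map_cong) (simp add: OX1_base base)
  next
    case zero
    show ?case
      using k_linear_map_zero[OF X1.M.k_vector_space_axioms B.k_vector_space_axioms]
      by (rule k_linear_map_cong) (simp add: OX1_zero)
  next
    case (add \<eta> \<theta>)
    show ?case
      using k_linear_map_add[OF add(3,4)] by (rule k_linear_map_cong) (simp add: OX1_add add)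
  qed
qed

lemma base_leibniz:
  assumes "r \<in> grade W 0" "s \<in> grade W 0" "a \<in> grade W 0"
  shows "r \<otimes>\<^bsub>W\<^esub> d s \<otimes>\<^bsub>W\<^esub> a \<oplus>\<^bsub>W\<^esub> (r \<otimes>\<^bsub>W\<^esub> s) \<otimes>\<^bsub>W\<^esub> d a = r \<otimes>\<^bsub>W\<^esub> d (s \<otimes>\<^bsub>W\<^esub> a)"
  using assms W.grade_mem[OF W.diff_closed[of s]] W.grade_mem[OF W.diff_closed[of a]]
  by (simp add: W.leibniz_zero[of s a 0] W.grade_mem[of _ 0] W.r_distr W.m_assoc)

lemma XO1_acts: "acts X1 \<Omega>1 XO1"
  unfolding acts_def
proof (intro ballI)
  fix a u \<eta> assume a: "a \<in> grade W 0" and u: "u \<in> carrier X1" and "\<eta> \<in> carrier \<Omega>1"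
  then have "\<eta> \<in> grade W 1" by simp
  then have "\<alpha> a \<otimes> XO1 u \<eta> = XO1 (lact X1 a u) \<eta> \<and> XO1 u \<eta> \<otimes> \<alpha> a = XO1 (ract X1 u a) \<eta> \<and>
    \<beta> a \<otimes> XO1 u \<eta> = XO1 u (\<eta> \<otimes>\<^bsub>W\<^esub> a) \<and> XO1 u \<eta> \<otimes> \<beta> a = XO1 u (a \<otimes>\<^bsub>W\<^esub> \<eta>)"
  proof (induction rule: one_form_induct)
    case (base r s)
    have "XO1 u (r \<otimes>\<^bsub>W\<^esub> d s \<otimes>\<^bsub>W\<^esub> a) \<oplus> dX u a \<otimes> \<beta> (r \<otimes>\<^bsub>W\<^esub> s) = dX u (s \<otimes>\<^bsub>W\<^esub> a) \<otimes> \<beta> r"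
      using base a u XO1_add[of u "r \<otimes>\<^bsub>W\<^esub> d s \<otimes>\<^bsub>W\<^esub> a" "(r \<otimes>\<^bsub>W\<^esub> s) \<otimes>\<^bsub>W\<^esub> d a"]
      by (simp add: mem base_leibniz XO1_base)
    moreover have "dX u (s \<otimes>\<^bsub>W\<^esub> a) \<otimes> \<beta> r = \<beta> a \<otimes> (dX u s \<otimes> \<beta> r) \<oplus> dX u a \<otimes> \<beta> (r \<otimes>\<^bsub>W\<^esub> s)"
    proof -
      have "(v \<ominus> w) \<otimes> t \<oplus> w \<otimes> t = v \<otimes> t" if "v \<in> carrier B" "w \<in> carrier B" "t \<in> carrier B" for v w t
        using that by algebra
      moreover have "\<beta> a \<otimes> (dX u s \<otimes> \<beta> r) = (dX u (s \<otimes>\<^bsub>W\<^esub> a) \<ominus> dX u a \<otimes> \<beta> s) \<otimes> \<beta> r"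
        using base a u by (subst dX_actions(3)[OF u a base(2), symmetric]) (simp add: mem B.m_assoc)
      moreover have "dX u a \<otimes> \<beta> (r \<otimes>\<^bsub>W\<^esub> s) = dX u a \<otimes> \<beta> s \<otimes> \<beta> r"
        using base a u by (simp add: mem \<beta> B.m_assoc)
      ultimately show ?thesis using base a u by (simp add: mem)
    qed
    ultimately have 3: "XO1 u (r \<otimes>\<^bsub>W\<^esub> d s \<otimes>\<^bsub>W\<^esub> a) = \<beta> a \<otimes> (dX u s \<otimes> \<beta> r)"
      using base a u by (simp add: mem)
    have 2: "dX u s \<otimes> \<beta> r \<otimes> \<alpha> a = dX u s \<otimes> \<alpha> a \<otimes> \<beta> r"
      using base a u by (simp add: mem B.m_assoc comm)
    have 4: "XO1 u (a \<otimes>\<^bsub>W\<^esub> (r \<otimes>\<^bsub>W\<^esub> d s)) = XO1 u (a \<otimes>\<^bsub>W\<^esub> r \<otimes>\<^bsub>W\<^esub> d s)"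
      using base a W.grade_mem[OF W.diff_closed[of s]] by (simp add: W.m_assoc W.grade_mem[of _ 0])
    show ?case
      using base a u by (simp add: XO1_base mem 2 3 4 dX_actions(2)[OF u a base(2)] \<beta>)
        (simp add: mem B.m_assoc flip: dX_actions(1)[OF u a base(2)])
  next
    case zero
    then show ?case using a u by (simp add: XO1_zero mem W.grade_mem[of _ 0])
  next
    case (add \<eta> \<theta>)
    then show ?case
      using a u by (simp add: XO1_add mem B.l_distr B.r_distr W.l_distr W.r_distr W.grade_mem[of _ 0] W.grade_mem[of _ 1])
  qed
  then show "\<alpha> a \<otimes> XO1 u \<eta> = XO1 (lact X1 a u) \<eta> \<and> XO1 u \<eta> \<otimes> \<alpha> a = XO1 (ract X1 u a) \<eta> \<and>
    \<beta> a \<otimes> XO1 u \<eta> = XO1 u (ract \<Omega>1 \<eta> a) \<and> XO1 u \<eta> \<otimes> \<beta> a = XO1 u (lact \<Omega>1 a \<eta>)" by simp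
qed

lemma OX1_acts: "acts \<Omega>1 X1 OX1"
  unfolding acts_def
proof (intro ballI)
  fix a \<eta> u assume a: "a \<in> grade W 0" and u: "u \<in> carrier X1" and "\<eta> \<in> carrier \<Omega>1"
  then have "\<eta> \<in> grade W 1" by simp
  then have "\<alpha> a \<otimes> OX1 \<eta> u = OX1 (a \<otimes>\<^bsub>W\<^esub> \<eta>) u \<and> OX1 \<eta> u \<otimes> \<alpha> a = OX1 (\<eta> \<otimes>\<^bsub>W\<^esub> a) u \<and>
    \<beta> a \<otimes> OX1 \<eta> u = OX1 \<eta> (ract X1 u a) \<and> OX1 \<eta> u \<otimes> \<beta> a = OX1 \<eta> (lact X1 a u)"
  proof (induction rule: one_form_induct)
    case (base r s)
    have "OX1 (r \<otimes>\<^bsub>W\<^esub> d s \<otimes>\<^bsub>W\<^esub> a) u \<oplus> \<alpha> (r \<otimes>\<^bsub>W\<^esub> s) \<otimes> dY u a = \<alpha> r \<otimes> dY u (s \<otimes>\<^bsub>W\<^esub> a)"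
      using base a u OX1_add[of u "r \<otimes>\<^bsub>W\<^esub> d s \<otimes>\<^bsub>W\<^esub> a" "(r \<otimes>\<^bsub>W\<^esub> s) \<otimes>\<^bsub>W\<^esub> d a"]
      by (simp add: mem base_leibniz OX1_base)
    moreover have "\<alpha> r \<otimes> dY u (s \<otimes>\<^bsub>W\<^esub> a) = \<alpha> r \<otimes> dY u s \<otimes> \<alpha> a \<oplus> \<alpha> (r \<otimes>\<^bsub>W\<^esub> s) \<otimes> dY u a"
    proof -
      have "t \<otimes> (v \<ominus> w) \<oplus> t \<otimes> w = t \<otimes> v" if "v \<in> carrier B" "w \<in> carrier B" "t \<in> carrier B" for v w t
        using that by algebra
      moreover have "\<alpha> r \<otimes> dY u s \<otimes> \<alpha> a = \<alpha> r \<otimes> (dY u (s \<otimes>\<^bsub>W\<^esub> a) \<ominus> \<alpha> s \<otimes> dY u a)"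
        using base a u by (subst dY_actions(3)[OF u a base(2), symmetric]) (simp add: mem B.m_assoc)
      moreover have "\<alpha> (r \<otimes>\<^bsub>W\<^esub> s) \<otimes> dY u a = \<alpha> r \<otimes> (\<alpha> s \<otimes> dY u a)"
        using base a u by (simp add: mem \<alpha> B.m_assoc)
      ultimately show ?thesis using base a u by (simp add: mem)
    qed
    ultimately have 3: "OX1 (r \<otimes>\<^bsub>W\<^esub> d s \<otimes>\<^bsub>W\<^esub> a) u = \<alpha> r \<otimes> dY u s \<otimes> \<alpha> a"
      using base a u by (simp add: mem)
    have 2: "\<beta> a \<otimes> (\<alpha> r \<otimes> dY u s) = \<alpha> r \<otimes> (\<beta> a \<otimes> dY u s)"
      using base a u by (simp add: mem comm flip: B.m_assoc)
    have 4: "OX1 (a \<otimes>\<^bsub>W\<^esub> (r \<otimes>\<^bsub>W\<^esub> d s)) u = OX1 (a \<otimes>\<^bsub>W\<^esub> r \<otimes>\<^bsub>W\<^esub> d s) u"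
      using base a W.grade_mem[OF W.diff_closed[of s]] by (simp add: W.m_assoc W.grade_mem[of _ 0])
    show ?case
      using base a u by (simp add: OX1_base mem 2 3 4 dY_actions(1)[OF u a base(2)] \<alpha> B.m_assoc)
        (simp add: mem flip: dY_actions(2)[OF u a base(2)])
  next
    case zero
    then show ?case using a u by (simp add: OX1_zero mem W.grade_mem[of _ 0])
  next
    case (add \<eta> \<theta>)
    then show ?case
      using a u by (simp add: OX1_add mem B.l_distr B.r_distr W.l_distr W.r_distr W.grade_mem[of _ 0] W.grade_mem[of _ 1])
  qed
  then show "\<alpha> a \<otimes> OX1 \<eta> u = OX1 (lact \<Omega>1 a \<eta>) u \<and> OX1 \<eta> u \<otimes> \<alpha> a = OX1 (ract \<Omega>1 \<eta> a) u \<and>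
    \<beta> a \<otimes> OX1 \<eta> u = OX1 \<eta> (ract X1 u a) \<and> OX1 \<eta> u \<otimes> \<beta> a = OX1 \<eta> (lact X1 a u)" by simp
qed

end

context pivotal_calculus
begin

text \<open>Two-forms are sums of products of one-forms, and in a product \<open>\<eta> \<and> (s de)\<close> the coefficient \<open>s\<close> can be absorbed
  into \<open>\<eta>\<close>.\<close>
lemma exact_two_form_induct [consumes 1, case_names base zero add]:
  assumes "\<zeta> \<in> grade W 2"
    and base: "\<And>r a e. r \<in> grade W 0 \<Longrightarrow> a \<in> grade W 0 \<Longrightarrow> e \<in> grade W 0 \<Longrightarrow>
      R (r \<otimes>\<^bsub>W\<^esub> d a \<otimes>\<^bsub>W\<^esub> d e)"
    and zero: "R \<zero>\<^bsub>W\<^esub>"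
    and add: "\<And>\<eta> \<theta>. \<eta> \<in> grade W 2 \<Longrightarrow> \<theta> \<in> grade W 2 \<Longrightarrow> R \<eta> \<Longrightarrow> R \<theta> \<Longrightarrow> R (\<eta> \<oplus>\<^bsub>W\<^esub> \<theta>)"
  shows "R \<zeta>"
  using assms(1)
proof (induction rule: two_form_induct)
  note cl = W.grade_mem[of _ 0] W.grade_mem[of _ 1] W.diff_closed W.wedge_closed W.grade_mult_zero
  have 1: "R (\<theta> \<otimes>\<^bsub>W\<^esub> d e)" if "\<theta> \<in> grade W 1" and e: "e \<in> grade W 0" for \<theta> e
    using that(1)
    by (induction rule: one_form_induct)
      (use e in \<open>simp_all add: base zero add cl W.l_distr\<close>)
  fix \<theta> \<theta>' assume \<theta>: "\<theta> \<in> grade W 1" and \<theta>': "\<theta>' \<in> grade W 1"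
  show "R (\<theta> \<otimes>\<^bsub>W\<^esub> \<theta>')"
    using \<theta>'
  proof (induction \<theta>' rule: one_form_induct)
    case (base r a)
    then show ?case using 1[of "\<theta> \<otimes>\<^bsub>W\<^esub> r" a] \<theta> by (simp add: cl W.m_assoc)
  qed (use \<theta> in \<open>simp_all add: zero add cl W.r_distr\<close>)
qed (auto simp: zero add)

lemma ev_linear:
  "u \<in> carrier X1 \<Longrightarrow> k_linear_map \<Omega>1 A (ev1 u)"
  "u \<in> carrier X1 \<Longrightarrow> k_linear_map \<Omega>1 A (\<lambda>\<eta>. uev1 \<eta> u)"
  "\<xi> \<in> carrier X2 \<Longrightarrow> k_linear_map \<Omega>2 A (ev2 \<xi>)"
  "\<xi> \<in> carrier X2 \<Longrightarrow> k_linear_map \<Omega>2 A (\<lambda>\<zeta>. uev2 \<zeta> \<xi>)"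
  "\<zeta> \<in> grade W 2 \<Longrightarrow> k_linear_map X2 A (\<lambda>\<xi>. ev2 \<xi> \<zeta>)"
  "\<zeta> \<in> grade W 2 \<Longrightarrow> k_linear_map X2 A (uev2 \<zeta>)"
  using k_bilinear_linear_right[OF ev1(1) O1.M.k_vector_space_axioms A.k_vector_space_axioms]
    k_bilinear_linear_left[OF uev1(1) O1.M.k_vector_space_axioms A.k_vector_space_axioms]
    k_bilinear_linear_right[OF ev2(1) O2.M.k_vector_space_axioms A.k_vector_space_axioms]
    k_bilinear_linear_left[OF uev2(1) O2.M.k_vector_space_axioms A.k_vector_space_axioms]
    k_bilinear_linear_left[OF ev2(1) X2.M.k_vector_space_axioms A.k_vector_space_axioms]
    k_bilinear_linear_right[OF uev2(1) X2.M.k_vector_space_axioms A.k_vector_space_axioms]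
  by simp_all

lemma wedge_linear:
  "\<eta> \<in> grade W 1 \<Longrightarrow> k_linear_map \<Omega>1 \<Omega>2 (\<lambda>\<theta>. \<eta> \<otimes>\<^bsub>W\<^esub> \<theta>)"
  "\<eta> \<in> grade W 1 \<Longrightarrow> k_linear_map \<Omega>1 \<Omega>2 (\<lambda>\<theta>. \<theta> \<otimes>\<^bsub>W\<^esub> \<eta>)"
  using k_bilinear_linear_right[OF wedge_bilinear O1.M.k_vector_space_axioms O2.M.k_vector_space_axioms]
    k_bilinear_linear_left[OF wedge_bilinear O1.M.k_vector_space_axioms O2.M.k_vector_space_axioms]
  by simp_all

lemma diff_linear: "k_linear_map \<Omega>1 \<Omega>2 d"
  by unfold_locales (simp_all add: W.diff_closed_1 W.diff_add W.diff_smult W.grade_mem[of _ 1])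

lemma one_form_maps_eq:
  assumes f: "k_linear_map \<Omega>1 C f" and g: "k_linear_map \<Omega>1 C g"
    and eq: "\<And>r a. r \<in> grade W 0 \<Longrightarrow> a \<in> grade W 0 \<Longrightarrow> f (r \<otimes>\<^bsub>W\<^esub> d a) = g (r \<otimes>\<^bsub>W\<^esub> d a)"
    and "\<eta> \<in> grade W 1"
  shows "f \<eta> = g \<eta>"
  using assms(4)
  by (induction rule: one_form_induct)
    (use k_linear_map.add[OF f] k_linear_map.add[OF g] k_linear_map.zero[OF f] k_linear_map.zero[OF g] eq in simp_all)

lemma two_form_maps_eq:
  assumes f: "k_linear_map \<Omega>2 C f" and g: "k_linear_map \<Omega>2 C g"
    and eq: "\<And>\<eta> \<theta>. \<eta> \<in> grade W 1 \<Longrightarrow> \<theta> \<in> grade W 1 \<Longrightarrow> f (\<eta> \<otimes>\<^bsub>W\<^esub> \<theta>) = g (\<eta> \<otimes>\<^bsub>W\<^esub> \<theta>)"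
    and "\<zeta> \<in> grade W 2"
  shows "f \<zeta> = g \<zeta>"
  using assms(4)
  by (induction rule: two_form_induct)
    (use k_linear_map.add[OF f] k_linear_map.add[OF g] k_linear_map.zero[OF f] k_linear_map.zero[OF g] eq in simp_all)

end

context H_model
begin

lemma X_commutator_bar: "u \<in> carrier X1 \<Longrightarrow> a \<in> grade W 0 \<Longrightarrow> dX u a = X u \<otimes> \<beta> a \<ominus> \<beta> a \<otimes> X u"
  and Y_commutator: "u \<in> carrier X1 \<Longrightarrow> a \<in> grade W 0 \<Longrightarrow> dY u a = Y u \<otimes> \<alpha> a \<ominus> \<alpha> a \<otimes> Y u"
  by (simp_all add: commutator_def)

lemma cancel: "v \<in> carrier B \<Longrightarrow> w \<in> carrier B \<Longrightarrow> v \<oplus> w \<ominus> v = w"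
  by algebra

subsection \<open>The duality relations\<close>
lemma linear_sums:
  assumes "\<And>i. i < n \<Longrightarrow> v i \<in> carrier B" and "\<And>i. i < n \<Longrightarrow> k_linear_map V B (f i)" and "k_vector_space V"
  shows "k_linear_map V B (\<lambda>\<eta>. \<Oplus>i\<in>{..<n::nat}. v i \<otimes> f i \<eta>)" and "k_linear_map V B (\<lambda>\<eta>. \<Oplus>i\<in>{..<n}. f i \<eta> \<otimes> v i)"
  by (rule k_linear_map_finsum[OF assms(3) B.k_vector_space_axioms];
      use assms in \<open>auto intro: k_linear_map_comp[OF _ B.mult_left_linear] k_linear_map_comp[OF _ B.mult_right_linear]\<close>)+

text \<open>Both sides are linear and compatible with the actions in \<open>\<eta>\<close>, which reduces the claim to \<open>\<eta> = da\<close>.  There it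
  is the commutator of \<open>\<Sum>\<^sub>i (\<omega>\<^sub>i, v) x\<^sub>i = Y v\<close> with \<open>\<beta> a\<close>.\<close>
lemma OX_XO_coev:
  assumes v: "v \<in> carrier X1" and \<eta>: "\<eta> \<in> grade W 1"
  shows "(\<Oplus>i\<in>{..<p}. OX1 (\<omega> i) v \<otimes> XO1 (x i) \<eta>) = \<beta> (uev1 \<eta> v)"
proof (rule one_form_maps_eq[OF _ k_linear_map_comp[OF ev_linear(2)[OF v] \<beta>_linear] _ \<eta>])
  show "k_linear_map \<Omega>1 B (\<lambda>\<eta>. \<Oplus>i\<in>{..<p}. OX1 (\<omega> i) v \<otimes> XO1 (x i) \<eta>)"
    by (rule linear_sums(1)) (use v in \<open>simp_all add: mem XO1_linear O1.M.k_vector_space_axioms\<close>)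
  fix r a assume r: "r \<in> grade W 0" and a: "a \<in> grade W 0"
  have "(\<Oplus>i\<in>{..<p}. dY v (b i) \<otimes> dX (x i) a)
      = (\<Oplus>i\<in>{..<p}. dY v (b i) \<otimes> X (x i) \<otimes> \<beta> a \<ominus> dY (lact X1 a v) (b i) \<otimes> X (x i))"
    using v a by (intro finsum_cong_simple)
      (simp add: X_commutator_bar B.minus_distrib mem B.m_assoc flip: dY_actions(2))
  also have "\<dots> = (\<Oplus>i\<in>{..<p}. dY v (b i) \<otimes> X (x i)) \<otimes> \<beta> a \<ominus> (\<Oplus>i\<in>{..<p}. dY (lact X1 a v) (b i) \<otimes> X (x i))"
    using v a by (subst B.finsum_minus) (auto simp: mem, subst B.finsum_mult, auto simp: mem)
  also have "\<dots> = \<beta> (uev1 (d a) v)"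
    using v a by (simp add: Y_coev Y_right mem cancel)
  finally have *: "(\<Oplus>i\<in>{..<p}. dY v (b i) \<otimes> dX (x i) a) = \<beta> (uev1 (d a) v)" .
  have "(\<Oplus>i\<in>{..<p}. OX1 (\<omega> i) v \<otimes> XO1 (x i) (r \<otimes>\<^bsub>W\<^esub> d a)) = (\<Oplus>i\<in>{..<p}. dY v (b i) \<otimes> dX (x i) a \<otimes> \<beta> r)"
    using v r a by (intro finsum_cong_simple) (simp add: XO1_base OX1_d mem B.m_assoc)
  also have "\<dots> = \<beta> (uev1 (d a) v) \<otimes> \<beta> r"
    using v r a by (subst B.finsum_mult[symmetric]) (auto simp: mem *)
  also have "\<dots> = \<beta> (uev1 (r \<otimes>\<^bsub>W\<^esub> d a) v)"
    using v r a uev1(3)[of "d a" v r] by (simp add: mem \<beta>)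
  finally show "(\<Oplus>i\<in>{..<p}. OX1 (\<omega> i) v \<otimes> XO1 (x i) (r \<otimes>\<^bsub>W\<^esub> d a)) = \<beta> (uev1 (r \<otimes>\<^bsub>W\<^esub> d a) v)" .
qed

text \<open>The mirror image of \<open>OX_XO_coev\<close>, from the commutator of \<open>\<Sum>\<^sub>j (u, \<rho>\<^sub>j) Y (y\<^sub>j) = X u\<close> with \<open>\<alpha> a\<close>.\<close>
lemma XO_OX_ucoev:
  assumes u: "u \<in> carrier X1" and \<eta>: "\<eta> \<in> grade W 1"
  shows "(\<Oplus>j\<in>{..<q}. XO1 u (\<rho> j) \<otimes> OX1 \<eta> (y j)) = \<alpha> (ev1 u \<eta>)"
proof (rule one_form_maps_eq[OF _ k_linear_map_comp[OF ev_linear(1)[OF u] \<alpha>_linear] _ \<eta>])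
  show "k_linear_map \<Omega>1 B (\<lambda>\<eta>. \<Oplus>j\<in>{..<q}. XO1 u (\<rho> j) \<otimes> OX1 \<eta> (y j))"
    by (rule linear_sums(1)) (use u in \<open>simp_all add: mem OX1_linear O1.M.k_vector_space_axioms\<close>)
  fix r a assume r: "r \<in> grade W 0" and a: "a \<in> grade W 0"
  let ?u = "ract X1 u r"
  have u': "?u \<in> carrier X1" using u r by (simp add: mem)
  have "(\<Oplus>j\<in>{..<q}. XO1 u (\<rho> j) \<otimes> OX1 (r \<otimes>\<^bsub>W\<^esub> d a) (y j)) = (\<Oplus>j\<in>{..<q}. dX ?u (c j) \<otimes> dY (y j) a)"
    using u r a by (intro finsum_cong_simple) (simp add: OX1_base XO1_d mem flip: B.m_assoc dX_actions(2))
  also have "\<dots> = (\<Oplus>j\<in>{..<q}. dX ?u (c j) \<otimes> Y (y j) \<otimes> \<alpha> a \<ominus> dX (ract X1 ?u a) (c j) \<otimes> Y (y j))"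
    using u' a by (intro finsum_cong_simple)
      (simp add: Y_commutator B.minus_distrib mem B.m_assoc flip: dX_actions(2))
  also have "\<dots> = (\<Oplus>j\<in>{..<q}. dX ?u (c j) \<otimes> Y (y j)) \<otimes> \<alpha> a \<ominus> (\<Oplus>j\<in>{..<q}. dX (ract X1 ?u a) (c j) \<otimes> Y (y j))"
    using u' a by (subst B.finsum_minus) (auto simp: mem, subst B.finsum_mult, auto simp: mem)
  also have "\<dots> = \<alpha> (ev1 ?u (d a))"
    using u' a by (simp add: X_ucoev X_right mem cancel)
  also have "\<dots> = \<alpha> (ev1 u (r \<otimes>\<^bsub>W\<^esub> d a))"
    using u r a ev1(5)[of u "d a" r] by (simp add: mem)
  finally show "(\<Oplus>j\<in>{..<q}. XO1 u (\<rho> j) \<otimes> OX1 (r \<otimes>\<^bsub>W\<^esub> d a) (y j)) = \<alpha> (ev1 u (r \<otimes>\<^bsub>W\<^esub> d a))" .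
qed

lemma XO_OX_bar:
  assumes u: "u \<in> carrier X1" and \<eta>: "\<eta> \<in> grade W 1"
  shows "(\<Oplus>j\<in>{..<q}. XO1 (y j) \<eta> \<otimes> OX1 (\<rho> j) u) = \<beta> (ev1 u \<eta>)"
proof (rule one_form_maps_eq[OF _ k_linear_map_comp[OF ev_linear(1)[OF u] \<beta>_linear] _ \<eta>])
  show "k_linear_map \<Omega>1 B (\<lambda>\<eta>. \<Oplus>j\<in>{..<q}. XO1 (y j) \<eta> \<otimes> OX1 (\<rho> j) u)"
    by (rule linear_sums(2)) (use u in \<open>simp_all add: mem XO1_linear O1.M.k_vector_space_axioms\<close>)
  fix r a assume r: "r \<in> grade W 0" and a: "a \<in> grade W 0"
  have "(\<Oplus>j\<in>{..<q}. XO1 (y j) (r \<otimes>\<^bsub>W\<^esub> d a) \<otimes> OX1 (\<rho> j) u) = (\<Oplus>j\<in>{..<q}. dX (y j) a \<otimes> dY (ract X1 u r) (c j))"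
    using u r a by (intro finsum_cong_simple) (simp add: XO1_base OX1_d mem B.m_assoc dY_actions(1))
  then show "(\<Oplus>j\<in>{..<q}. XO1 (y j) (r \<otimes>\<^bsub>W\<^esub> d a) \<otimes> OX1 (\<rho> j) u) = \<beta> (ev1 u (r \<otimes>\<^bsub>W\<^esub> d a))"
    using u r a ev1(5)[of u "d a" r] by (simp add: XY mem)
qed

lemma OX_XO:
  assumes u: "u \<in> carrier X1" and \<eta>: "\<eta> \<in> grade W 1"
  shows "(\<Oplus>i\<in>{..<p}. OX1 \<eta> (x i) \<otimes> XO1 u (\<omega> i)) = \<alpha> (uev1 \<eta> u)"
proof (rule one_form_maps_eq[OF _ k_linear_map_comp[OF ev_linear(2)[OF u] \<alpha>_linear] _ \<eta>])
  show "k_linear_map \<Omega>1 B (\<lambda>\<eta>. \<Oplus>i\<in>{..<p}. OX1 \<eta> (x i) \<otimes> XO1 u (\<omega> i))"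
    by (rule linear_sums(2)) (use u in \<open>simp_all add: mem OX1_linear O1.M.k_vector_space_axioms\<close>)
  fix r a assume r: "r \<in> grade W 0" and a: "a \<in> grade W 0"
  have "(\<Oplus>i\<in>{..<p}. OX1 (r \<otimes>\<^bsub>W\<^esub> d a) (x i) \<otimes> XO1 u (\<omega> i)) = \<alpha> r \<otimes> (\<Oplus>i\<in>{..<p}. dY (x i) a \<otimes> dX u (b i))"
    using u r a by (subst B.mult_finsum) (auto simp: OX1_base XO1_d mem B.m_assoc intro!: finsum_cong_simple)
  then show "(\<Oplus>i\<in>{..<p}. OX1 (r \<otimes>\<^bsub>W\<^esub> d a) (x i) \<otimes> XO1 u (\<omega> i)) = \<alpha> (uev1 (r \<otimes>\<^bsub>W\<^esub> d a) u)"
    using u r a uev1(3)[of "d a" u r] by (simp add: YX mem \<alpha>)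
qed

subsection \<open>Extension to two-forms\<close>
text \<open>The value that the relations of \<open>DX\<close> prescribe for \<open>(\<xi>, \<eta> \<and> \<theta>)\<close>, as a function of \<open>\<eta>\<close> and \<open>\<theta>\<close>.\<close>
definition XO_wedge :: "'y \<Rightarrow> 'w \<Rightarrow> 'w \<Rightarrow> 'e" where
  "XO_wedge \<xi> \<eta> \<theta> = (\<Oplus>i\<in>{..<p}. \<Oplus>j\<in>{..<p}. \<alpha> (ev2 \<xi> (\<omega> i \<and>\<^sub>W \<omega> j)) \<otimes> XO1 (x j) \<theta> \<otimes> XO1 (x i) \<eta>)"

definition OX_wedge :: "'y \<Rightarrow> 'w \<Rightarrow> 'w \<Rightarrow> 'e" where
  "OX_wedge \<xi> \<eta> \<theta> = (\<Oplus>i\<in>{..<q}. \<Oplus>j\<in>{..<q}. \<beta> (uev2 (\<rho> i \<and>\<^sub>W \<rho> j) \<xi>) \<otimes> OX1 \<eta> (y i) \<otimes> OX1 \<theta> (y j))"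

lemma double_sum_linear:
  assumes "k_vector_space V" and "\<And>i j. i < n \<Longrightarrow> j < n \<Longrightarrow> k_linear_map V B (f i j)"
  shows "k_linear_map V B (\<lambda>v. \<Oplus>i\<in>{..<n::nat}. \<Oplus>j\<in>{..<n}. f i j v)"
  by (intro k_linear_map_finsum assms B.k_vector_space_axioms) auto

lemma XO_wedge_linear:
  "\<eta> \<in> grade W 1 \<Longrightarrow> \<theta> \<in> grade W 1 \<Longrightarrow> k_linear_map X2 B (\<lambda>\<xi>. XO_wedge \<xi> \<eta> \<theta>)"
  "\<xi> \<in> carrier X2 \<Longrightarrow> \<theta> \<in> grade W 1 \<Longrightarrow> k_linear_map \<Omega>1 B (\<lambda>\<eta>. XO_wedge \<xi> \<eta> \<theta>)"
  "\<xi> \<in> carrier X2 \<Longrightarrow> \<eta> \<in> grade W 1 \<Longrightarrow> k_linear_map \<Omega>1 B (XO_wedge \<xi> \<eta>)"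
  unfolding XO_wedge_def[abs_def]
  by (rule double_sum_linear[OF X2.M.k_vector_space_axioms]
        double_sum_linear[OF O1.M.k_vector_space_axioms],
      rule k_linear_map_comp[OF k_linear_map_comp[OF k_linear_map_comp[OF ev_linear(5) \<alpha>_linear] B.mult_right_linear] B.mult_right_linear]
        k_linear_map_comp[OF XO1_linear B.mult_left_linear]
        k_linear_map_comp[OF k_linear_map_comp[OF XO1_linear B.mult_left_linear] B.mult_right_linear];
      simp add: mem)+

lemma OX_wedge_linear:
  "\<eta> \<in> grade W 1 \<Longrightarrow> \<theta> \<in> grade W 1 \<Longrightarrow> k_linear_map X2 B (\<lambda>\<xi>. OX_wedge \<xi> \<eta> \<theta>)"
  "\<xi> \<in> carrier X2 \<Longrightarrow> \<theta> \<in> grade W 1 \<Longrightarrow> k_linear_map \<Omega>1 B (\<lambda>\<eta>. OX_wedge \<xi> \<eta> \<theta>)"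
  "\<xi> \<in> carrier X2 \<Longrightarrow> \<eta> \<in> grade W 1 \<Longrightarrow> k_linear_map \<Omega>1 B (OX_wedge \<xi> \<eta>)"
  unfolding OX_wedge_def[abs_def]
  by (rule double_sum_linear[OF X2.M.k_vector_space_axioms]
        double_sum_linear[OF O1.M.k_vector_space_axioms],
      rule k_linear_map_comp[OF k_linear_map_comp[OF k_linear_map_comp[OF ev_linear(6) \<beta>_linear] B.mult_right_linear] B.mult_right_linear]
        k_linear_map_comp[OF k_linear_map_comp[OF OX1_linear B.mult_left_linear] B.mult_right_linear]
        k_linear_map_comp[OF OX1_linear B.mult_left_linear];
      simp add: mem)+

text \<open>By balancedness \<open>F\<close> is determined by the values \<open>F (r da) (de)\<close>, and the forms \<open>r da \<and> de\<close> span; so \<open>F\<close> factors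
  through the product as soon as it vanishes on the kernel of \<open>\<and>\<close>, in the form \<open>wedge_null\<close>.\<close>
lemma two_form_extension:
  fixes F :: "'w \<Rightarrow> 'w \<Rightarrow> 'e"
  assumes lin: "\<And>\<theta>. \<theta> \<in> grade W 1 \<Longrightarrow> k_linear_map \<Omega>1 B (\<lambda>\<eta>. F \<eta> \<theta>)"
    and lin': "\<And>\<eta>. \<eta> \<in> grade W 1 \<Longrightarrow> k_linear_map \<Omega>1 B (F \<eta>)"
    and bal: "\<And>\<eta> \<theta> s. \<eta> \<in> grade W 1 \<Longrightarrow> \<theta> \<in> grade W 1 \<Longrightarrow> s \<in> grade W 0 \<Longrightarrow>
      F \<eta> (s \<otimes>\<^bsub>W\<^esub> \<theta>) = F (\<eta> \<otimes>\<^bsub>W\<^esub> s) \<theta>"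
    and null: "\<And>n r a e. wedge_null n r a e \<Longrightarrow> (\<Oplus>m\<in>{..<n}. F (r m \<otimes>\<^bsub>W\<^esub> d (a m)) (d (e m))) = \<zero>"
  shows "\<exists>G. k_linear_map \<Omega>2 B G \<and> (\<forall>\<eta>\<in>grade W 1. \<forall>\<theta>\<in>grade W 1. G (\<eta> \<otimes>\<^bsub>W\<^esub> \<theta>) = F \<eta> \<theta>)"
proof -
  let ?T = "grade W 0 \<times> grade W 0 \<times> grade W 0"
  let ?g = "\<lambda>(r, a, e). r \<otimes>\<^bsub>W\<^esub> d a \<otimes>\<^bsub>W\<^esub> d e" and ?f = "\<lambda>(r, a, e). F (r \<otimes>\<^bsub>W\<^esub> d a) (d e)"
  have "\<exists>G. k_linear_map \<Omega>2 B G \<and> (\<forall>t\<in>?T. G (?g t) = ?f t)"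
  proof (rule linear_extension[OF O2.M.k_vector_space_axioms B.k_vector_space_axioms])
    fix R v assume "v \<in> carrier \<Omega>2" and R: "\<And>t. t \<in> ?T \<Longrightarrow> R (?g t)" "R \<zero>\<^bsub>\<Omega>2\<^esub>"
      and add: "\<And>u v. u \<in> carrier \<Omega>2 \<Longrightarrow> v \<in> carrier \<Omega>2 \<Longrightarrow> R u \<Longrightarrow> R v \<Longrightarrow> R (u \<oplus>\<^bsub>\<Omega>2\<^esub> v)"
    then have "v \<in> grade W 2" by simp
    then show "R v"
      by (induction rule: exact_two_form_induct) (use R(1)[of "(_, _, _)"] R(2) add in simp_all)
  next
    fix n :: nat and t assume t: "t \<in> {..<n} \<rightarrow> ?T" and 0: "(\<Oplus>\<^bsub>\<Omega>2\<^esub>m\<in>{..<n}. ?g (t m)) = \<zero>\<^bsub>\<Omega>2\<^esub>"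
    let ?r = "\<lambda>m. fst (t m)" and ?a = "\<lambda>m. fst (snd (t m))" and ?e = "\<lambda>m. snd (snd (t m))"
    have tm: "?r m \<in> grade W 0" "?a m \<in> grade W 0" "?e m \<in> grade W 0" if "m < n" for m
      using t that by (auto simp: Pi_iff mem_Times_iff)
    have "(\<Oplus>\<^bsub>W\<^esub>m\<in>{..<n}. ?r m \<otimes>\<^bsub>W\<^esub> d (?a m) \<otimes>\<^bsub>W\<^esub> d (?e m)) = \<zero>\<^bsub>W\<^esub>"
      using 0 forms_finsum[of "{..<n}" "\<lambda>m. ?r m \<otimes>\<^bsub>W\<^esub> d (?a m) \<otimes>\<^bsub>W\<^esub> d (?e m)" 2] tm
      by (simp add: closed split_beta)
    then have "wedge_null n ?r ?a ?e" using tm by (auto simp: wedge_null_iff)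
    then show "(\<Oplus>m\<in>{..<n}. ?f (t m)) = \<zero>" using null by (simp add: split_beta)
  next
    fix k t assume "t \<in> ?T"
    then obtain r a e where t: "t = (r, a, e)" "r \<in> grade W 0" "a \<in> grade W 0" "e \<in> grade W 0" by auto
    then have m: "r \<otimes>\<^bsub>W\<^esub> d a \<in> grade W 1" "d e \<in> grade W 1" by (auto simp: closed)
    have "(k \<odot>\<^bsub>W\<^esub> r) \<otimes>\<^bsub>W\<^esub> d a = k \<odot>\<^bsub>W\<^esub> (r \<otimes>\<^bsub>W\<^esub> d a)"
      using t by (simp add: W.smult_mult_left W.grade_mem[of _ 0] W.grade_mem[OF W.diff_closed])
    then show "\<exists>t'\<in>?T. ?g t' = k \<odot>\<^bsub>\<Omega>2\<^esub> ?g t \<and> ?f t' = k \<odot> ?f t"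
      using t m k_linear_map.smult[OF lin[OF m(2)], of "r \<otimes>\<^bsub>W\<^esub> d a" k]
      by (intro bexI[of _ "(k \<odot>\<^bsub>W\<^esub> r, a, e)"])
        (auto simp: W.grade_smult W.smult_mult_left W.grade_mem[of _ 1])
  qed (auto simp: closed intro!: k_linear_map.closed[OF lin, simplified])
  then obtain G where G: "k_linear_map \<Omega>2 B G"
    and G1: "\<And>r a e. r \<in> grade W 0 \<Longrightarrow> a \<in> grade W 0 \<Longrightarrow> e \<in> grade W 0 \<Longrightarrow>
      G (r \<otimes>\<^bsub>W\<^esub> d a \<otimes>\<^bsub>W\<^esub> d e) = F (r \<otimes>\<^bsub>W\<^esub> d a) (d e)" by fastforce
  have 1: "G (\<eta> \<otimes>\<^bsub>W\<^esub> d e) = F \<eta> (d e)" if "\<eta> \<in> grade W 1" "e \<in> grade W 0" for \<eta> e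
    by (rule one_form_maps_eq[OF k_linear_map_comp[OF wedge_linear(2) G] lin _ that(1)])
      (use that(2) in \<open>simp_all add: closed G1\<close>)
  have "G (\<eta> \<otimes>\<^bsub>W\<^esub> \<theta>) = F \<eta> \<theta>" if \<eta>: "\<eta> \<in> grade W 1" and \<theta>: "\<theta> \<in> grade W 1" for \<eta> \<theta>
  proof (rule one_form_maps_eq[OF k_linear_map_comp[OF wedge_linear(1)[OF \<eta>] G] lin'[OF \<eta>] _ \<theta>])
    fix s e assume "s \<in> grade W 0" "e \<in> grade W 0"
    then show "G (\<eta> \<otimes>\<^bsub>W\<^esub> (s \<otimes>\<^bsub>W\<^esub> d e)) = F \<eta> (s \<otimes>\<^bsub>W\<^esub> d e)"
      using \<eta> 1[of "\<eta> \<otimes>\<^bsub>W\<^esub> s" e] bal[of \<eta> "d e" s] W.m_assoc[of \<eta> s "d e"]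
      by (simp add: closed W.grade_mem[of _ 0] W.grade_mem[of _ 1])
  qed
  with G show ?thesis by blast
qed

text \<open>On \<open>r da \<and> de\<close> the prescribed value is a summand of the relation of \<open>HX_quotient\<close> that is indexed by the kernel
  of \<open>\<and>\<close>.\<close>
lemma XO2_exists:
  assumes \<xi>: "\<xi> \<in> carrier X2"
  shows "\<exists>G. k_linear_map \<Omega>2 B G \<and> (\<forall>\<eta>\<in>grade W 1. \<forall>\<theta>\<in>grade W 1. G (\<eta> \<otimes>\<^bsub>W\<^esub> \<theta>) = XO_wedge \<xi> \<eta> \<theta>)"
proof (rule two_form_extension)
  fix \<eta> \<theta> s assume "\<eta> \<in> grade W 1" "\<theta> \<in> grade W 1" "s \<in> grade W 0"
  note m = this
  have "XO1 u (s \<otimes>\<^bsub>W\<^esub> \<theta>) \<otimes> XO1 v \<eta> = XO1 u \<theta> \<otimes> XO1 v (\<eta> \<otimes>\<^bsub>W\<^esub> s)" if "u \<in> carrier X1" "v \<in> carrier X1" for u v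
    using that m actsD(3)[OF XO1_acts, of s v \<eta>, symmetric] actsD(4)[OF XO1_acts, of s u \<theta>, symmetric]
    by (simp add: mem B.m_assoc)
  then show "XO_wedge \<xi> \<eta> (s \<otimes>\<^bsub>W\<^esub> \<theta>) = XO_wedge \<xi> (\<eta> \<otimes>\<^bsub>W\<^esub> s) \<theta>"
    unfolding XO_wedge_def using \<xi> m by (intro finsum_cong_simple) (simp add: mem B.m_assoc)
next
  fix n r a e assume null: "wedge_null n r a e"
  then have m: "r m \<in> grade W 0" "a m \<in> grade W 0" "e m \<in> grade W 0" if "m < n" for m
    using that by (auto simp: wedge_null_iff)
  have "(\<Oplus>m\<in>{..<n}. XO_wedge \<xi> (r m \<otimes>\<^bsub>W\<^esub> d (a m)) (d (e m))) =
      (\<Oplus>m\<in>{..<n}. \<Oplus>i\<in>{..<p}. \<Oplus>j\<in>{..<p}. \<alpha> (ev2 \<xi> (\<omega> i \<and>\<^sub>W \<omega> j)) \<otimes> dX (x j) (e m) \<otimes> dX (x i) (a m) \<otimes> \<beta> (r m))"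
    unfolding XO_wedge_def using m \<xi> by (intro finsum_cong_simple) (simp add: XO1_base XO1_d mem B.m_assoc)
  then show "(\<Oplus>m\<in>{..<n}. XO_wedge \<xi> (r m \<otimes>\<^bsub>W\<^esub> d (a m)) (d (e m))) = \<zero>"
    using X_wedge_null[OF null \<xi>] by simp
qed (use \<xi> in \<open>simp_all add: XO_wedge_linear\<close>)

lemma OX2_exists:
  assumes \<xi>: "\<xi> \<in> carrier X2"
  shows "\<exists>G. k_linear_map \<Omega>2 B G \<and> (\<forall>\<eta>\<in>grade W 1. \<forall>\<theta>\<in>grade W 1. G (\<eta> \<otimes>\<^bsub>W\<^esub> \<theta>) = OX_wedge \<xi> \<eta> \<theta>)"
proof (rule two_form_extension)
  fix \<eta> \<theta> s assume "\<eta> \<in> grade W 1" "\<theta> \<in> grade W 1" "s \<in> grade W 0"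
  then show "OX_wedge \<xi> \<eta> (s \<otimes>\<^bsub>W\<^esub> \<theta>) = OX_wedge \<xi> (\<eta> \<otimes>\<^bsub>W\<^esub> s) \<theta>"
    unfolding OX_wedge_def using \<xi> actsD(1)[OF OX1_acts, of s \<theta>] actsD(2)[OF OX1_acts, of s \<eta>, symmetric]
    by (intro finsum_cong_simple) (simp add: mem B.m_assoc)
next
  fix n r a e assume null: "wedge_null n r a e"
  then have m: "r m \<in> grade W 0" "a m \<in> grade W 0" "e m \<in> grade W 0" if "m < n" for m
    using that by (auto simp: wedge_null_iff)
  have "(\<Oplus>m\<in>{..<n}. OX_wedge \<xi> (r m \<otimes>\<^bsub>W\<^esub> d (a m)) (d (e m))) =
      (\<Oplus>m\<in>{..<n}. \<Oplus>i\<in>{..<q}. \<Oplus>j\<in>{..<q}. \<beta> (uev2 (\<rho> i \<and>\<^sub>W \<rho> j) \<xi>) \<otimes> \<alpha> (r m) \<otimes> dY (y i) (a m) \<otimes> dY (y j) (e m))"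
    unfolding OX_wedge_def using m \<xi> by (intro finsum_cong_simple) (simp add: OX1_base OX1_d mem B.m_assoc)
  then show "(\<Oplus>m\<in>{..<n}. OX_wedge \<xi> (r m \<otimes>\<^bsub>W\<^esub> d (a m)) (d (e m))) = \<zero>"
    using Y_wedge_null[OF null \<xi>] by simp
qed (use \<xi> in \<open>simp_all add: OX_wedge_linear\<close>)

definition XO2 :: "'y \<Rightarrow> 'w \<Rightarrow> 'e" where
  "XO2 \<xi> = (SOME G. k_linear_map \<Omega>2 B G \<and>
    (\<forall>\<eta>\<in>grade W 1. \<forall>\<theta>\<in>grade W 1. G (\<eta> \<otimes>\<^bsub>W\<^esub> \<theta>) = XO_wedge \<xi> \<eta> \<theta>))"

definition OX2 :: "'w \<Rightarrow> 'y \<Rightarrow> 'e" where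
  "OX2 \<zeta> \<xi> = (SOME G. k_linear_map \<Omega>2 B G \<and>
    (\<forall>\<eta>\<in>grade W 1. \<forall>\<theta>\<in>grade W 1. G (\<eta> \<otimes>\<^bsub>W\<^esub> \<theta>) = OX_wedge \<xi> \<eta> \<theta>)) \<zeta>"

lemma XO2_linear: "\<xi> \<in> carrier X2 \<Longrightarrow> k_linear_map \<Omega>2 B (XO2 \<xi>)"
  and XO2_wedge: "\<xi> \<in> carrier X2 \<Longrightarrow> \<eta> \<in> grade W 1 \<Longrightarrow> \<theta> \<in> grade W 1 \<Longrightarrow> XO2 \<xi> (\<eta> \<otimes>\<^bsub>W\<^esub> \<theta>) = XO_wedge \<xi> \<eta> \<theta>"
  using someI_ex[OF XO2_exists] unfolding XO2_def by blast+

lemma OX2_linear: "\<xi> \<in> carrier X2 \<Longrightarrow> k_linear_map \<Omega>2 B (\<lambda>\<zeta>. OX2 \<zeta> \<xi>)"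
  and OX2_wedge: "\<xi> \<in> carrier X2 \<Longrightarrow> \<eta> \<in> grade W 1 \<Longrightarrow> \<theta> \<in> grade W 1 \<Longrightarrow> OX2 (\<eta> \<otimes>\<^bsub>W\<^esub> \<theta>) \<xi> = OX_wedge \<xi> \<eta> \<theta>"
  using someI_ex[OF OX2_exists] unfolding OX2_def by blast+

lemmas XO2_add = k_linear_map.add[OF XO2_linear, simplified]
lemmas OX2_add = k_linear_map.add[OF OX2_linear, simplified]
lemmas XO2_zero = k_linear_map.zero[OF XO2_linear, simplified]
lemmas OX2_zero = k_linear_map.zero[OF OX2_linear, simplified]

lemma XO2_bilinear: "k_bilinear X2 \<Omega>2 B XO2"
proof (rule k_bilinearI)
  show "k_linear_map \<Omega>2 B (XO2 \<xi>)" if "\<xi> \<in> carrier X2" for \<xi> using that by (rule XO2_linear)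
  fix \<zeta> assume "\<zeta> \<in> carrier \<Omega>2"
  then have "\<zeta> \<in> grade W 2" by simp
  then show "k_linear_map X2 B (\<lambda>\<xi>. XO2 \<xi> \<zeta>)"
  proof (induction rule: two_form_induct)
    case (base \<eta> \<theta>)
    show ?case using XO_wedge_linear(1)[OF base] by (rule k_linear_map_cong) (simp add: XO2_wedge base)
  next
    case zero
    show ?case
      using k_linear_map_zero[OF X2.M.k_vector_space_axioms B.k_vector_space_axioms]
      by (rule k_linear_map_cong) (simp add: XO2_zero)
  next
    case (add \<eta> \<theta>)
    show ?case using k_linear_map_add[OF add(3,4)] by (rule k_linear_map_cong) (simp add: XO2_add add)
  qed
qed

lemma OX2_bilinear: "k_bilinear \<Omega>2 X2 B OX2"
proof (rule k_bilinearI)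
  show "k_linear_map \<Omega>2 B (\<lambda>\<zeta>. OX2 \<zeta> \<xi>)" if "\<xi> \<in> carrier X2" for \<xi> using that by (rule OX2_linear)
  fix \<zeta> assume "\<zeta> \<in> carrier \<Omega>2"
  then have "\<zeta> \<in> grade W 2" by simp
  then show "k_linear_map X2 B (OX2 \<zeta>)"
  proof (induction rule: two_form_induct)
    case (base \<eta> \<theta>)
    show ?case using OX_wedge_linear(1)[OF base] by (rule k_linear_map_cong) (simp add: OX2_wedge base)
  next
    case zero
    show ?case
      using k_linear_map_zero[OF X2.M.k_vector_space_axioms B.k_vector_space_axioms]
      by (rule k_linear_map_cong) (simp add: OX2_zero)
  next
    case (add \<eta> \<theta>)
    show ?case using k_linear_map_add[OF add(3,4)] by (rule k_linear_map_cong) (simp add: OX2_add add)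
  qed
qed

end

lemma k_bilinear_flip: "k_bilinear M N C h \<Longrightarrow> k_bilinear N M C (\<lambda>n m. h m n)"
  unfolding k_bilinear_def by simp

context H_model
begin

lemmas XO1_linear_left = k_bilinear_linear_left[OF XO1_bilinear X1.M.k_vector_space_axioms B.k_vector_space_axioms, simplified]
lemmas OX1_linear_right = k_bilinear_linear_right[OF OX1_bilinear X1.M.k_vector_space_axioms B.k_vector_space_axioms, simplified]

lemma bar_past:
  assumes "a \<in> grade W 0" "z \<in> grade W 0" "v \<in> carrier B" "w \<in> carrier B"
  shows "\<beta> a \<otimes> (\<alpha> z \<otimes> v \<otimes> w) = \<alpha> z \<otimes> (\<beta> a \<otimes> v) \<otimes> w"
    and "\<alpha> a \<otimes> (\<beta> z \<otimes> v \<otimes> w) = \<beta> z \<otimes> (\<alpha> a \<otimes> v) \<otimes> w"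
  using assms by (simp_all add: mem comm flip: B.m_assoc)

text \<open>The right action by \<open>\<alpha> a\<close> moves \<open>a\<close> through both coevaluations, until it acts on \<open>\<xi>\<close>.\<close>
lemma XO_wedge_right:
  assumes a: "a \<in> grade W 0" and \<xi>: "\<xi> \<in> carrier X2" and \<eta>: "\<eta> \<in> grade W 1" and \<theta>: "\<theta> \<in> grade W 1"
  shows "XO_wedge \<xi> \<eta> \<theta> \<otimes> \<alpha> a = XO_wedge (ract X2 \<xi> a) \<eta> \<theta>"
proof -
  define S where "S m = (\<Oplus>j\<in>{..<p}. \<alpha> (ev2 \<xi> (m \<otimes>\<^bsub>W\<^esub> \<omega> j)) \<otimes> XO1 (x j) \<theta>)" for m
  have S_lin: "k_linear_map \<Omega>1 B S"
    unfolding S_def[abs_def]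
    by (rule linear_sums(2)[OF _ k_linear_map_comp[OF wedge_linear(2) k_linear_map_comp[OF ev_linear(3)[OF \<xi>] \<alpha>_linear]]])
      (use \<theta> in \<open>simp_all add: mem O1.M.k_vector_space_axioms\<close>)
  note S_mem = k_linear_map.closed[OF S_lin, simplified]
  have S_bal: "S (m \<otimes>\<^bsub>W\<^esub> e) = S m \<otimes> \<alpha> e" if m: "m \<in> grade W 1" and e: "e \<in> grade W 0" for m e
  proof -
    let ?h = "\<lambda>m' u. \<alpha> (ev2 \<xi> (m \<otimes>\<^bsub>W\<^esub> m')) \<otimes> XO1 u \<theta>"
    have "k_bilinear \<Omega>1 X1 B ?h"
      by (rule B.k_bilinear_mult[OF k_linear_map_comp[OF wedge_linear(1)[OF m] k_linear_map_comp[OF ev_linear(3)[OF \<xi>] \<alpha>_linear]]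
            XO1_linear_left[OF \<theta>]])
    then have "(\<Oplus>j\<in>{..<p}. ?h (e \<otimes>\<^bsub>W\<^esub> \<omega> j) (x j)) = (\<Oplus>j\<in>{..<p}. ?h (\<omega> j) (ract X1 (x j) e))"
    proof (rule coev_sum[OF _ e])
      fix m' s u assume s: "m' \<in> grade W 1" "s \<in> grade W 0" "u \<in> carrier X1"
      have "ev2 \<xi> (m \<otimes>\<^bsub>W\<^esub> (m' \<otimes>\<^bsub>W\<^esub> s)) = ev2 \<xi> (m \<otimes>\<^bsub>W\<^esub> m') \<otimes>\<^bsub>W\<^esub> s"
        using ev2(4)[OF \<xi>, of "m \<otimes>\<^bsub>W\<^esub> m'" s] s m
        by (simp add: mem W.m_assoc W.grade_mem[of _ 0] W.grade_mem[of _ 1])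
      then show "?h (m' \<otimes>\<^bsub>W\<^esub> s) u = ?h m' (lact X1 s u)"
        using s m \<xi> \<theta> actsD(1)[OF XO1_acts, of s u \<theta>, symmetric] by (simp add: mem \<alpha> B.m_assoc)
    qed
    moreover have "S m \<otimes> \<alpha> e = (\<Oplus>j\<in>{..<p}. ?h (\<omega> j) (ract X1 (x j) e))"
      unfolding S_def using m e \<xi> \<theta>
      by (subst B.finsum_mult) (auto simp: mem B.m_assoc actsD(2)[OF XO1_acts] intro!: finsum_cong_simple)
    moreover have "S (m \<otimes>\<^bsub>W\<^esub> e) = (\<Oplus>j\<in>{..<p}. ?h (e \<otimes>\<^bsub>W\<^esub> \<omega> j) (x j))"
      unfolding S_def using m e
      by (intro finsum_cong_simple) (simp add: mem W.m_assoc W.grade_mem[of _ 0] W.grade_mem[of _ 1])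
    ultimately show ?thesis by simp
  qed
  have K: "XO_wedge \<xi> \<eta> \<theta> = (\<Oplus>i\<in>{..<p}. S (\<omega> i) \<otimes> XO1 (x i) \<eta>)"
    unfolding XO_wedge_def S_def using \<xi> \<eta> \<theta>
    by (intro finsum_cong_simple B.finsum_mult[symmetric]) (auto simp: mem)
  have "XO_wedge \<xi> \<eta> \<theta> \<otimes> \<alpha> a = (\<Oplus>i\<in>{..<p}. S (\<omega> i) \<otimes> XO1 (ract X1 (x i) a) \<eta>)"
    unfolding K using \<xi> \<eta> \<theta> a
    by (subst B.finsum_mult) (auto simp: mem S_mem B.m_assoc actsD(2)[OF XO1_acts] intro!: finsum_cong_simple)
  also have "\<dots> = (\<Oplus>i\<in>{..<p}. S (a \<otimes>\<^bsub>W\<^esub> \<omega> i) \<otimes> XO1 (x i) \<eta>)"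
  proof (rule coev_sum[OF B.k_bilinear_mult[OF S_lin XO1_linear_left[OF \<eta>]] a, symmetric])
    fix m s u assume "m \<in> grade W 1" "s \<in> grade W 0" "u \<in> carrier X1"
    then show "S (m \<otimes>\<^bsub>W\<^esub> s) \<otimes> XO1 u \<eta> = S m \<otimes> XO1 (lact X1 s u) \<eta>"
      using \<eta> actsD(1)[OF XO1_acts, of s u \<eta>, symmetric] by (simp add: S_bal mem S_mem B.m_assoc)
  qed
  also have "\<dots> = XO_wedge (ract X2 \<xi> a) \<eta> \<theta>"
  proof -
    have "ev2 (ract X2 \<xi> a) (\<omega> i \<otimes>\<^bsub>W\<^esub> \<omega> j) = ev2 \<xi> (a \<otimes>\<^bsub>W\<^esub> \<omega> i \<otimes>\<^bsub>W\<^esub> \<omega> j)" if "i < p" "j < p" for i j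
      using ev2(5)[OF \<xi>, of "\<omega> i \<otimes>\<^bsub>W\<^esub> \<omega> j" a] that a
      by (simp add: mem W.m_assoc W.grade_mem[of _ 0] W.grade_mem[of _ 1])
    then have "(\<Oplus>j\<in>{..<p}. \<alpha> (ev2 (ract X2 \<xi> a) (\<omega> i \<and>\<^sub>W \<omega> j)) \<otimes> XO1 (x j) \<theta> \<otimes> XO1 (x i) \<eta>)
        = (\<Oplus>j\<in>{..<p}. \<alpha> (ev2 \<xi> (a \<otimes>\<^bsub>W\<^esub> \<omega> i \<otimes>\<^bsub>W\<^esub> \<omega> j)) \<otimes> XO1 (x j) \<theta> \<otimes> XO1 (x i) \<eta>)" if "i < p" for i
      using that by (intro finsum_cong_simple) simp
    moreover have "S (a \<otimes>\<^bsub>W\<^esub> \<omega> i) \<otimes> XO1 (x i) \<eta>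
        = (\<Oplus>j\<in>{..<p}. \<alpha> (ev2 \<xi> (a \<otimes>\<^bsub>W\<^esub> \<omega> i \<otimes>\<^bsub>W\<^esub> \<omega> j)) \<otimes> XO1 (x j) \<theta> \<otimes> XO1 (x i) \<eta>)" if "i < p" for i
      unfolding S_def using that \<xi> \<eta> \<theta> a by (intro B.finsum_mult) (auto simp: mem)
    ultimately show ?thesis
      unfolding XO_wedge_def by (intro finsum_cong_simple) simp
  qed
  finally show ?thesis .
qed

lemma OX_wedge_right:
  assumes a: "a \<in> grade W 0" and \<xi>: "\<xi> \<in> carrier X2" and \<eta>: "\<eta> \<in> grade W 1" and \<theta>: "\<theta> \<in> grade W 1"
  shows "OX_wedge \<xi> \<eta> \<theta> \<otimes> \<beta> a = OX_wedge (lact X2 a \<xi>) \<eta> \<theta>"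
proof -
  define S where "S m = (\<Oplus>i\<in>{..<q}. \<beta> (uev2 (\<rho> i \<otimes>\<^bsub>W\<^esub> m) \<xi>) \<otimes> OX1 \<eta> (y i))" for m
  have S_lin: "k_linear_map \<Omega>1 B S"
    unfolding S_def[abs_def]
    by (rule linear_sums(2)[OF _ k_linear_map_comp[OF wedge_linear(1) k_linear_map_comp[OF ev_linear(4)[OF \<xi>] \<beta>_linear]]])
      (use \<eta> in \<open>simp_all add: mem O1.M.k_vector_space_axioms\<close>)
  note S_mem = k_linear_map.closed[OF S_lin, simplified]
  have S_bal: "S (e \<otimes>\<^bsub>W\<^esub> m) = S m \<otimes> \<beta> e" if m: "m \<in> grade W 1" and e: "e \<in> grade W 0" for m e
  proof -
    let ?g = "\<lambda>m'. \<beta> (uev2 (m' \<otimes>\<^bsub>W\<^esub> m) \<xi>)"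
    have g_lin: "k_linear_map \<Omega>1 B ?g"
      by (rule k_linear_map_comp[OF wedge_linear(2)[OF m] k_linear_map_comp[OF ev_linear(4)[OF \<xi>] \<beta>_linear]])
    have "k_bilinear X1 \<Omega>1 B (\<lambda>u m'. ?g m' \<otimes> OX1 \<eta> u)"
      by (rule k_bilinear_flip[OF B.k_bilinear_mult[OF g_lin OX1_linear_right[OF \<eta>]]])
    then have "(\<Oplus>j\<in>{..<q}. ?g (\<rho> j) \<otimes> OX1 \<eta> (lact X1 e (y j))) = (\<Oplus>j\<in>{..<q}. ?g (\<rho> j \<otimes>\<^bsub>W\<^esub> e) \<otimes> OX1 \<eta> (y j))"
    proof (rule ucoev_sum[OF _ e])
      fix u s m' assume s: "u \<in> carrier X1" "s \<in> grade W 0" "m' \<in> grade W 1"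
      have "uev2 (s \<otimes>\<^bsub>W\<^esub> m' \<otimes>\<^bsub>W\<^esub> m) \<xi> = s \<otimes>\<^bsub>W\<^esub> uev2 (m' \<otimes>\<^bsub>W\<^esub> m) \<xi>"
        using uev2(3)[OF _ \<xi>, of "m' \<otimes>\<^bsub>W\<^esub> m" s] s m
        by (simp add: mem W.m_assoc W.grade_mem[of _ 0] W.grade_mem[of _ 1])
      then show "?g m' \<otimes> OX1 \<eta> (ract X1 u s) = ?g (s \<otimes>\<^bsub>W\<^esub> m') \<otimes> OX1 \<eta> u"
        using s m \<xi> \<eta> actsD(3)[OF OX1_acts, of s \<eta> u, symmetric] by (simp add: mem \<beta> B.m_assoc)
    qed
    moreover have "S m \<otimes> \<beta> e = (\<Oplus>j\<in>{..<q}. ?g (\<rho> j) \<otimes> OX1 \<eta> (lact X1 e (y j)))"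
      unfolding S_def using m e \<xi> \<eta>
      by (subst B.finsum_mult) (auto simp: mem B.m_assoc actsD(4)[OF OX1_acts] intro!: finsum_cong_simple)
    moreover have "S (e \<otimes>\<^bsub>W\<^esub> m) = (\<Oplus>j\<in>{..<q}. ?g (\<rho> j \<otimes>\<^bsub>W\<^esub> e) \<otimes> OX1 \<eta> (y j))"
      unfolding S_def using m e
      by (intro finsum_cong_simple) (simp add: mem W.m_assoc W.grade_mem[of _ 0] W.grade_mem[of _ 1])
    ultimately show ?thesis by simp
  qed
  have K: "OX_wedge \<xi> \<eta> \<theta> = (\<Oplus>j\<in>{..<q}. S (\<rho> j) \<otimes> OX1 \<theta> (y j))"
    unfolding OX_wedge_def S_def using \<xi> \<eta> \<theta>
    by (subst B.finsum_exchange) (auto simp: mem intro!: finsum_cong_simple B.finsum_mult[symmetric])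
  have "OX_wedge \<xi> \<eta> \<theta> \<otimes> \<beta> a = (\<Oplus>j\<in>{..<q}. S (\<rho> j) \<otimes> OX1 \<theta> (lact X1 a (y j)))"
    unfolding K using \<xi> \<eta> \<theta> a
    by (subst B.finsum_mult) (auto simp: mem S_mem B.m_assoc actsD(4)[OF OX1_acts] intro!: finsum_cong_simple)
  also have "\<dots> = (\<Oplus>j\<in>{..<q}. S (\<rho> j \<otimes>\<^bsub>W\<^esub> a) \<otimes> OX1 \<theta> (y j))"
  proof (rule ucoev_sum[OF _ a])
    show "k_bilinear X1 \<Omega>1 B (\<lambda>u m. S m \<otimes> OX1 \<theta> u)"
      by (rule k_bilinear_flip[OF B.k_bilinear_mult[OF S_lin OX1_linear_right[OF \<theta>]]])
    fix u s m assume "u \<in> carrier X1" "s \<in> grade W 0" "m \<in> grade W 1"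
    then show "S m \<otimes> OX1 \<theta> (ract X1 u s) = S (s \<otimes>\<^bsub>W\<^esub> m) \<otimes> OX1 \<theta> u"
      using \<theta> actsD(3)[OF OX1_acts, of s \<theta> u, symmetric] by (simp add: S_bal mem S_mem B.m_assoc)
  qed
  also have "\<dots> = (\<Oplus>j\<in>{..<q}. \<Oplus>i\<in>{..<q}. \<beta> (uev2 (\<rho> i \<and>\<^sub>W \<rho> j) (lact X2 a \<xi>)) \<otimes> OX1 \<eta> (y i) \<otimes> OX1 \<theta> (y j))"
  proof -
    have "uev2 (\<rho> i \<otimes>\<^bsub>W\<^esub> \<rho> j) (lact X2 a \<xi>) = uev2 (\<rho> i \<otimes>\<^bsub>W\<^esub> (\<rho> j \<otimes>\<^bsub>W\<^esub> a)) \<xi>" if "i < q" "j < q" for i j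
      using uev2(5)[OF _ \<xi>, of "\<rho> i \<otimes>\<^bsub>W\<^esub> \<rho> j" a] that a
      by (simp add: mem W.m_assoc W.grade_mem[of _ 0] W.grade_mem[of _ 1])
    then have "(\<Oplus>i\<in>{..<q}. \<beta> (uev2 (\<rho> i \<and>\<^sub>W \<rho> j) (lact X2 a \<xi>)) \<otimes> OX1 \<eta> (y i) \<otimes> OX1 \<theta> (y j))
        = (\<Oplus>i\<in>{..<q}. \<beta> (uev2 (\<rho> i \<otimes>\<^bsub>W\<^esub> (\<rho> j \<otimes>\<^bsub>W\<^esub> a)) \<xi>) \<otimes> OX1 \<eta> (y i) \<otimes> OX1 \<theta> (y j))" if "j < q" for j
      using that by (intro finsum_cong_simple) simp
    moreover have "S (\<rho> j \<otimes>\<^bsub>W\<^esub> a) \<otimes> OX1 \<theta> (y j)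
        = (\<Oplus>i\<in>{..<q}. \<beta> (uev2 (\<rho> i \<otimes>\<^bsub>W\<^esub> (\<rho> j \<otimes>\<^bsub>W\<^esub> a)) \<xi>) \<otimes> OX1 \<eta> (y i) \<otimes> OX1 \<theta> (y j))" if "j < q" for j
      unfolding S_def using that \<xi> \<eta> \<theta> a by (intro B.finsum_mult) (auto simp: mem)
    ultimately show ?thesis by (intro finsum_cong_simple) simp
  qed
  also have "\<dots> = OX_wedge (lact X2 a \<xi>) \<eta> \<theta>"
    unfolding OX_wedge_def using \<xi> \<eta> \<theta> a by (subst B.finsum_exchange) (auto simp: mem)
  finally show ?thesis .
qed

lemma XO_wedge_actions:
  assumes a: "a \<in> grade W 0" and \<xi>: "\<xi> \<in> carrier X2" and \<eta>: "\<eta> \<in> grade W 1" and \<theta>: "\<theta> \<in> grade W 1"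
  shows "\<alpha> a \<otimes> XO_wedge \<xi> \<eta> \<theta> = XO_wedge (lact X2 a \<xi>) \<eta> \<theta>"
    and "\<beta> a \<otimes> XO_wedge \<xi> \<eta> \<theta> = XO_wedge \<xi> \<eta> (\<theta> \<otimes>\<^bsub>W\<^esub> a)"
    and "XO_wedge \<xi> \<eta> \<theta> \<otimes> \<beta> a = XO_wedge \<xi> (a \<otimes>\<^bsub>W\<^esub> \<eta>) \<theta>"
proof -
  show "\<alpha> a \<otimes> XO_wedge \<xi> \<eta> \<theta> = XO_wedge (lact X2 a \<xi>) \<eta> \<theta>"
    unfolding XO_wedge_def using a \<xi> \<eta> \<theta>
    by (subst k_linear_map.finsum2[OF B.mult_left_linear], simp_all add: mem)
      (intro finsum_cong_simple, simp add: mem ev2(3) \<alpha> B.m_assoc)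
  show "\<beta> a \<otimes> XO_wedge \<xi> \<eta> \<theta> = XO_wedge \<xi> \<eta> (\<theta> \<otimes>\<^bsub>W\<^esub> a)"
    unfolding XO_wedge_def using a \<xi> \<eta> \<theta> actsD(3)[OF XO1_acts, of a _ \<theta>]
    by (subst k_linear_map.finsum2[OF B.mult_left_linear], simp_all add: mem)
      (intro finsum_cong_simple, simp add: mem bar_past(1))
  show "XO_wedge \<xi> \<eta> \<theta> \<otimes> \<beta> a = XO_wedge \<xi> (a \<otimes>\<^bsub>W\<^esub> \<eta>) \<theta>"
    unfolding XO_wedge_def using a \<xi> \<eta> \<theta> actsD(4)[OF XO1_acts, of a _ \<eta>]
    by (subst k_linear_map.finsum2[OF B.mult_right_linear], simp_all add: mem)
      (intro finsum_cong_simple, simp add: mem B.m_assoc)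
qed

lemma OX_wedge_actions:
  assumes a: "a \<in> grade W 0" and \<xi>: "\<xi> \<in> carrier X2" and \<eta>: "\<eta> \<in> grade W 1" and \<theta>: "\<theta> \<in> grade W 1"
  shows "\<beta> a \<otimes> OX_wedge \<xi> \<eta> \<theta> = OX_wedge (ract X2 \<xi> a) \<eta> \<theta>"
    and "\<alpha> a \<otimes> OX_wedge \<xi> \<eta> \<theta> = OX_wedge \<xi> (a \<otimes>\<^bsub>W\<^esub> \<eta>) \<theta>"
    and "OX_wedge \<xi> \<eta> \<theta> \<otimes> \<alpha> a = OX_wedge \<xi> \<eta> (\<theta> \<otimes>\<^bsub>W\<^esub> a)"
proof -
  show "\<beta> a \<otimes> OX_wedge \<xi> \<eta> \<theta> = OX_wedge (ract X2 \<xi> a) \<eta> \<theta>"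
    unfolding OX_wedge_def using a \<xi> \<eta> \<theta>
    by (subst k_linear_map.finsum2[OF B.mult_left_linear], simp_all add: mem)
      (intro finsum_cong_simple, simp add: mem uev2(4) \<beta> B.m_assoc)
  show "\<alpha> a \<otimes> OX_wedge \<xi> \<eta> \<theta> = OX_wedge \<xi> (a \<otimes>\<^bsub>W\<^esub> \<eta>) \<theta>"
    unfolding OX_wedge_def using a \<xi> \<eta> \<theta> actsD(1)[OF OX1_acts, of a \<eta>]
    by (subst k_linear_map.finsum2[OF B.mult_left_linear], simp_all add: mem)
      (intro finsum_cong_simple, simp add: mem bar_past(2))
  show "OX_wedge \<xi> \<eta> \<theta> \<otimes> \<alpha> a = OX_wedge \<xi> \<eta> (\<theta> \<otimes>\<^bsub>W\<^esub> a)"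
    unfolding OX_wedge_def using a \<xi> \<eta> \<theta> actsD(2)[OF OX1_acts, of a \<theta>]
    by (subst k_linear_map.finsum2[OF B.mult_right_linear], simp_all add: mem)
      (intro finsum_cong_simple, simp add: mem B.m_assoc)
qed

lemma XO2_acts: "acts X2 \<Omega>2 XO2"
proof -
  have lin_r: "a \<in> grade W 0 \<Longrightarrow> k_linear_map \<Omega>2 \<Omega>2 (\<lambda>\<zeta>. \<zeta> \<otimes>\<^bsub>W\<^esub> a)"
    and lin_l: "a \<in> grade W 0 \<Longrightarrow> k_linear_map \<Omega>2 \<Omega>2 (\<lambda>\<zeta>. a \<otimes>\<^bsub>W\<^esub> \<zeta>)" for a
    using O2.ract_linear[of a] O2.lact_linear[of a] by simp_all
  note as = W.m_assoc W.grade_mem[of _ 0] W.grade_mem[of _ 1]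
  show ?thesis
    unfolding acts_def
  proof (intro ballI conjI)
    fix a \<xi> \<zeta> assume a: "a \<in> grade W 0" and \<xi>: "\<xi> \<in> carrier X2" and "\<zeta> \<in> carrier \<Omega>2"
    then have \<zeta>: "\<zeta> \<in> grade W 2" by simp
    show "\<alpha> a \<otimes> XO2 \<xi> \<zeta> = XO2 (lact X2 a \<xi>) \<zeta>"
      by (rule two_form_maps_eq[OF k_linear_map_comp[OF XO2_linear B.mult_left_linear] XO2_linear _ \<zeta>])
        (use a \<xi> in \<open>simp_all add: mem XO2_wedge XO_wedge_actions\<close>)
    show "XO2 \<xi> \<zeta> \<otimes> \<alpha> a = XO2 (ract X2 \<xi> a) \<zeta>"
      by (rule two_form_maps_eq[OF k_linear_map_comp[OF XO2_linear B.mult_right_linear] XO2_linear _ \<zeta>])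
        (use a \<xi> in \<open>simp_all add: mem XO2_wedge XO_wedge_right\<close>)
    have "\<beta> a \<otimes> XO2 \<xi> \<zeta> = XO2 \<xi> (\<zeta> \<otimes>\<^bsub>W\<^esub> a)"
      by (rule two_form_maps_eq[OF k_linear_map_comp[OF XO2_linear B.mult_left_linear]
            k_linear_map_comp[OF lin_r XO2_linear] _ \<zeta>])
        (use a \<xi> in \<open>simp_all add: mem XO2_wedge XO_wedge_actions as\<close>)
    then show "\<beta> a \<otimes> XO2 \<xi> \<zeta> = XO2 \<xi> (ract \<Omega>2 \<zeta> a)" by simp
    have "XO2 \<xi> \<zeta> \<otimes> \<beta> a = XO2 \<xi> (a \<otimes>\<^bsub>W\<^esub> \<zeta>)"
      by (rule two_form_maps_eq[OF k_linear_map_comp[OF XO2_linear B.mult_right_linear]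
            k_linear_map_comp[OF lin_l XO2_linear] _ \<zeta>])
        (use a \<xi> in \<open>simp_all add: mem XO2_wedge XO_wedge_actions flip: W.m_assoc[OF W.grade_mem[of _ 0] W.grade_mem[of _ 1] W.grade_mem[of _ 1]]\<close>)
    then show "XO2 \<xi> \<zeta> \<otimes> \<beta> a = XO2 \<xi> (lact \<Omega>2 a \<zeta>)" by simp
  qed
qed

lemma OX2_acts: "acts \<Omega>2 X2 OX2"
proof -
  have lin_r: "a \<in> grade W 0 \<Longrightarrow> k_linear_map \<Omega>2 \<Omega>2 (\<lambda>\<zeta>. \<zeta> \<otimes>\<^bsub>W\<^esub> a)"
    and lin_l: "a \<in> grade W 0 \<Longrightarrow> k_linear_map \<Omega>2 \<Omega>2 (\<lambda>\<zeta>. a \<otimes>\<^bsub>W\<^esub> \<zeta>)" for a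
    using O2.ract_linear[of a] O2.lact_linear[of a] by simp_all
  note as = W.m_assoc W.grade_mem[of _ 0] W.grade_mem[of _ 1]
  show ?thesis
    unfolding acts_def
  proof (intro ballI conjI)
    fix a \<zeta> \<xi> assume a: "a \<in> grade W 0" and \<xi>: "\<xi> \<in> carrier X2" and "\<zeta> \<in> carrier \<Omega>2"
    then have \<zeta>: "\<zeta> \<in> grade W 2" by simp
    show "\<beta> a \<otimes> OX2 \<zeta> \<xi> = OX2 \<zeta> (ract X2 \<xi> a)"
      by (rule two_form_maps_eq[OF k_linear_map_comp[OF OX2_linear B.mult_left_linear] OX2_linear _ \<zeta>])
        (use a \<xi> in \<open>simp_all add: mem OX2_wedge OX_wedge_actions\<close>)
    show "OX2 \<zeta> \<xi> \<otimes> \<beta> a = OX2 \<zeta> (lact X2 a \<xi>)"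
      by (rule two_form_maps_eq[OF k_linear_map_comp[OF OX2_linear B.mult_right_linear] OX2_linear _ \<zeta>])
        (use a \<xi> in \<open>simp_all add: mem OX2_wedge OX_wedge_right\<close>)
    have "OX2 \<zeta> \<xi> \<otimes> \<alpha> a = OX2 (\<zeta> \<otimes>\<^bsub>W\<^esub> a) \<xi>"
      by (rule two_form_maps_eq[OF k_linear_map_comp[OF OX2_linear B.mult_right_linear]
            k_linear_map_comp[OF lin_r OX2_linear] _ \<zeta>])
        (use a \<xi> in \<open>simp_all add: mem OX2_wedge OX_wedge_actions as\<close>)
    then show "OX2 \<zeta> \<xi> \<otimes> \<alpha> a = OX2 (ract \<Omega>2 \<zeta> a) \<xi>" by simp
    have "\<alpha> a \<otimes> OX2 \<zeta> \<xi> = OX2 (a \<otimes>\<^bsub>W\<^esub> \<zeta>) \<xi>"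
      by (rule two_form_maps_eq[OF k_linear_map_comp[OF OX2_linear B.mult_left_linear]
            k_linear_map_comp[OF lin_l OX2_linear] _ \<zeta>])
        (use a \<xi> in \<open>simp_all add: mem OX2_wedge OX_wedge_actions flip: W.m_assoc[OF W.grade_mem[of _ 0] W.grade_mem[of _ 1] W.grade_mem[of _ 1]]\<close>)
    then show "\<alpha> a \<otimes> OX2 \<zeta> \<xi> = OX2 (lact \<Omega>2 a \<zeta>) \<xi>" by simp
  qed
qed

subsection \<open>The mixed relation\<close>
lemma bar_commutator:
  assumes a: "a \<in> grade W 0" and z: "z \<in> grade W 0" and w: "w \<in> carrier B"
  shows "commutator B (\<alpha> z \<otimes> w) (\<beta> a) = \<alpha> z \<otimes> commutator B w (\<beta> a)"
proof -
  have "\<beta> a \<otimes> (\<alpha> z \<otimes> w) = \<alpha> z \<otimes> (\<beta> a \<otimes> w)"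
    using assms by (simp add: mem comm flip: B.m_assoc)
  then show ?thesis
    using assms by (simp add: mem commutator_def B.minus_distrib B.m_assoc)
qed

lemma twisted_derivation_X:
  assumes "r \<in> grade W 0" and "a \<in> grade W 0" and "z \<in> grade W 0" and "u \<in> carrier X1"
  shows "commutator B (\<alpha> z \<otimes> X u) (\<beta> a) \<otimes> \<beta> r = \<alpha> z \<otimes> XO1 u (r \<otimes>\<^bsub>W\<^esub> d a)"
  using assms by (simp add: mem bar_commutator XO1_base B.m_assoc)

text \<open>\<open>w \<mapsto> [w, \<beta> a] \<beta> r\<close> is a twisted derivation; applied to both sides of the flatness relation
  it gives the mixed relation for \<open>r da\<close>.\<close>
lemma twisted_derivation:
  assumes r: "r \<in> grade W 0" and a: "a \<in> grade W 0" and z: "z \<in> grade W 0"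
    and u: "u \<in> carrier X1" and v: "v \<in> carrier X1"
  shows "commutator B (\<alpha> z \<otimes> X u \<otimes> X v) (\<beta> a) \<otimes> \<beta> r =
      \<alpha> z \<otimes> (X u \<otimes> XO1 v (r \<otimes>\<^bsub>W\<^esub> d a) \<oplus> XO1 u (r \<otimes>\<^bsub>W\<^esub> d a) \<otimes> X v) \<oplus> \<alpha> z \<otimes> XO1 u (d a) \<otimes> XO1 v (d r)"
proof -
  note m = mem r a z u v
  note pull = bar_commutator[OF a z]
  have leib: "commutator B (s \<otimes> t) w = s \<otimes> commutator B t w \<oplus> commutator B s w \<otimes> t"
    if "s \<in> carrier B" "t \<in> carrier B" "w \<in> carrier B" for s t w
    unfolding commutator_def using that by algebra
  have "commutator B (\<alpha> z \<otimes> X u \<otimes> X v) (\<beta> a) \<otimes> \<beta> r = \<alpha> z \<otimes> (X u \<otimes> dX v a \<oplus> dX u a \<otimes> X v) \<otimes> \<beta> r"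
    using m pull[of "X u \<otimes> X v"] leib[of "X u" "X v" "\<beta> a"] by (simp add: B.m_assoc)
  also have "\<dots> = \<alpha> z \<otimes> (X u \<otimes> (dX v a \<otimes> \<beta> r) \<oplus> dX u a \<otimes> (X v \<otimes> \<beta> r))"
    using m by (simp add: B.m_assoc B.l_distr)
  also have "X v \<otimes> \<beta> r = \<beta> r \<otimes> X v \<oplus> dX v r" using m by (simp add: X_beta)
  also have "\<alpha> z \<otimes> (X u \<otimes> (dX v a \<otimes> \<beta> r) \<oplus> dX u a \<otimes> (\<beta> r \<otimes> X v \<oplus> dX v r)) =
      \<alpha> z \<otimes> (X u \<otimes> (dX v a \<otimes> \<beta> r) \<oplus> dX u a \<otimes> \<beta> r \<otimes> X v) \<oplus> \<alpha> z \<otimes> dX u a \<otimes> dX v r"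
    using m by (simp add: B.r_distr B.m_assoc B.a_assoc)
  finally show "commutator B (\<alpha> z \<otimes> X u \<otimes> X v) (\<beta> a) \<otimes> \<beta> r =
      \<alpha> z \<otimes> (X u \<otimes> XO1 v (r \<otimes>\<^bsub>W\<^esub> d a) \<oplus> XO1 u (r \<otimes>\<^bsub>W\<^esub> d a) \<otimes> X v) \<oplus> \<alpha> z \<otimes> XO1 u (d a) \<otimes> XO1 v (d r)"
    using m by (simp add: XO1_base XO1_d)
qed

text \<open>Write \<open>\<eta> = r da\<close> and apply the linear map \<open>w \<mapsto> [w, \<beta> a] \<beta> r\<close> to both sides of \<open>flat\<close>.  Its failure to be a
  derivation contributes the terms \<open>(x\<^sub>j, da) (x\<^sub>i, dr)\<close>, which add up to \<open>(\<xi>, dr \<and> da) = (\<xi>, d\<eta>)\<close>.\<close>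
lemma mixed:
  assumes \<xi>: "\<xi> \<in> carrier X2" and \<eta>: "\<eta> \<in> grade W 1"
  shows "(\<Oplus>i\<in>{..<p}. \<Oplus>j\<in>{..<p}. \<alpha> (ev2 \<xi> (\<omega> i \<and>\<^sub>W \<omega> j)) \<otimes>
          (X (x j) \<otimes> XO1 (x i) \<eta> \<oplus> XO1 (x j) \<eta> \<otimes> X (x i)))
      = (\<Oplus>i\<in>{..<p}. \<alpha> (ev2 \<xi> (d (\<omega> i))) \<otimes> XO1 (x i) \<eta>) \<ominus> XO2 \<xi> (d \<eta>)"
proof -
  let ?L = "\<lambda>\<eta>. \<Oplus>i\<in>{..<p}. \<Oplus>j\<in>{..<p}. \<alpha> (ev2 \<xi> (\<omega> i \<and>\<^sub>W \<omega> j)) \<otimes>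
      (X (x j) \<otimes> XO1 (x i) \<eta> \<oplus> XO1 (x j) \<eta> \<otimes> X (x i))"
  let ?R = "\<lambda>\<eta>. \<Oplus>i\<in>{..<p}. \<alpha> (ev2 \<xi> (d (\<omega> i))) \<otimes> XO1 (x i) \<eta>"
  have L: "k_linear_map \<Omega>1 B ?L"
  proof (rule double_sum_linear[OF O1.M.k_vector_space_axioms])
    fix i j assume "i < p" "j < p"
    then show "k_linear_map \<Omega>1 B (\<lambda>\<eta>. \<alpha> (ev2 \<xi> (\<omega> i \<and>\<^sub>W \<omega> j)) \<otimes> (X (x j) \<otimes> XO1 (x i) \<eta> \<oplus> XO1 (x j) \<eta> \<otimes> X (x i)))"
      using \<xi>
      by (intro k_linear_map_comp[OF k_linear_map_add[OF k_linear_map_comp[OF XO1_linear B.mult_left_linear]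
              k_linear_map_comp[OF XO1_linear B.mult_right_linear]] B.mult_left_linear])
        (simp_all add: mem)
  qed
  have R: "k_linear_map \<Omega>1 B ?R"
    by (rule linear_sums(1)) (use \<xi> in \<open>simp_all add: mem XO1_linear O1.M.k_vector_space_axioms\<close>)
  have dd: "k_linear_map \<Omega>1 B (\<lambda>\<eta>. XO2 \<xi> (d \<eta>))" by (rule k_linear_map_comp[OF diff_linear XO2_linear[OF \<xi>]])
  have eq: "?L \<eta> \<oplus> XO2 \<xi> (d \<eta>) = ?R \<eta>"
  proof (rule one_form_maps_eq[OF k_linear_map_add[OF L dd] R _ \<eta>])
    fix r a assume r: "r \<in> grade W 0" and a: "a \<in> grade W 0"
    let ?\<eta> = "r \<otimes>\<^bsub>W\<^esub> d a"
    have \<eta>': "?\<eta> \<in> grade W 1" using r a by (simp add: mem)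
    interpret T: k_linear_map B B "\<lambda>w. commutator B w (\<beta> a) \<otimes> \<beta> r"
      by (rule k_linear_map_comp[OF B.commutator_linear B.mult_right_linear]) (use r a in \<open>simp_all add: mem\<close>)
    have "?R ?\<eta> = (\<Oplus>i\<in>{..<p}. commutator B (\<alpha> (ev2 \<xi> (d (\<omega> i))) \<otimes> X (x i)) (\<beta> a) \<otimes> \<beta> r)"
      using r a \<xi> by (intro finsum_cong_simple) (simp add: twisted_derivation_X mem)
    also have "\<dots> = commutator B (\<Oplus>i\<in>{..<p}. \<alpha> (ev2 \<xi> (d (\<omega> i))) \<otimes> X (x i)) (\<beta> a) \<otimes> \<beta> r"
      using \<xi> by (intro T.finsum[symmetric]) (auto simp: mem)
    also have "\<dots> = (\<Oplus>i\<in>{..<p}. \<Oplus>j\<in>{..<p}. commutator B (\<alpha> (ev2 \<xi> (\<omega> i \<and>\<^sub>W \<omega> j)) \<otimes> X (x j) \<otimes> X (x i)) (\<beta> a) \<otimes> \<beta> r)"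
      unfolding flat[OF \<xi>] using \<xi> by (intro T.finsum2) (auto simp: mem)
    also have "\<dots> = (\<Oplus>i\<in>{..<p}. \<Oplus>j\<in>{..<p}. \<alpha> (ev2 \<xi> (\<omega> i \<and>\<^sub>W \<omega> j)) \<otimes> (X (x j) \<otimes> XO1 (x i) ?\<eta> \<oplus> XO1 (x j) ?\<eta> \<otimes> X (x i))
        \<oplus> \<alpha> (ev2 \<xi> (\<omega> i \<and>\<^sub>W \<omega> j)) \<otimes> XO1 (x j) (d a) \<otimes> XO1 (x i) (d r))"
      using r a \<xi> by (intro finsum_cong_simple) (simp add: twisted_derivation mem)
    also have "\<dots> = (\<Oplus>i\<in>{..<p}. (\<Oplus>j\<in>{..<p}. \<alpha> (ev2 \<xi> (\<omega> i \<and>\<^sub>W \<omega> j)) \<otimes> (X (x j) \<otimes> XO1 (x i) ?\<eta> \<oplus> XO1 (x j) ?\<eta> \<otimes> X (x i)))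
        \<oplus> (\<Oplus>j\<in>{..<p}. \<alpha> (ev2 \<xi> (\<omega> i \<and>\<^sub>W \<omega> j)) \<otimes> XO1 (x j) (d a) \<otimes> XO1 (x i) (d r)))"
      using r a \<xi> \<eta>' by (intro finsum_cong_simple B.finsum_plus) (auto simp: mem)
    also have "\<dots> = ?L ?\<eta> \<oplus> XO_wedge \<xi> (d r) (d a)"
      unfolding XO_wedge_def using r a \<xi> \<eta>' by (intro B.finsum_plus B.finsum_mem) (auto simp: mem)
    also have "XO_wedge \<xi> (d r) (d a) = XO2 \<xi> (d ?\<eta>)"
    proof -
      have "d ?\<eta> = d r \<otimes>\<^bsub>W\<^esub> d a"
        using W.leibniz_zero[OF r W.diff_closed[OF a]] W.diff_diff[OF W.grade_mem[OF a]] r a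
          W.grade_mem[OF W.wedge_closed[OF W.diff_closed[OF r] W.diff_closed[OF a]]]
        by (simp add: W.grade_mem[of _ 0])
      then show ?thesis using XO2_wedge[OF \<xi> W.diff_closed[OF r] W.diff_closed[OF a]] by simp
    qed
    finally show "?L ?\<eta> \<oplus> XO2 \<xi> (d ?\<eta>) = ?R ?\<eta>" by simp
  qed
  have minus: "v = v \<oplus> w \<ominus> w" if "v \<in> carrier B" "w \<in> carrier B" for v w using that by algebra
  show ?thesis
    unfolding eq[symmetric]
    by (rule minus[OF k_linear_map.closed[OF L] k_linear_map.closed[OF dd]]) (use \<eta> in simp_all)
qed

theorem D_model: "D_model W P Q p b x q y c B \<alpha> \<beta> X XO1 XO2 OX1 OX2"
proof (rule D_model.intro[OF base_model_axioms D_model_axioms.intro], goal_cases)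
  case 1 show ?case by (rule XO1_bilinear)
next
  case 2 show ?case by (rule XO2_bilinear)
next
  case 3 show ?case by (rule OX1_bilinear)
next
  case 4 show ?case by (rule OX2_bilinear)
next
  case 5 show ?case by (rule XO1_acts)
next
  case 6 show ?case by (rule XO2_acts)
next
  case 7 show ?case by (rule OX1_acts)
next
  case 8 show ?case by (rule OX2_acts)
next
  case (9 a u) then show ?case by (simp add: X_beta XO1_d)
next
  case (10 v \<eta>) then show ?case by (rule OX_XO_coev)
next
  case (11 v \<eta>) then show ?case by (rule XO_OX_ucoev)
next
  case (12 v \<eta>) then show ?case by (rule XO_OX_bar)
next
  case (13 v \<eta>) then show ?case by (rule OX_XO)
next
  case (14 \<xi> \<eta>) then show ?case by (rule mixed)
next
  case (15 \<xi> \<eta> \<theta>) then show ?case by (simp add: XO2_wedge XO_wedge_def)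
next
  case (16 \<xi> \<eta> \<theta>) then show ?case by (simp add: OX2_wedge OX_wedge_def)
qed

text \<open>The passage from \<open>H\<close> to \<open>D\<close> and back returns the original \<open>Y\<close>, by the relation \<open>\<Sum>\<^sub>i [Y v, b\<^sub>i] x\<^sub>i = Y v\<close>.\<close>
lemma Y_recovered:
  "v \<in> carrier X1 \<Longrightarrow> (\<Oplus>i\<in>{..<p}. OX1 (\<omega> i) v \<otimes> X (x i)) = Y v"
  using Y_coev[of v] by (simp add: OX1_d mem)

end

section \<open>The relations as equations between generators\<close>
lemma (in k_vector_space) finsum_lessThan_mem:
  fixes n :: nat
  shows "(\<And>i. i < n \<Longrightarrow> f i \<in> carrier M) \<Longrightarrow> finsum M f {..<n} \<in> carrier M"
  by (rule finsum_mem) simp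

lemma (in k_linear_map) finsum_lessThan:
  fixes n :: nat
  shows "(\<And>i. i < n \<Longrightarrow> g i \<in> carrier V) \<Longrightarrow> f (finsum V g {..<n}) = finsum C (\<lambda>i. f (g i)) {..<n}"
  by (rule finsum) simp_all

lemma ball_collect:
  "(\<forall>s\<in>{F1 u | u. P1 u}. Z s) \<longleftrightarrow> (\<forall>u. P1 u \<longrightarrow> Z (F1 u))"
  "(\<forall>s\<in>{F2 u v | u v. P2 u v}. Z s) \<longleftrightarrow> (\<forall>u v. P2 u v \<longrightarrow> Z (F2 u v))"
  "(\<forall>s\<in>{F3 u v w | u v w. P3 u v w}. Z s) \<longleftrightarrow> (\<forall>u v w. P3 u v w \<longrightarrow> Z (F3 u v w))"
  "(\<forall>s\<in>{F4 u v w t | u v w t. P4 u v w t}. Z s) \<longleftrightarrow> (\<forall>u v w t. P4 u v w t \<longrightarrow> Z (F4 u v w t))"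
  "(\<forall>s\<in>{F5 u v w t r | u v w t r. P5 u v w t r}. Z s) \<longleftrightarrow>
    (\<forall>u v w t r. P5 u v w t r \<longrightarrow> Z (F5 u v w t r))"
  "(\<forall>s\<in>{F6 u v w t r q | u v w t r q. P6 u v w t r q}. Z s) \<longleftrightarrow>
    (\<forall>u v w t r q. P6 u v w t r q \<longrightarrow> Z (F6 u v w t r q))"
  by blast+

context base_generators
begin

lemma first_order_null_mem:
  "first_order_null n r s \<Longrightarrow> (\<forall>m<n. r m \<in> grade W 0) \<and> (\<forall>m<n. s m \<in> grade W 0)"
  using null_sums(1,2) by blast

lemma wedge_null_mem:
  "wedge_null n r s t \<Longrightarrow> (\<forall>m<n. r m \<in> grade W 0) \<and> (\<forall>m<n. s m \<in> grade W 0) \<and> (\<forall>m<n. t m \<in> grade W 0)"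
  by (auto simp: wedge_null_iff)

text \<open>The two-sided relation for all four elements at once is equivalent to the four one-sided ones: put three of
  the elements equal to one.\<close>
lemma acts_iff:
  assumes "bimodule A M" and "bimodule A N" and bil: "k_bilinear M N B F"
  shows "(\<forall>a a' e e' m n. {a, a', e, e'} \<subseteq> carrier A \<and> m \<in> carrier M \<and> n \<in> carrier N \<longrightarrow>
      \<alpha> a \<otimes> \<beta> a' \<otimes> F m n \<otimes> (\<alpha> e \<otimes> \<beta> e') = F (ract M (lact M a m) e) (ract N (lact N e' n) a')) \<longleftrightarrow>
    acts M N F" (is "?L \<longleftrightarrow> _")
proof
  note F = k_bilinear_closed[OF bil]
  interpret M: bimodule A M by fact
  interpret N: bimodule A N by fact
  note one = M.lact_one[simplified] M.ract_one[simplified] N.lact_one[simplified] N.ract_one[simplified]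
  assume L: ?L
  show "acts M N F"
    unfolding acts_def
  proof (intro ballI)
    fix a m n assume a: "a \<in> grade W 0" and m: "m \<in> carrier M" "n \<in> carrier N"
    have L': "\<alpha> a1 \<otimes> \<beta> a2 \<otimes> F m n \<otimes> (\<alpha> a3 \<otimes> \<beta> a4) = F (ract M (lact M a1 m) a3) (ract N (lact N a4 n) a2)"
      if "a1 \<in> grade W 0" "a2 \<in> grade W 0" "a3 \<in> grade W 0" "a4 \<in> grade W 0" for a1 a2 a3 a4
      using L m that by simp
    show "\<alpha> a \<otimes> F m n = F (lact M a m) n \<and> F m n \<otimes> \<alpha> a = F (ract M m a) n \<and>
        \<beta> a \<otimes> F m n = F m (ract N n a) \<and> F m n \<otimes> \<beta> a = F m (lact N a n)"
      using L'[of a "\<one>\<^bsub>W\<^esub>" "\<one>\<^bsub>W\<^esub>" "\<one>\<^bsub>W\<^esub>"] L'[of "\<one>\<^bsub>W\<^esub>" "\<one>\<^bsub>W\<^esub>" a "\<one>\<^bsub>W\<^esub>"]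
        L'[of "\<one>\<^bsub>W\<^esub>" a "\<one>\<^bsub>W\<^esub>" "\<one>\<^bsub>W\<^esub>"] L'[of "\<one>\<^bsub>W\<^esub>" "\<one>\<^bsub>W\<^esub>" "\<one>\<^bsub>W\<^esub>" a] a m
        M.lact_closed[of a m] M.ract_closed[of a m] N.lact_closed[of a n] N.ract_closed[of a n]
      by (simp add: closed one \<alpha> \<beta> F)
  qed
next
  note F = k_bilinear_closed[OF bil]
  interpret M: bimodule A M by fact
  interpret N: bimodule A N by fact
  note cl = M.lact_closed[simplified] M.ract_closed[simplified] N.lact_closed[simplified] N.ract_closed[simplified]
  assume ac: "acts M N F"
  show ?L
  proof (intro allI impI)
    fix a a' e e' m n assume "{a, a', e, e'} \<subseteq> carrier A \<and> m \<in> carrier M \<and> n \<in> carrier N"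
    then have m: "a \<in> grade W 0" "a' \<in> grade W 0" "e \<in> grade W 0" "e' \<in> grade W 0" "m \<in> carrier M" "n \<in> carrier N"
      by auto
    have "\<alpha> a \<otimes> \<beta> a' \<otimes> F m n \<otimes> (\<alpha> e \<otimes> \<beta> e') = \<alpha> a \<otimes> (\<beta> a' \<otimes> (F m n \<otimes> \<alpha> e \<otimes> \<beta> e'))"
      using m by (simp add: closed F B.m_assoc)
    also have "\<dots> = F (lact M a (ract M m e)) (ract N (lact N e' n) a')"
      using m by (simp add: actsD[OF ac] cl)
    finally show "\<alpha> a \<otimes> \<beta> a' \<otimes> F m n \<otimes> (\<alpha> e \<otimes> \<beta> e') = F (ract M (lact M a m) e) (ract N (lact N e' n) a')"
      using m M.lact_ract[of a e m] by simp
  qed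
qed

end

text \<open>A homomorphism out of the free algebra \<open>D\<close>, together with the images of the generators.  It kills the relations
  of \<open>DX\<close> iff these images form a \<open>D_model\<close>.\<close>
locale D_hom = base_generators W P Q p b x q y c B \<alpha> \<beta> X
  for W :: "('k::field, 'w) dga" and P :: "('k, 'w, 'x) two_sided_dual"
    and Q :: "('k, 'w, 'y) two_sided_dual" and p :: nat and b :: "nat \<Rightarrow> 'w" and x :: "nat \<Rightarrow> 'x"
    and q :: nat and y :: "nat \<Rightarrow> 'x" and c :: "nat \<Rightarrow> 'w"
    and B :: "('k, 'e, 'z) module_scheme" (structure) and \<alpha> \<beta> :: "'w \<Rightarrow> 'e" and X :: "'x \<Rightarrow> 'e" +
  fixes XO1 :: "'x \<Rightarrow> 'w \<Rightarrow> 'e" and XO2 :: "'y \<Rightarrow> 'w \<Rightarrow> 'e"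
    and OX1 :: "'w \<Rightarrow> 'x \<Rightarrow> 'e" and OX2 :: "'w \<Rightarrow> 'y \<Rightarrow> 'e" and \<phi>
  assumes bil: "k_bilinear X1 \<Omega>1 B XO1" "k_bilinear X2 \<Omega>2 B XO2"
      "k_bilinear \<Omega>1 X1 B OX1" "k_bilinear \<Omega>2 X2 B OX2"
    and hom: "k_algebra_hom D B \<phi>"
    and \<phi>_A: "a \<in> grade W 0 \<Longrightarrow> a' \<in> grade W 0 \<Longrightarrow> \<phi> (D_A a a') = \<alpha> a \<otimes> \<beta> a'"
    and \<phi>_X: "u \<in> carrier X1 \<Longrightarrow> \<phi> (D_X u) = X u"
    and \<phi>_XO1: "u \<in> carrier X1 \<Longrightarrow> \<eta> \<in> grade W 1 \<Longrightarrow> \<phi> (D_X\<Omega>1 u \<eta>) = XO1 u \<eta>"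
    and \<phi>_XO2: "\<xi> \<in> carrier X2 \<Longrightarrow> \<zeta> \<in> grade W 2 \<Longrightarrow> \<phi> (D_X\<Omega>2 \<xi> \<zeta>) = XO2 \<xi> \<zeta>"
    and \<phi>_OX1: "u \<in> carrier X1 \<Longrightarrow> \<eta> \<in> grade W 1 \<Longrightarrow> \<phi> (D_\<Omega>X1 \<eta> u) = OX1 \<eta> u"
    and \<phi>_OX2: "\<xi> \<in> carrier X2 \<Longrightarrow> \<zeta> \<in> grade W 2 \<Longrightarrow> \<phi> (D_\<Omega>X2 \<zeta> \<xi>) = OX2 \<zeta> \<xi>"
begin

interpretation \<phi>: k_algebra_hom D B \<phi> by (rule hom)

lemma D_A_mem: "a \<in> grade W 0 \<Longrightarrow> a' \<in> grade W 0 \<Longrightarrow> D_A a a' \<in> carrier D"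
  using k_linear_map.closed[OF k_algebra_hom.axioms(3)[OF D_a_hom], of a]
    k_linear_map.closed[OF k_algebra_hom.axioms(3)[OF D_bar_hom], of a'] D_A_factors(1)[of a a', symmetric]
  by simp

lemmas D_mem = closed D_A_mem k_linear_map.closed[OF D_X_linear] D_bilinear[THEN k_bilinear_closed, simplified]
  bil[THEN k_bilinear_closed, simplified] \<phi>.R.finsum_lessThan_mem B.finsum_lessThan_mem

lemmas \<phi>_simps = B.minus_eq_zero_iff \<phi>.mult \<phi>.add \<phi>.minus \<phi>.finsum_lessThan \<alpha>(5) \<beta>(5) \<phi>_A \<phi>_X \<phi>_XO1 \<phi>_XO2 \<phi>_OX1 \<phi>_OX2

lemma bimod_iff:
  "(\<forall>r\<in>D_rels_bimod. \<phi> r = \<zero>) \<longleftrightarrow>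
    ((acts X1 \<Omega>1 XO1 \<and> acts X2 \<Omega>2 XO2) \<and> acts \<Omega>1 X1 OX1) \<and> acts \<Omega>2 X2 OX2"
  unfolding D_rels_bimod_def ball_Un ball_collect
    acts_iff[OF X1_bimodule W.forms_bimodule bil(1), symmetric]
    acts_iff[OF X2_bimodule W.forms_bimodule bil(2), symmetric]
    acts_iff[OF W.forms_bimodule X1_bimodule bil(3), symmetric]
    acts_iff[OF W.forms_bimodule X2_bimodule bil(4), symmetric]
  by (intro arg_cong2[where f = "(\<and>)"] all_cong1 imp_cong refl) (simp_all add: \<phi>_simps D_mem)

lemma first_order_iff:
  "(\<forall>r\<in>D_rels_first_order. \<phi> r = \<zero>) \<longleftrightarrow>
   ((((((\<forall>a u. a \<in> carrier A \<and> u \<in> carrier X1 \<longrightarrow> \<alpha> a \<otimes> X u = X (lact X1 a u)) \<and>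
    (\<forall>a u. a \<in> carrier A \<and> u \<in> carrier X1 \<longrightarrow> X u \<otimes> \<alpha> a = X (ract X1 u a) \<oplus> \<alpha> (ev1 u (d a)))) \<and>
    (\<forall>a u. a \<in> carrier A \<and> u \<in> carrier X1 \<longrightarrow> X u \<otimes> \<beta> a = \<beta> a \<otimes> X u \<oplus> XO1 u (d a))) \<and>
    (\<forall>v \<eta>. v \<in> carrier X1 \<and> \<eta> \<in> carrier \<Omega>1 \<longrightarrow>
      (\<Oplus>i\<in>{..<p}. OX1 (\<omega> i) v \<otimes> XO1 (x i) \<eta>) = \<beta> (uev1 \<eta> v))) \<and>
    (\<forall>v \<eta>. v \<in> carrier X1 \<and> \<eta> \<in> carrier \<Omega>1 \<longrightarrow>
      (\<Oplus>j\<in>{..<q}. XO1 v (\<rho> j) \<otimes> OX1 \<eta> (y j)) = \<alpha> (ev1 v \<eta>))) \<and>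
    (\<forall>v \<eta>. v \<in> carrier X1 \<and> \<eta> \<in> carrier \<Omega>1 \<longrightarrow>
      (\<Oplus>j\<in>{..<q}. XO1 (y j) \<eta> \<otimes> OX1 (\<rho> j) v) = \<beta> (ev1 v \<eta>))) \<and>
    (\<forall>v \<eta>. v \<in> carrier X1 \<and> \<eta> \<in> carrier \<Omega>1 \<longrightarrow>
      (\<Oplus>i\<in>{..<p}. OX1 \<eta> (x i) \<otimes> XO1 v (\<omega> i)) = \<alpha> (uev1 \<eta> v))"
  unfolding D_rels_first_order_def ball_Un ball_collect
  by (intro arg_cong2[where f = "(\<and>)"] all_cong1 imp_cong refl) (simp_all add: \<phi>_simps D_mem)

lemma second_order_iff:
  "(\<forall>r\<in>D_rels_second_order. \<phi> r = \<zero>) \<longleftrightarrow>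
   (((\<forall>\<xi>. \<xi> \<in> carrier X2 \<longrightarrow> (\<Oplus>i\<in>{..<p}. \<alpha> (ev2 \<xi> (d (\<omega> i))) \<otimes> X (x i))
      = (\<Oplus>j\<in>{..<p}. \<Oplus>k\<in>{..<p}. \<alpha> (ev2 \<xi> (\<omega> j \<and>\<^sub>W \<omega> k)) \<otimes> X (x k) \<otimes> X (x j))) \<and>
    (\<forall>\<xi> \<eta>. \<xi> \<in> carrier X2 \<and> \<eta> \<in> carrier \<Omega>1 \<longrightarrow>
      (\<Oplus>i\<in>{..<p}. \<Oplus>j\<in>{..<p}. \<alpha> (ev2 \<xi> (\<omega> i \<and>\<^sub>W \<omega> j)) \<otimes>
          (X (x j) \<otimes> XO1 (x i) \<eta> \<oplus> XO1 (x j) \<eta> \<otimes> X (x i)))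
      = (\<Oplus>i\<in>{..<p}. \<alpha> (ev2 \<xi> (d (\<omega> i))) \<otimes> XO1 (x i) \<eta>) \<ominus> XO2 \<xi> (d \<eta>))) \<and>
    (\<forall>\<xi> \<eta> \<theta>. \<xi> \<in> carrier X2 \<and> \<eta> \<in> carrier \<Omega>1 \<and> \<theta> \<in> carrier \<Omega>1 \<longrightarrow>
      (\<Oplus>i\<in>{..<p}. \<Oplus>j\<in>{..<p}. \<alpha> (ev2 \<xi> (\<omega> i \<and>\<^sub>W \<omega> j)) \<otimes> XO1 (x j) \<theta> \<otimes> XO1 (x i) \<eta>)
      = XO2 \<xi> (\<eta> \<and>\<^sub>W \<theta>))) \<and>
    (\<forall>\<xi> \<eta> \<theta>. \<xi> \<in> carrier X2 \<and> \<eta> \<in> carrier \<Omega>1 \<and> \<theta> \<in> carrier \<Omega>1 \<longrightarrow>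
      (\<Oplus>i\<in>{..<q}. \<Oplus>j\<in>{..<q}. \<beta> (uev2 (\<rho> i \<and>\<^sub>W \<rho> j) \<xi>) \<otimes> OX1 \<eta> (y i) \<otimes> OX1 \<theta> (y j))
      = OX2 (\<eta> \<and>\<^sub>W \<theta>) \<xi>)"
  unfolding D_rels_second_order_def ball_Un ball_collect
  by (intro arg_cong2[where f = "(\<and>)"] all_cong1 imp_cong refl) (simp_all add: \<phi>_simps D_mem)

lemma D_rels_iff:
  "(\<forall>r\<in>D_rels_bimod \<union> D_rels_first_order \<union> D_rels_second_order. \<phi> r = \<zero>) \<longleftrightarrow>
    D_model W P Q p b x q y c B \<alpha> \<beta> X XO1 XO2 OX1 OX2"
proof
  assume m: "D_model W P Q p b x q y c B \<alpha> \<beta> X XO1 XO2 OX1 OX2"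
  note base = D_model.axioms(1)[OF m]
  note eqs = base_model.X_left[OF base] base_model.X_right[OF base] base_model.flat[OF base]
    D_model.actions[OF m] D_model.X_bar[OF m] D_model.OX_XO_coev[OF m] D_model.XO_OX_ucoev[OF m]
    D_model.XO_OX_bar[OF m] D_model.OX_XO[OF m] D_model.mixed[OF m] D_model.XO2_wedge[OF m] D_model.OX2_wedge[OF m]
  show "\<forall>r\<in>D_rels_bimod \<union> D_rels_first_order \<union> D_rels_second_order. \<phi> r = \<zero>"
    unfolding ball_Un bimod_iff first_order_iff second_order_iff base_algebra_simps forms_simps
    by (intro conjI allI impI; (elim conjE)?; (rule eqs; assumption))
next
  assume R: "\<forall>r\<in>D_rels_bimod \<union> D_rels_first_order \<union> D_rels_second_order. \<phi> r = \<zero>"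
  note bi = R[unfolded ball_Un, THEN conjunct1, THEN conjunct1, unfolded bimod_iff]
  note fo = R[unfolded ball_Un, THEN conjunct1, THEN conjunct2, unfolded first_order_iff base_algebra_simps forms_simps]
  note so = R[unfolded ball_Un, THEN conjunct2, unfolded second_order_iff base_algebra_simps forms_simps]
  \<comment> \<open>The conjuncts are listed separately, so that each axiom of the model is closed by resolution with one of them.\<close>
  note eqs = bi[THEN conjunct1, THEN conjunct1, THEN conjunct1] bi[THEN conjunct1, THEN conjunct1, THEN conjunct2] bi[THEN conjunct1, THEN conjunct2] bi[THEN conjunct2]
    fo[THEN conjunct1, THEN conjunct1, THEN conjunct1, THEN conjunct1, THEN conjunct1, THEN conjunct1] fo[THEN conjunct1, THEN conjunct1, THEN conjunct1, THEN conjunct1, THEN conjunct1, THEN conjunct2] fo[THEN conjunct1, THEN conjunct1, THEN conjunct1, THEN conjunct1, THEN conjunct2] fo[THEN conjunct1, THEN conjunct1, THEN conjunct1, THEN conjunct2] fo[THEN conjunct1, THEN conjunct1, THEN conjunct2] fo[THEN conjunct1, THEN conjunct2] fo[THEN conjunct2]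
    so[THEN conjunct1, THEN conjunct1, THEN conjunct1] so[THEN conjunct1, THEN conjunct1, THEN conjunct2] so[THEN conjunct1, THEN conjunct2] so[THEN conjunct2]
  show "D_model W P Q p b x q y c B \<alpha> \<beta> X XO1 XO2 OX1 OX2"
    by (intro D_model.intro base_model.intro base_generators_axioms base_model_axioms.intro D_model_axioms.intro bil;
        (rule eqs | rule eqs[rule_format]; (intro conjI)?; assumption))
qed

lemma D_rels_carrier: "D_rels_bimod \<union> D_rels_first_order \<union> D_rels_second_order \<subseteq> carrier D"
  unfolding D_rels_bimod_def D_rels_first_order_def D_rels_second_order_def
  by (auto simp: D_mem intro!: \<phi>.R.minus_closed)

end

text \<open>A homomorphism out of the free algebra \<open>H\<close>, together with the images of the generators.  It kills the
  relations of \<open>HX1\<close> iff these images satisfy all equations of an \<open>H_model\<close> that do not involve two-forms.\<close>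
locale H_hom = base_generators W P Q p b x q y c B \<alpha> \<beta> X
  for W :: "('k::field, 'w) dga" and P :: "('k, 'w, 'x) two_sided_dual"
    and Q :: "('k, 'w, 'y) two_sided_dual" and p :: nat and b :: "nat \<Rightarrow> 'w" and x :: "nat \<Rightarrow> 'x"
    and q :: nat and y :: "nat \<Rightarrow> 'x" and c :: "nat \<Rightarrow> 'w"
    and B :: "('k, 'e, 'z) module_scheme" (structure) and \<alpha> \<beta> :: "'w \<Rightarrow> 'e" and X :: "'x \<Rightarrow> 'e" +
  fixes Y :: "'x \<Rightarrow> 'e" and \<phi>
  assumes Y_lin: "k_linear_map X1 B Y" and hom: "k_algebra_hom H B \<phi>"
    and \<phi>_A: "a \<in> grade W 0 \<Longrightarrow> a' \<in> grade W 0 \<Longrightarrow> \<phi> (H_A a a') = \<alpha> a \<otimes> \<beta> a'"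
    and \<phi>_X: "u \<in> carrier X1 \<Longrightarrow> \<phi> (H_X u) = X u"
    and \<phi>_Y: "u \<in> carrier X1 \<Longrightarrow> \<phi> (H_Y u) = Y u"
begin

interpretation \<phi>: k_algebra_hom H B \<phi> by (rule hom)

lemma H_A_mem: "a \<in> grade W 0 \<Longrightarrow> a' \<in> grade W 0 \<Longrightarrow> H_A a a' \<in> carrier H"
  using k_linear_map.closed[OF k_algebra_hom.axioms(3)[OF H_a_hom], of a]
    k_linear_map.closed[OF k_algebra_hom.axioms(3)[OF H_bar_hom], of a'] H_A_factors(1)[of a a', symmetric]
  by simp

lemmas H_mem = closed H_A_mem k_linear_map.closed[OF H_X_linear] k_linear_map.closed[OF H_Y_linear]
  \<phi>.R.commutator_mem \<phi>.R.finsum_lessThan_mem B.finsum_lessThan_mem k_linear_map.closed[OF Y_lin]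

lemmas \<phi>_simps = B.minus_eq_zero_iff \<phi>.mult \<phi>.add \<phi>.minus \<phi>.commutator \<phi>.finsum_lessThan \<alpha>(5) \<beta>(5) \<phi>_A \<phi>_X \<phi>_Y

lemma H_rels_iff:
  "(\<forall>r\<in>H_rels. \<phi> r = \<zero>) \<longleftrightarrow>
   (((((((((\<forall>a u. a \<in> carrier A \<and> u \<in> carrier X1 \<longrightarrow> \<alpha> a \<otimes> X u = X (lact X1 a u)) \<and>
    (\<forall>a u. a \<in> carrier A \<and> u \<in> carrier X1 \<longrightarrow> X u \<otimes> \<alpha> a = X (ract X1 u a) \<oplus> \<alpha> (ev1 u (d a)))) \<and>
    (\<forall>a v. a \<in> carrier A \<and> v \<in> carrier X1 \<longrightarrow> \<beta> a \<otimes> Y v = Y (ract X1 v a))) \<and>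
    (\<forall>a v. a \<in> carrier A \<and> v \<in> carrier X1 \<longrightarrow> Y v \<otimes> \<beta> a = Y (lact X1 a v) \<oplus> \<beta> (uev1 (d a) v))) \<and>
    (\<forall>n r s u. first_order_null n r s \<and> u \<in> carrier X1 \<longrightarrow>
      (\<Oplus>m\<in>{..<n}. \<beta> (s m) \<otimes> X u \<otimes> \<beta> (r m)) = \<zero>)) \<and>
    (\<forall>n r s v. first_order_null n r s \<and> v \<in> carrier X1 \<longrightarrow>
      (\<Oplus>m\<in>{..<n}. \<alpha> (r m) \<otimes> Y v \<otimes> \<alpha> (s m)) = \<zero>)) \<and>
    (\<forall>v. v \<in> carrier X1 \<longrightarrow> (\<Oplus>i\<in>{..<p}. commutator B (Y v) (\<alpha> (b i)) \<otimes> X (x i)) = Y v)) \<and>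
    (\<forall>u. u \<in> carrier X1 \<longrightarrow> (\<Oplus>j\<in>{..<q}. commutator B (X u) (\<beta> (c j)) \<otimes> Y (y j)) = X u)) \<and>
    (\<forall>a u. a \<in> carrier A \<and> u \<in> carrier X1 \<longrightarrow>
      (\<Oplus>j\<in>{..<q}. commutator B (X (y j)) (\<beta> a) \<otimes> commutator B (Y u) (\<alpha> (c j))) = \<beta> (ev1 u (d a)))) \<and>
    (\<forall>a u. a \<in> carrier A \<and> u \<in> carrier X1 \<longrightarrow>
      (\<Oplus>i\<in>{..<p}. commutator B (Y (x i)) (\<alpha> a) \<otimes> commutator B (X u) (\<beta> (b i))) = \<alpha> (uev1 (d a) u))"
  unfolding H_rels_def ball_Un ball_collect
  by (intro arg_cong2[where f = "(\<and>)"] all_cong1 imp_cong refl; (elim conjE)?; (drule first_order_null_mem)?; simp add: \<phi>_simps H_mem)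

lemma H_model_kills_H_rels:
  assumes m: "H_model W P Q p b x q y c B \<alpha> \<beta> X Y"
  shows "\<forall>r\<in>H_rels. \<phi> r = \<zero>"
proof -
  note base = H_model.axioms(1)[OF m]
  note eqs = base_model.X_left[OF base] base_model.X_right[OF base] H_model.Y_left[OF m] H_model.Y_right[OF m]
    H_model.X_null[OF m] H_model.Y_null[OF m] H_model.Y_coev[OF m] H_model.X_ucoev[OF m] H_model.XY[OF m] H_model.YX[OF m]
  show ?thesis
    unfolding H_rels_iff base_algebra_simps forms_simps
    by (intro conjI allI impI; (elim conjE)?; (rule eqs; assumption))
qed

lemma H_rels_carrier: "H_rels \<subseteq> carrier H"
  unfolding H_rels_def
  by (intro Un_least; clarify; (drule first_order_null_mem)?; simp add: H_mem)

end

text \<open>\<open>HX_quotient\<close> is a quotient in two steps; \<open>\<psi>\<close> is a homomorphism on the intermediate algebra \<open>HX1\<close>, so that the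
  relations of \<open>HX1\<close> hold automatically for the images of the generators.\<close>
locale HX_hom = H_hom W P Q p b x q y c B \<alpha> \<beta> X Y \<phi>
  for W :: "('k::field, 'w) dga" and P :: "('k, 'w, 'x) two_sided_dual"
    and Q :: "('k, 'w, 'y) two_sided_dual" and p :: nat and b :: "nat \<Rightarrow> 'w" and x :: "nat \<Rightarrow> 'x"
    and q :: nat and y :: "nat \<Rightarrow> 'x" and c :: "nat \<Rightarrow> 'w"
    and B :: "('k, 'e, 'z) module_scheme" (structure) and \<alpha> \<beta> :: "'w \<Rightarrow> 'e" and X Y :: "'x \<Rightarrow> 'e" and \<phi> +
  fixes \<psi>
  assumes HX_hom: "k_algebra_hom HX1 B \<psi>"
    and \<psi>_class: "u \<in> carrier H \<Longrightarrow> \<psi> (rel_class H H_rels u) = \<phi> u"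
begin

interpretation \<phi>: k_algebra_hom H B \<phi> by (rule hom)
interpretation \<psi>: k_algebra_hom HX1 B \<psi> by (rule HX_hom)

sublocale rels: relations H H_rels
  using H_rels_carrier by (intro relations.intro relations_axioms.intro H_algebra)

lemmas class_mem = k_linear_map.closed[OF k_algebra_hom.axioms(3)[OF rels.rel_class_hom], folded HX1_def]

lemma HX_gens_mem:
  "a \<in> grade W 0 \<Longrightarrow> a' \<in> grade W 0 \<Longrightarrow> HX_A a a' \<in> carrier HX1"
  "u \<in> carrier X1 \<Longrightarrow> HX_X u \<in> carrier HX1" "u \<in> carrier X1 \<Longrightarrow> HX_Y u \<in> carrier HX1"
  by (simp_all add: HX_A_def HX_X_def HX_Y_def class_mem H_mem)

lemma HX_gens:
  "a \<in> grade W 0 \<Longrightarrow> a' \<in> grade W 0 \<Longrightarrow> \<psi> (HX_A a a') = \<alpha> a \<otimes> \<beta> a'"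
  "u \<in> carrier X1 \<Longrightarrow> \<psi> (HX_X u) = X u" "u \<in> carrier X1 \<Longrightarrow> \<psi> (HX_Y u) = Y u"
  by (simp_all add: HX_A_def HX_X_def HX_Y_def \<psi>_class H_mem \<phi>_A \<phi>_X \<phi>_Y)

lemmas HX_mem = closed HX_gens_mem \<psi>.R.commutator_mem \<psi>.R.finsum_lessThan_mem B.finsum_lessThan_mem k_linear_map.closed[OF Y_lin]

lemmas HX_simps = B.minus_eq_zero_iff \<psi>.mult \<psi>.add \<psi>.minus \<psi>.commutator \<psi>.finsum_lessThan \<alpha>(5) \<beta>(5) HX_gens

lemma HX_rels_second_order_iff:
  "(\<forall>r\<in>HX_rels. \<psi> r = \<zero>) \<longleftrightarrow>
   ((\<forall>\<xi>. \<xi> \<in> carrier X2 \<longrightarrow> (\<Oplus>i\<in>{..<p}. \<alpha> (ev2 \<xi> (d (\<omega> i))) \<otimes> X (x i))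
      = (\<Oplus>j\<in>{..<p}. \<Oplus>k\<in>{..<p}. \<alpha> (ev2 \<xi> (\<omega> j \<and>\<^sub>W \<omega> k)) \<otimes> X (x k) \<otimes> X (x j))) \<and>
    (\<forall>n r s t \<xi>. wedge_null n r s t \<and> \<xi> \<in> carrier X2 \<longrightarrow>
      (\<Oplus>m\<in>{..<n}. \<Oplus>i\<in>{..<p}. \<Oplus>j\<in>{..<p}. \<alpha> (ev2 \<xi> (\<omega> i \<and>\<^sub>W \<omega> j)) \<otimes> commutator B (X (x j)) (\<beta> (t m))
        \<otimes> commutator B (X (x i)) (\<beta> (s m)) \<otimes> \<beta> (r m)) = \<zero>)) \<and>
    (\<forall>n r s t \<xi>. wedge_null n r s t \<and> \<xi> \<in> carrier X2 \<longrightarrow>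
      (\<Oplus>m\<in>{..<n}. \<Oplus>i\<in>{..<q}. \<Oplus>j\<in>{..<q}. \<beta> (uev2 (\<rho> i \<and>\<^sub>W \<rho> j) \<xi>) \<otimes> \<alpha> (r m)
        \<otimes> commutator B (Y (y i)) (\<alpha> (s m)) \<otimes> commutator B (Y (y j)) (\<alpha> (t m))) = \<zero>)"
  unfolding HX_rels_def ball_Un ball_collect
  by (intro arg_cong2[where f = "(\<and>)"] all_cong1 imp_cong refl; (elim conjE)?; (drule wedge_null_mem)?; simp add: HX_simps HX_mem)

lemma HX_rels_carrier: "HX_rels \<subseteq> carrier HX1"
  unfolding HX_rels_def
  by (intro Un_least; clarify; (drule wedge_null_mem)?; simp add: HX_mem)

lemma HX_rels_iff:
  "(\<forall>r\<in>HX_rels. \<psi> r = \<zero>) \<longleftrightarrow> H_model W P Q p b x q y c B \<alpha> \<beta> X Y"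
proof
  assume m: "H_model W P Q p b x q y c B \<alpha> \<beta> X Y"
  note eqs = base_model.flat[OF H_model.axioms(1)[OF m]] H_model.X_wedge_null[OF m] H_model.Y_wedge_null[OF m]
  show "\<forall>r\<in>HX_rels. \<psi> r = \<zero>"
    unfolding HX_rels_second_order_iff by (intro conjI allI impI; (elim conjE)?; (rule eqs; assumption))
next
  assume so: "\<forall>r\<in>HX_rels. \<psi> r = \<zero>"
  have fo: "\<forall>r\<in>H_rels. \<phi> r = \<zero>"
  proof
    fix r assume r: "r \<in> H_rels"
    have "\<phi> r = \<psi> \<zero>\<^bsub>HX1\<^esub>"
      using \<psi>_class[OF subsetD[OF H_rels_carrier r]] rels.rel_class_zero[OF r] by (simp add: HX1_def)
    then show "\<phi> r = \<zero>" by (simp add: \<psi>.zero)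
  qed
  note fo' = fo[unfolded H_rels_iff base_algebra_simps forms_simps]
  note so' = so[unfolded HX_rels_second_order_iff base_algebra_simps forms_simps]
  \<comment> \<open>The conjuncts are listed separately, so that each axiom of the model is closed by resolution with one of them.\<close>
  note eqs = fo'[THEN conjunct1, THEN conjunct1, THEN conjunct1, THEN conjunct1, THEN conjunct1, THEN conjunct1, THEN conjunct1, THEN conjunct1, THEN conjunct1] fo'[THEN conjunct1, THEN conjunct1, THEN conjunct1, THEN conjunct1, THEN conjunct1, THEN conjunct1, THEN conjunct1, THEN conjunct1, THEN conjunct2] fo'[THEN conjunct1, THEN conjunct1, THEN conjunct1, THEN conjunct1, THEN conjunct1, THEN conjunct1, THEN conjunct1, THEN conjunct2] fo'[THEN conjunct1, THEN conjunct1, THEN conjunct1, THEN conjunct1, THEN conjunct1, THEN conjunct1, THEN conjunct2] fo'[THEN conjunct1, THEN conjunct1, THEN conjunct1, THEN conjunct1, THEN conjunct1, THEN conjunct2] fo'[THEN conjunct1, THEN conjunct1, THEN conjunct1, THEN conjunct1, THEN conjunct2] fo'[THEN conjunct1, THEN conjunct1, THEN conjunct1, THEN conjunct2] fo'[THEN conjunct1, THEN conjunct1, THEN conjunct2] fo'[THEN conjunct1, THEN conjunct2] fo'[THEN conjunct2]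
    so'[THEN conjunct1, THEN conjunct1] so'[THEN conjunct1, THEN conjunct2] so'[THEN conjunct2]
  show "H_model W P Q p b x q y c B \<alpha> \<beta> X Y"
    by (intro H_model.intro base_model.intro base_generators_axioms base_model_axioms.intro H_model_axioms.intro Y_lin;
        (rule eqs[rule_format]; (intro conjI)?; assumption))
qed

end

section \<open>Universal properties and the isomorphism\<close>

context pivotal_calculus
begin

lemma D_hom_from_free:
  assumes \<phi>: "k_algebra_hom D B \<phi>"
  shows "D_hom W P Q p b x q y c B (\<lambda>a. \<phi> (D_a a)) (\<lambda>a. \<phi> (D_bar a)) (\<lambda>u. \<phi> (D_X u))
    (\<lambda>u \<eta>. \<phi> (D_X\<Omega>1 u \<eta>)) (\<lambda>\<xi> \<zeta>. \<phi> (D_X\<Omega>2 \<xi> \<zeta>)) (\<lambda>\<eta> u. \<phi> (D_\<Omega>X1 \<eta> u)) (\<lambda>\<zeta> \<xi>. \<phi> (D_\<Omega>X2 \<zeta> \<xi>)) \<phi>"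
proof -
  interpret \<phi>: k_algebra_hom D B \<phi> by fact
  note lin = k_algebra_hom.axioms(3)[OF \<phi>]
  note mem = k_linear_map.closed[OF k_algebra_hom.axioms(3)[OF D_a_hom]]
    k_linear_map.closed[OF k_algebra_hom.axioms(3)[OF D_bar_hom]]
  have prods: "\<phi> (D_A a a') = \<phi> (D_a a) \<otimes>\<^bsub>B\<^esub> \<phi> (D_bar a')" "\<phi> (D_A a a') = \<phi> (D_bar a') \<otimes>\<^bsub>B\<^esub> \<phi> (D_a a)"
    if "a \<in> grade W 0" "a' \<in> grade W 0" for a a'
    using that by (simp_all add: \<phi>.mult[symmetric] mem[simplified] D_A_factors[simplified])
  have "base_generators W P Q p b x q y c B (\<lambda>a. \<phi> (D_a a)) (\<lambda>a. \<phi> (D_bar a)) (\<lambda>u. \<phi> (D_X u))"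
    by (intro base_generators.intro base_generators_axioms.intro pivotal_calculus_axioms \<phi>.B.k_algebra_axioms
        k_algebra_hom_comp[OF D_a_hom \<phi>] k_algebra_hom_comp[OF D_bar_hom \<phi>] k_linear_map_comp[OF D_X_linear lin])
      (simp flip: prods[simplified])
  then show ?thesis
    by (intro D_hom.intro D_hom_axioms.intro k_bilinear_comp[OF _ lin] D_bilinear \<phi>) (simp_all add: prods)
qed

lemma H_hom_from_free:
  assumes \<phi>: "k_algebra_hom H B \<phi>"
  shows "H_hom W P Q p b x q y c B (\<lambda>a. \<phi> (H_a a)) (\<lambda>a. \<phi> (H_bar a)) (\<lambda>u. \<phi> (H_X u)) (\<lambda>u. \<phi> (H_Y u)) \<phi>"
proof -
  interpret \<phi>: k_algebra_hom H B \<phi> by fact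
  note lin = k_algebra_hom.axioms(3)[OF \<phi>]
  note mem = k_linear_map.closed[OF k_algebra_hom.axioms(3)[OF H_a_hom]]
    k_linear_map.closed[OF k_algebra_hom.axioms(3)[OF H_bar_hom]]
  have prods: "\<phi> (H_A a a') = \<phi> (H_a a) \<otimes>\<^bsub>B\<^esub> \<phi> (H_bar a')" "\<phi> (H_A a a') = \<phi> (H_bar a') \<otimes>\<^bsub>B\<^esub> \<phi> (H_a a)"
    if "a \<in> grade W 0" "a' \<in> grade W 0" for a a'
    using that by (simp_all add: \<phi>.mult[symmetric] mem[simplified] H_A_factors[simplified])
  have "base_generators W P Q p b x q y c B (\<lambda>a. \<phi> (H_a a)) (\<lambda>a. \<phi> (H_bar a)) (\<lambda>u. \<phi> (H_X u))"
    by (intro base_generators.intro base_generators_axioms.intro pivotal_calculus_axioms \<phi>.B.k_algebra_axioms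
        k_algebra_hom_comp[OF H_a_hom \<phi>] k_algebra_hom_comp[OF H_bar_hom \<phi>] k_linear_map_comp[OF H_X_linear lin])
      (simp flip: prods[simplified])
  then show ?thesis
    by (intro H_hom.intro H_hom_axioms.intro k_linear_map_comp[OF H_Y_linear lin] \<phi>) (simp_all add: prods)
qed

abbreviation "D_rels \<equiv> D_rels_bimod \<union> D_rels_first_order \<union> D_rels_second_order"

lemma D_relations: "relations D D_rels"
  using D_hom.D_rels_carrier[OF D_hom_from_free[OF k_algebra_hom_id[OF D_algebra]]]
  by (intro relations.intro relations_axioms.intro D_algebra)

definition \<delta> where "\<delta> = rel_class D D_rels"

lemma \<delta>_hom: "k_algebra_hom D DX \<delta>"
  unfolding \<delta>_def DX_def by (rule relations.rel_class_hom[OF D_relations])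

lemma DX_model: "D_model W P Q p b x q y c DX (\<lambda>a. \<delta> (D_a a)) (\<lambda>a. \<delta> (D_bar a)) (\<lambda>u. \<delta> (D_X u))
    (\<lambda>u \<eta>. \<delta> (D_X\<Omega>1 u \<eta>)) (\<lambda>\<xi> \<zeta>. \<delta> (D_X\<Omega>2 \<xi> \<zeta>)) (\<lambda>\<eta> u. \<delta> (D_\<Omega>X1 \<eta> u)) (\<lambda>\<zeta> \<xi>. \<delta> (D_\<Omega>X2 \<zeta> \<xi>))"
  using relations.rel_class_zero[OF D_relations]
  by (intro D_hom.D_rels_iff[OF D_hom_from_free[OF \<delta>_hom], THEN iffD1] ballI) (simp add: \<delta>_def DX_def)

text \<open>The universal property of \<open>DX\<close>: it carries the initial \<open>D_model\<close>.\<close>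
lemma DX_lift:
  assumes m: "D_model W P Q p b x q y c B \<alpha> \<beta> X XO1 XO2 OX1 OX2"
  obtains \<Phi> where "k_algebra_hom DX B \<Phi>"
    and "\<And>a. a \<in> grade W 0 \<Longrightarrow> \<Phi> (\<delta> (D_a a)) = \<alpha> a" and "\<And>a. a \<in> grade W 0 \<Longrightarrow> \<Phi> (\<delta> (D_bar a)) = \<beta> a"
    and "\<And>u. u \<in> carrier X1 \<Longrightarrow> \<Phi> (\<delta> (D_X u)) = X u"
    and "\<And>u \<eta>. u \<in> carrier X1 \<Longrightarrow> \<eta> \<in> grade W 1 \<Longrightarrow> \<Phi> (\<delta> (D_\<Omega>X1 \<eta> u)) = OX1 \<eta> u"
proof -
  interpret m: D_model W P Q p b x q y c B \<alpha> \<beta> X XO1 XO2 OX1 OX2 by fact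
  obtain \<phi> where \<phi>: "k_algebra_hom D B \<phi>"
    and gens: "\<And>a a'. a \<in> grade W 0 \<Longrightarrow> a' \<in> grade W 0 \<Longrightarrow> \<phi> (D_A a a') = \<alpha> a \<otimes>\<^bsub>B\<^esub> \<beta> a'"
      "\<And>u. u \<in> carrier X1 \<Longrightarrow> \<phi> (D_X u) = X u"
      "\<And>u \<eta>. u \<in> carrier X1 \<Longrightarrow> \<eta> \<in> grade W 1 \<Longrightarrow> \<phi> (D_X\<Omega>1 u \<eta>) = XO1 u \<eta>"
      "\<And>u \<eta>. u \<in> carrier X2 \<Longrightarrow> \<eta> \<in> grade W 2 \<Longrightarrow> \<phi> (D_X\<Omega>2 u \<eta>) = XO2 u \<eta>"
      "\<And>u \<eta>. u \<in> carrier X1 \<Longrightarrow> \<eta> \<in> grade W 1 \<Longrightarrow> \<phi> (D_\<Omega>X1 \<eta> u) = OX1 \<eta> u"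
      "\<And>u \<eta>. u \<in> carrier X2 \<Longrightarrow> \<eta> \<in> grade W 2 \<Longrightarrow> \<phi> (D_\<Omega>X2 \<eta> u) = OX2 \<eta> u"
    by (rule D_lift[OF m.B.k_algebra_axioms m.\<alpha>_hom m.\<beta>_hom m.comm m.X_linear m.bilinear]) blast+
  have "D_hom W P Q p b x q y c B \<alpha> \<beta> X XO1 XO2 OX1 OX2 \<phi>"
    by (intro D_hom.intro D_hom_axioms.intro m.base_generators_axioms m.bilinear \<phi>) (simp_all add: gens)
  then have kill: "\<And>r. r \<in> D_rels \<Longrightarrow> \<phi> r = \<zero>\<^bsub>B\<^esub>"
    using D_hom.D_rels_iff m by blast
  obtain \<Phi> where \<Phi>: "k_algebra_hom DX B \<Phi>" "\<And>u. u \<in> carrier D \<Longrightarrow> \<Phi> (\<delta> u) = \<phi> u"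
    using relations.mod_rels_lift[OF D_relations \<phi> kill] unfolding DX_def \<delta>_def by blast
  interpret D_hom W P Q p b x q y c B \<alpha> \<beta> X XO1 XO2 OX1 OX2 \<phi> by fact
  show ?thesis
    by (rule that[OF \<Phi>(1)]) (simp_all add: \<Phi>(2) D_mem gens m.\<alpha> m.\<beta> W.grade_one)
qed

lemma DX_maps_eq:
  assumes f: "k_algebra_hom DX B f" and g: "k_algebra_hom DX B g"
    and eq: "\<And>a. a \<in> grade W 0 \<Longrightarrow> f (\<delta> (D_a a)) = g (\<delta> (D_a a))"
      "\<And>a. a \<in> grade W 0 \<Longrightarrow> f (\<delta> (D_bar a)) = g (\<delta> (D_bar a))"
      "\<And>u. u \<in> carrier X1 \<Longrightarrow> f (\<delta> (D_X u)) = g (\<delta> (D_X u))"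
      "\<And>u \<eta>. u \<in> carrier X1 \<Longrightarrow> \<eta> \<in> grade W 1 \<Longrightarrow> f (\<delta> (D_X\<Omega>1 u \<eta>)) = g (\<delta> (D_X\<Omega>1 u \<eta>))"
      "\<And>u \<eta>. u \<in> carrier X2 \<Longrightarrow> \<eta> \<in> grade W 2 \<Longrightarrow> f (\<delta> (D_X\<Omega>2 u \<eta>)) = g (\<delta> (D_X\<Omega>2 u \<eta>))"
      "\<And>u \<eta>. u \<in> carrier X1 \<Longrightarrow> \<eta> \<in> grade W 1 \<Longrightarrow> f (\<delta> (D_\<Omega>X1 \<eta> u)) = g (\<delta> (D_\<Omega>X1 \<eta> u))"
      "\<And>u \<eta>. u \<in> carrier X2 \<Longrightarrow> \<eta> \<in> grade W 2 \<Longrightarrow> f (\<delta> (D_\<Omega>X2 \<eta> u)) = g (\<delta> (D_\<Omega>X2 \<eta> u))"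
    and u: "u \<in> carrier DX"
  shows "f u = g u"
proof -
  note f' = k_algebra_hom_comp[OF \<delta>_hom f] and g' = k_algebra_hom_comp[OF \<delta>_hom g]
  obtain v where v: "v \<in> carrier D" "u = \<delta> v"
    using u unfolding DX_def \<delta>_def relations.mod_rels_carrier[OF D_relations] by (rule imageE)
  have "f (\<delta> (D_A a a')) = g (\<delta> (D_A a a'))" if "a \<in> grade W 0" "a' \<in> grade W 0" for a a'
    using that D_hom.\<phi>_A[OF D_hom_from_free[OF f'], of a a'] D_hom.\<phi>_A[OF D_hom_from_free[OF g'], of a a'] eq(1,2) by simp
  then show ?thesis
    unfolding v(2) using eq(3-) by (intro D_maps_eq[OF f' g' _ _ _ _ _ _ v(1)]) simp_all
qed

text \<open>The image in \<open>HX_quotient\<close> of an element of the free product \<open>H\<close>, through both quotients.\<close>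
definition \<kappa> where "\<kappa> u = rel_class HX1 HX_rels (rel_class H H_rels u)"

lemma H_relations: "relations H H_rels"
  using H_hom.H_rels_carrier[OF H_hom_from_free[OF k_algebra_hom_id[OF H_algebra]]]
  by (intro relations.intro relations_axioms.intro H_algebra)

lemmas HX1_class_hom = relations.rel_class_hom[OF H_relations, folded HX1_def]

text \<open>The relations are elements of \<open>HX1\<close> because \<open>HX1\<close> with its own generators and the identity is an instance of \<open>HX_hom\<close>.\<close>
lemma HX_relations: "relations HX1 HX_rels"
proof -
  have "HX_hom W P Q p b x q y c HX1 (\<lambda>a. rel_class H H_rels (H_a a)) (\<lambda>a. rel_class H H_rels (H_bar a))
    (\<lambda>u. rel_class H H_rels (H_X u)) (\<lambda>u. rel_class H H_rels (H_Y u)) (rel_class H H_rels) (\<lambda>u. u)"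
    using H_hom_from_free[OF HX1_class_hom] k_algebra_hom_id[OF k_algebra_hom.axioms(2)[OF HX1_class_hom]]
    by (intro HX_hom.intro HX_hom_axioms.intro) simp_all
  then show ?thesis
    using HX_hom.HX_rels_carrier k_algebra_hom.axioms(2)[OF HX1_class_hom]
    by (intro relations.intro relations_axioms.intro)
qed

lemmas HX_class_hom = relations.rel_class_hom[OF HX_relations, folded HX_quotient_def]

lemma \<kappa>_hom: "k_algebra_hom H HX_quotient \<kappa>"
  unfolding \<kappa>_def[abs_def] by (rule k_algebra_hom_comp[OF HX1_class_hom HX_class_hom])

lemma HX_quotient_model: "H_model W P Q p b x q y c HX_quotient
    (\<lambda>a. \<kappa> (H_a a)) (\<lambda>a. \<kappa> (H_bar a)) (\<lambda>u. \<kappa> (H_X u)) (\<lambda>u. \<kappa> (H_Y u))"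
proof -
  have h: "HX_hom W P Q p b x q y c HX_quotient (\<lambda>a. \<kappa> (H_a a)) (\<lambda>a. \<kappa> (H_bar a)) (\<lambda>u. \<kappa> (H_X u)) (\<lambda>u. \<kappa> (H_Y u))
    \<kappa> (rel_class HX1 HX_rels)"
    using H_hom_from_free[OF \<kappa>_hom] HX_class_hom by (intro HX_hom.intro HX_hom_axioms.intro) (simp_all add: \<kappa>_def)
  show ?thesis
    using relations.rel_class_zero[OF HX_relations]
    by (intro HX_hom.HX_rels_iff[OF h, THEN iffD1] ballI) (simp add: HX_quotient_def)
qed

lemma HX_quotient_lift:
  assumes m: "H_model W P Q p b x q y c B \<alpha> \<beta> X Y"
  obtains \<Psi> where "k_algebra_hom HX_quotient B \<Psi>"
    and "\<And>a. a \<in> grade W 0 \<Longrightarrow> \<Psi> (\<kappa> (H_a a)) = \<alpha> a" and "\<And>a. a \<in> grade W 0 \<Longrightarrow> \<Psi> (\<kappa> (H_bar a)) = \<beta> a"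
    and "\<And>u. u \<in> carrier X1 \<Longrightarrow> \<Psi> (\<kappa> (H_X u)) = X u" and "\<And>u. u \<in> carrier X1 \<Longrightarrow> \<Psi> (\<kappa> (H_Y u)) = Y u"
proof -
  interpret m: H_model W P Q p b x q y c B \<alpha> \<beta> X Y by fact
  obtain \<phi> where \<phi>: "k_algebra_hom H B \<phi>"
    and gens: "\<And>a a'. a \<in> grade W 0 \<Longrightarrow> a' \<in> grade W 0 \<Longrightarrow> \<phi> (H_A a a') = \<alpha> a \<otimes>\<^bsub>B\<^esub> \<beta> a'"
      "\<And>u. u \<in> carrier X1 \<Longrightarrow> \<phi> (H_X u) = X u" "\<And>u. u \<in> carrier X1 \<Longrightarrow> \<phi> (H_Y u) = Y u"
    by (rule H_lift[OF m.B.k_algebra_axioms m.\<alpha>_hom m.\<beta>_hom m.comm m.X_linear m.Y_linear]) blast+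
  have \<phi>': "H_hom W P Q p b x q y c B \<alpha> \<beta> X Y \<phi>"
    by (intro H_hom.intro H_hom_axioms.intro m.base_generators_axioms m.Y_linear \<phi>) (simp_all add: gens)
  obtain \<psi> where \<psi>: "k_algebra_hom HX1 B \<psi>" "\<And>u. u \<in> carrier H \<Longrightarrow> \<psi> (rel_class H H_rels u) = \<phi> u"
    using relations.mod_rels_lift[OF H_relations \<phi> bspec[OF H_hom.H_model_kills_H_rels[OF \<phi>' m]]]
    unfolding HX1_def by blast
  have \<psi>': "HX_hom W P Q p b x q y c B \<alpha> \<beta> X Y \<phi> \<psi>"
    by (intro HX_hom.intro HX_hom_axioms.intro \<phi>' \<psi>)
  obtain \<Psi> where \<Psi>: "k_algebra_hom HX_quotient B \<Psi>" "\<And>u. u \<in> carrier HX1 \<Longrightarrow> \<Psi> (rel_class HX1 HX_rels u) = \<psi> u"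
    using relations.mod_rels_lift[OF HX_relations \<psi>(1) bspec[OF HX_hom.HX_rels_iff[OF \<psi>', THEN iffD2, OF m]]]
    unfolding HX_quotient_def by blast
  have \<Psi>\<eta>: "\<Psi> (\<kappa> u) = \<phi> u" if "u \<in> carrier H" for u
    using that k_linear_map.closed[OF k_algebra_hom.axioms(3)[OF HX1_class_hom]] by (simp add: \<kappa>_def \<Psi>(2) \<psi>(2))
  interpret H_hom W P Q p b x q y c B \<alpha> \<beta> X Y \<phi> by fact
  show ?thesis
    by (rule that[OF \<Psi>(1)]) (simp_all add: \<Psi>\<eta> H_mem gens m.\<alpha> m.\<beta> W.grade_one)
qed

lemma HX_quotient_maps_eq:
  assumes f: "k_algebra_hom HX_quotient B f" and g: "k_algebra_hom HX_quotient B g"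
    and eq: "\<And>a. a \<in> grade W 0 \<Longrightarrow> f (\<kappa> (H_a a)) = g (\<kappa> (H_a a))"
      "\<And>a. a \<in> grade W 0 \<Longrightarrow> f (\<kappa> (H_bar a)) = g (\<kappa> (H_bar a))"
      "\<And>u. u \<in> carrier X1 \<Longrightarrow> f (\<kappa> (H_X u)) = g (\<kappa> (H_X u))"
      "\<And>u. u \<in> carrier X1 \<Longrightarrow> f (\<kappa> (H_Y u)) = g (\<kappa> (H_Y u))"
    and u: "u \<in> carrier HX_quotient"
  shows "f u = g u"
proof -
  note f' = k_algebra_hom_comp[OF \<kappa>_hom f] and g' = k_algebra_hom_comp[OF \<kappa>_hom g]
  obtain v where v: "v \<in> carrier H" "u = \<kappa> v"
  proof -
    obtain w where w: "w \<in> carrier HX1" "u = rel_class HX1 HX_rels w"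
      using u unfolding HX_quotient_def relations.mod_rels_carrier[OF HX_relations] by (rule imageE)
    obtain v where "v \<in> carrier H" "w = rel_class H H_rels v"
      using w(1) unfolding HX1_def relations.mod_rels_carrier[OF H_relations] by (rule imageE)
    then show ?thesis using that w(2) by (simp add: \<kappa>_def)
  qed
  have "f (\<kappa> (H_A a a')) = g (\<kappa> (H_A a a'))" if "a \<in> grade W 0" "a' \<in> grade W 0" for a a'
    using that H_hom.\<phi>_A[OF H_hom_from_free[OF f'], of a a'] H_hom.\<phi>_A[OF H_hom_from_free[OF g'], of a a'] eq(1,2) by simp
  then show ?thesis
    unfolding v(2) using eq(3-) by (intro H_maps_eq[OF f' g' _ _ _ v(1)]) simp_all
qed

text \<open>The homomorphisms given by the two universal properties exchange the generators: \<open>\<Phi>\<close> maps \<open>Y\<close>, built from pairs, to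
  the generator with a bar by \<open>Y_recovered\<close>, and \<open>\<Psi> \<circ> \<Phi>\<close> fixes the pairs because \<open>homs_agree\<close> expresses them by \<open>\<alpha>\<close>,
  \<open>\<beta>\<close>, \<open>X\<close> and \<open>Y\<close>.\<close>
theorem DX_iso_HX_quotient: "k_algebra_iso DX HX_quotient"
proof -
  interpret D: D_model W P Q p b x q y c DX "\<lambda>a. \<delta> (D_a a)" "\<lambda>a. \<delta> (D_bar a)" "\<lambda>u. \<delta> (D_X u)"
    "\<lambda>u \<eta>. \<delta> (D_X\<Omega>1 u \<eta>)" "\<lambda>\<xi> \<zeta>. \<delta> (D_X\<Omega>2 \<xi> \<zeta>)" "\<lambda>\<eta> u. \<delta> (D_\<Omega>X1 \<eta> u)" "\<lambda>\<zeta> \<xi>. \<delta> (D_\<Omega>X2 \<zeta> \<xi>)"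
    by (rule DX_model)
  interpret H: H_model W P Q p b x q y c HX_quotient "\<lambda>a. \<kappa> (H_a a)" "\<lambda>a. \<kappa> (H_bar a)" "\<lambda>u. \<kappa> (H_X u)" "\<lambda>u. \<kappa> (H_Y u)"
    by (rule HX_quotient_model)
  obtain \<Phi> where \<Phi>: "k_algebra_hom DX HX_quotient \<Phi>"
    and \<Phi>_gens: "\<And>a. a \<in> grade W 0 \<Longrightarrow> \<Phi> (\<delta> (D_a a)) = \<kappa> (H_a a)"
      "\<And>a. a \<in> grade W 0 \<Longrightarrow> \<Phi> (\<delta> (D_bar a)) = \<kappa> (H_bar a)"
      "\<And>u. u \<in> carrier X1 \<Longrightarrow> \<Phi> (\<delta> (D_X u)) = \<kappa> (H_X u)"
      "\<And>u \<eta>. u \<in> carrier X1 \<Longrightarrow> \<eta> \<in> grade W 1 \<Longrightarrow> \<Phi> (\<delta> (D_\<Omega>X1 \<eta> u)) = H.OX1 \<eta> u"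
    by (rule DX_lift[OF H.D_model]) blast
  obtain \<Psi> where \<Psi>: "k_algebra_hom HX_quotient DX \<Psi>"
    and \<Psi>_gens: "\<And>a. a \<in> grade W 0 \<Longrightarrow> \<Psi> (\<kappa> (H_a a)) = \<delta> (D_a a)"
      "\<And>a. a \<in> grade W 0 \<Longrightarrow> \<Psi> (\<kappa> (H_bar a)) = \<delta> (D_bar a)"
      "\<And>u. u \<in> carrier X1 \<Longrightarrow> \<Psi> (\<kappa> (H_X u)) = \<delta> (D_X u)"
      "\<And>u. u \<in> carrier X1 \<Longrightarrow> \<Psi> (\<kappa> (H_Y u)) = D.Y u"
    by (rule HX_quotient_lift[OF D.H_model]) blast
  interpret \<Phi>: k_algebra_hom DX HX_quotient \<Phi> by fact
  interpret \<Psi>: k_algebra_hom HX_quotient DX \<Psi> by fact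
  have OX_mem: "\<delta> (D_\<Omega>X1 \<eta> u) \<in> carrier DX" if "u \<in> carrier X1" "\<eta> \<in> grade W 1" for u \<eta>
    using k_bilinear_closed[OF D.bilinear(3)] that by simp
  have \<Phi>_Y: "\<Phi> (D.Y v) = \<kappa> (H_Y v)" if v: "v \<in> carrier X1" for v
  proof -
    have "\<Phi> (D.Y v) = (\<Oplus>\<^bsub>HX_quotient\<^esub>i\<in>{..<p}. H.OX1 (\<omega> i) v \<otimes>\<^bsub>HX_quotient\<^esub> \<kappa> (H_X (x i)))"
      using v by (simp add: D.Y_def \<Phi>.finsum_lessThan \<Phi>.mult OX_mem D.closed \<Phi>_gens)
    then show ?thesis using H.Y_recovered[OF v] by (rule trans)
  qed
  have \<Phi>\<Psi>: "\<Phi> (\<Psi> u) = u" if "u \<in> carrier HX_quotient" for u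
    using that by (rule HX_quotient_maps_eq[OF k_algebra_hom_comp[OF \<Psi> \<Phi>] k_algebra_hom_id[OF H.B.k_algebra_axioms], rotated -1])
      (simp_all add: \<Psi>_gens[simplified] \<Phi>_gens[simplified] \<Phi>_Y)
  have \<Psi>\<Phi>: "\<Psi> (\<Phi> u) = u" if "u \<in> carrier DX" for u
  proof -
    note hom = k_algebra_hom_comp[OF \<Phi> \<Psi>] and id = k_algebra_hom_id[OF D.B.k_algebra_axioms]
    note gens = \<Psi>_gens[simplified] \<Phi>_gens(1-3)[simplified] \<Phi>_Y
    show ?thesis
      using that
      by (rule DX_maps_eq[OF hom id, rotated -1])
        ((simp add: gens; fail) | (rule D.homs_agree[OF hom id]; simp add: gens))+
  qed
  have "bij_betw \<Phi> (carrier DX) (carrier HX_quotient)"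
    by (rule bij_betwI[where g = \<Psi>]) (auto simp: \<Phi>.closed \<Psi>.closed \<Phi>\<Psi> \<Psi>\<Phi>)
  then show ?thesis
    unfolding k_algebra_iso_def ring_iso_def ring_hom_def
    by (intro bexI[of _ \<Phi>]) (auto simp: \<Phi>.closed \<Phi>.add \<Phi>.mult \<Phi>.one \<Phi>.smult)
qed

end

theorem corollary4p5:
  fixes W :: "('k::field, 'w) dga"
    and P :: "('k, 'w, 'x) two_sided_dual"
    and Q :: "('k, 'w, 'y) two_sided_dual"
    and p q :: nat
    and b c :: "nat \<Rightarrow> 'w"
    and x y :: "nat \<Rightarrow> 'x"
  assumes "dg_algebra W"
    and "surjective_calculus W"
    and "calculus_data.pivotal_structure W P Q p b x q y c"
    and "wedge_surjective W"
  shows "k_algebra_iso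
    (calculus_data.DX W P Q p b x q y c)
    (calculus_data.HX_quotient W P Q p b x q y c)"
  using assms by (intro pivotal_calculus.DX_iso_HX_quotient pivotal_calculus.intro)

end
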